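(* Let $d\in\mathbb N$, $\mu\ge0$, $1\le p,q\le\infty$, $r>(d+2\mu)/p$ and $0<\tau\le\infty$. Let $X_p^r$ denote either the weighted Sobolev space $W_{p,\mu}^r$ or the weighted Besov space $B_\tau^r(L_{p,\mu})$ on $\mathbb B^d$, and for $L\in\mathbb N$ let $G_L$ be the filtered hyperinterpolation operator $G_L(f)(x)=\sum_{\omega\in\Lambda_L}\lambda_\omega f(\omega)K_{L,\eta}(x,\omega)$. Then for all $f\in X_p^r$, $$\|f-G_L(f)\|_{q,\mu}\lesssim L^{-r+(d+2\mu)\left(\frac1p-\frac1q\right)_+}\,\|f\|_{X_p^r},$$ where the implied constant is independent of $L\in\mathbb N$ and $f$, and $a_+=\max(a,0)$.
   Context: $\mathbb B^d=\{x\in\mathbb R^d: |x|\le 1\}$ is the Euclidean unit ball, and $w_\mu(x)=b_d^\mu(1-|x|^2)^{\mu-1/2}$, $\mu\ge 0$, with $b_d^\mu$ chosen so that $\int_{\mathbb B^d}w_\mu(x)\,dx=1$. For $1\le p<\infty$, $L_{p,\mu}$ is the space of measurable $f$ on $\mathbb B^d$ with $\|f\|_{p,\mu}=(\int_{\mathbb B^d}|f|^pw_\mu\,dx)^{1/p}<\infty$; for $p=\infty$, $L_{\infty,\mu}$ means $C(\mathbb B^d)$ with the uniform norm $\|\cdot\|_{\infty,\mu}$. $\Pi_n^d$ is the space of polynomials in $d$ variables of total degree at most $n$. $\mathcal V_n^d(w_\mu)$ is the space of polynomials of degree $n$ orthogonal in $L_{2,\mu}$ to all polynomials of lower degree, and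 $P_n(w_\mu;x,y)$ is its reproducing kernel in $L_{2,\mu}$. ${\rm Proj}_nf(x)=\int_{\mathbb B^d}f(y)P_n(w_\mu;x,y)w_\mu(y)\,dy$, $f\in L_{1,\mu}$. The spaces $\mathcal V_n^d(w_\mu)$ are the eigenspaces, with eigenvalues $-n(n+2\mu+d-1)$, of $D_\mu=\Delta-(x\cdot\nabla)^2-(2\mu+d-1)x\cdot\nabla$. For $r>0$, $(-D_\mu)^{r/2}f=\sum_{k=0}^\infty (k(k+2\mu+d-1))^{r/2}{\rm Proj}_kf$ in the sense of distributions (i.e. $(-D_\mu)^{r/2}f=g\in L_{p,\mu}$ means ${\rm Proj}_kg=(k(k+2\mu+d-1))^{r/2}{\rm Proj}_kf$ for all $k\ge0$). $W_{p,\mu}^r$ consists of $f\in L_{p,\mu}$ with $\|f\|_{W_{p,\mu}^r}=\|f\|_{p,\mu}+\|(-D_\mu)^{r/2}f\|_{p,\mu}<\infty$. With $E_L(f)_{p,\mu}=\inf_{P\in\Pi_L^d}\|f-P\|_{p,\mu}$, $B_\tau^r(L_{p,\mu})$ consists of real functions $f\in L_{p,\mu}$ with finite quasi-norm $\|f\|_{B_\tau^r(L_{p,\mu})}=\|f\|_{p,\mu}+\big(\sum_{j=0}^\infty 2^{jr\tau}E_{2^j}(f)_{p,\mu}^\tau\big)^{1/\tau}$ for $0<\tau<\infty$, and $\|f\|_{p,\mu}+\sup_{j\ge0}2^{jr}E_{2^j}(f)_{p,\mu}$ for $\tau=\infty$. If $r>(d+2\mu)/p$, both spaces are compactly embedded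 in $C(\mathbb B^d)$, so their elements are regarded as continuous functions. Filter: $\eta$ is a fixed continuous function on $[0,\infty)$ with $\chi_{[0,1]}\le\eta\le\chi_{[0,2]}$ ($\chi_A$ the characteristic function of $A$). Put $K_{L,\eta}(x,y)=\sum_{k=0}^\infty\eta(k/L)P_k(w_\mu;x,y)$ and $V_L(f)(x)=\int_{\mathbb B^d}f(y)K_{L,\eta}(x,y)w_\mu(y)\,dy$. It is assumed that $\eta$ is such that $\sup_{L\in\mathbb N}\sup_{x\in\mathbb B^d}\|K_{L,\eta}(x,\cdot)\|_{1,\mu}<\infty$ (e.g. any $\eta\in C^\infty[0,\infty)$); then $V_L(f)\in\Pi_{2L-1}^d$, $V_L(P)=P$ for $P\in\Pi_L^d$, and the $V_L$ are uniformly bounded on $L_{p,\mu}$, $1\le p\le\infty$, with $\|f-V_L(f)\|_{p,\mu}\lesssim E_L(f)_{p,\mu}$. Quadrature: for each $L\in\mathbb N$ there is fixed a positive quadrature rule $Q_L(f)=\sum_{\omega\in\Lambda_L}\lambda_\omega f(\omega)$ with $\Lambda_L\subset\mathbb B^d$ finite, $\#\Lambda_L\asymp L^d$ (constants independent of $L$), $\lambda_\omega>0$, and $\int_{\mathbb B^d}P\,w_\mu\,dx=Q_L(P)$ for all $P\in\Pi_{3L}^d$. *)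

theory Defs
  imports "HOL-Analysis.Analysis"
begin

text \<open>
  Functions on the unit ball are total functions on \<open>real ^ 'n\<close>, of which only the values on
  \<open>cball 0 1\<close> matter; the dimension is \<open>CARD('n)\<close>. Exponents in \<open>[1, \<infinity>]\<close> and \<open>(0, \<infinity>]\<close> are of
  type \<^typ>\<open>ennreal\<close>.
\<close>

definition ball_weight :: "real \<Rightarrow> real ^ 'n \<Rightarrow> real" where
  "ball_weight \<mu> x = (1 - (norm x)\<^sup>2) powr (\<mu> - 1/2)
     / (LINT y|lebesgue_on (cball (0 :: real ^ 'n) 1). (1 - (norm y)\<^sup>2) powr (\<mu> - 1/2))"

definition ball_measure :: "real \<Rightarrow> (real ^ 'n) measure" where
  "ball_measure \<mu> = density (lebesgue_on (cball 0 1)) (\<lambda>x. ennreal (ball_weight \<mu> x))"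

text \<open>As usual in this setting, \<open>p = \<infinity>\<close> stands for the continuous functions.\<close>

definition lp_space :: "real \<Rightarrow> ennreal \<Rightarrow> (real ^ 'n \<Rightarrow> real) set" where
  "lp_space \<mu> p =
     (if p = \<infinity> then {f. continuous_on (cball 0 1) f}
      else {f. f \<in> borel_measurable (ball_measure \<mu>) \<and>
               integrable (ball_measure \<mu>) (\<lambda>x. \<bar>f x\<bar> powr enn2real p)})"

definition lp_norm :: "real \<Rightarrow> ennreal \<Rightarrow> (real ^ 'n \<Rightarrow> real) \<Rightarrow> real" where
  "lp_norm \<mu> p f =
     (if p = \<infinity> then (SUP x\<in>cball 0 1. \<bar>f x\<bar>)
      else (LINT x|ball_measure \<mu>. \<bar>f x\<bar> powr enn2real p) powr (1 / enn2real p))"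

definition poly_space :: "nat \<Rightarrow> (real ^ 'n \<Rightarrow> real) set" where
  "poly_space n =
     {P. \<exists>c. \<forall>x. P x = (\<Sum>a\<in>{a :: 'n \<Rightarrow> nat. (\<Sum>i\<in>UNIV. a i) \<le> n}. c a * (\<Prod>i\<in>UNIV. (x $ i) ^ a i))}"

text \<open>The index set of the sum above is finite, so the sum is not degenerate.\<close>

lemma finite_multi_indices: "finite {a :: 'n::finite \<Rightarrow> nat. (\<Sum>i\<in>UNIV. a i) \<le> n}"
proof (rule finite_subset)
  show "{a :: 'n \<Rightarrow> nat. (\<Sum>i\<in>UNIV. a i) \<le> n} \<subseteq> (\<Pi>\<^sub>E i\<in>UNIV. {..n})"
  proof
    fix a :: "'n \<Rightarrow> nat" assume "a \<in> {a. (\<Sum>i\<in>UNIV. a i) \<le> n}"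
    then have "a i \<le> n" for i
      using member_le_sum[of i UNIV a] by simp
    then show "a \<in> (\<Pi>\<^sub>E i\<in>UNIV. {..n})" by (simp add: PiE_iff)
  qed
  show "finite (\<Pi>\<^sub>E i\<in>(UNIV :: 'n set). {..n})" by (rule finite_PiE) simp_all
qed

definition orth_poly_space :: "real \<Rightarrow> nat \<Rightarrow> (real ^ 'n \<Rightarrow> real) set" where
  "orth_poly_space \<mu> n =
     {P \<in> poly_space n. \<forall>m<n. \<forall>Q\<in>poly_space m. (LINT x|ball_measure \<mu>. P x * Q x) = 0}"

text \<open>
  For fixed \<open>x\<close>, the Riesz representer of evaluation at \<open>x\<close> on \<^const>\<open>orth_poly_space\<close>; it is
  unique because a polynomial vanishing almost everywhere on the ball is zero.
\<close>

definition repr_kernel :: "real \<Rightarrow> nat \<Rightarrow> real ^ 'n \<Rightarrow> real ^ 'n \<Rightarrow> real" where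
  "repr_kernel \<mu> n x =
     (THE k. k \<in> orth_poly_space \<mu> n \<and>
             (\<forall>P\<in>orth_poly_space \<mu> n. P x = (LINT y|ball_measure \<mu>. P y * k y)))"

definition proj :: "real \<Rightarrow> nat \<Rightarrow> (real ^ 'n \<Rightarrow> real) \<Rightarrow> real ^ 'n \<Rightarrow> real" where
  "proj \<mu> n f x = (LINT y|ball_measure \<mu>. f y * repr_kernel \<mu> n x y)"

text \<open>
  \<open>is_frac_D \<mu> p r f g\<close> says that \<open>(- D\<^sub>\<mu>)\<^bsup>r/2\<^esup> f = g\<close> in the sense of distributions, with \<open>g\<close> in
  the space \<open>L\<^sub>p\<close>. Here \<open>- k (k + 2\<mu> + d - 1)\<close> is the eigenvalue of
  \<open>D\<^sub>\<mu> = \<Delta> - (x \<cdot> \<nabla>)\<^sup>2 - (2\<mu> + d - 1) x \<cdot> \<nabla>\<close> on \<open>orth_poly_space \<mu> k\<close>. The function \<open>g\<close> is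
  determined up to null sets (on the whole ball if \<open>p = \<infinity>\<close>), so the choice made by \<open>SOME\<close>
  below does not affect the norm.
\<close>

definition is_frac_D ::
    "real \<Rightarrow> ennreal \<Rightarrow> real \<Rightarrow> (real ^ 'n \<Rightarrow> real) \<Rightarrow> (real ^ 'n \<Rightarrow> real) \<Rightarrow> bool" where
  "is_frac_D \<mu> p r f g \<longleftrightarrow> g \<in> lp_space \<mu> p \<and>
     (\<forall>k. \<forall>x\<in>cball 0 1.
        proj \<mu> k g x = (real k * (real k + 2 * \<mu> + real CARD('n) - 1)) powr (r/2) * proj \<mu> k f x)"

definition sobolev_space :: "real \<Rightarrow> ennreal \<Rightarrow> real \<Rightarrow> (real ^ 'n \<Rightarrow> real) set" where
  "sobolev_space \<mu> p r = {f \<in> lp_space \<mu> p. \<exists>g. is_frac_D \<mu> p r f g}"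

definition sobolev_norm :: "real \<Rightarrow> ennreal \<Rightarrow> real \<Rightarrow> (real ^ 'n \<Rightarrow> real) \<Rightarrow> real" where
  "sobolev_norm \<mu> p r f = lp_norm \<mu> p f + lp_norm \<mu> p (SOME g. is_frac_D \<mu> p r f g)"

definition best_approx :: "real \<Rightarrow> ennreal \<Rightarrow> nat \<Rightarrow> (real ^ 'n \<Rightarrow> real) \<Rightarrow> real" where
  "best_approx \<mu> p L f = (INF P\<in>poly_space L. lp_norm \<mu> p (\<lambda>x. f x - P x))"

definition besov_space ::
    "real \<Rightarrow> ennreal \<Rightarrow> real \<Rightarrow> ennreal \<Rightarrow> (real ^ 'n \<Rightarrow> real) set" where
  "besov_space \<mu> p r \<tau> =
     {f \<in> lp_space \<mu> p.
        if \<tau> = \<infinity> then bdd_above (range (\<lambda>j::nat. 2 powr (real j * r) * best_approx \<mu> p (2 ^ j) f))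
        else summable (\<lambda>j::nat. 2 powr (real j * r * enn2real \<tau>)
                                  * best_approx \<mu> p (2 ^ j) f powr enn2real \<tau>)}"

definition besov_norm ::
    "real \<Rightarrow> ennreal \<Rightarrow> real \<Rightarrow> ennreal \<Rightarrow> (real ^ 'n \<Rightarrow> real) \<Rightarrow> real" where
  "besov_norm \<mu> p r \<tau> f = lp_norm \<mu> p f +
     (if \<tau> = \<infinity> then (SUP j::nat. 2 powr (real j * r) * best_approx \<mu> p (2 ^ j) f)
      else (\<Sum>j::nat. 2 powr (real j * r * enn2real \<tau>)
                        * best_approx \<mu> p (2 ^ j) f powr enn2real \<tau>) powr (1 / enn2real \<tau>))"

definition filter_kernel ::
    "real \<Rightarrow> (real \<Rightarrow> real) \<Rightarrow> nat \<Rightarrow> real ^ 'n \<Rightarrow> real ^ 'n \<Rightarrow> real" where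
  "filter_kernel \<mu> \<eta> L x y = (\<Sum>k. \<eta> (real k / real L) * repr_kernel \<mu> k x y)"

text \<open>
  The nodes \<open>\<Lambda> L\<close> and the quadrature weights \<open>\<omega> \<mapsto> w L \<omega>\<close> are those of the rule of index \<open>L\<close>.
\<close>

definition hyperinterp ::
    "real \<Rightarrow> (real \<Rightarrow> real) \<Rightarrow> (nat \<Rightarrow> (real ^ 'n) set) \<Rightarrow> (nat \<Rightarrow> real ^ 'n \<Rightarrow> real)
      \<Rightarrow> nat \<Rightarrow> (real ^ 'n \<Rightarrow> real) \<Rightarrow> real ^ 'n \<Rightarrow> real" where
  "hyperinterp \<mu> \<eta> \<Lambda> w L f x = (\<Sum>\<omega>\<in>\<Lambda> L. w L \<omega> * f \<omega> * filter_kernel \<mu> \<eta> L x \<omega>)"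

end

theory Submission
  imports Defs "HOL-Probability.Probability"
begin

text \<open>
  Put \<open>D = d + 2\<mu>\<close>. If \<open>E\<^bsub>2^j\<^esub>(f)\<^sub>p \<le> B 2\<^bsup>-jr\<^esup>\<close> for all \<open>j\<close>, let \<open>2^j\<^sub>0 \<le> L < 2^(j\<^sub>0+1)\<close> and write
  \<open>f - P\<^bsub>j\<^sub>0\<^esub> = \<Sum>\<^bsub>j\<ge>j\<^sub>0\<^esub> R\<^sub>j\<close> with near best approximations \<open>P\<^sub>j\<close> and \<open>R\<^sub>j = P\<^bsub>j+1\<^esub> - P\<^sub>j\<close>. The operator \<open>G\<^sub>L\<close>
  reproduces \<open>P\<^bsub>j\<^sub>0\<^esub>\<close> and is bounded from the discrete to the continuous \<open>L\<^sub>q\<close> norm by Schur's test, so it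
  suffices to sum both \<open>L\<^sub>q\<close> norms of \<open>R\<^sub>j\<close>, which are controlled by Nikolskii's inequality and by the
  Marcinkiewicz-Zygmund inequality \<open>\<Sum>\<lambda>\<^sub>\<omega>|P(\<omega>)|\<^sup>q \<lesssim> (n/L)\<^sup>D \<parallel>P\<parallel>\<^sub>q\<^sup>q\<close> for \<open>P\<close> of degree \<open>n \<ge> L\<close>.

  These inequalities follow from a reproducing kernel for polynomials of degree \<open>n\<close> that is dominated by
  \<open>n\<^sup>D (1 + n\<^sup>2(1 - s))\<^bsup>-K\<^esup>\<close>. Zonal kernels on the ball are averages
  \<open>\<integral> g(x\<bullet>y + t \<surd>(1-|x|\<^sup>2) \<surd>(1-|y|\<^sup>2)) d\<nu>(t)\<close> of functions \<open>g\<close> on \<open>[-1,1]\<close>; they act on each \<open>V\<^sub>k\<close> as scalars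
  (computed for \<open>g(s) = s\<^sup>n\<close> from moments), which gives the Poisson kernel in closed form. Bessel's
  inequality for the Poisson kernel bounds the Dirichlet kernel, and multiplication by powers of
  Chebyshev quotients localises it.

  For the Sobolev space the required decay of \<open>E\<^sub>n(f)\<^sub>p\<close> is a Jackson inequality: \<open>(-D\<^sub>\<mu>)\<^bsup>-r/2\<^esup>\<close> is an
  iterated Laplace integral of Poisson means, and the Poisson kernel, a multiple of
  \<open>(cosh \<tau> - s)\<^bsup>-\<kappa>\<^esup>\<close>, is approximated by polynomials of degree \<open>n\<close> with relative error \<open>O(e\<^bsup>-cn\<tau>\<^esup>)\<close>.
\<close>

section \<open>Polynomials on Euclidean space\<close>

text \<open>Kernel estimates are made for functions of one variable on [-1,1] and carried to the
  ball by monotonicity of the average; multipliers are read off at boundary points z, where the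
  average collapses to g(z . y). The average of s^n is a polynomial in x and y, so its action on
  powers of a linear form is a computation with moments of the weight. The Poisson kernel is
  positive and of total mass 1; with 1 - rho = 1/(2n) it dominates the localised kernel and bounds
  its integral by a multiple of n^(-D), uniformly up to the boundary. The nodes form a null set.
  Hence sup bounds are kept pointwise, and the dyadic sums are shown to converge to f at every
  point. The hypothesis r > D/p enters through geometric series of ratio 2^(D/p - r). Norm bounds
  are handled as inequalities \<open>lpb\<close>, for which a factor 4 in the triangle inequality
  does no harm. The eigenvalue k(k + D - 1) has two factors; this is why two Laplace integrals, each
  of exponent r/2, are iterated.\<close>

definition mpow :: "('n \<Rightarrow> nat) \<Rightarrow> real ^ 'n \<Rightarrow> real" where
  "mpow a x = (\<Prod>i\<in>UNIV. (x $ i) ^ a i)"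

lemma mpow_add: "mpow (\<lambda>i. a i + b i) x = mpow a x * mpow b x"
  by (simp add: mpow_def power_add prod.distrib)

lemma poly_space_iff:
  "P \<in> poly_space n \<longleftrightarrow>
     (\<exists>c. \<forall>x. P x = (\<Sum>a\<in>{a :: 'n::finite \<Rightarrow> nat. (\<Sum>i\<in>UNIV. a i) \<le> n}. c a * mpow a x))"
  by (simp add: poly_space_def mpow_def)

text \<open>Linear subspaces of a space of functions. Statements on all polynomials are proved by
  letting W be the set of functions with the wanted property and checking that W is such a subspace
  and contains generators.\<close>

definition lin_closed :: "('a \<Rightarrow> real) set \<Rightarrow> bool" where
  "lin_closed W \<longleftrightarrow> (\<lambda>x. 0) \<in> W \<and> (\<forall>P\<in>W. \<forall>Q\<in>W. (\<lambda>x. P x + Q x) \<in> W) \<and> (\<forall>P\<in>W. \<forall>c. (\<lambda>x. c * P x) \<in> W)"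

lemma lin_closed_zero: "lin_closed W \<Longrightarrow> (\<lambda>x. 0) \<in> W"
  and lin_closed_add: "lin_closed W \<Longrightarrow> P \<in> W \<Longrightarrow> Q \<in> W \<Longrightarrow> (\<lambda>x. P x + Q x) \<in> W"
  and lin_closed_cmult: "lin_closed W \<Longrightarrow> P \<in> W \<Longrightarrow> (\<lambda>x. c * P x) \<in> W"
  by (auto simp: lin_closed_def)

lemma lin_closed_diff:
  assumes "lin_closed W" "P \<in> W" "Q \<in> W"
  shows "(\<lambda>x. P x - Q x) \<in> W"
  using lin_closed_add[OF assms(1,2) lin_closed_cmult[OF assms(1,3), of "-1"]] by simp

lemma lin_closed_sum:
  assumes "lin_closed W" "\<And>i. i \<in> I \<Longrightarrow> f i \<in> W"
  shows "(\<lambda>x. \<Sum>i\<in>I. f i x) \<in> W"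
  using assms(2)
proof (induction I rule: infinite_finite_induct)
  case (insert i I)
  then show ?case using lin_closed_add[OF assms(1), of "f i" "\<lambda>x. \<Sum>i\<in>I. f i x"] by simp
qed (auto simp: lin_closed_zero[OF assms(1)])

lemma lin_closed_poly_space: "lin_closed (poly_space n :: (real ^ 'n \<Rightarrow> real) set)"
proof -
  have z: "(\<lambda>x. 0) \<in> (poly_space n :: (real ^ 'n \<Rightarrow> real) set)"
    unfolding poly_space_iff by (rule exI[of _ "\<lambda>_. 0"]) simp
  have a: "(\<lambda>x. P x + Q x) \<in> poly_space n" if P: "P \<in> poly_space n" and Q: "Q \<in> poly_space n"
    for P Q :: "real ^ 'n \<Rightarrow> real"
  proof -
    obtain c c' where *: "\<And>x. P x = (\<Sum>a\<in>{a. (\<Sum>i\<in>UNIV. a i) \<le> n}. c a * mpow a x)"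
       "\<And>x. Q x = (\<Sum>a\<in>{a. (\<Sum>i\<in>UNIV. a i) \<le> n}. c' a * mpow a x)"
      using P Q unfolding poly_space_iff by blast
    show ?thesis unfolding poly_space_iff
      by (rule exI[of _ "\<lambda>a. c a + c' a"]) (simp only: * sum.distrib distrib_right simp_thms)
  qed
  have m: "(\<lambda>x. k * P x) \<in> poly_space n" if P: "P \<in> poly_space n" for P :: "real ^ 'n \<Rightarrow> real" and k
  proof -
    obtain c where *: "\<And>x. P x = (\<Sum>a\<in>{a. (\<Sum>i\<in>UNIV. a i) \<le> n}. c a * mpow a x)"
      using P unfolding poly_space_iff by blast
    show ?thesis unfolding poly_space_iff
      by (rule exI[of _ "\<lambda>a. k * c a"]) (simp only: * sum_distrib_left mult.assoc simp_thms)
  qed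
  show ?thesis unfolding lin_closed_def using z a m by blast
qed

lemmas poly_space_add = lin_closed_add[OF lin_closed_poly_space]
  and poly_space_cmult = lin_closed_cmult[OF lin_closed_poly_space]
  and poly_space_diff = lin_closed_diff[OF lin_closed_poly_space]
  and poly_space_sum = lin_closed_sum[OF lin_closed_poly_space]
  and poly_space_zero = lin_closed_zero[OF lin_closed_poly_space]

lemma mpow_in_poly_space:
  assumes "(\<Sum>i\<in>UNIV. a i) \<le> n"
  shows "mpow a \<in> poly_space n"
  unfolding poly_space_iff
proof (intro exI[of _ "\<lambda>b. if b = a then 1 else 0"] allI)
  fix x :: "real ^ 'a"
  have "(\<Sum>b\<in>{b. (\<Sum>i\<in>UNIV. b i) \<le> n}. (if b = a then 1 else 0) * mpow b x)
     = (\<Sum>b\<in>{b. (\<Sum>i\<in>UNIV. b i) \<le> n}. (if b = a then mpow b x else 0))"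
    by (rule sum.cong) auto
  also have "\<dots> = mpow a x" using assms by (subst sum.delta) (auto simp: finite_multi_indices)
  finally show "mpow a x = (\<Sum>b\<in>{b. (\<Sum>i\<in>UNIV. b i) \<le> n}. (if b = a then 1 else 0) * mpow b x)" by simp
qed

lemma poly_space_subset:
  assumes "lin_closed W" "\<And>a. (\<Sum>i\<in>UNIV. a i) \<le> n \<Longrightarrow> mpow a \<in> W"
  shows "poly_space n \<subseteq> W"
proof
  fix P :: "real ^ 'a \<Rightarrow> real" assume "P \<in> poly_space n"
  then obtain c where *: "\<And>x. P x = (\<Sum>a\<in>{a. (\<Sum>i\<in>UNIV. a i) \<le> n}. c a * mpow a x)"
    unfolding poly_space_iff by blast
  have "(\<lambda>x. \<Sum>a\<in>{a. (\<Sum>i\<in>UNIV. a i) \<le> n}. c a * mpow a x) \<in> W"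
    by (intro lin_closed_sum lin_closed_cmult assms) auto
  then show "P \<in> W" using * by presburger
qed

lemma poly_space_mono: "n \<le> m \<Longrightarrow> P \<in> poly_space n \<Longrightarrow> P \<in> poly_space m"
  by (rule subsetD[OF poly_space_subset[OF lin_closed_poly_space mpow_in_poly_space[OF le_trans]]])

lemma poly_space_mult:
  assumes "P \<in> poly_space n" "Q \<in> poly_space m"
  shows "(\<lambda>x. P x * Q x) \<in> poly_space (n + m)"
proof -
  obtain c c' where *: "\<And>x. P x = (\<Sum>a\<in>{a. (\<Sum>i\<in>UNIV. a i) \<le> n}. c a * mpow a x)"
     "\<And>x. Q x = (\<Sum>a\<in>{a. (\<Sum>i\<in>UNIV. a i) \<le> m}. c' a * mpow a x)"
    using assms unfolding poly_space_iff by blast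
  have "(\<lambda>x. \<Sum>a\<in>{a. (\<Sum>i\<in>UNIV. a i) \<le> n}. \<Sum>b\<in>{a. (\<Sum>i\<in>UNIV. a i) \<le> m}.
       (c a * c' b) * mpow (\<lambda>i. a i + b i) x) \<in> poly_space (n + m)"
    by (intro poly_space_sum poly_space_cmult mpow_in_poly_space) (auto simp: sum.distrib intro: add_mono)
  also have "(\<lambda>x. \<Sum>a\<in>{a. (\<Sum>i\<in>UNIV. a i) \<le> n}. \<Sum>b\<in>{a. (\<Sum>i\<in>UNIV. a i) \<le> m}.
       (c a * c' b) * mpow (\<lambda>i. a i + b i) x) = (\<lambda>x. P x * Q x)"
    unfolding * sum_product mpow_add by (intro ext sum.cong refl) (simp add: mult_ac)
  finally show ?thesis .
qed

lemma poly_space_const: "(\<lambda>x. c) \<in> poly_space n"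
  using poly_space_cmult[OF mpow_in_poly_space[of "\<lambda>_. 0" n], of c] by (simp add: mpow_def)

lemma poly_space_component: "(\<lambda>x. x $ i) \<in> poly_space 1"
proof -
  have "mpow (\<lambda>j. if j = i then 1 else 0) \<in> poly_space 1"
    by (rule mpow_in_poly_space) simp
  moreover have "mpow (\<lambda>j. if j = i then 1 else 0) = (\<lambda>x. x $ i)"
  proof
    fix x :: "real ^ 'a"
    have "mpow (\<lambda>j. if j = i then 1 else 0) x = (\<Prod>j\<in>UNIV. if j = i then x $ j else 1)"
      unfolding mpow_def by (rule prod.cong) auto
    then show "mpow (\<lambda>j. if j = i then 1 else 0) x = x $ i" by simp
  qed
  ultimately show ?thesis by simp
qed

lemma poly_space_inner: "(\<lambda>x. z \<bullet> x) \<in> poly_space 1"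
  unfolding inner_vec_def inner_real_def
  by (intro poly_space_sum poly_space_cmult poly_space_component)

lemma poly_space_norm2: "(\<lambda>x. (norm x)\<^sup>2) \<in> poly_space 2"
proof -
  have "(\<lambda>x. \<Sum>i\<in>UNIV. x $ i * x $ i) \<in> poly_space (1 + 1)"
    by (intro poly_space_sum poly_space_mult poly_space_component)
  also have "(\<lambda>x. \<Sum>i\<in>UNIV. x $ i * x $ i) = (\<lambda>x :: real ^ 'a. (norm x)\<^sup>2)"
    unfolding power2_norm_eq_inner by (simp add: inner_vec_def)
  finally show ?thesis by (simp add: one_add_one del: One_nat_def)
qed

lemma poly_space_power: "P \<in> poly_space n \<Longrightarrow> (\<lambda>x. P x ^ k) \<in> poly_space (k * n)"
proof (induction k)
  case 0 then show ?case using poly_space_const[of 1] by simp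
next
  case (Suc k) then show ?case using poly_space_mult[of P n "\<lambda>x. P x ^ k" "k * n"] by simp
qed

lemma poly_space_inner_power: "(\<lambda>x. (z \<bullet> x) ^ k) \<in> poly_space k"
  using poly_space_power[OF poly_space_inner, of z k] by simp

lemma poly_space_continuous: "P \<in> poly_space n \<Longrightarrow> continuous_on S P"
proof -
  assume P: "P \<in> poly_space n"
  have "lin_closed {P :: real ^ 'a \<Rightarrow> real. continuous_on S P}"
    by (auto simp: lin_closed_def intro!: continuous_intros)
  then have "poly_space n \<subseteq> {P :: real ^ 'a \<Rightarrow> real. continuous_on S P}"
    by (rule poly_space_subset) (auto simp: mpow_def[abs_def] intro!: continuous_intros)
  then show ?thesis using P by auto
qed

lemma poly_space_borel: "P \<in> poly_space n \<Longrightarrow> P \<in> borel_measurable borel"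
  using poly_space_continuous borel_measurable_continuous_onI by blast

text \<open>A polynomial in a parameter with values in \<open>W\<close> has its coefficients in \<open>W\<close>: replacing the
  parameter by its double and subtracting eliminates the top coefficient.\<close>

lemma lin_closed_coeffs:
  assumes "lin_closed W" "\<And>c::real. (\<lambda>x. \<Sum>k\<le>M. c ^ k * f k x) \<in> W" "k \<le> M"
  shows "f k \<in> W"
  using assms(2,3)
proof (induction M arbitrary: f k)
  case 0
  then show ?case using 0(1)[of 1] by simp
next
  case (Suc M)
  have *: "(\<lambda>x. (2 ^ k - 2 ^ Suc M) * f k x) \<in> W" if "k \<le> M" for k
  proof (rule Suc.IH[where f = "\<lambda>k x. (2 ^ k - 2 ^ Suc M) * f k x", OF _ that])
    fix c :: real
    have "(\<lambda>x. (\<Sum>k\<le>Suc M. (2*c) ^ k * f k x) - 2 ^ Suc M * (\<Sum>k\<le>Suc M. c ^ k * f k x)) \<in> W"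
      by (intro lin_closed_diff lin_closed_cmult assms(1) Suc.prems(1))
    also have "(\<lambda>x. (\<Sum>k\<le>Suc M. (2*c) ^ k * f k x) - 2 ^ Suc M * (\<Sum>k\<le>Suc M. c ^ k * f k x))
       = (\<lambda>x. \<Sum>k\<le>M. c ^ k * ((2 ^ k - 2 ^ Suc M) * f k x))"
    proof
      fix x
      have "(\<Sum>k\<le>M. (2 * c) ^ k * f k x) - 2 ^ Suc M * (\<Sum>k\<le>M. c ^ k * f k x)
        = (\<Sum>k\<le>M. (2 * c) ^ k * f k x - 2 ^ Suc M * (c ^ k * f k x))"
        unfolding sum_distrib_left sum_subtractf ..
      also have "\<dots> = (\<Sum>k\<le>M. c ^ k * ((2 ^ k - 2 ^ Suc M) * f k x))"
        by (rule sum.cong) (simp_all only: power_mult_distrib algebra_simps)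
      finally show "(\<Sum>k\<le>Suc M. (2*c) ^ k * f k x) - 2 ^ Suc M * (\<Sum>k\<le>Suc M. c ^ k * f k x)
        = (\<Sum>k\<le>M. c ^ k * ((2 ^ k - 2 ^ Suc M) * f k x))"
        by (simp add: power_mult_distrib distrib_left)
    qed
    finally show "(\<lambda>x. \<Sum>k\<le>M. c ^ k * ((2 ^ k - 2 ^ Suc M) * f k x)) \<in> W" .
  qed
  have low: "f k \<in> W" if "k \<le> M" for k
  proof -
    have "(2::real) ^ k - 2 ^ Suc M \<noteq> 0" using that power_strict_increasing[of k "Suc M" "2::real"] by simp
    then have "(\<lambda>x. inverse (2 ^ k - 2 ^ Suc M) * ((2 ^ k - 2 ^ Suc M) * f k x)) = f k"
      by (intro ext) (simp add: field_simps)
    then show ?thesis using lin_closed_cmult[OF assms(1) *[OF that], of "inverse (2 ^ k - 2 ^ Suc M)"] by simp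
  qed
  show ?case
  proof (cases "k \<le> M")
    case False
    then have k: "k = Suc M" using Suc.prems by simp
    have "(\<lambda>x. (\<Sum>k\<le>Suc M. 1 ^ k * f k x) - (\<Sum>k\<le>M. f k x)) \<in> W"
      by (intro lin_closed_diff lin_closed_sum assms(1) Suc.prems(1) low) auto
    then show ?thesis by (simp add: k)
  qed (rule low)
qed

text \<open>Polarisation. One factor is split off at a time: in the power l of
  \<open>(z0 + c *\<^sub>R w) \<bullet> x\<close> the coefficient of c is l times
  \<open>w \<bullet> x\<close> times the power l - 1 of \<open>z0 \<bullet> x\<close>. The remaining
  power of \<open>z0 \<bullet> x\<close> keeps the total degree equal to m at every stage.\<close>

lemma prod_linear_forms_in_span:
  fixes W :: "(real ^ 'n \<Rightarrow> real) set"
  assumes W: "lin_closed W" and pow: "\<And>z. (\<lambda>x. (z \<bullet> x) ^ m) \<in> W"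
  shows "length zs \<le> m \<Longrightarrow> (\<lambda>x. prod_list (map (\<lambda>z. z \<bullet> x) zs) * (z0 \<bullet> x) ^ (m - length zs)) \<in> W"
proof (induction zs arbitrary: z0)
  case Nil
  then show ?case using pow by simp
next
  case (Cons w zs)
  define l where "l = m - length zs"
  have l: "l \<ge> 1" "m - length (w # zs) = l - 1" using Cons.prems by (auto simp: l_def)
  define p where "p x = prod_list (map (\<lambda>z. z \<bullet> x) zs)" for x
  have "(\<lambda>x. of_nat (l choose 1) * (p x * (w \<bullet> x) ^ 1 * (z0 \<bullet> x) ^ (l - 1))) \<in> W"
  proof (rule lin_closed_coeffs[OF W, where M = l and f = "\<lambda>k x. of_nat (l choose k) * (p x * (w \<bullet> x) ^ k * (z0 \<bullet> x) ^ (l - k))"])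
    fix c :: real
    have "(\<lambda>x. p x * ((z0 + c *\<^sub>R w) \<bullet> x) ^ l) \<in> W"
      using Cons.IH[of "z0 + c *\<^sub>R w"] Cons.prems by (simp add: l_def p_def)
    also have "(\<lambda>x. p x * ((z0 + c *\<^sub>R w) \<bullet> x) ^ l)
      = (\<lambda>x. \<Sum>k\<le>l. c ^ k * (of_nat (l choose k) * (p x * (w \<bullet> x) ^ k * (z0 \<bullet> x) ^ (l - k))))"
    proof
      fix x
      have "((z0 + c *\<^sub>R w) \<bullet> x) ^ l = (c * (w \<bullet> x) + z0 \<bullet> x) ^ l"
        by (simp add: inner_add_left add.commute)
      show "p x * ((z0 + c *\<^sub>R w) \<bullet> x) ^ l
       = (\<Sum>k\<le>l. c ^ k * (of_nat (l choose k) * (p x * (w \<bullet> x) ^ k * (z0 \<bullet> x) ^ (l - k))))"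
        unfolding \<open>((z0 + c *\<^sub>R w) \<bullet> x) ^ l = _\<close> binomial_ring sum_distrib_left by (intro sum.cong refl) (simp add: power_mult_distrib mult_ac)
    qed
    finally show "(\<lambda>x. \<Sum>k\<le>l. c ^ k * (of_nat (l choose k) * (p x * (w \<bullet> x) ^ k * (z0 \<bullet> x) ^ (l - k)))) \<in> W" .
  qed (use l in simp)
  then have "(\<lambda>x. (1 / real l) * (of_nat (l choose 1) * (p x * (w \<bullet> x) ^ 1 * (z0 \<bullet> x) ^ (l - 1)))) \<in> W"
    by (rule lin_closed_cmult[OF W])
  then show ?case using l by (simp add: p_def mult.commute mult.left_commute mult.assoc)
qed

lemma mpow_as_linear_forms:
  "\<exists>zs. length zs = (\<Sum>i\<in>UNIV. a i) \<and> (\<forall>x. mpow a x = prod_list (map (\<lambda>z. z \<bullet> x) zs))"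
proof -
  have "\<exists>zs. length zs = (\<Sum>i\<in>I. a i) \<and> (\<forall>x. (\<Prod>i\<in>I. (x $ i) ^ a i) = prod_list (map (\<lambda>z. z \<bullet> x) zs))"
    if "finite I" for I using that
  proof (induction I)
    case empty then show ?case by simp
  next
    case (insert i I)
    then obtain zs where zs: "length zs = (\<Sum>i\<in>I. a i)"
      "\<forall>x. (\<Prod>i\<in>I. (x $ i) ^ a i) = prod_list (map (\<lambda>z. z \<bullet> x) zs)" by auto
    show ?case using insert zs
      by (intro exI[of _ "replicate (a i) (axis i 1) @ zs"]) (simp add: inner_axis')
  qed
  from this[of UNIV] show ?thesis by (simp add: mpow_def)
qed

text \<open>The generating identity for moments is derived for unit directions, so polarisation is
  combined with rescaling.\<close>

lemma poly_space_span_unit_powers: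
  fixes W :: "(real ^ 'n \<Rightarrow> real) set"
  assumes W: "lin_closed W" and pow: "\<And>z k. k \<le> m \<Longrightarrow> norm z = 1 \<Longrightarrow> (\<lambda>x. (z \<bullet> x) ^ k) \<in> W"
  shows "poly_space m \<subseteq> W"
proof (rule poly_space_subset[OF W])
  fix a :: "'n \<Rightarrow> nat" assume a: "(\<Sum>i\<in>UNIV. a i) \<le> m"
  define k where "k = (\<Sum>i\<in>UNIV. a i)"
  have pow': "(\<lambda>x. (z \<bullet> x) ^ k) \<in> W" for z
  proof (cases "z = 0 \<and> k > 0")
    case True then show ?thesis using lin_closed_zero[OF W] by (simp add: zero_power)
  next
    case False
    \<comment> \<open>Here z = 0 forces k = 0, where both powers are 1, so any unit vector
      serves.\<close>
    define z' where "z' = (if z = 0 then axis undefined 1 else sgn z)"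
    have "norm z' = 1" by (auto simp: z'_def norm_sgn)
    then have "(\<lambda>x. norm z ^ k * (z' \<bullet> x) ^ k) \<in> W" using lin_closed_cmult[OF W pow[of k z']] a by (simp add: k_def)
    moreover have "(\<lambda>x. norm z ^ k * (z' \<bullet> x) ^ k) = (\<lambda>x. (z \<bullet> x) ^ k)"
      using False by (intro ext) (auto simp: z'_def sgn_div_norm power_mult_distrib[symmetric] mult.assoc[symmetric])
    ultimately show ?thesis by simp
  qed
  obtain zs where zs: "length zs = k" "\<And>x. mpow a x = prod_list (map (\<lambda>z. z \<bullet> x) zs)"
    using mpow_as_linear_forms[of a] k_def by metis
  have "(\<lambda>x. prod_list (map (\<lambda>z. z \<bullet> x) zs)) \<in> W"
    using prod_linear_forms_in_span[OF W pow', of zs 0] zs by simp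
  then show "mpow a \<in> W" using zs(2) by presburger
qed

section \<open>Moments of the Gegenbauer weights\<close>

text \<open>The weight extended by 0 to the whole space, so that integration by parts leaves no
  boundary terms. Since \<open>0 powr c = 0\<close>, it vanishes on the sphere even for negative c.
  It serves on the ball with exponent \<mu> - 1/2 and on the real line with other exponents.\<close>

definition bump :: "real \<Rightarrow> 'a::euclidean_space \<Rightarrow> real" where
  "bump c y = (max 0 (1 - (norm y)\<^sup>2)) powr c"

lemma bump_nonneg: "0 \<le> bump c y"
  by (simp add: bump_def)

lemma norm_sq_less_1: "norm y < 1 \<Longrightarrow> (norm y)\<^sup>2 < 1"
  by (simp add: abs_square_less_1)

lemma bump_pos: "norm y < 1 \<Longrightarrow> 0 < bump c y"
  using norm_sq_less_1[of y] by (simp add: bump_def)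

lemma bump_outside: "1 \<le> norm y \<Longrightarrow> bump c y = 0"
  using power_mono[of 1 "norm y" 2] by (simp add: bump_def max_absorb1)

lemma bump_le_1: "0 \<le> c \<Longrightarrow> bump c y \<le> 1"
  by (auto simp: bump_def intro!: powr_le1)

lemma bump_borel [measurable]: "bump c \<in> borel_measurable borel"
  unfolding bump_def by measurable

lemma bump_mult_power: "norm y < 1 \<or> c > 0 \<Longrightarrow> bump c y * (1 - (norm y)\<^sup>2) ^ k = bump (c + real k) y"
proof (cases "norm y < 1")
  case True
  then have "1 - (norm y)\<^sup>2 > 0" using norm_sq_less_1[of y] by simp
  then show ?thesis by (simp add: bump_def powr_add powr_realpow max_def)
qed (simp add: bump_outside)

lemma bump_mult_power': "bump c y * (1 - (norm y)\<^sup>2) ^ k = bump (c + real k) y"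
  by (cases "norm y < 1") (auto simp: bump_mult_power bump_outside)

lemma bump_continuous: "0 < c \<Longrightarrow> continuous_on S f \<Longrightarrow> continuous_on S (\<lambda>s. bump c (f s))"
  unfolding bump_def by (intro continuous_on_powr' continuous_intros) auto

text \<open>These are the points of a line at which \<open>bump\<close> may fail to be
  differentiable; a finite exceptional set is harmless in the fundamental theorem of
  calculus.\<close>

lemma finite_line_sphere:
  fixes y \<xi> :: "'a::euclidean_space"
  assumes "\<xi> \<noteq> 0"
  shows "finite {s. norm (y + s *\<^sub>R \<xi>) = 1}"
proof (rule finite_subset)
  have *: "(norm (y + s *\<^sub>R \<xi>))\<^sup>2 = poly [:y \<bullet> y, 2 * (y \<bullet> \<xi>), \<xi> \<bullet> \<xi>:] s" for s
    unfolding power2_norm_eq_inner by (simp add: inner_add_left inner_add_right algebra_simps inner_commute)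
  show "{s. norm (y + s *\<^sub>R \<xi>) = 1} \<subseteq> {s. poly [:y \<bullet> y - 1, 2 * (y \<bullet> \<xi>), \<xi> \<bullet> \<xi>:] s = 0}"
  proof
    fix s assume "s \<in> {s. norm (y + s *\<^sub>R \<xi>) = 1}"
    then have "(norm (y + s *\<^sub>R \<xi>))\<^sup>2 = 1" by simp
    then show "s \<in> {s. poly [:y \<bullet> y - 1, 2 * (y \<bullet> \<xi>), \<xi> \<bullet> \<xi>:] s = 0}"
      using *[of s] by simp
  qed
  show "finite {s. poly [:y \<bullet> y - 1, 2 * (y \<bullet> \<xi>), \<xi> \<bullet> \<xi>:] s = 0}"
    using assms by (intro poly_roots_finite) auto
qed

text \<open>The derivative of \<open>(\<xi> \<bullet> y) ^ a * bump c y\<close> in direction \<xi>,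
  off the unit sphere. For a = 0 the truncated exponent \<open>a - 1\<close> is multiplied by
  0.\<close>

definition bump_flux :: "nat \<Rightarrow> real \<Rightarrow> 'a::euclidean_space \<Rightarrow> 'a \<Rightarrow> real" where
  "bump_flux a c \<xi> y = real a * (\<xi> \<bullet> \<xi>) * (\<xi> \<bullet> y) ^ (a - 1) * bump c y
     - 2 * c * (\<xi> \<bullet> y) ^ (a + 1) * bump (c - 1) y"

lemma bump_flux_borel [measurable]: "bump_flux a c \<xi> \<in> borel_measurable borel"
  unfolding bump_flux_def by measurable

lemma bump_line_derivative:
  fixes y \<xi> :: "'a::euclidean_space"
  assumes "norm (y + s *\<^sub>R \<xi>) \<noteq> 1"
  shows "((\<lambda>s. (\<xi> \<bullet> (y + s *\<^sub>R \<xi>)) ^ a * bump c (y + s *\<^sub>R \<xi>)) has_real_derivative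
           bump_flux a c \<xi> (y + s *\<^sub>R \<xi>)) (at s)"
proof (cases "norm (y + s *\<^sub>R \<xi>) < 1")
  case True
  define v where "v = 1 - (norm (y + s *\<^sub>R \<xi>))\<^sup>2"
  have v: "v > 0" using True using norm_sq_less_1 by (simp add: v_def)
  have "((\<lambda>s. (\<xi> \<bullet> (y + s *\<^sub>R \<xi>)) ^ a * (1 - (y + s *\<^sub>R \<xi>) \<bullet> (y + s *\<^sub>R \<xi>)) powr c) has_real_derivative
      bump_flux a c \<xi> (y + s *\<^sub>R \<xi>)) (at s)"
  proof -
    have v': "v = 1 - (y + s *\<^sub>R \<xi>) \<bullet> (y + s *\<^sub>R \<xi>)" by (simp add: v_def power2_norm_eq_inner)
    have d1: "((\<lambda>s. \<xi> \<bullet> (y + s *\<^sub>R \<xi>)) has_real_derivative \<xi> \<bullet> \<xi>) (at s)"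
      by (auto simp: inner_add_right intro!: derivative_eq_intros)
    have e: "(\<lambda>s. 1 - (y + s *\<^sub>R \<xi>) \<bullet> (y + s *\<^sub>R \<xi>)) = (\<lambda>s. 1 - y \<bullet> y - 2 * s * (y \<bullet> \<xi>) - s\<^sup>2 * (\<xi> \<bullet> \<xi>))"
      by (intro ext) (simp add: inner_add_left inner_add_right inner_commute power2_eq_square)
    have d2: "((\<lambda>s. 1 - (y + s *\<^sub>R \<xi>) \<bullet> (y + s *\<^sub>R \<xi>)) has_real_derivative - 2 * (\<xi> \<bullet> (y + s *\<^sub>R \<xi>))) (at s)"
      unfolding e by (auto intro!: derivative_eq_intros simp: inner_add_right inner_commute)
    have d3: "((\<lambda>s. (1 - (y + s *\<^sub>R \<xi>) \<bullet> (y + s *\<^sub>R \<xi>)) powr c) has_real_derivative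
       c * v powr (c - 1) * (- 2 * (\<xi> \<bullet> (y + s *\<^sub>R \<xi>)))) (at s)"
      using DERIV_chain2[OF has_real_derivative_powr[of v c, unfolded v'] d2] v v' by simp
    have d4: "((\<lambda>s. (\<xi> \<bullet> (y + s *\<^sub>R \<xi>)) ^ a) has_real_derivative
         real a * (\<xi> \<bullet> (y + s *\<^sub>R \<xi>)) ^ (a - 1) * (\<xi> \<bullet> \<xi>)) (at s)"
      using DERIV_power[OF d1, of a] by (simp add: mult_ac)
    show ?thesis
      by (rule DERIV_cong[OF DERIV_mult[OF d4 d3]])
        (use v in \<open>simp add: bump_flux_def bump_def v_def[symmetric] v'[symmetric] max_def\<close>)
  qed
  note deriv = this
  have "\<forall>\<^sub>F s in nhds s. 1 - (y + s *\<^sub>R \<xi>) \<bullet> (y + s *\<^sub>R \<xi>) > 0"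
  proof -
    have "open {s. 1 - (y + s *\<^sub>R \<xi>) \<bullet> (y + s *\<^sub>R \<xi>) > 0}"
      by (intro open_Collect_less continuous_intros)
    then show ?thesis using v by (auto simp: eventually_nhds v_def power2_norm_eq_inner)
  qed
  then have "\<forall>\<^sub>F s in nhds s. (\<xi> \<bullet> (y + s *\<^sub>R \<xi>)) ^ a * (1 - (y + s *\<^sub>R \<xi>) \<bullet> (y + s *\<^sub>R \<xi>)) powr c
      = (\<xi> \<bullet> (y + s *\<^sub>R \<xi>)) ^ a * bump c (y + s *\<^sub>R \<xi>)"
    by eventually_elim (simp add: bump_def power2_norm_eq_inner max_def)
  from DERIV_cong_ev[OF refl this refl] deriv show ?thesis by simp
next
  case False
  then have n: "norm (y + s *\<^sub>R \<xi>) > 1" using assms by simp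
  have "\<forall>\<^sub>F s in nhds s. norm (y + s *\<^sub>R \<xi>) > 1"
  proof -
    have "open {s. norm (y + s *\<^sub>R \<xi>) > 1}" by (intro open_Collect_less continuous_intros)
    then show ?thesis using n by (auto simp: eventually_nhds)
  qed
  then have "\<forall>\<^sub>F s in nhds s. 0 = (\<xi> \<bullet> (y + s *\<^sub>R \<xi>)) ^ a * bump c (y + s *\<^sub>R \<xi>)"
    by eventually_elim (simp add: bump_outside)
  then show ?thesis using DERIV_cong_ev[OF refl _ refl, of "\<lambda>_. 0" _ s 0] n
    by (simp add: bump_flux_def bump_outside)
qed

text \<open>For c > 0 the primitive is continuous across the sphere, although its derivative may be
  unbounded there.\<close>

lemma bump_line_integral:
  fixes y \<xi> :: "'a::euclidean_space"
  assumes "0 < c" "\<xi> \<noteq> 0"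
  shows "((\<lambda>s. bump_flux a c \<xi> (y + s *\<^sub>R \<xi>)) has_integral
     ((\<xi> \<bullet> (y + \<xi>)) ^ a * bump c (y + \<xi>) - (\<xi> \<bullet> y) ^ a * bump c y)) {0..1}"
proof -
  define F where "F s = (\<xi> \<bullet> (y + s *\<^sub>R \<xi>)) ^ a * bump c (y + s *\<^sub>R \<xi>)" for s
  have "((\<lambda>s. bump_flux a c \<xi> (y + s *\<^sub>R \<xi>)) has_integral (F 1 - F 0)) {0..1}"
    by (rule fundamental_theorem_of_calculus_strong[OF finite_line_sphere[OF assms(2), of y]])
      (auto simp: F_def has_real_derivative_iff_has_vector_derivative[symmetric]
        intro!: bump_line_derivative continuous_intros bump_continuous assms)
  then show ?thesis by (simp add: F_def)
qed

lemma nn_integral_translate: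
  fixes f :: "'a::euclidean_space \<Rightarrow> ennreal"
  assumes "f \<in> borel_measurable borel"
  shows "(\<integral>\<^sup>+y. f (y + c) \<partial>lborel) = (\<integral>\<^sup>+y. f y \<partial>lborel)"
proof -
  have "(\<integral>\<^sup>+y. f y \<partial>lborel) = (\<integral>\<^sup>+y. f y \<partial>distr lborel borel ((+) c))"
    by (simp add: lborel_distr_plus)
  also have "\<dots> = (\<integral>\<^sup>+y. f (y + c) \<partial>lborel)"
    using assms by (subst nn_integral_distr) (auto simp: add.commute)
  finally show ?thesis by simp
qed

lemma integral_translate:
  fixes f :: "'a::euclidean_space \<Rightarrow> real"
  assumes "f \<in> borel_measurable borel"
  shows "(\<integral>y. f (y + c) \<partial>lborel) = (\<integral>y. f y \<partial>lborel)"
    and "integrable lborel (\<lambda>y. f (y + c)) \<longleftrightarrow> integrable lborel f"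
proof -
  have "(\<integral>y. f y \<partial>lborel) = (\<integral>y. f y \<partial>distr lborel borel ((+) c))"
    by (simp add: lborel_distr_plus)
  also have "\<dots> = (\<integral>y. f (y + c) \<partial>lborel)"
    using assms by (subst integral_distr) (auto simp: add.commute)
  finally show "(\<integral>y. f (y + c) \<partial>lborel) = (\<integral>y. f y \<partial>lborel)" by simp
  have "integrable lborel f \<longleftrightarrow> integrable (distr lborel borel ((+) c)) f"
    by (simp add: lborel_distr_plus)
  also have "\<dots> \<longleftrightarrow> integrable lborel (\<lambda>y. f (y + c))"
    using assms by (subst integrable_distr_eq) (auto simp: add.commute)
  finally show "integrable lborel (\<lambda>y. f (y + c)) \<longleftrightarrow> integrable lborel f" by simp
qed

lemma indicator_mult_if: "indicator A s * (x :: real) = (if s \<in> A then x else 0)"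
  by (simp add: indicator_def)

lemma sum_Basis_power2: "(\<Sum>b\<in>Basis. (b \<bullet> y)\<^sup>2) = (norm (y :: 'a::euclidean_space))\<^sup>2"
  unfolding power2_norm_eq_inner by (subst euclidean_inner) (simp add: power2_eq_square inner_commute)

text \<open>Averaging over translates in direction \<open>\<xi>\<close> reduces the claim to the fundamental theorem
  of calculus on lines.\<close>

lemma integral_directional_derivative_zero:
  fixes F G :: "'a::euclidean_space \<Rightarrow> real"
  assumes F: "integrable lborel F" and G: "integrable lborel G"
    and line: "\<And>y. ((\<lambda>s. G (y + s *\<^sub>R \<xi>)) has_integral (F (y + \<xi>) - F y)) {0..1}"
  shows "(\<integral>y. G y \<partial>lborel) = 0"
proof -
  have [measurable]: "G \<in> borel_measurable borel" "F \<in> borel_measurable borel" using F G by auto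
  define H where "H s y = indicator {0..1} s * G (y + s *\<^sub>R \<xi>)" for s :: real and y
  have Hm [measurable]: "case_prod H \<in> borel_measurable (lborel \<Otimes>\<^sub>M lborel)"
    unfolding H_def by measurable
  have intH: "integrable (lborel \<Otimes>\<^sub>M lborel) (case_prod H)"
  proof (rule lborel_pair.Fubini_integrable)
    have "(\<lambda>s. \<integral>y. norm (case_prod H (s, y)) \<partial>lborel) = (\<lambda>s. indicator {0..1} s *\<^sub>R (\<integral>y. \<bar>G y\<bar> \<partial>lborel))"
      using integral_translate(1)[of "\<lambda>y. \<bar>G y\<bar>"] by (intro ext) (simp add: H_def abs_mult)
    then show "integrable lborel (\<lambda>s. \<integral>y. norm (case_prod H (s, y)) \<partial>lborel)" by simp
    show "AE s in lborel. integrable lborel (\<lambda>y. case_prod H (s, y))"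
      using integral_translate(2)[of G] G by (simp add: H_def)
  qed (rule Hm)
  have int2: "AE y in lborel. integrable lborel (\<lambda>s. H s y)"
    using lborel_pair.AE_integrable_snd[OF intH] .
  have "(\<integral>y. G y \<partial>lborel) = (\<integral>s. indicator {0..1} s *\<^sub>R (\<integral>y. G y \<partial>lborel) \<partial>(lborel :: real measure))"
    by simp
  also have "\<dots> = (\<integral>s. (\<integral>y. H s y \<partial>lborel) \<partial>lborel)"
    using integral_translate(1)[of G] by (simp add: H_def)
  also have "\<dots> = (\<integral>y. (\<integral>s. H s y \<partial>lborel) \<partial>lborel)"
    using lborel_pair.Fubini_integral[OF intH] by simp
  also have "\<dots> = (\<integral>y. F (y + \<xi>) - F y \<partial>lborel)"
  proof (rule integral_cong_AE)
    show "AE y in lborel. (\<integral>s. H s y \<partial>lborel) = F (y + \<xi>) - F y"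
      using int2
    proof eventually_elim
      case (elim y)
      have "((\<lambda>s. H s y) has_integral (\<integral>s. H s y \<partial>lborel)) UNIV"
        by (rule has_integral_integral_lborel[OF elim])
      moreover have "((\<lambda>s. H s y) has_integral (F (y + \<xi>) - F y)) UNIV"
        using line[of y] has_integral_restrict_UNIV[of "{0..1}" "\<lambda>s. G (y + s *\<^sub>R \<xi>)"]
        by (simp add: H_def indicator_mult_if)
      ultimately show ?case by (rule has_integral_unique)
    qed
  qed measurable
  also have "\<dots> = 0"
    using F integral_translate[of F \<xi>] by simp
  finally show ?thesis .
qed

lemma integrable_bounded_support:
  fixes f :: "'a::euclidean_space \<Rightarrow> real"
  assumes [measurable]: "f \<in> borel_measurable borel" and "\<And>y. \<bar>f y\<bar> \<le> B" "\<And>y. 1 \<le> norm y \<Longrightarrow> f y = 0"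
  shows "integrable lborel f"
proof (rule Bochner_Integration.integrable_bound)
  show "integrable lborel (\<lambda>y. indicator (cball 0 1 :: 'a set) y *\<^sub>R B)"
    by (intro integrable_real_mult_indicator integrable_scaleR_left integrable_real_indicator)
      (use emeasure_bounded_finite[of "cball (0::'a) 1"] in auto)
  show "AE y in lborel. norm (f y) \<le> norm (indicator (cball 0 1) y *\<^sub>R B)"
    using assms(2,3) by (intro AE_I2) (auto simp: indicator_def intro: order_trans[OF _ abs_ge_self])
qed auto

lemma bump_integrable_pos:
  assumes "0 \<le> c"
  shows "integrable lborel (\<lambda>y::'a::euclidean_space. bump c y)"
  using assms by (intro integrable_bounded_support[where B = 1]) (auto simp: bump_nonneg bump_le_1 bump_outside)

lemma inner_power_bump_bound:
  assumes "0 \<le> c"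
  shows "\<bar>(\<xi> \<bullet> y) ^ a * bump c y\<bar> \<le> norm \<xi> ^ a"
proof (cases "norm y < 1")
  case True
  have "\<bar>\<xi> \<bullet> y\<bar> \<le> norm \<xi>"
    using Cauchy_Schwarz_ineq2[of \<xi> y] mult_left_mono[of "norm y" 1 "norm \<xi>"] True by simp
  then have "\<bar>\<xi> \<bullet> y\<bar> ^ a * bump c y \<le> norm \<xi> ^ a * 1"
    by (intro mult_mono power_mono bump_le_1 assms) (auto simp: bump_nonneg)
  then show ?thesis by (simp add: abs_mult bump_nonneg power_abs)
qed (simp add: bump_outside)

text \<open>For c < 1 the integrand is singular at the sphere and its integrability is not yet
  known. On each segment of direction \<xi> the fundamental theorem with a = 1 controls G, because
  the flux is \<open>bump c\<close> minus 2c times G; averaging over translates turns this into a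
  bound on the whole space.\<close>

lemma bump_moment2_finite:
  fixes \<xi> :: "'a::euclidean_space"
  assumes c: "0 < c" and \<xi>: "norm \<xi> = 1"
  shows "(\<integral>\<^sup>+y. ennreal ((\<xi> \<bullet> y)\<^sup>2 * bump (c - 1) y) \<partial>lborel) < \<infinity>"
proof -
  define G where "G y = (\<xi> \<bullet> y)\<^sup>2 * bump (c - 1) y" for y
  have [measurable]: "G \<in> borel_measurable borel" unfolding G_def by measurable
  have G0: "0 \<le> G y" for y by (simp add: G_def bump_nonneg)
  \<comment> \<open>The 3 collects the integral of \<open>bump c\<close> and two boundary values,
    each at most 1 in absolute value. A unit segment that starts outside the ball of radius 2 does
    not enter the open unit ball.\<close>
  have inner: "(\<integral>\<^sup>+s. ennreal (indicator {0..1} s * G (y + s *\<^sub>R \<xi>)) \<partial>lborel)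
      \<le> ennreal (3 / (2 * c)) * indicator (cball 0 2) y" for y
  proof (cases "norm y \<le> 2")
    case True
    define F where "F s = (\<xi> \<bullet> (y + s *\<^sub>R \<xi>)) * bump c (y + s *\<^sub>R \<xi>)" for s
    define I where "I = integral {0..1} (\<lambda>s. bump c (y + s *\<^sub>R \<xi>))"
    have cont: "continuous_on {0..1} (\<lambda>s. bump c (y + s *\<^sub>R \<xi>))"
      by (intro bump_continuous c continuous_intros)
    have I: "((\<lambda>s. bump c (y + s *\<^sub>R \<xi>)) has_integral I) {0..1}"
      unfolding I_def by (intro integrable_integral integrable_continuous_real cont)
    have I1: "I \<le> 1"
      using has_integral_le[OF I has_integral_const_real[of "1::real" 0 1]] c by (auto simp: bump_le_1)
    have "((\<lambda>s. bump_flux 1 c \<xi> (y + s *\<^sub>R \<xi>)) has_integral (F 1 - F 0)) {0..1}"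
      using bump_line_integral[OF c, of \<xi> 1 y] \<xi> by (force simp: F_def)
    from has_integral_diff[OF I this]
    have "((\<lambda>s. 2 * c * G (y + s *\<^sub>R \<xi>)) has_integral (I - (F 1 - F 0))) {0..1}"
      using \<xi> by (simp add: bump_flux_def G_def power2_norm_eq_inner[symmetric] mult.assoc power2_eq_square)
    from has_integral_mult_right[OF this, of "1 / (2 * c)"]
    have "((\<lambda>s. G (y + s *\<^sub>R \<xi>)) has_integral ((I - (F 1 - F 0)) / (2 * c))) {0..1}"
      using c by simp
    then have "((\<lambda>s. indicator {0..1} s * G (y + s *\<^sub>R \<xi>)) has_integral ((I - (F 1 - F 0)) / (2 * c))) UNIV"
      using has_integral_restrict_UNIV[of "{0..1}" "\<lambda>s. G (y + s *\<^sub>R \<xi>)"]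
      by (simp add: indicator_mult_if)
    then have "(\<integral>\<^sup>+s. ennreal (indicator {0..1} s * G (y + s *\<^sub>R \<xi>)) \<partial>lborel) = ennreal ((I - (F 1 - F 0)) / (2 * c))"
      by (intro nn_integral_has_integral_lborel) (auto simp: G0)
    also have "\<dots> \<le> ennreal (3 / (2 * c))"
    proof -
      have "\<bar>F s\<bar> \<le> 1" for s using inner_power_bump_bound[of c \<xi> "y + s *\<^sub>R \<xi>" 1] c \<xi> by (simp add: F_def)
      from this[of 0] this[of 1] show ?thesis using I1 c by (intro ennreal_leI divide_right_mono) auto
    qed
    finally show ?thesis using True by simp
  next
    case False
    have "G (y + s *\<^sub>R \<xi>) = 0" if "0 \<le> s" "s \<le> 1" for s
    proof -
      have "norm y \<le> norm (y + s *\<^sub>R \<xi>) + norm (s *\<^sub>R \<xi>)"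
        using norm_triangle_ineq4[of "y + s *\<^sub>R \<xi>" "s *\<^sub>R \<xi>"] by simp
      then have "1 \<le> norm (y + s *\<^sub>R \<xi>)" using False that \<xi> by simp
      then show ?thesis by (simp add: G_def bump_outside)
    qed
    then have "(\<integral>\<^sup>+s. ennreal (indicator {0..1} s * G (y + s *\<^sub>R \<xi>)) \<partial>lborel) = (\<integral>\<^sup>+s. 0 \<partial>(lborel::real measure))"
      by (intro nn_integral_cong) (auto simp: indicator_def)
    then show ?thesis by simp
  qed
  have "(\<integral>\<^sup>+y. ennreal (G y) \<partial>lborel) = (\<integral>\<^sup>+s. indicator {0..1} s * (\<integral>\<^sup>+y. ennreal (G y) \<partial>lborel) \<partial>(lborel::real measure))"
    by (subst nn_integral_multc) auto
  also have "\<dots> = (\<integral>\<^sup>+s. (\<integral>\<^sup>+y. ennreal (indicator {0..1} s * G (y + s *\<^sub>R \<xi>)) \<partial>lborel) \<partial>lborel)"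
  proof (rule nn_integral_cong)
    fix s :: real
    have "(\<integral>\<^sup>+y. ennreal (indicator {0..1} s * G (y + s *\<^sub>R \<xi>)) \<partial>lborel)
        = (\<integral>\<^sup>+y. indicator {0..1} s * ennreal (G (y + s *\<^sub>R \<xi>)) \<partial>lborel)"
      by (intro nn_integral_cong) (auto simp: indicator_def)
    also have "\<dots> = indicator {0..1} s * (\<integral>\<^sup>+y. ennreal (G (y + s *\<^sub>R \<xi>)) \<partial>lborel)"
      by (rule nn_integral_cmult) measurable
    also have "(\<integral>\<^sup>+y. ennreal (G (y + s *\<^sub>R \<xi>)) \<partial>lborel) = (\<integral>\<^sup>+y. ennreal (G y) \<partial>lborel)"
      by (rule nn_integral_translate) measurable
    finally show "indicator {0..1} s * (\<integral>\<^sup>+y. ennreal (G y) \<partial>lborel)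
      = (\<integral>\<^sup>+y. ennreal (indicator {0..1} s * G (y + s *\<^sub>R \<xi>)) \<partial>lborel)" by simp
  qed
  also have "\<dots> = (\<integral>\<^sup>+y. (\<integral>\<^sup>+s. ennreal (indicator {0..1} s * G (y + s *\<^sub>R \<xi>)) \<partial>lborel) \<partial>lborel)"
    by (rule lborel_pair.Fubini') measurable
  also have "\<dots> \<le> (\<integral>\<^sup>+(y::'a). ennreal (3 / (2 * c)) * indicator (cball 0 2) y \<partial>lborel)"
    by (intro nn_integral_mono inner)
  also have "\<dots> = ennreal (3 / (2 * c)) * emeasure lborel (cball 0 2 :: 'a set)"
    by (rule nn_integral_cmult_indicator) auto
  also have "\<dots> < \<infinity>" using emeasure_bounded_finite[of "cball (0::'a) 2"] by (simp add: ennreal_mult_less_top)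
  finally show ?thesis by (simp add: G_def)
qed

text \<open>\<open>bump c\<close> is the sum of \<open>(1 - (norm y)\<^sup>2) * bump c y\<close>,
  which is the bounded function \<open>bump (c + 1)\<close>, and of its second moments along the
  coordinate axes.\<close>

lemma bump_integrable:
  assumes "- 1 < c"
  shows "integrable lborel (\<lambda>y::'a::euclidean_space. bump c y)"
proof -
  have *: "integrable lborel (\<lambda>y::'a. (b \<bullet> y)\<^sup>2 * bump c y)" if "b \<in> Basis" for b
    using bump_moment2_finite[of "c + 1" b] assms that
    by (intro integrableI_nonneg) (auto simp: bump_nonneg)
  have "integrable lborel (\<lambda>y::'a. bump (c + 1) y + (\<Sum>b\<in>Basis. (b \<bullet> y)\<^sup>2 * bump c y))"
    using assms by (intro Bochner_Integration.integrable_add Bochner_Integration.integrable_sum * bump_integrable_pos) auto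
  moreover have "bump (c + 1) y + (\<Sum>b\<in>Basis. (b \<bullet> y)\<^sup>2 * bump c y) = bump c y" for y :: 'a
  proof -
    have "(\<Sum>b\<in>Basis. (b \<bullet> y)\<^sup>2 * bump c y) = (norm y)\<^sup>2 * bump c y"
      by (simp add: sum_distrib_right[symmetric] sum_Basis_power2)
    then show ?thesis using bump_mult_power'[of c y 1] by (simp add: algebra_simps)
  qed
  ultimately show ?thesis by simp
qed

lemma bump_integral_pos:
  assumes "- 1 < c"
  shows "0 < integral\<^sup>L lborel (bump c :: 'a::euclidean_space \<Rightarrow> real)"
proof (rule ccontr)
  assume "\<not> ?thesis"
  then have "(integral\<^sup>L lborel (bump c :: 'a \<Rightarrow> real)) = 0"
    by (intro antisym Bochner_Integration.integral_nonneg) (auto simp: bump_nonneg not_less)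
  then have "AE y::'a in lborel. bump c y = 0"
    using integral_nonneg_eq_0_iff_AE[OF bump_integrable[OF assms, where 'a = 'a]] by (simp add: bump_nonneg)
  then have "AE y::'a in lborel. y \<notin> ball 0 1"
    by eventually_elim (use bump_pos[of _ c] in force)
  then have "emeasure lborel (ball (0::'a) 1) = 0"
    by (subst (asm) AE_iff_measurable[OF _ refl]) (auto simp: ball_def dist_norm)
  then have "negligible (ball (0::'a) 1)"
    unfolding negligible_iff_null_sets by (intro null_sets_completionI) auto
  then show False using open_not_negligible[of "ball (0::'a) 1"] by auto
qed

section \<open>Normalised weights and their moments\<close>

definition bump_measure :: "real \<Rightarrow> 'a::euclidean_space measure" where
  "bump_measure c = density lborel (\<lambda>y. ennreal (bump c y / (integral\<^sup>L lborel (bump c :: 'a \<Rightarrow> real))))"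

lemma sets_bump_measure [simp, measurable_cong]: "sets (bump_measure c) = sets borel"
  and space_bump_measure [simp]: "space (bump_measure c) = UNIV"
  by (simp_all add: bump_measure_def)

lemma integrable_bump_measure:
  fixes f :: "'a::euclidean_space \<Rightarrow> real"
  assumes "-1 < c" "f \<in> borel_measurable borel"
  shows "integrable (bump_measure c) f \<longleftrightarrow> integrable lborel (\<lambda>y. bump c y * f y)"
proof -
  define Z where "Z = (integral\<^sup>L lborel (bump c :: 'a \<Rightarrow> real))"
  have Z: "Z > 0" using bump_integral_pos[OF assms(1)] by (simp add: Z_def)
  have "integrable (bump_measure c) f \<longleftrightarrow> integrable lborel (\<lambda>y. bump c y / Z * f y)"
    unfolding bump_measure_def Z_def[symmetric] using assms Z
    by (subst integrable_density) (auto simp: bump_nonneg)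
  also have "(\<lambda>y. bump c y / Z * f y) = (\<lambda>y. inverse Z * (bump c y * f y))" by (simp add: field_simps)
  also have "integrable lborel \<dots> \<longleftrightarrow> integrable lborel (\<lambda>y. bump c y * f y)"
  proof
    assume "integrable lborel (\<lambda>y. inverse Z * (bump c y * f y))"
    then have "integrable lborel (\<lambda>y. Z * (inverse Z * (bump c y * f y)))" by (rule integrable_mult_right)
    then show "integrable lborel (\<lambda>y. bump c y * f y)" using Z by (simp add: mult.assoc[symmetric])
  qed (rule integrable_mult_right)
  finally show ?thesis .
qed

lemma integral_bump_measure:
  fixes f :: "'a::euclidean_space \<Rightarrow> real"
  assumes "-1 < c" "f \<in> borel_measurable borel"
  shows "(\<integral>y. f y \<partial>bump_measure c) = (\<integral>y. bump c y * f y \<partial>lborel) / (integral\<^sup>L lborel (bump c :: 'a \<Rightarrow> real))"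
  unfolding bump_measure_def using assms bump_integral_pos[OF assms(1), where 'a = 'a]
  by (subst integral_density) (auto simp: bump_nonneg)

lemma prob_space_bump_measure:
  assumes "-1 < c"
  shows "prob_space (bump_measure c :: 'a::euclidean_space measure)"
proof
  define Z where "Z = (integral\<^sup>L lborel (bump c :: 'a \<Rightarrow> real))"
  have Z: "Z > 0" using bump_integral_pos[OF assms(1)] by (simp add: Z_def)
  have "emeasure (bump_measure c) (space (bump_measure c :: 'a measure)) = (\<integral>\<^sup>+(y::'a). ennreal (bump c y / Z) \<partial>lborel)"
    by (simp add: bump_measure_def Z_def emeasure_density)
  also have "\<dots> = ennreal (\<integral>(y::'a). bump c y / Z \<partial>lborel)"
    using bump_integrable[OF assms, where 'a = 'a] Z by (intro nn_integral_eq_integral) (auto simp: bump_nonneg)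
  also have "\<dots> = 1" using Z by (simp add: Z_def)
  finally show "emeasure (bump_measure c) (space (bump_measure c :: 'a measure)) = 1" .
qed

lemma AE_bump_measure: "AE y in bump_measure c. norm y < 1"
proof -
  have "0 < ennreal (bump c y / k) \<Longrightarrow> norm y < 1" for y :: 'a and k
    by (rule ccontr) (simp add: bump_outside)
  then show ?thesis unfolding bump_measure_def by (subst AE_density) auto
qed

lemma bump_measure_integrable_bounded:
  fixes f :: "'a::euclidean_space \<Rightarrow> real"
  assumes c: "-1 < c" and [measurable]: "f \<in> borel_measurable borel" and "\<And>y. norm y \<le> 1 \<Longrightarrow> \<bar>f y\<bar> \<le> B"
  shows "integrable (bump_measure c) f"
proof -
  interpret prob_space "bump_measure c :: 'a measure" by (rule prob_space_bump_measure[OF c])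
  show ?thesis
    by (rule integrable_const_bound[where B = B]) (use AE_bump_measure[of c] assms(3) in \<open>auto elim!: eventually_mono\<close>)
qed

definition bump_moment :: "real \<Rightarrow> nat \<Rightarrow> nat \<Rightarrow> 'a::euclidean_space \<Rightarrow> real" where
  "bump_moment c a i \<xi> = (\<integral>y. (\<xi> \<bullet> y) ^ a * (1 - (norm y)\<^sup>2) ^ i \<partial>bump_measure c)"

lemma bump_moment_integrable:
  assumes "- 1 < c"
  shows "integrable (bump_measure c) (\<lambda>y. (\<xi> \<bullet> y) ^ a * (1 - (norm y)\<^sup>2) ^ i)"
proof (rule bump_measure_integrable_bounded[OF assms, where B = "norm \<xi> ^ a"])
  fix y :: 'a assume y: "norm y \<le> 1"
  have 1: "\<bar>\<xi> \<bullet> y\<bar> \<le> norm \<xi>"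
    using Cauchy_Schwarz_ineq2[of \<xi> y] mult_left_mono[of "norm y" 1 "norm \<xi>"] y by simp
  have 2: "\<bar>1 - (norm y)\<^sup>2\<bar> \<le> 1" using y power_le_one[of "norm y" 2] by simp
  have "\<bar>\<xi> \<bullet> y\<bar> ^ a * \<bar>1 - (norm y)\<^sup>2\<bar> ^ i \<le> norm \<xi> ^ a * 1"
    by (intro mult_mono power_mono 1 power_le_one 2) auto
  then show "\<bar>(\<xi> \<bullet> y) ^ a * (1 - (norm y)\<^sup>2) ^ i\<bar> \<le> norm \<xi> ^ a" by (simp add: abs_mult power_abs)
qed measurable

text \<open>Integration by parts: \<open>bump_flux\<close> with exponent c + i + 1 is a directional
  derivative, so its integral is 0, and its two terms are the two moments.\<close>

lemma bump_moment_rec: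
  fixes \<xi> :: "'a::euclidean_space"
  assumes c: "- 1 < c"
  shows "2 * (c + real i + 1) * bump_moment c (a + 1) i \<xi> = real a * (norm \<xi>)\<^sup>2 * bump_moment c (a - 1) (i + 1) \<xi>"
proof (cases "\<xi> = 0")
  case True
  then show ?thesis by (simp add: bump_moment_def)
next
  case False
  define e where "e = c + real i + 1"
  have e: "e > 0" using c by (simp add: e_def)
  define Z where "Z = (integral\<^sup>L lborel (bump c :: 'a \<Rightarrow> real))"
  have Z: "Z > 0" using bump_integral_pos[OF assms(1)] by (simp add: Z_def)
  have mom: "bump_moment c a i \<xi> = (\<integral>y. (\<xi> \<bullet> y) ^ a * bump (c + real i) y \<partial>lborel) / Z" for a i
  proof -
    have "bump_moment c a i \<xi> = (\<integral>y. bump c y * ((\<xi> \<bullet> y) ^ a * (1 - (norm y)\<^sup>2) ^ i) \<partial>lborel) / Z"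
      unfolding bump_moment_def Z_def by (subst integral_bump_measure[OF c]) auto
    also have "(\<lambda>y. bump c y * ((\<xi> \<bullet> y) ^ a * (1 - (norm y)\<^sup>2) ^ i)) = (\<lambda>y. (\<xi> \<bullet> y) ^ a * bump (c + real i) y)"
      by (intro ext) (simp add: bump_mult_power'[symmetric] mult_ac)
    finally show ?thesis .
  qed
  have int: "integrable lborel (\<lambda>y. (\<xi> \<bullet> y) ^ a * bump (c + real i) y)" for a i
  proof -
    have "integrable lborel (\<lambda>y. bump c y * ((\<xi> \<bullet> y) ^ a * (1 - (norm y)\<^sup>2) ^ i))"
      using bump_moment_integrable[OF c, of \<xi> a i] by (subst (asm) integrable_bump_measure[OF c]) auto
    also have "(\<lambda>y. bump c y * ((\<xi> \<bullet> y) ^ a * (1 - (norm y)\<^sup>2) ^ i)) = (\<lambda>y. (\<xi> \<bullet> y) ^ a * bump (c + real i) y)"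
      by (intro ext) (simp add: bump_mult_power'[symmetric] mult_ac)
    finally show ?thesis .
  qed
  have int1: "integrable lborel (\<lambda>y. (\<xi> \<bullet> y) ^ (a - 1) * bump e y)"
    and int2: "integrable lborel (\<lambda>y. (\<xi> \<bullet> y) ^ (a + 1) * bump (e - 1) y)"
    and int3: "integrable lborel (\<lambda>y. (\<xi> \<bullet> y) ^ a * bump e y)"
    using int[of "a - 1" "i + 1"] int[of "a + 1" i] int[of a "i + 1"] by (simp_all add: e_def add_ac)
  have flux: "bump_flux a e \<xi> = (\<lambda>y. real a * (\<xi> \<bullet> \<xi>) * ((\<xi> \<bullet> y) ^ (a - 1) * bump e y)
      - 2 * e * ((\<xi> \<bullet> y) ^ (a + 1) * bump (e - 1) y))"
    by (intro ext) (simp add: bump_flux_def mult_ac)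
  have "(\<integral>y. bump_flux a e \<xi> y \<partial>lborel) = 0"
    by (rule integral_directional_derivative_zero[OF int3 _ bump_line_integral[OF e False]])
      (unfold flux, intro Bochner_Integration.integrable_diff integrable_mult_right int1 int2)
  then have "real a * (\<xi> \<bullet> \<xi>) * (\<integral>y. (\<xi> \<bullet> y) ^ (a - 1) * bump e y \<partial>lborel)
     = 2 * e * (\<integral>y. (\<xi> \<bullet> y) ^ (a + 1) * bump (e - 1) y \<partial>lborel)"
    unfolding flux using int1 int2 by simp
  moreover have "(\<integral>y. (\<xi> \<bullet> y) ^ (a - 1) * bump e y \<partial>lborel) = Z * bump_moment c (a - 1) (i + 1) \<xi>"
    unfolding mom using Z by (simp add: e_def add_ac)
  moreover have "(\<integral>y. (\<xi> \<bullet> y) ^ (a + 1) * bump (e - 1) y \<partial>lborel) = Z * bump_moment c (a + 1) i \<xi>"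
    unfolding mom using Z by (simp add: e_def)
  ultimately have "Z * (2 * e * bump_moment c (a + 1) i \<xi>)
     = Z * (real a * (norm \<xi>)\<^sup>2 * bump_moment c (a - 1) (i + 1) \<xi>)"
    unfolding power2_norm_eq_inner by (simp only: mult_ac)
  then show ?thesis using Z by (simp add: e_def)
qed

text \<open>The recurrence with a = 0 makes the first moment vanish, and its steps of length two
  carry this to all odd orders.\<close>

lemma bump_moment_odd:
  assumes "- 1 < c" "odd a"
  shows "bump_moment c a i \<xi> = 0"
proof -
  have "bump_moment c (2 * k + 1) i \<xi> = 0" for k i
  proof (induction k arbitrary: i)
    case 0
    then show ?case using bump_moment_rec[OF assms(1), of i 0 \<xi>] assms(1) by simp
  next
    case (Suc k)
    have "2 * (c + real i + 1) * bump_moment c (2 * k + 2 + 1) i \<xi>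
      = real (2 * k + 2) * (norm \<xi>)\<^sup>2 * bump_moment c (2 * k + 2 - 1) (i + 1) \<xi>"
      by (rule bump_moment_rec[OF assms(1)])
    then show ?case using Suc[of "i + 1"] assms(1) by simp
  qed
  then show ?thesis using assms(2) by (auto elim!: oddE)
qed

text \<open>Each use of the recurrence trades a factor \<open>(\<xi> \<bullet> y)\<^sup>2\<close>
  for a factor \<open>1 - (norm y)\<^sup>2\<close>, until a radial moment is left.\<close>

lemma bump_moment_even:
  assumes "- 1 < c"
  shows "bump_moment c (2 * k) i \<xi>
    = norm \<xi> ^ (2 * k) * pochhammer (1/2) k / pochhammer (c + real i + 1) k * bump_moment c 0 (i + k) \<xi>"
proof (induction k arbitrary: i)
  case (Suc k)
  have "2 * (c + real i + 1) * bump_moment c (2 * k + 1 + 1) i \<xi>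
      = real (2 * k + 1) * (norm \<xi>)\<^sup>2 * bump_moment c (2 * k + 1 - 1) (i + 1) \<xi>"
    by (rule bump_moment_rec[OF assms(1)])
  then have "bump_moment c (2 * Suc k) i \<xi>
     = (1/2 + real k) * (norm \<xi>)\<^sup>2 / (c + real i + 1) * bump_moment c (2 * k) (i + 1) \<xi>"
    using assms by (simp add: field_simps)
  moreover have "pochhammer (c + real i + 1) (Suc k) = (c + real i + 1) * pochhammer (c + real (i + 1) + 1) k"
    by (simp add: pochhammer_rec add_ac)
  moreover have "norm \<xi> ^ (2 * Suc k) = (norm \<xi>)\<^sup>2 * norm \<xi> ^ (2 * k)"
    by (simp add: power2_eq_square)
  ultimately show ?case unfolding Suc[of "i + 1"] pochhammer_rec'[of "1/2"] by (simp add: power2_eq_square)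
qed simp

text \<open>The second moments along the coordinate axes add up to the moment of
  \<open>(norm y)\<^sup>2\<close>, so the recurrence with a = 1 links consecutive radial moments.
  Their ratios multiply to Pochhammer symbols.\<close>

lemma bump_moment_zero:
  assumes c: "- 1 < c"
  shows "bump_moment c 0 i (\<xi> :: 'a::euclidean_space)
    = pochhammer (c + 1) i / pochhammer (c + 1 + real DIM('a) / 2) i"
proof (induction i)
  case 0
  interpret prob_space "bump_measure c :: 'a measure" by (rule prob_space_bump_measure[OF c])
  show ?case using prob_space by (simp add: bump_moment_def)
next
  case (Suc i)
  define m where "m i = bump_moment c 0 i (0::'a)" for i
  have m: "bump_moment c 0 i \<xi> = m i" for i and \<xi> :: 'a by (simp add: m_def bump_moment_def)
  have "m i - m (Suc i) = (\<integral>(y::'a). (norm y)\<^sup>2 * (1 - (norm y)\<^sup>2) ^ i \<partial>bump_measure c)"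
    unfolding m_def bump_moment_def
    using bump_moment_integrable[OF c, of "0::'a" 0 i] bump_moment_integrable[OF c, of "0::'a" 0 "Suc i"]
    by (subst Bochner_Integration.integral_diff[symmetric]) (auto simp: algebra_simps)
  also have "\<dots> = (\<integral>(y::'a). (\<Sum>b\<in>Basis. (b \<bullet> y) ^ 2 * (1 - (norm y)\<^sup>2) ^ i) \<partial>bump_measure c)"
  proof (intro Bochner_Integration.integral_cong refl)
    fix y :: 'a
    show "(norm y)\<^sup>2 * (1 - (norm y)\<^sup>2) ^ i = (\<Sum>b\<in>Basis. (b \<bullet> y) ^ 2 * (1 - (norm y)\<^sup>2) ^ i)"
      by (simp add: sum_distrib_right[symmetric] sum_Basis_power2)
  qed
  also have "\<dots> = (\<Sum>b\<in>(Basis::'a set). bump_moment c 2 i b)"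
    unfolding bump_moment_def using bump_moment_integrable[OF c] by (subst Bochner_Integration.integral_sum) auto
  also have "\<dots> = (\<Sum>b\<in>(Basis::'a set). m (Suc i) / (2 * (c + real i + 1)))"
  proof (rule sum.cong)
    fix b :: 'a assume b: "b \<in> Basis"
    have "bump_moment c 2 i b = bump_moment c (2 * 1) i b" by simp
    also have "\<dots> = m (Suc i) / (2 * (c + real i + 1))"
      unfolding bump_moment_even[OF c] m using b by simp
    finally show "bump_moment c 2 i b = m (Suc i) / (2 * (c + real i + 1))" .
  qed simp
  also have "\<dots> = real DIM('a) * m (Suc i) / (2 * (c + real i + 1))" by simp
  finally have *: "m i - m (Suc i) = real DIM('a) * m (Suc i) / (2 * (c + real i + 1))" .
  have "c + real i + 1 > 0" "c + 1 + real DIM('a) / 2 + real i > 0" using c by (auto intro: add_pos_nonneg)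
  with * have "m (Suc i) = m i * ((c + 1 + real i) / (c + 1 + real DIM('a) / 2 + real i))"
    by (simp add: field_simps)
  then show ?case using Suc m by (simp add: pochhammer_rec' mult_ac)
qed

section \<open>The measure on the ball\<close>

lemma ball_weight_eq:
  fixes x :: "real ^ 'n"
  assumes "x \<in> cball 0 1"
  shows "ball_weight \<mu> x = bump (\<mu> - 1/2) x / integral\<^sup>L lborel (bump (\<mu> - 1/2) :: real ^ 'n \<Rightarrow> real)"
proof -
  have *: "(1 - (norm y)\<^sup>2) powr (\<mu> - 1/2) = bump (\<mu> - 1/2) y" if "norm y \<le> 1" for y :: "real ^ 'n"
    using that power_le_one[of "norm y" 2] by (simp add: bump_def max_def)
  have "(LINT y|lebesgue_on (cball (0 :: real ^ 'n) 1). (1 - (norm y)\<^sup>2) powr (\<mu> - 1/2))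
     = (LINT y|lebesgue_on (cball (0 :: real ^ 'n) 1). bump (\<mu> - 1/2) y)"
    by (intro Bochner_Integration.integral_cong refl) (auto simp: *)
  also have "\<dots> = integral\<^sup>L lebesgue (\<lambda>y :: real ^ 'n. indicator (cball 0 1) y *\<^sub>R bump (\<mu> - 1/2) y)"
    by (subst integral_restrict_space) auto
  also have "(\<lambda>y :: real ^ 'n. indicator (cball 0 1) y *\<^sub>R bump (\<mu> - 1/2) y) = bump (\<mu> - 1/2)"
    by (intro ext) (auto simp: indicator_def bump_outside)
  also have "integral\<^sup>L lebesgue (bump (\<mu> - 1/2) :: real ^ 'n \<Rightarrow> real) = integral\<^sup>L lborel (bump (\<mu> - 1/2) :: real ^ 'n \<Rightarrow> real)"
    by (rule integral_completion) auto
  finally show ?thesis using assms by (simp add: ball_weight_def *)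
qed

lemma ball_weight_measurable: "(\<lambda>x. ball_weight \<mu> x) \<in> borel_measurable (lebesgue_on S)"
proof -
  have "(\<lambda>x::real^'n. ball_weight \<mu> x) \<in> borel_measurable borel" unfolding ball_weight_def by measurable
  then have "(\<lambda>x::real^'n. ball_weight \<mu> x) \<in> borel_measurable lebesgue" by (intro measurable_completion) simp
  then show ?thesis by (rule measurable_restrict_space1)
qed

lemma space_ball_measure [simp]: "space (ball_measure \<mu> :: (real ^ 'n) measure) = cball 0 1"
  by (simp add: ball_measure_def space_restrict_space)

lemma measurable_ball_measure_iff:
  "f \<in> borel_measurable (ball_measure \<mu>) \<longleftrightarrow> f \<in> borel_measurable (lebesgue_on (cball 0 1))"
  by (simp add: ball_measure_def)

lemma borel_ball_measure: "f \<in> borel_measurable borel \<Longrightarrow> f \<in> borel_measurable (ball_measure \<mu>)"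
  unfolding measurable_ball_measure_iff by (intro measurable_restrict_space1 measurable_completion) simp

lemma continuous_ball_measure: "continuous_on (cball 0 1) f \<Longrightarrow> f \<in> borel_measurable (ball_measure \<mu>)"
  unfolding measurable_ball_measure_iff by (rule continuous_imp_measurable_on_sets_lebesgue) auto

text \<open>The two measures live on different sigma-algebras, the Lebesgue sets of the ball and the
  Borel sets of the space. Explicit integrals are computed on the Borel side and transferred for
  Borel integrands.\<close>

lemma nn_integral_ball_measure:
  fixes f :: "real ^ 'n \<Rightarrow> ennreal"
  assumes [measurable]: "f \<in> borel_measurable borel"
  shows "(\<integral>\<^sup>+y. f y \<partial>ball_measure \<mu>) = (\<integral>\<^sup>+y. f y \<partial>bump_measure (\<mu> - 1/2))"
proof -
  define Z where "Z = integral\<^sup>L lborel (bump (\<mu> - 1/2) :: real ^ 'n \<Rightarrow> real)"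
  have fm: "f \<in> borel_measurable (lebesgue_on (cball 0 1))"
    by (intro measurable_restrict_space1 measurable_completion) simp
  have "(\<integral>\<^sup>+y. f y \<partial>ball_measure \<mu>) = (\<integral>\<^sup>+y. ennreal (ball_weight \<mu> y) * f y \<partial>lebesgue_on (cball 0 1))"
    unfolding ball_measure_def
    by (rule nn_integral_density) (use fm ball_weight_measurable in \<open>auto intro: measurable_compose[OF _ measurable_ennreal]\<close>)
  also have "\<dots> = (\<integral>\<^sup>+y. (ennreal (ball_weight \<mu> y) * f y) * indicator (cball 0 1) y \<partial>lebesgue)"
    by (subst nn_integral_restrict_space) auto
  also have "\<dots> = (\<integral>\<^sup>+y. ennreal (bump (\<mu> - 1/2) y / Z) * f y \<partial>lebesgue)"
    by (intro nn_integral_cong) (auto simp: indicator_def ball_weight_eq Z_def bump_outside)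
  also have "\<dots> = (\<integral>\<^sup>+y. ennreal (bump (\<mu> - 1/2) y / Z) * f y \<partial>lborel)"
    by (rule nn_integral_completion)
  also have "\<dots> = (\<integral>\<^sup>+y. f y \<partial>bump_measure (\<mu> - 1/2))"
    unfolding bump_measure_def Z_def by (subst nn_integral_density) auto
  finally show ?thesis .
qed

lemma integrable_ball_measure:
  fixes f :: "real ^ 'n \<Rightarrow> real"
  assumes [measurable]: "f \<in> borel_measurable borel"
  shows "integrable (ball_measure \<mu>) f \<longleftrightarrow> integrable (bump_measure (\<mu> - 1/2)) f"
  using nn_integral_ball_measure[of "\<lambda>y. ennreal (norm (f y))" \<mu>]
  by (simp add: integrable_iff_bounded borel_ball_measure)

lemma integral_ball_measure:
  fixes f :: "real ^ 'n \<Rightarrow> real"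
  assumes [measurable]: "f \<in> borel_measurable borel"
  shows "(\<integral>y. f y \<partial>ball_measure \<mu>) = (\<integral>y. f y \<partial>bump_measure (\<mu> - 1/2))"
proof (cases "integrable (ball_measure \<mu>) f")
  case True
  then have "integrable (bump_measure (\<mu> - 1/2)) f" by (simp add: integrable_ball_measure)
  then show ?thesis using True
    by (simp add: real_lebesgue_integral_def nn_integral_ball_measure)
next
  case False
  then show ?thesis by (simp add: integrable_ball_measure not_integrable_integral_eq)
qed

text \<open>\<kappa> is the exponent of the Poisson kernel, and \<open>2 * \<kappa> - 1\<close> is
  the effective dimension d + 2\<mu>. The parameter \<open>dim_type\<close> ties the dimension type
  to the locale.\<close>

locale ball_setting =
  fixes \<mu> \<kappa> :: real and dim_type :: "'n::finite itself"
  assumes mu_nonneg: "0 \<le> \<mu>" and kappa_eq: "\<kappa> = \<mu> + (real CARD('n) + 1) / 2"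
begin

abbreviation M :: "(real ^ 'n) measure" where "M \<equiv> ball_measure \<mu>"

lemma mu_gt: "- 1 < \<mu> - 1/2" using mu_nonneg by simp

lemma kappa_ge_1: "1 \<le> \<kappa>"
proof -
  have "1 \<le> real CARD('n)" using zero_less_card_finite[where 'a = 'n] by (simp add: Suc_leI)
  moreover have "1 \<le> \<mu> + (c + 1) / 2" if "1 \<le> c" for c :: real
    using that mu_nonneg by (simp add: field_simps)
  ultimately show ?thesis unfolding kappa_eq by blast
qed

sublocale prob_space M
proof
  interpret B: prob_space "bump_measure (\<mu> - 1/2) :: (real ^ 'n) measure"
    by (rule prob_space_bump_measure[OF mu_gt])
  have "emeasure M (space M) = (\<integral>\<^sup>+y. 1 \<partial>M)" by simp
  also have "\<dots> = (\<integral>\<^sup>+y. 1 \<partial>(bump_measure (\<mu> - 1/2) :: (real ^ 'n) measure))"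
    by (rule nn_integral_ball_measure) simp
  also have "\<dots> = 1" using B.emeasure_space_1 by simp
  finally show "emeasure M (space M) = 1" .
qed

lemma integrable_bounded:
  fixes f :: "real ^ 'n \<Rightarrow> real"
  assumes "f \<in> borel_measurable M" "\<And>y. y \<in> cball 0 1 \<Longrightarrow> \<bar>f y\<bar> \<le> B"
  shows "integrable M f"
  by (rule integrable_const_bound[where B = B]) (use assms in \<open>auto intro!: AE_I2\<close>)

lemma integrable_continuous:
  fixes f :: "real ^ 'n \<Rightarrow> real"
  assumes "continuous_on (cball 0 1) f"
  shows "integrable M f"
proof -
  have "compact (f ` cball 0 1)" by (intro compact_continuous_image assms compact_cball)
  then obtain B where "\<And>y. y \<in> cball 0 1 \<Longrightarrow> \<bar>f y\<bar> \<le> B"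
    by (force dest!: compact_imp_bounded simp: bounded_iff)
  then show ?thesis by (intro integrable_bounded[where B = B] continuous_ball_measure assms)
qed

lemma integrable_poly: "P \<in> poly_space n \<Longrightarrow> integrable M P"
  by (intro integrable_continuous poly_space_continuous)

text \<open>The point x may lie on the sphere, where the weight degenerates. By continuity f is also
  positive on a nonempty open set of interior points near x, which has positive measure.\<close>

lemma integral_continuous_pos:
  fixes f :: "real ^ 'n \<Rightarrow> real"
  assumes f: "continuous_on (cball 0 1) f" and nn: "\<And>y. y \<in> cball 0 1 \<Longrightarrow> 0 \<le> f y"
    and x: "x \<in> cball 0 1" "0 < f x"
  shows "0 < (\<integral>y. f y \<partial>M)"
proof (rule ccontr)
  assume "\<not> ?thesis"
  moreover have "0 \<le> (\<integral>y. f y \<partial>M)" using nn by (intro Bochner_Integration.integral_nonneg) auto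
  ultimately have "(\<integral>y. f y \<partial>M) = 0" by simp
  then have "AE y in M. f y = 0"
    using nn by (subst (asm) integral_nonneg_eq_0_iff_AE) (auto intro!: integrable_continuous f AE_I2)
  have "\<exists>e>0. \<forall>y\<in>cball 0 1. dist y x < e \<longrightarrow> dist (f y) (f x) < f x"
    using f x by (auto simp: continuous_on_iff)
  then obtain e where e: "e > 0" "\<And>y. y \<in> cball 0 1 \<Longrightarrow> dist y x < e \<Longrightarrow> f y > 0"
    by (force simp: dist_real_def)
  define U where "U = ball 0 1 \<inter> ball x e"
  have "x \<in> closure (ball 0 1)" using x by simp
  then obtain z where "z \<in> ball 0 1" "dist z x < e" using e(1) by (auto simp: closure_approachable simp del: closure_ball)
  then have U: "open U" "z \<in> U" by (auto simp: U_def dist_commute)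
  have "(\<integral>\<^sup>+y. indicator U y \<partial>M) = 0"
  proof -
    have "(\<integral>\<^sup>+y. indicator U y \<partial>M) = (\<integral>\<^sup>+y. 0 \<partial>M)"
    proof (rule nn_integral_cong_AE)
      show "AE y in M. indicator U y = (0::ennreal)"
        using \<open>AE y in M. f y = 0\<close> e(2) by (auto simp: U_def indicator_def dist_commute elim!: eventually_mono)
          (metis dist_commute less_imp_le less_irrefl mem_cball_0 mem_ball_0)
    qed
    then show ?thesis by simp
  qed
  then have "(\<integral>\<^sup>+y. indicator U y \<partial>(bump_measure (\<mu> - 1/2) :: (real ^ 'n) measure)) = 0"
    using borel_open[OF U(1)] by (subst (asm) nn_integral_ball_measure) auto
  then have "AE y in bump_measure (\<mu> - 1/2). y \<notin> U"
    using borel_open[OF U(1)] by (subst (asm) nn_integral_0_iff_AE) (auto simp: indicator_def split: if_splits elim!: eventually_mono)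
  moreover have "0 < bump (\<mu> - 1/2) y / integral\<^sup>L lborel (bump (\<mu> - 1/2) :: real ^ 'n \<Rightarrow> real)" if "y \<in> U" for y
    using that bump_pos[of y] bump_integral_pos[OF mu_gt, where 'a = "real ^ 'n"] by (auto simp: U_def)
  ultimately have "AE y in lborel. y \<notin> U"
    unfolding bump_measure_def by (subst (asm) AE_density) (auto elim!: eventually_mono)
  then have "emeasure lborel U = 0"
    using U(1) by (subst (asm) AE_iff_measurable[OF _ refl]) auto
  then have "U \<in> null_sets lebesgue" using U(1) by (auto intro: null_sets_completionI)
  then have "negligible U" by (simp add: negligible_iff_null_sets)
  then show False using open_not_negligible[OF U(1)] U(2) by auto
qed

lemma integral_square_zero:
  fixes f :: "real ^ 'n \<Rightarrow> real"
  assumes "continuous_on (cball 0 1) f" "(\<integral>y. (f y)\<^sup>2 \<partial>M) = 0" "x \<in> cball 0 1"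
  shows "f x = 0"
  using integral_continuous_pos[of "\<lambda>y. (f y)\<^sup>2" x] assms by (force intro!: continuous_intros)

definition mom :: "nat \<Rightarrow> nat \<Rightarrow> real ^ 'n \<Rightarrow> real" where
  "mom a i \<xi> = (\<integral>y. (\<xi> \<bullet> y) ^ a * (1 - (norm y)\<^sup>2) ^ i \<partial>M)"

lemma mom_eq: "mom a i \<xi> = bump_moment (\<mu> - 1/2) a i \<xi>"
  unfolding mom_def bump_moment_def by (rule integral_ball_measure) measurable

lemma mom_odd: "odd a \<Longrightarrow> mom a i \<xi> = 0"
  unfolding mom_eq by (rule bump_moment_odd[OF mu_gt])

lemma mom_even:
  "mom (2 * k) i \<xi> = norm \<xi> ^ (2 * k) * pochhammer (1/2) k / pochhammer (\<mu> + 1/2 + real i) k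
     * (pochhammer (\<mu> + 1/2) (i + k) / pochhammer \<kappa> (i + k))"
proof -
  have "\<mu> - 1/2 + 1 + real DIM(real ^ 'n) / 2 = \<kappa>" by (simp add: kappa_eq field_simps)
  then show ?thesis unfolding mom_eq bump_moment_even[OF mu_gt] bump_moment_zero[OF mu_gt]
    by (simp add: add_ac)
qed

end

section \<open>Kernel averages\<close>

lemma sum_even_indices:
  fixes f :: "nat \<Rightarrow> real"
  assumes "\<And>i. odd i \<Longrightarrow> f i = 0" "\<And>i. n < i \<Longrightarrow> f i = 0"
  shows "(\<Sum>i\<le>n. f i) = (\<Sum>l\<le>n. f (2 * l))"
proof -
  have *: "(\<Sum>i\<le>2 * n. f i) = (\<Sum>l\<le>n. f (2 * l))" for n
    by (induction n) (simp_all add: assms(1))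
  have "(\<Sum>i\<le>n. f i) = (\<Sum>i\<le>2 * n. f i)"
    by (rule sum.mono_neutral_left) (auto intro: assms(2))
  then show ?thesis by (simp add: *)
qed

text \<open>\<open>tri j m i\<close> is the coefficient of \<open>\<beta> ^ m * u ^ i\<close> in
  \<open>(1 + 2 * u * \<beta> + \<beta>\<^sup>2) ^ j\<close>; the recursion multiplies by one more
  trinomial.\<close>

primrec tri :: "nat \<Rightarrow> nat \<Rightarrow> nat \<Rightarrow> real" where
  "tri 0 m i = (if m = 0 \<and> i = 0 then 1 else 0)"
| "tri (Suc j) m i = tri j m i + (if 1 \<le> m \<and> 1 \<le> i then 2 * tri j (m - 1) (i - 1) else 0)
     + (if 2 \<le> m then tri j (m - 2) i else 0)"

lemma tri_zero: "m < i \<Longrightarrow> tri j m i = 0"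
  by (induction j arbitrary: m i) auto

lemma tri_top: "tri j m m = real (j choose m) * 2 ^ m"
proof (induction j arbitrary: m)
  case 0 then show ?case by (cases m) auto
next
  case (Suc j)
  show ?case
  proof (cases m)
    case (Suc m')
    then show ?thesis using Suc.IH[of m] Suc.IH[of m'] by (auto simp: tri_zero algebra_simps)
  qed (use Suc.IH[of 0] in simp)
qed

lemma coeff_trinomial: "coeff ([:1, 2 * u, 1:] ^ j) m = (\<Sum>i\<le>m. tri j m i * u ^ i)" for u :: real
proof (induction j arbitrary: m)
  case 0
  have "(\<Sum>i\<le>m. tri 0 m i * u ^ i) = (\<Sum>i\<le>m. if i = 0 then (if m = 0 then 1 else 0) else 0)"
    by (rule sum.cong) auto
  then show ?case by (simp add: coeff_1)
next
  case (Suc j)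
  define p where "p = [:1, 2 * u, 1:] ^ j"
  have p: "[:1, 2 * u, 1:] ^ Suc j = p + pCons 0 (smult (2 * u) p + pCons 0 p)"
    by (simp add: p_def algebra_simps)
  have pc: "coeff p m = (\<Sum>i\<le>m. tri j m i * u ^ i)" for m using Suc by (simp add: p_def)
  have ext: "(\<Sum>i\<le>m. tri j m i * u ^ i) = (\<Sum>i\<le>m'. tri j m i * u ^ i)" if "m \<le> m'" for m m'
    by (rule sum.mono_neutral_left) (use that in \<open>auto simp: tri_zero\<close>)
  show ?case
  proof (cases m)
    case 0
    then show ?thesis unfolding p by (simp add: pc)
  next
    case (Suc m1)
    have a: "2 * u * coeff p m1 = (\<Sum>i\<le>m. (if 1 \<le> i then 2 * tri j m1 (i - 1) else 0) * u ^ i)"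
      unfolding Suc sum.atMost_Suc_shift by (simp add: pc sum_distrib_left mult_ac)
    have b: "coeff (pCons 0 p) m1 = (\<Sum>i\<le>m. (if 2 \<le> m then tri j (m - 2) i else 0) * u ^ i)"
    proof (cases m1)
      case (Suc m2)
      then show ?thesis using \<open>m = Suc m1\<close> ext[of m2 m] by (simp add: pc)
    qed (use Suc in simp)
    have "coeff ([:1, 2 * u, 1:] ^ Suc j) m = coeff p m + (2 * u * coeff p m1 + coeff (pCons 0 p) m1)"
      unfolding p by (simp add: Suc)
    also have "\<dots> = (\<Sum>i\<le>m. tri (Suc j) m i * u ^ i)"
      unfolding a b unfolding pc sum.distrib[symmetric] using Suc by (intro sum.cong refl) (auto simp: algebra_simps)
    finally show ?thesis .
  qed
qed

text \<open>From (2n)! = 4^n (1/2)_n n!. It turns the product of a moment in t and a moment in y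
  into a plain binomial coefficient, so that the sum over l becomes a binomial expansion
  again.\<close>

lemma choose_pochhammer_half:
  assumes "l \<le> j"
  shows "real (2 * j choose (2 * l)) * pochhammer (1/2) l * pochhammer (1/2) (j - l)
    = real (j choose l) * pochhammer (1/2) j"
proof -
  have f: "(fact (2 * n) :: real) = 4 ^ n * pochhammer (1/2) n * fact n" for n
    using fact_double[of n, where 'a = real] by (simp add: power_mult)
  have "real (2 * j choose (2 * l)) = fact (2 * j) / (fact (2 * l) * fact (2 * (j - l)))"
    using binomial_fact[of "2 * l" "2 * j", where 'a = real] assms by (simp add: diff_mult_distrib2)
  also have "\<dots> = (4 ^ j * pochhammer (1/2) j * fact j)
     / ((4 ^ l * pochhammer (1/2) l * fact l) * (4 ^ (j - l) * pochhammer (1/2) (j - l) * fact (j - l)))"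
    by (simp only: f)
  also have "(4::real) ^ j = 4 ^ l * 4 ^ (j - l)" using assms by (simp add: power_add[symmetric])
  finally have "real (2 * j choose (2 * l)) = (pochhammer (1/2) j * fact j)
     / ((pochhammer (1/2) l * fact l) * (pochhammer (1/2) (j - l) * fact (j - l)))"
    by (simp add: field_simps)
  moreover have "pochhammer (1/2::real) l > 0" "pochhammer (1/2::real) (j - l) > 0" by (auto intro: pochhammer_pos)
  ultimately show ?thesis unfolding binomial_fact[OF assms, where 'a = real] by simp
qed

text \<open>With a and b the two square roots, this is the inner product of (x, a) and (y, t b) in
  one more dimension, where (x, a) and (y, b) are unit vectors.\<close>

lemma abs_inner_plus_le:
  fixes x y :: "'a::real_inner"
  assumes "norm x \<le> 1" "norm y \<le> 1" "\<bar>t\<bar> \<le> 1"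
  shows "\<bar>x \<bullet> y + t * sqrt (1 - (norm x)\<^sup>2) * sqrt (1 - (norm y)\<^sup>2)\<bar> \<le> 1"
proof -
  define a where "a = sqrt (1 - (norm x)\<^sup>2)"
  define b where "b = sqrt (1 - (norm y)\<^sup>2)"
  have ab: "a \<ge> 0" "b \<ge> 0" "a\<^sup>2 = 1 - (norm x)\<^sup>2" "b\<^sup>2 = 1 - (norm y)\<^sup>2"
    using assms(1,2) by (auto simp: a_def b_def power_le_one)
  have "\<bar>t * a * b\<bar> \<le> a * b"
    using mult_right_mono[OF assms(3), of "a * b"] ab by (simp add: abs_mult mult.assoc)
  moreover have "\<bar>x \<bullet> y\<bar> \<le> norm x * norm y" by (rule Cauchy_Schwarz_ineq2)
  moreover have "norm x * norm y + a * b \<le> 1"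
    using sum_squares_bound[of "norm x" "norm y"] sum_squares_bound[of a b] ab by simp
  ultimately show ?thesis unfolding a_def[symmetric] b_def[symmetric] by simp
qed

section \<open>Averages over the extra variable and their multipliers\<close>

context ball_setting
begin

text \<open>The probability measure on [-1,1] with density proportional to
  \<open>(1 - t\<^sup>2) powr (\<mu> - 1)\<close>. For \<mu> tending to 0 it concentrates at the end
  points, hence the uniform measure on two points when \<mu> = 0.\<close>

definition N :: "real measure" where
  "N = (if \<mu> = 0 then distr (measure_pmf (pmf_of_set {-1, 1})) borel id else bump_measure (\<mu> - 1))"

lemma sets_N [simp, measurable_cong]: "sets N = sets borel"
  and space_N [simp]: "space N = UNIV"
  by (simp_all add: N_def)

sublocale N: prob_space N
proof (cases "\<mu> = 0")
  case True
  then show "prob_space N" unfolding N_def by (auto intro!: measure_pmf.prob_space_distr)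
next
  case False
  then show "prob_space N" unfolding N_def using mu_nonneg by (auto intro!: prob_space_bump_measure)
qed

lemma AE_N: "AE t in N. \<bar>t\<bar> \<le> 1"
proof (cases "\<mu> = 0")
  case True
  then have "AE t in distr (measure_pmf (pmf_of_set {-1, 1})) borel id. \<bar>t::real\<bar> \<le> 1"
    by (subst AE_distr_iff) (auto simp: AE_measure_pmf_iff)
  then show ?thesis unfolding N_def if_P[OF True] .
next
  case False
  have "AE t::real in bump_measure (\<mu> - 1). \<bar>t\<bar> \<le> 1"
    using AE_bump_measure[of "\<mu> - 1", where 'a = real] by eventually_elim simp
  then show ?thesis unfolding N_def if_not_P[OF False] .
qed

lemma integrable_N:
  fixes f :: "real \<Rightarrow> real"
  assumes "f \<in> borel_measurable borel" "\<And>t. \<bar>t\<bar> \<le> 1 \<Longrightarrow> \<bar>f t\<bar> \<le> B"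
  shows "integrable N f"
  by (rule N.integrable_const_bound[where B = B]) (use assms AE_N in \<open>auto elim!: eventually_mono\<close>)

lemma integrable_N_continuous:
  fixes f :: "real \<Rightarrow> real"
  assumes "continuous_on UNIV f"
  shows "integrable N f"
proof -
  have "compact (f ` {-1..1})" using assms by (intro compact_continuous_image) (auto intro: continuous_on_subset)
  then obtain B where "\<And>y. y \<in> {-1..1} \<Longrightarrow> \<bar>f y\<bar> \<le> B"
    by (force dest!: compact_imp_bounded simp: bounded_iff)
  then show ?thesis using assms by (intro integrable_N[where B = B] borel_measurable_continuous_onI) (auto simp: abs_le_iff)
qed

definition tmom :: "nat \<Rightarrow> real" where "tmom i = (\<integral>t. t ^ i \<partial>N)"

lemma tmom_pmf: "\<mu> = 0 \<Longrightarrow> tmom i = (if even i then 1 else 0)"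
  unfolding tmom_def N_def by (simp add: integral_distr integral_pmf_of_set)

lemma tmom_bump: "\<mu> \<noteq> 0 \<Longrightarrow> tmom i = bump_moment (\<mu> - 1) i 0 (1::real)"
  unfolding tmom_def N_def bump_moment_def by simp

lemma tmom_odd: "odd i \<Longrightarrow> tmom i = 0"
  using tmom_pmf[of i] tmom_bump[of i] bump_moment_odd[of "\<mu> - 1" i 0 "1::real"] mu_nonneg
  by (cases "\<mu> = 0") simp_all

lemma tmom_even: "tmom (2 * k) = pochhammer (1/2) k / pochhammer (\<mu> + 1/2) k"
proof (cases "\<mu> = 0")
  case True
  have "pochhammer (1/2::real) k > 0" by (auto intro: pochhammer_pos)
  then show ?thesis using tmom_pmf[OF True, of "2 * k"] True by simp
next
  case False
  then have m: "\<mu> > 0" using mu_nonneg by simp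
  then have "pochhammer \<mu> k > 0" by (rule pochhammer_pos)
  then show ?thesis using m by (simp add: tmom_bump bump_moment_even bump_moment_zero)
qed

abbreviation \<delta> :: "real ^ 'n \<Rightarrow> real" where "\<delta> x \<equiv> sqrt (1 - (norm x)\<^sup>2)"

text \<open>By the addition formula, the reproducing kernels of the spaces \<open>orth_poly_space \<mu> n\<close> are averages of this
  form of Gegenbauer polynomials.\<close>

definition kav :: "(real \<Rightarrow> real) \<Rightarrow> real ^ 'n \<Rightarrow> real ^ 'n \<Rightarrow> real" where
  "kav g x y = (\<integral>t. g (x \<bullet> y + t * \<delta> x * \<delta> y) \<partial>N)"

text \<open>The average of the n-th power. Odd moments in t vanish, so the square roots occur only
  squared and a polynomial in x and in y results, defined off the ball too. Terms with 2l > n drop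
  out through the binomial coefficient.\<close>

definition kmon :: "nat \<Rightarrow> real ^ 'n \<Rightarrow> real ^ 'n \<Rightarrow> real" where
  "kmon n x y = (\<Sum>l\<le>n. real (n choose (2 * l)) * tmom (2 * l) * (x \<bullet> y) ^ (n - 2 * l)
      * ((1 - (norm x)\<^sup>2) * (1 - (norm y)\<^sup>2)) ^ l)"

lemma integral_N_binomial:
  "(\<integral>t. (a + t * b) ^ n \<partial>N) = (\<Sum>l\<le>n. real (n choose (2 * l)) * tmom (2 * l) * a ^ (n - 2 * l) * (b\<^sup>2) ^ l)"
proof -
  have "(\<integral>t. (a + t * b) ^ n \<partial>N) = (\<integral>t. (\<Sum>i\<le>n. real (n choose i) * b ^ i * a ^ (n - i) * t ^ i) \<partial>N)"
  proof (rule Bochner_Integration.integral_cong[OF refl])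
    fix t
    show "(a + t * b) ^ n = (\<Sum>i\<le>n. real (n choose i) * b ^ i * a ^ (n - i) * t ^ i)"
      unfolding add.commute[of a] binomial_ring by (intro sum.cong refl) (simp add: power_mult_distrib)
  qed
  also have "\<dots> = (\<Sum>i\<le>n. real (n choose i) * b ^ i * a ^ (n - i) * tmom i)"
    unfolding tmom_def
    by (subst Bochner_Integration.integral_sum) (auto intro!: integrable_N_continuous continuous_intros)
  also have "\<dots> = (\<Sum>l\<le>n. real (n choose (2 * l)) * b ^ (2 * l) * a ^ (n - 2 * l) * tmom (2 * l))"
    by (rule sum_even_indices) (auto simp: tmom_odd binomial_eq_0)
  also have "\<dots> = (\<Sum>l\<le>n. real (n choose (2 * l)) * tmom (2 * l) * a ^ (n - 2 * l) * (b\<^sup>2) ^ l)"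
    by (intro sum.cong refl, unfold power_mult) (simp only: mult_ac)
  finally show ?thesis .
qed

lemma delta_sq: "x \<in> cball 0 1 \<Longrightarrow> (\<delta> x)\<^sup>2 = 1 - (norm x)\<^sup>2"
  by (simp add: power_le_one)

lemma kav_power:
  assumes "x \<in> cball 0 1" "y \<in> cball 0 1"
  shows "kav (\<lambda>s. s ^ n) x y = kmon n x y"
  using integral_N_binomial[of "x \<bullet> y" "\<delta> x * \<delta> y" n]
  unfolding power_mult_distrib delta_sq[OF assms(1)] delta_sq[OF assms(2)]
  by (simp add: kav_def kmon_def mult.assoc power_mult_distrib)

lemma kmon_commute: "kmon n x y = kmon n y x"
  by (simp add: kmon_def inner_commute mult.commute)

lemma kmon_poly: "kmon n x \<in> poly_space n"
proof -
  have "(\<lambda>y. real (n choose (2 * l)) * tmom (2 * l) * (x \<bullet> y) ^ (n - 2 * l)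
      * ((1 - (norm x)\<^sup>2) * (1 - (norm y)\<^sup>2)) ^ l) \<in> poly_space n" for l
  proof (cases "2 * l \<le> n")
    case True
    have "(\<lambda>y. real (n choose (2 * l)) * tmom (2 * l) * (1 - (norm x)\<^sup>2) ^ l *
        ((x \<bullet> y) ^ (n - 2 * l) * (1 - (norm y)\<^sup>2) ^ l)) \<in> poly_space ((n - 2 * l) + l * 2)"
      by (intro poly_space_cmult poly_space_mult poly_space_inner_power poly_space_power
          poly_space_diff poly_space_const poly_space_norm2)
    moreover have "(n - 2 * l) + l * 2 = n" using True by simp
    ultimately show ?thesis by (simp add: power_mult_distrib mult_ac)
  qed (simp add: binomial_eq_0 poly_space_zero)
  then show ?thesis unfolding kmon_def[abs_def] by (intro poly_space_sum)
qed

text \<open>The double average depends on \<open>(x + \<beta> z, \<delta> x)\<close> only through its Euclidean length; this is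
  the rotation invariance of the sphere in the extended variables.\<close>

lemma integral_kmon_generating:
  fixes x z :: "real ^ 'n"
  assumes x: "x \<in> cball 0 1" and z: "norm z = 1"
  shows "(\<Sum>m\<le>n. real (n choose m) * (\<integral>y. kmon (n - m) x y * (z \<bullet> y) ^ m \<partial>M) * \<beta> ^ m)
    = (if even n then pochhammer (1/2) (n div 2) / pochhammer \<kappa> (n div 2) * (1 + 2 * (x \<bullet> z) * \<beta> + \<beta>\<^sup>2) ^ (n div 2)
       else 0)"
proof -
  \<comment> \<open>Summing over m first merges the powers of
    \<open>\<beta> * (z \<bullet> y)\<close> with those inside the average: what remains is the
    average of \<open>(\<xi> \<bullet> y + t * b) ^ n\<close>.\<close>
  define \<xi> where "\<xi> = x + \<beta> *\<^sub>R z"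
  have x1: "norm x \<le> 1" using x by simp
  have contN: "integrable N (\<lambda>t. (a + t * b) ^ k)" for a b k
    by (intro integrable_N_continuous continuous_intros)
  have "(\<Sum>m\<le>n. real (n choose m) * (\<integral>y. kmon (n - m) x y * (z \<bullet> y) ^ m \<partial>M) * \<beta> ^ m)
     = (\<integral>y. (\<Sum>m\<le>n. real (n choose m) * \<beta> ^ m * (kmon (n - m) x y * (z \<bullet> y) ^ m)) \<partial>M)"
    by (subst Bochner_Integration.integral_sum)
      (auto intro!: sum.cong integrable_mult_right integrable_poly poly_space_mult[OF kmon_poly poly_space_inner_power])
  also have "\<dots> = (\<integral>y. (\<Sum>l\<le>n. real (n choose (2 * l)) * tmom (2 * l) * (1 - (norm x)\<^sup>2) ^ l
       * ((\<xi> \<bullet> y) ^ (n - 2 * l) * (1 - (norm y)\<^sup>2) ^ l)) \<partial>M)"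
  proof (rule Bochner_Integration.integral_cong[OF refl])
    fix y :: "real ^ 'n" assume "y \<in> space M"
    then have y: "y \<in> cball 0 1" by simp
    define b where "b = \<delta> x * \<delta> y"
    have b2: "b\<^sup>2 = (1 - (norm x)\<^sup>2) * (1 - (norm y)\<^sup>2)"
      unfolding b_def power_mult_distrib delta_sq[OF x] delta_sq[OF y] ..
    have "(\<Sum>m\<le>n. real (n choose m) * \<beta> ^ m * (kmon (n - m) x y * (z \<bullet> y) ^ m))
      = (\<Sum>m\<le>n. real (n choose m) * (\<beta> * (z \<bullet> y)) ^ m * (\<integral>t. (x \<bullet> y + t * b) ^ (n - m) \<partial>N))"
      unfolding kav_power[OF x y, symmetric] kav_def b_def
      by (intro sum.cong refl) (simp add: power_mult_distrib mult_ac)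
    also have "\<dots> = (\<integral>t. (\<Sum>m\<le>n. real (n choose m) * (\<beta> * (z \<bullet> y)) ^ m * (x \<bullet> y + t * b) ^ (n - m)) \<partial>N)"
      by (subst Bochner_Integration.integral_sum) (auto intro!: contN integrable_mult_right)
    also have "\<dots> = (\<integral>t. (\<xi> \<bullet> y + t * b) ^ n \<partial>N)"
      unfolding binomial_ring[symmetric] \<xi>_def by (simp add: inner_add_left add_ac)
    also have "\<dots> = (\<Sum>l\<le>n. real (n choose (2 * l)) * tmom (2 * l) * (1 - (norm x)\<^sup>2) ^ l
       * ((\<xi> \<bullet> y) ^ (n - 2 * l) * (1 - (norm y)\<^sup>2) ^ l))"
      unfolding integral_N_binomial b2 by (intro sum.cong refl) (simp add: power_mult_distrib mult_ac)
    finally show "(\<Sum>m\<le>n. real (n choose m) * \<beta> ^ m * (kmon (n - m) x y * (z \<bullet> y) ^ m)) = \<dots>" .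
  qed
  also have "\<dots> = (\<Sum>l\<le>n. real (n choose (2 * l)) * tmom (2 * l) * (1 - (norm x)\<^sup>2) ^ l * mom (n - 2 * l) l \<xi>)"
  proof -
    have "integrable M (\<lambda>y. (\<xi> \<bullet> y) ^ (n - 2 * l) * (1 - (norm y)\<^sup>2) ^ l)" for l
      by (intro integrable_continuous continuous_intros)
    then show ?thesis unfolding mom_def by (subst Bochner_Integration.integral_sum) auto
  qed
  also have "\<dots> = (if even n then pochhammer (1/2) (n div 2) / pochhammer \<kappa> (n div 2) * (1 + 2 * (x \<bullet> z) * \<beta> + \<beta>\<^sup>2) ^ (n div 2)
       else 0)"
  proof (cases "even n")
    case False
    have "real (n choose (2 * l)) * tmom (2 * l) * (1 - (norm x)\<^sup>2) ^ l * mom (n - 2 * l) l \<xi> = 0" for l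
    proof (cases "2 * l \<le> n")
      case True
      then have "odd (n - 2 * l)" using False by simp
      then show ?thesis by (simp add: mom_odd)
    qed (simp add: binomial_eq_0)
    then have "(\<Sum>l\<le>n. real (n choose (2 * l)) * tmom (2 * l) * (1 - (norm x)\<^sup>2) ^ l * mom (n - 2 * l) l \<xi>) = (\<Sum>l\<le>n. 0)"
      by (intro sum.cong refl)
    then show ?thesis using False by simp
  next
    case True
    then obtain j where j: "n = 2 * j" by (auto elim: evenE)
    have "(\<Sum>l\<le>n. real (n choose (2 * l)) * tmom (2 * l) * (1 - (norm x)\<^sup>2) ^ l * mom (n - 2 * l) l \<xi>)
      = (\<Sum>l\<le>j. real (n choose (2 * l)) * tmom (2 * l) * (1 - (norm x)\<^sup>2) ^ l * mom (n - 2 * l) l \<xi>)"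
      by (rule sum.mono_neutral_right) (auto simp: j binomial_eq_0)
    \<comment> \<open>The Pochhammer symbols based at \<mu> + 1/2 cancel between the two moments;
      what is left expands the j-th power of the squared length of
      \<open>(\<xi>, \<delta> x)\<close>.\<close>
    also have "\<dots> = (\<Sum>l\<le>j. pochhammer (1/2) j / pochhammer \<kappa> j
        * (real (j choose l) * (1 - (norm x)\<^sup>2) ^ l * ((norm \<xi>)\<^sup>2) ^ (j - l)))"
    proof (rule sum.cong[OF refl])
      fix l assume l: "l \<in> {..j}"
      have a: "n - 2 * l = 2 * (j - l)" "l + (j - l) = j" using l j by auto
      have p: "pochhammer (\<mu> + 1/2) j = pochhammer (\<mu> + 1/2) l * pochhammer (\<mu> + 1/2 + real l) (j - l)"
        using l by (intro pochhammer_product) simp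
      have pos: "pochhammer (\<mu> + 1/2) l > 0" "pochhammer (\<mu> + 1/2 + real l) (j - l) > 0" "pochhammer \<kappa> j > 0"
        using mu_nonneg kappa_ge_1 by (auto intro!: pochhammer_pos)
      have "real (n choose (2 * l)) * tmom (2 * l) * (1 - (norm x)\<^sup>2) ^ l * mom (n - 2 * l) l \<xi>
        = (real (2 * j choose (2 * l)) * pochhammer (1/2) l * pochhammer (1/2) (j - l))
          * (1 - (norm x)\<^sup>2) ^ l * norm \<xi> ^ (2 * (j - l)) / pochhammer \<kappa> j"
        unfolding a(1) mom_even a(2) tmom_even p using pos by (simp add: j field_simps)
      also have "\<dots> = pochhammer (1/2) j / pochhammer \<kappa> j
        * (real (j choose l) * (1 - (norm x)\<^sup>2) ^ l * ((norm \<xi>)\<^sup>2) ^ (j - l))"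
        using l by (subst choose_pochhammer_half) (auto simp: power_mult)
      finally show "real (n choose (2 * l)) * tmom (2 * l) * (1 - (norm x)\<^sup>2) ^ l * mom (n - 2 * l) l \<xi> = \<dots>" .
    qed
    also have "\<dots> = pochhammer (1/2) j / pochhammer \<kappa> j * ((1 - (norm x)\<^sup>2) + (norm \<xi>)\<^sup>2) ^ j"
      by (simp add: binomial_ring sum_distrib_left)
    also have "(1 - (norm x)\<^sup>2) + (norm \<xi>)\<^sup>2 = 1 + 2 * (x \<bullet> z) * \<beta> + \<beta>\<^sup>2"
    proof -
      have "z \<bullet> z = 1" using z by (simp add: power2_norm_eq_inner[symmetric])
      then show ?thesis
        unfolding \<xi>_def power2_norm_eq_inner
        by (simp add: inner_add_left inner_add_right inner_commute power2_eq_square algebra_simps)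
    qed
    finally show ?thesis using j by simp
  qed
  finally show ?thesis .
qed

text \<open>The Funk-Hecke multiplier of \<open>s\<^sup>n\<close> on \<open>orth_poly_space \<mu> m\<close>.\<close>

definition eig :: "nat \<Rightarrow> nat \<Rightarrow> real" where
  "eig n m = (if even (n + m) then pochhammer (1/2) ((n + m) div 2) / pochhammer \<kappa> ((n + m) div 2)
      * (real ((n + m) div 2 choose m) * 2 ^ m) / real (n + m choose m) else 0)"

lemma eig_below: "n < m \<Longrightarrow> eig n m = 0"
  by (simp add: eig_def binomial_eq_0)

lemma eig_eq: "eig (m + 2 * i) m = fact (m + 2 * i) / (2 ^ m * 4 ^ i * fact i * pochhammer \<kappa> (m + i))"
proof -
  have f: "(fact (2 * n) :: real) = 4 ^ n * pochhammer (1/2) n * fact n" for n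
    using fact_double[of n, where 'a = real] by (simp add: power_mult)
  have h: "(m + 2 * i + m) div 2 = m + i" "even (m + 2 * i + m)" "m + 2 * i + m = 2 * (m + i)" by auto
  have 1: "pochhammer (1/2) (m + i) = fact (2 * (m + i)) / (4 ^ (m + i) * fact (m + i) :: real)"
    using f[of "m + i"] by simp
  have 2: "real (m + i choose m) = fact (m + i) / (fact m * fact i)"
    by (subst binomial_fact) auto
  have 3: "real (2 * (m + i) choose m) = fact (2 * (m + i)) / (fact m * fact (m + 2 * i))"
    by (subst binomial_fact) auto
  have 4: "(4::real) ^ (m + i) = 2 ^ m * 2 ^ m * 4 ^ i"
    by (simp add: power_add power_mult_distrib[symmetric])
  have "eig (m + 2 * i) m = pochhammer (1/2) (m + i) / pochhammer \<kappa> (m + i) * (real (m + i choose m) * 2 ^ m)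
      / real (2 * (m + i) choose m)"
    unfolding eig_def h(1) if_P[OF h(2)] unfolding h(3) ..
  then show ?thesis unfolding 1 2 3 4 by (simp add: field_simps)
qed

lemma eig_odd: "odd (n + m) \<Longrightarrow> eig n m = 0"
  by (simp add: eig_def)

lemma eig_pos: "eig m m > 0"
  using eig_eq[of m 0] kappa_ge_1 by (simp add: pochhammer_pos)

text \<open>Polynomials of degree strictly below m; m = 0 is separate because \<open>m - 1\<close>
  is truncated.\<close>

definition low_space :: "nat \<Rightarrow> (real ^ 'n \<Rightarrow> real) set" where
  "low_space m = (if m = 0 then {\<lambda>_. 0} else poly_space (m - 1))"

lemma lin_closed_low_space: "lin_closed (low_space m)"
  by (cases "m = 0") (auto simp: low_space_def lin_closed_poly_space, simp add: lin_closed_def)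

definition kop :: "nat \<Rightarrow> (real ^ 'n \<Rightarrow> real) \<Rightarrow> real ^ 'n \<Rightarrow> real" where
  "kop n Q x = (\<integral>y. kmon n x y * Q y \<partial>M)"

text \<open>Comparison of the coefficients of \<open>\<beta> ^ m\<close> in the generating identity
  with total exponent n + m. The result is a polynomial of degree m in \<open>x \<bullet> z\<close>,
  and \<open>tri_top\<close> supplies its leading coefficient.\<close>

lemma kop_inner_power:
  assumes z: "norm z = 1"
  shows "\<exists>R\<in>low_space m. \<forall>x\<in>cball 0 1. kop n (\<lambda>y. (z \<bullet> y) ^ m) x = eig n m * (z \<bullet> x) ^ m + R x"
proof (cases "even (n + m)")
  case False
  have "kop n (\<lambda>y. (z \<bullet> y) ^ m) x = 0" if x: "x \<in> cball 0 1" for x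
  proof -
    have "(\<Sum>k\<le>n + m. (real (n + m choose k) * (\<integral>y. kmon (n + m - k) x y * (z \<bullet> y) ^ k \<partial>M)) * \<beta> ^ k) = (\<Sum>k\<le>n + m. 0 * \<beta> ^ k)" for \<beta>
      using integral_kmon_generating[OF x z, of "n + m" \<beta>] False by simp
    then have "\<forall>k\<le>n + m. real (n + m choose k) * (\<integral>y. kmon (n + m - k) x y * (z \<bullet> y) ^ k \<partial>M) = 0"
      by (intro polyfun_eq_coeffs[THEN iffD1] allI)
    from this[rule_format, of m]
    have "real (n + m choose m) * (\<integral>y. kmon (n + m - m) x y * (z \<bullet> y) ^ m \<partial>M) = 0" by simp
    then show ?thesis by (simp add: kop_def)
  qed
  then show ?thesis using False
    by (intro bexI[of _ "\<lambda>_. 0"]) (auto simp: eig_odd lin_closed_zero[OF lin_closed_low_space])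
next
  case True
  define j where "j = (n + m) div 2"
  define C where "C = pochhammer (1/2) j / pochhammer \<kappa> j"
  have nm: "n + m = 2 * j" using True by (simp add: j_def)
  have key: "kop n (\<lambda>y. (z \<bullet> y) ^ m) x = C * (\<Sum>i\<le>m. tri j m i * (x \<bullet> z) ^ i) / real (n + m choose m)"
    if x: "x \<in> cball 0 1" for x
  proof -
    define p where "p = [:1, 2 * (x \<bullet> z), 1:] ^ j"
    have "degree p \<le> 2 * j"
    proof -
      have "degree p \<le> degree [:1, 2 * (x \<bullet> z), 1:] * j" unfolding p_def by (rule degree_power_le)
      then show ?thesis by simp
    qed
    have "(\<Sum>k\<le>n + m. (real (n + m choose k) * (\<integral>y. kmon (n + m - k) x y * (z \<bullet> y) ^ k \<partial>M)) * \<beta> ^ k)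
      = (\<Sum>k\<le>n + m. (C * coeff p k) * \<beta> ^ k)" for \<beta>
    proof -
      have "poly p \<beta> = (\<Sum>k\<le>degree p. coeff p k * \<beta> ^ k)" by (rule poly_altdef)
      also have "\<dots> = (\<Sum>k\<le>n + m. coeff p k * \<beta> ^ k)"
        by (rule sum.mono_neutral_left) (use \<open>degree p \<le> 2 * j\<close> nm in \<open>auto simp: coeff_eq_0\<close>)
      finally have "(\<Sum>k\<le>n + m. (C * coeff p k) * \<beta> ^ k) = C * poly p \<beta>" by (simp add: sum_distrib_left mult.assoc)
      also have "poly p \<beta> = (1 + 2 * (x \<bullet> z) * \<beta> + \<beta>\<^sup>2) ^ j"
        by (simp add: p_def power2_eq_square algebra_simps)
      finally show ?thesis using integral_kmon_generating[OF x z, of "n + m" \<beta>] True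
        by (simp add: j_def[symmetric] C_def)
    qed
    then have "\<forall>k\<le>n + m. real (n + m choose k) * (\<integral>y. kmon (n + m - k) x y * (z \<bullet> y) ^ k \<partial>M) = C * coeff p k"
      by (intro polyfun_eq_coeffs[THEN iffD1] allI)
    from this[rule_format, of m]
    have "real (n + m choose m) * (\<integral>y. kmon (n + m - m) x y * (z \<bullet> y) ^ m \<partial>M) = C * coeff p m" by simp
    moreover have "real (n + m choose m) > 0" by (simp add: zero_less_binomial)
    ultimately show ?thesis unfolding p_def coeff_trinomial by (simp add: kop_def field_simps)
  qed
  define R where "R x = C * (\<Sum>i<m. tri j m i * (z \<bullet> x) ^ i) / real (n + m choose m)" for x
  have "R = (\<lambda>x. (C / real (n + m choose m)) * (\<Sum>i<m. tri j m i * (z \<bullet> x) ^ i))"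
    by (intro ext) (simp add: R_def)
  also have "\<dots> \<in> low_space m"
  proof (cases "m = 0")
    case True
    then show ?thesis by (simp add: low_space_def)
  next
    case False
    then show ?thesis unfolding low_space_def if_not_P[OF False]
      by (intro poly_space_cmult poly_space_sum)
        (auto intro: poly_space_mono[OF _ poly_space_inner_power])
  qed
  finally have "R \<in> low_space m" .
  moreover have "kop n (\<lambda>y. (z \<bullet> y) ^ m) x = eig n m * (z \<bullet> x) ^ m + R x" if "x \<in> cball 0 1" for x
  proof -
    have "(\<Sum>i\<le>m. tri j m i * (x \<bullet> z) ^ i) = real (j choose m) * 2 ^ m * (z \<bullet> x) ^ m + (\<Sum>i<m. tri j m i * (z \<bullet> x) ^ i)"
      unfolding lessThan_Suc_atMost[symmetric] by (simp add: tri_top inner_commute)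
    then show ?thesis unfolding key[OF that] R_def eig_def using True
      by (simp add: j_def[symmetric] C_def[symmetric] distrib_left add_divide_distrib)
  qed
  ultimately show ?thesis by blast
qed

lemma kop_add:
  assumes "continuous_on (cball 0 1) P" "continuous_on (cball 0 1) Q"
  shows "kop n (\<lambda>y. P y + Q y) x = kop n P x + kop n Q x"
  unfolding kop_def using assms
  by (subst Bochner_Integration.integral_add[symmetric])
    (auto simp: algebra_simps intro!: integrable_continuous continuous_intros poly_space_continuous[OF kmon_poly])

lemma kop_cmult: "kop n (\<lambda>y. c * Q y) x = c * kop n Q x"
  unfolding kop_def by (simp add: mult.left_commute)

text \<open>The claim is linear in Q, so powers of linear forms suffice. A power of degree k < m has
  another multiplier, but the discrepancy has degree below m and goes into the remainder.\<close>

lemma kop_poly_space: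
  assumes "Q \<in> poly_space m"
  shows "\<exists>R\<in>low_space m. \<forall>x\<in>cball 0 1. kop n Q x = eig n m * Q x + R x"
proof -
  define W where "W = {Q \<in> poly_space m. \<exists>R\<in>low_space m. \<forall>x\<in>cball 0 1. kop n Q x = eig n m * Q x + R x}"
  have "lin_closed W"
    unfolding lin_closed_def
  proof (intro conjI ballI allI)
    show "(\<lambda>x. 0) \<in> W" unfolding W_def
      by (auto simp: poly_space_zero kop_def intro!: bexI[of _ "\<lambda>_. 0"] lin_closed_zero[OF lin_closed_low_space])
  next
    fix P Q assume "P \<in> W" "Q \<in> W"
    then obtain R R' where R: "P \<in> poly_space m" "Q \<in> poly_space m" "R \<in> low_space m" "R' \<in> low_space m"
      "\<forall>x\<in>cball 0 1. kop n P x = eig n m * P x + R x" "\<forall>x\<in>cball 0 1. kop n Q x = eig n m * Q x + R' x"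
      by (auto simp: W_def)
    then show "(\<lambda>x. P x + Q x) \<in> W" unfolding W_def
      by (auto simp: kop_add poly_space_continuous algebra_simps
          intro!: poly_space_add bexI[of _ "\<lambda>x. R x + R' x"] lin_closed_add[OF lin_closed_low_space])
  next
    fix P c assume "P \<in> W"
    then obtain R where R: "P \<in> poly_space m" "R \<in> low_space m"
      "\<forall>x\<in>cball 0 1. kop n P x = eig n m * P x + R x"
      by (auto simp: W_def)
    then show "(\<lambda>x. c * P x) \<in> W" unfolding W_def
      by (auto simp: kop_cmult algebra_simps
          intro!: poly_space_cmult bexI[of _ "\<lambda>x. c * R x"] lin_closed_cmult[OF lin_closed_low_space])
  qed
  moreover have "(\<lambda>x. (z \<bullet> x) ^ k) \<in> W" if k: "k \<le> m" and z: "norm z = 1" for z k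
  proof -
    obtain R where R: "R \<in> low_space k" "\<forall>x\<in>cball 0 1. kop n (\<lambda>y. (z \<bullet> y) ^ k) x = eig n k * (z \<bullet> x) ^ k + R x"
      using kop_inner_power[OF z] by blast
    have p: "(\<lambda>x. (z \<bullet> x) ^ k) \<in> poly_space m" by (rule poly_space_mono[OF k poly_space_inner_power])
    show ?thesis
    proof (cases "k = m")
      case True
      then show ?thesis using R p by (auto simp: W_def)
    next
      case False
      then have km: "k \<le> m - 1" "m \<noteq> 0" using k by auto
      have "R \<in> poly_space (m - 1)"
      proof (cases "k = 0")
        case True
        then show ?thesis using R(1) poly_space_zero by (simp add: low_space_def)
      next
        case False
        then show ?thesis using R(1) km poly_space_mono[of "k - 1" "m - 1" R] by (simp add: low_space_def)
      qed
      moreover have "(\<lambda>x. (z \<bullet> x) ^ k) \<in> poly_space (m - 1)" by (rule poly_space_mono[OF km(1) poly_space_inner_power])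
      ultimately have "(\<lambda>x. (eig n k - eig n m) * (z \<bullet> x) ^ k + R x) \<in> low_space m"
        unfolding low_space_def using km by (auto intro!: poly_space_add poly_space_cmult)
      then show ?thesis using R p unfolding W_def
        by (auto intro!: bexI[of _ "\<lambda>x. (eig n k - eig n m) * (z \<bullet> x) ^ k + R x"] simp: algebra_simps)
    qed
  qed
  ultimately have "poly_space m \<subseteq> W" by (rule poly_space_span_unit_powers)
  then show ?thesis using assms by (auto simp: W_def)
qed

sublocale MM: pair_prob_space M M ..

lemma kmon_measurable [measurable]: "case_prod (kmon n) \<in> borel_measurable (borel \<Otimes>\<^sub>M borel)"
  unfolding kmon_def by measurable

lemma id_measurable_M [measurable]: "(\<lambda>x. x) \<in> M \<rightarrow>\<^sub>M borel"
  using borel_ball_measure continuous_ball_measure by (auto intro: continuous_imp_measurable_on_sets_lebesgue simp: ball_measure_def)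

lemma kop_symmetric:
  assumes P: "P \<in> poly_space a" and Q: "Q \<in> poly_space b"
  shows "(\<integral>x. kop n P x * Q x \<partial>M) = (\<integral>x. P x * kop n Q x \<partial>M)"
proof -
  have [measurable]: "P \<in> borel_measurable borel" "Q \<in> borel_measurable borel"
    using assms by (auto intro: poly_space_borel)
  define F where "F = (\<lambda>(x, y). kmon n x y * P y * Q x)"
  have Fm: "F \<in> borel_measurable (M \<Otimes>\<^sub>M M)"
  proof -
    have "F \<in> borel_measurable (borel \<Otimes>\<^sub>M borel)" unfolding F_def by measurable
    moreover have "(\<lambda>p. (fst p, snd p)) \<in> (M \<Otimes>\<^sub>M M) \<rightarrow>\<^sub>M (borel \<Otimes>\<^sub>M borel)" by measurable
    ultimately have "(\<lambda>p. F (fst p, snd p)) \<in> borel_measurable (M \<Otimes>\<^sub>M M)" by measurable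
    then show ?thesis by simp
  qed
  have "continuous_on (cball 0 1 \<times> cball 0 1) F"
    unfolding F_def kmon_def case_prod_unfold
    by (intro continuous_intros continuous_on_compose2[OF poly_space_continuous[OF P, of UNIV]]
        continuous_on_compose2[OF poly_space_continuous[OF Q, of UNIV]]) auto
  then have "compact (F ` (cball 0 1 \<times> cball 0 1))"
    by (intro compact_continuous_image compact_Times compact_cball)
  then obtain B where B: "\<And>p. p \<in> cball 0 1 \<times> cball 0 1 \<Longrightarrow> \<bar>F p\<bar> \<le> B"
    by (force dest!: compact_imp_bounded simp: bounded_iff)
  have "integrable (M \<Otimes>\<^sub>M M) F"
    by (rule MM.P.integrable_const_bound[where B = B]) (auto intro!: AE_I2 B Fm simp: space_pair_measure)
  then have "(\<integral>y. (\<integral>x. F (x, y) \<partial>M) \<partial>M) = (\<integral>x. (\<integral>y. F (x, y) \<partial>M) \<partial>M)"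
    by (intro MM.Fubini_integral) simp
  moreover have "(\<integral>x. F (x, y) \<partial>M) = P y * kop n Q y" for y
  proof -
    have "(\<integral>x. F (x, y) \<partial>M) = (\<integral>x. P y * (kmon n y x * Q x) \<partial>M)"
      by (intro Bochner_Integration.integral_cong refl) (simp add: F_def kmon_commute[of n _ y])
    then show ?thesis by (simp add: kop_def)
  qed
  moreover have "(\<integral>y. F (x, y) \<partial>M) = kop n P x * Q x" for x
    by (simp add: F_def kop_def)
  ultimately show ?thesis by simp
qed

text \<open>The remainder R has lower degree than Q. By symmetry the product of R with
  \<open>kop n Q\<close> equals that of Q with \<open>kop n R\<close>, which is again of lower
  degree, hence 0. So R has norm 0.\<close>

lemma kop_eigen:
  assumes Q: "Q \<in> orth_poly_space \<mu> m" and x: "x \<in> cball 0 1"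
  shows "kop n Q x = eig n m * Q x"
proof -
  have Qm: "Q \<in> poly_space m" and orth: "\<And>k R. k < m \<Longrightarrow> R \<in> poly_space k \<Longrightarrow> (\<integral>x. Q x * R x \<partial>M) = 0"
    using Q by (auto simp: orth_poly_space_def)
  obtain R where R: "R \<in> low_space m" "\<And>x. x \<in> cball 0 1 \<Longrightarrow> kop n Q x = eig n m * Q x + R x"
    using kop_poly_space[OF Qm] by blast
  have "R x = 0"
  proof (cases "m = 0")
    case True
    then show ?thesis using R(1) by (simp add: low_space_def)
  next
    case False
    then have Rp: "R \<in> poly_space (m - 1)" "m - 1 < m" using R(1) by (auto simp: low_space_def)
    obtain R' where R': "R' \<in> low_space (m - 1)" "\<And>x. x \<in> cball 0 1 \<Longrightarrow> kop n R x = eig n (m - 1) * R x + R' x"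
      using kop_poly_space[OF Rp(1)] by blast
    have "R' \<in> poly_space (m - 1)"
      using R'(1) poly_space_mono[of "m - 1 - 1" "m - 1" R'] poly_space_zero by (auto simp: low_space_def split: if_splits)
    then have S: "(\<lambda>x. eig n (m - 1) * R x + R' x) \<in> poly_space (m - 1)"
      by (intro poly_space_add poly_space_cmult Rp)
    have "(\<integral>x. kop n Q x * R x \<partial>M) = (\<integral>x. Q x * kop n R x \<partial>M)" by (rule kop_symmetric[OF Qm Rp(1)])
    also have "\<dots> = (\<integral>x. Q x * (eig n (m - 1) * R x + R' x) \<partial>M)"
      by (intro Bochner_Integration.integral_cong refl) (simp add: R'(2))
    also have "\<dots> = 0" by (rule orth[OF Rp(2) S])
    also have "(\<integral>x. kop n Q x * R x \<partial>M) = (\<integral>x. eig n m * (Q x * R x) + (R x)\<^sup>2 \<partial>M)"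
      by (intro Bochner_Integration.integral_cong refl) (simp add: R(2) algebra_simps power2_eq_square)
    also have "\<dots> = eig n m * (\<integral>x. Q x * R x \<partial>M) + (\<integral>x. (R x)\<^sup>2 \<partial>M)"
      using integrable_poly[OF poly_space_mult[OF Qm Rp(1)]] integrable_poly[OF poly_space_power[OF Rp(1)], of 2]
      by (subst Bochner_Integration.integral_add) auto
    finally have "(\<integral>x. (R x)\<^sup>2 \<partial>M) = 0" using orth[OF Rp(2,1)] by simp
    then show ?thesis using integral_square_zero[OF poly_space_continuous[OF Rp(1)] _ x] by blast
  qed
  then show ?thesis using R(2)[OF x] by simp
qed

end

section \<open>Orthonormal bases and reproducing kernels\<close>

lemma poly_space_ray:
  assumes "P \<in> poly_space n"
  shows "\<exists>p. degree p \<le> n \<and> (\<forall>t. poly p t = P (t *\<^sub>R x))"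
proof -
  define W where "W = {P :: real ^ 'a \<Rightarrow> real. \<exists>p. degree p \<le> n \<and> (\<forall>t. poly p t = P (t *\<^sub>R x))}"
  have "lin_closed W"
    unfolding lin_closed_def
  proof (intro conjI ballI allI)
    show "(\<lambda>x. 0) \<in> W" unfolding W_def by (auto intro: exI[of _ 0])
  next
    fix P Q assume "P \<in> W" "Q \<in> W"
    then obtain p q where "degree p \<le> n" "degree q \<le> n" "\<forall>t. poly p t = P (t *\<^sub>R x)" "\<forall>t. poly q t = Q (t *\<^sub>R x)"
      by (auto simp: W_def)
    then show "(\<lambda>x. P x + Q x) \<in> W" unfolding W_def by (auto intro!: exI[of _ "p + q"] degree_add_le)
  next
    fix P c assume "P \<in> W"
    then obtain p where "degree p \<le> n" "\<forall>t. poly p t = P (t *\<^sub>R x)" by (auto simp: W_def)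
    then show "(\<lambda>x. c * P x) \<in> W" unfolding W_def
      by (auto intro!: exI[of _ "smult c p"] order_trans[OF degree_smult_le])
  qed
  moreover have "mpow a \<in> W" if "(\<Sum>i\<in>UNIV. a i) \<le> n" for a
    unfolding W_def using that
    by (auto intro!: exI[of _ "monom (mpow a x) (\<Sum>i\<in>UNIV. a i)"] order_trans[OF degree_monom_le]
        simp: poly_monom mpow_def power_mult_distrib prod.distrib power_sum)
  ultimately have "poly_space n \<subseteq> W" by (intro poly_space_subset)
  then show ?thesis using assms by (auto simp: W_def)
qed

text \<open>Along a ray P is a polynomial in one variable that vanishes on an interval next to
  0.\<close>

lemma poly_space_zero_on_ball:
  assumes P: "P \<in> poly_space n" and z: "\<And>x. x \<in> cball 0 1 \<Longrightarrow> P x = 0"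
  shows "P = (\<lambda>_. 0)"
proof
  fix x
  obtain p where p: "\<And>t. poly p t = P (t *\<^sub>R x)" using poly_space_ray[OF P] by blast
  define e where "e = 1 / (norm x + 1)"
  have e: "e > 0" "e * norm x \<le> 1"
    using norm_ge_zero[of x] by (auto simp: e_def divide_le_eq add_nonneg_pos)
  have "{0<..<e} \<subseteq> {t. poly p t = 0}"
  proof
    fix t assume t: "t \<in> {0<..<e}"
    then have "t * norm x \<le> e * norm x" by (intro mult_right_mono) auto
    then show "t \<in> {t. poly p t = 0}" using t e z[of "t *\<^sub>R x"] p by auto
  qed
  moreover have "infinite {0<..<e}" using e(1) by (simp add: infinite_Ioo)
  ultimately have "infinite {t. poly p t = 0}" using finite_subset by blast
  then have "p = 0" using poly_roots_finite by blast
  then show "P x = 0" using p[of 1] by simp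
qed

context ball_setting
begin

definition ip :: "(real ^ 'n \<Rightarrow> real) \<Rightarrow> (real ^ 'n \<Rightarrow> real) \<Rightarrow> real" where
  "ip f g = (\<integral>y. f y * g y \<partial>M)"

lemma integrable_mult_continuous:
  fixes f g :: "real ^ 'n \<Rightarrow> real"
  assumes f: "integrable M f" and g: "continuous_on (cball 0 1) g"
  shows "integrable M (\<lambda>y. f y * g y)"
proof -
  have "compact (g ` cball 0 1)" by (intro compact_continuous_image g compact_cball)
  then obtain B where B: "\<And>y. y \<in> cball 0 1 \<Longrightarrow> \<bar>g y\<bar> \<le> B"
    by (force dest!: compact_imp_bounded simp: bounded_iff)
  have "0 \<le> B" using B[of 0] by (meson abs_ge_zero centre_in_cball order_trans zero_le_one)
  have [measurable]: "g \<in> borel_measurable M" by (rule continuous_ball_measure[OF g])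
  show ?thesis
  proof (rule Bochner_Integration.integrable_bound)
    show "integrable M (\<lambda>y. B * f y)" using f by simp
    show "AE y in M. norm (f y * g y) \<le> norm (B * f y)"
      using B \<open>0 \<le> B\<close> by (intro AE_I2) (auto simp: abs_mult mult.commute[of B] intro!: mult_left_mono)
  qed (use f in measurable)
qed

lemma integrable_mult_poly: "integrable M f \<Longrightarrow> P \<in> poly_space n \<Longrightarrow> integrable M (\<lambda>y. f y * P y)"
  by (intro integrable_mult_continuous poly_space_continuous)

lemma ip_commute: "ip f g = ip g f"
  by (simp add: ip_def mult.commute)

lemma ip_sum_right:
  assumes "integrable M f" "\<And>b. b \<in> E \<Longrightarrow> b \<in> poly_space n"
  shows "ip f (\<lambda>y. \<Sum>b\<in>E. c b * b y) = (\<Sum>b\<in>E. c b * ip f b)"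
proof -
  have "ip f (\<lambda>y. \<Sum>b\<in>E. c b * b y) = (\<integral>y. (\<Sum>b\<in>E. c b * (f y * b y)) \<partial>M)"
    unfolding ip_def by (intro Bochner_Integration.integral_cong refl) (simp add: sum_distrib_left mult_ac)
  also have "\<dots> = (\<Sum>b\<in>E. c b * ip f b)"
    unfolding ip_def using assms
    by (subst Bochner_Integration.integral_sum) (auto intro!: integrable_mult_right integrable_mult_poly)
  finally show ?thesis .
qed

lemma ip_diff_left:
  assumes "integrable M f" "integrable M g" "P \<in> poly_space n"
  shows "ip (\<lambda>y. f y - g y) P = ip f P - ip g P"
  unfolding ip_def Bochner_Integration.integral_diff[OF integrable_mult_poly[OF assms(1,3)]
      integrable_mult_poly[OF assms(2,3)], symmetric]
  by (simp add: algebra_simps)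

lemma ip_self_zero:
  assumes "P \<in> poly_space n" "ip P P = 0"
  shows "P = (\<lambda>_. 0)"
  using assms integral_square_zero[OF poly_space_continuous[OF assms(1)]]
  by (intro poly_space_zero_on_ball) (auto simp: ip_def power2_eq_square)

definition orthonormal :: "(real ^ 'n \<Rightarrow> real) set \<Rightarrow> bool" where
  "orthonormal E \<longleftrightarrow> finite E \<and> (\<forall>b\<in>E. \<forall>b'\<in>E. ip b b' = (if b = b' then 1 else 0))"

definition spanned :: "(real ^ 'n \<Rightarrow> real) set \<Rightarrow> (real ^ 'n \<Rightarrow> real) set" where
  "spanned E = {P. \<exists>c. P = (\<lambda>x. \<Sum>b\<in>E. c b * b x)}"

lemma lin_closed_spanned: "lin_closed (spanned E)"
  unfolding lin_closed_def
proof (intro conjI ballI allI)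
  show "(\<lambda>x. 0) \<in> spanned E" unfolding spanned_def by (auto intro!: exI[of _ "\<lambda>_. 0"])
next
  fix P Q assume "P \<in> spanned E" "Q \<in> spanned E"
  then obtain c c' where "P = (\<lambda>x. \<Sum>b\<in>E. c b * b x)" "Q = (\<lambda>x. \<Sum>b\<in>E. c' b * b x)" by (auto simp: spanned_def)
  then show "(\<lambda>x. P x + Q x) \<in> spanned E" unfolding spanned_def
    by (auto intro!: exI[of _ "\<lambda>b. c b + c' b"] simp: sum.distrib algebra_simps)
next
  fix P k assume "P \<in> spanned E"
  then obtain c where "P = (\<lambda>x. \<Sum>b\<in>E. c b * b x)" by (auto simp: spanned_def)
  then show "(\<lambda>x. k * P x) \<in> spanned E" unfolding spanned_def
    by (auto intro!: exI[of _ "\<lambda>b. k * c b"] simp: sum_distrib_left mult_ac)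
qed

lemma spanned_mono:
  assumes "E \<subseteq> E'" "finite E'"
  shows "spanned E \<subseteq> spanned E'"
proof
  fix P assume "P \<in> spanned E"
  then obtain c where c: "P = (\<lambda>x. \<Sum>b\<in>E. c b * b x)" by (auto simp: spanned_def)
  have "(\<Sum>b\<in>E. c b * b x) = (\<Sum>b\<in>E'. (if b \<in> E then c b else 0) * b x)" for x
    by (rule sum.mono_neutral_cong_left) (use assms in auto)
  then have "P = (\<lambda>x. \<Sum>b\<in>E'. (if b \<in> E then c b else 0) * b x)" using c by simp
  then show "P \<in> spanned E'" unfolding spanned_def by (intro CollectI exI)
qed

lemma orthonormal_expansion:
  assumes E: "orthonormal E" "E \<subseteq> poly_space n" and P: "P \<in> spanned E"
  shows "P = (\<lambda>x. \<Sum>b\<in>E. ip P b * b x)"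
proof -
  obtain c where c: "P = (\<lambda>x. \<Sum>b\<in>E. c b * b x)" using P by (auto simp: spanned_def)
  have "ip P b = c b" if b: "b \<in> E" for b
  proof -
    have "ip P b = ip b (\<lambda>x. \<Sum>b\<in>E. c b * b x)" using c by (simp add: ip_commute)
    also have "\<dots> = (\<Sum>b'\<in>E. c b' * ip b b')"
      using E b by (intro ip_sum_right) (auto intro: integrable_poly)
    also have "\<dots> = (\<Sum>b'\<in>E. if b = b' then c b' else 0)"
      using E b by (intro sum.cong refl) (auto simp: orthonormal_def)
    also have "\<dots> = c b" using E b by (simp add: orthonormal_def)
    finally show ?thesis .
  qed
  then have "(\<Sum>b\<in>E. c b * b x) = (\<Sum>b\<in>E. ip P b * b x)" for x by (intro sum.cong) auto
  then show ?thesis using c by presburger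
qed

text \<open>One Gram-Schmidt step. A residual of norm 0 is the zero polynomial, and then E already
  spans P.\<close>

lemma orthonormal_extend:
  assumes E: "orthonormal E" "E \<subseteq> poly_space n" and P: "P \<in> poly_space n"
  shows "\<exists>E'. orthonormal E' \<and> E' \<subseteq> poly_space n \<and> E \<subseteq> E' \<and> P \<in> spanned E'"
proof -
  define S where "S x = (\<Sum>b\<in>E. ip P b * b x)" for x
  define R where "R x = P x - S x" for x
  have fin: "finite E" using E by (simp add: orthonormal_def)
  have Sp: "S \<in> poly_space n" unfolding S_def[abs_def] using E by (intro poly_space_sum poly_space_cmult) auto
  have Rp: "R \<in> poly_space n" unfolding R_def[abs_def] by (intro poly_space_diff P Sp)
  have SE: "S \<in> spanned E" unfolding S_def[abs_def] spanned_def by blast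
  have orthR: "ip R b = 0" if b: "b \<in> E" for b
  proof -
    have "b \<in> poly_space n" using b E by auto
    then have "ip R b = ip P b - ip S b" unfolding R_def[abs_def]
      by (intro ip_diff_left integrable_poly[OF P] integrable_poly[OF Sp])
    moreover have "ip S b = ip b (\<lambda>x. \<Sum>b\<in>E. ip P b * b x)" by (simp add: S_def[abs_def] ip_commute)
    moreover have "\<dots> = (\<Sum>b'\<in>E. ip P b' * ip b b')"
      using E b by (intro ip_sum_right) (auto intro: integrable_poly)
    moreover have "\<dots> = (\<Sum>b'\<in>E. if b = b' then ip P b' else 0)"
      using E b by (intro sum.cong refl) (auto simp: orthonormal_def)
    moreover have "\<dots> = ip P b" using fin b by simp
    ultimately show ?thesis by simp
  qed
  show ?thesis
  proof (cases "ip R R = 0")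
    case True
    then have "R = (\<lambda>_. 0)" by (rule ip_self_zero[OF Rp])
    then have "P x = S x" for x using R_def by (metis eq_iff_diff_eq_0)
    then have "P = S" by blast
    then show ?thesis using E SE by (intro exI[of _ E]) auto
  next
    case False
    have "0 \<le> ip R R" unfolding ip_def by (intro Bochner_Integration.integral_nonneg) simp
    then have pos: "0 < ip R R" using False by simp
    define k where "k = 1 / sqrt (ip R R)"
    define e where "e x = k * R x" for x
    have k: "k \<noteq> 0" "k * k * ip R R = 1" using pos by (auto simp: k_def field_simps)
    have ep: "e \<in> poly_space n" unfolding e_def[abs_def] by (intro poly_space_cmult Rp)
    have ee: "ip e e = 1"
    proof -
      have "ip e e = (\<integral>y. k * k * (R y * R y) \<partial>M)" unfolding ip_def e_def
        by (intro Bochner_Integration.integral_cong refl) (simp add: mult_ac)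
      then show ?thesis using k by (simp add: ip_def)
    qed
    have eb: "ip e b = 0" if "b \<in> E" for b
      using orthR[OF that] by (simp add: ip_def e_def mult.assoc)
    have "e \<notin> E" using eb[of e] ee by auto
    then have on: "orthonormal (insert e E)"
      using E ee eb fin unfolding orthonormal_def by (auto simp: ip_commute)
    have "(\<lambda>x. S x + (1 / k) * e x) \<in> spanned (insert e E)"
    proof (intro lin_closed_add[OF lin_closed_spanned] lin_closed_cmult[OF lin_closed_spanned])
      show "S \<in> spanned (insert e E)" using SE spanned_mono[of E "insert e E"] fin by auto
      have "(\<Sum>b\<in>insert e E. (if b = e then 1 else 0) * b x) = e x" for x
      proof -
        have "(\<Sum>b\<in>insert e E. (if b = e then 1 else 0) * b x) = (\<Sum>b\<in>insert e E. if b = e then b x else 0)"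
          by (rule sum.cong) auto
        then show ?thesis using fin by (simp add: sum.delta)
      qed
      then have "e = (\<lambda>x. \<Sum>b\<in>insert e E. (if b = e then 1 else 0) * b x)" by presburger
      then show "e \<in> spanned (insert e E)" unfolding spanned_def by (intro CollectI exI)
    qed
    moreover have "(\<lambda>x. S x + (1 / k) * e x) = P" using k by (intro ext) (simp add: e_def R_def)
    ultimately show ?thesis using on E ep by (intro exI[of _ "insert e E"]) auto
  qed
qed

lemma orthonormal_extend_finite:
  assumes "finite S" "S \<subseteq> poly_space n" "orthonormal E" "E \<subseteq> poly_space n"
  shows "\<exists>E'. orthonormal E' \<and> E' \<subseteq> poly_space n \<and> E \<subseteq> E' \<and> S \<subseteq> spanned E'"
  using assms(1,2)
proof (induction S)
  case empty
  then show ?case using assms by (intro exI[of _ E]) auto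
next
  case (insert P S)
  then obtain E1 where E1: "orthonormal E1" "E1 \<subseteq> poly_space n" "E \<subseteq> E1" "S \<subseteq> spanned E1" by auto
  obtain E2 where E2: "orthonormal E2" "E2 \<subseteq> poly_space n" "E1 \<subseteq> E2" "P \<in> spanned E2"
    using orthonormal_extend[OF E1(1,2), of P] insert.prems by blast
  moreover have "spanned E1 \<subseteq> spanned E2"
    using E2 by (intro spanned_mono) (auto simp: orthonormal_def)
  ultimately show ?case using E1 by (intro exI[of _ E2]) auto
qed

lemma orthonormal_basis_extend:
  assumes "orthonormal E" "E \<subseteq> poly_space n"
  shows "\<exists>E'. orthonormal E' \<and> E' \<subseteq> poly_space n \<and> E \<subseteq> E' \<and> poly_space n \<subseteq> spanned E'"
proof -
  have "finite (mpow ` {a :: 'n \<Rightarrow> nat. (\<Sum>i\<in>UNIV. a i) \<le> n})" by (intro finite_imageI finite_multi_indices)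
  moreover have "mpow ` {a :: 'n \<Rightarrow> nat. (\<Sum>i\<in>UNIV. a i) \<le> n} \<subseteq> poly_space n"
    by (auto intro: mpow_in_poly_space)
  ultimately have "\<exists>E'. orthonormal E' \<and> E' \<subseteq> poly_space n \<and> E \<subseteq> E' \<and>
      mpow ` {a :: 'n \<Rightarrow> nat. (\<Sum>i\<in>UNIV. a i) \<le> n} \<subseteq> spanned E'"
    by (rule orthonormal_extend_finite[OF _ _ assms])
  then obtain E' where E': "orthonormal E'" "E' \<subseteq> poly_space n" "E \<subseteq> E'"
    "mpow ` {a :: 'n \<Rightarrow> nat. (\<Sum>i\<in>UNIV. a i) \<le> n} \<subseteq> spanned E'"
    by blast
  moreover have "poly_space n \<subseteq> spanned E'"
    by (rule poly_space_subset[OF lin_closed_spanned]) (use E' in auto)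
  ultimately show ?thesis by blast
qed

text \<open>The bases are nested, so the elements that are new at step n form an orthonormal basis
  of the polynomials of degree n orthogonal to all lower degrees.\<close>

definition is_flag :: "(nat \<Rightarrow> (real ^ 'n \<Rightarrow> real) set) \<Rightarrow> bool" where
  "is_flag F \<longleftrightarrow> (\<forall>n. orthonormal (F n) \<and> F n \<subseteq> poly_space n \<and> poly_space n \<subseteq> spanned (F n) \<and> F n \<subseteq> F (Suc n))"

lemma flag_exists: "\<exists>F. is_flag F"
proof -
  define P where "P n E \<longleftrightarrow> orthonormal E \<and> E \<subseteq> poly_space n \<and> poly_space n \<subseteq> spanned E" for n E
  have "\<exists>F. \<forall>n. P n (F n) \<and> F n \<subseteq> F (Suc n)"
  proof (rule dependent_nat_choice)
    show "\<exists>E. P 0 E" using orthonormal_basis_extend[of "{}" 0] by (auto simp: P_def orthonormal_def)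
    fix E n assume "P n E"
    then have E: "orthonormal E" "E \<subseteq> poly_space (Suc n)" using poly_space_mono[of n "Suc n"] by (auto simp: P_def)
    then show "\<exists>E'. P (Suc n) E' \<and> E \<subseteq> E'"
      using orthonormal_basis_extend[OF E] by (auto simp: P_def)
  qed
  then show ?thesis by (auto simp: P_def is_flag_def)
qed

definition flag :: "nat \<Rightarrow> (real ^ 'n \<Rightarrow> real) set" where "flag = (SOME F. is_flag F)"

lemma flag: "orthonormal (flag n)" "flag n \<subseteq> poly_space n" "poly_space n \<subseteq> spanned (flag n)" "flag n \<subseteq> flag (Suc n)"
  using someI_ex[OF flag_exists] by (auto simp: is_flag_def flag_def)

lemma finite_flag: "finite (flag n)" using flag(1) by (simp add: orthonormal_def)

definition bas :: "nat \<Rightarrow> (real ^ 'n \<Rightarrow> real) set" where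
  "bas n = (case n of 0 \<Rightarrow> flag 0 | Suc m \<Rightarrow> flag (Suc m) - flag m)"

lemma bas_subset_flag: "bas n \<subseteq> flag n" by (auto simp: bas_def split: nat.splits)

lemma finite_bas: "finite (bas n)" using finite_subset[OF bas_subset_flag finite_flag] .

lemma sum_flag: "(\<Sum>b\<in>flag n. f b) = (\<Sum>k\<le>n. \<Sum>b\<in>bas k. f b)" for f :: "_ \<Rightarrow> real"
proof (induction n)
  case 0 then show ?case by (simp add: bas_def)
next
  case (Suc n)
  have "(\<Sum>b\<in>flag (Suc n). f b) = (\<Sum>b\<in>flag (Suc n) - flag n. f b) + (\<Sum>b\<in>flag n. f b)"
    by (rule sum.subset_diff[OF flag(4) finite_flag])
  then show ?case using Suc by (simp add: bas_def)
qed

lemma bas_poly: "b \<in> bas k \<Longrightarrow> b \<in> poly_space k"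
  using bas_subset_flag flag(2) by blast

lemma poly_expansion: "P \<in> poly_space n \<Longrightarrow> P = (\<lambda>x. \<Sum>b\<in>flag n. ip P b * b x)"
  using orthonormal_expansion[OF flag(1,2), of P n] flag(3) by blast

lemma orth_poly_space_iff:
  "P \<in> orth_poly_space \<mu> n \<longleftrightarrow> P \<in> poly_space n \<and> (\<forall>m<n. \<forall>Q\<in>poly_space m. ip P Q = 0)"
  by (simp add: orth_poly_space_def ip_def)

lemma bas_orth: "b \<in> bas n \<Longrightarrow> b \<in> orth_poly_space \<mu> n"
  unfolding orth_poly_space_iff
proof (intro conjI allI impI ballI)
  assume b: "b \<in> bas n"
  then show "b \<in> poly_space n" by (rule bas_poly)
  fix m and Q :: "real ^ 'n \<Rightarrow> real" assume m: "m < n" and Q: "Q \<in> poly_space m"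
  then obtain n' where n': "n = Suc n'" "m \<le> n'" by (cases n) auto
  have Q': "Q \<in> poly_space n'" using poly_space_mono[OF n'(2) Q] .
  have "ip b Q = ip b (\<lambda>x. \<Sum>b'\<in>flag n'. ip Q b' * b' x)" using poly_expansion[OF Q'] by simp
  also have "\<dots> = (\<Sum>b'\<in>flag n'. ip Q b' * ip b b')"
    using flag(2) bas_poly[OF b] by (intro ip_sum_right) (auto intro: integrable_poly)
  also have "\<dots> = (\<Sum>b'\<in>flag n'. 0)"
  proof (rule sum.cong[OF refl])
    fix b' assume "b' \<in> flag n'"
    then have "b' \<in> flag n" "b \<in> flag n" "b \<noteq> b'" using b n' flag(4)[of n'] by (auto simp: bas_def)
    then show "ip Q b' * ip b b' = 0" using flag(1)[of n] by (simp add: orthonormal_def)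
  qed
  finally show "ip b Q = 0" by simp
qed

lemma lin_closed_orth_poly_space: "lin_closed (orth_poly_space \<mu> n :: (real ^ 'n \<Rightarrow> real) set)"
  unfolding lin_closed_def
proof (intro conjI ballI allI)
  show "(\<lambda>x::real ^ 'n. 0) \<in> orth_poly_space \<mu> n" by (simp add: orth_poly_space_def poly_space_zero)
next
  fix P Q :: "real ^ 'n \<Rightarrow> real" assume PQ: "P \<in> orth_poly_space \<mu> n" "Q \<in> orth_poly_space \<mu> n"
  have "ip (\<lambda>x. P x + Q x) R = ip P R + ip Q R" if "R \<in> poly_space m" for m R
  proof -
    have "integrable M (\<lambda>x. P x * R x)" "integrable M (\<lambda>x. Q x * R x)"
      using PQ that integrable_mult_poly[OF integrable_poly[of P n] that]
        integrable_mult_poly[OF integrable_poly[of Q n] that] by (auto simp: orth_poly_space_iff)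
    then show ?thesis unfolding ip_def
      by (subst Bochner_Integration.integral_add[symmetric]) (auto simp: algebra_simps)
  qed
  then show "(\<lambda>x. P x + Q x) \<in> orth_poly_space \<mu> n"
    using PQ unfolding orth_poly_space_iff by (auto intro: poly_space_add)
next
  fix P :: "real ^ 'n \<Rightarrow> real" and c assume P: "P \<in> orth_poly_space \<mu> n"
  have "ip (\<lambda>x. c * P x) R = c * ip P R" for R
    by (simp add: ip_def mult.assoc)
  then show "(\<lambda>x. c * P x) \<in> orth_poly_space \<mu> n"
    using P unfolding orth_poly_space_iff by (auto intro: poly_space_cmult)
qed

lemma orth_expansion:
  assumes P: "P \<in> orth_poly_space \<mu> n"
  shows "P x = (\<Sum>b\<in>bas n. ip P b * b x)"
proof -
  have "P x = (\<Sum>b\<in>flag n. ip P b * b x)"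
    using poly_expansion[of P n] P unfolding orth_poly_space_iff by meson
  also have "\<dots> = (\<Sum>b\<in>bas n. ip P b * b x)"
  proof (rule sum.mono_neutral_right[OF finite_flag bas_subset_flag], intro ballI)
    fix b assume "b \<in> flag n - bas n"
    then obtain n' where n': "n = Suc n'" "b \<in> flag n'" by (cases n) (auto simp: bas_def)
    then have "b \<in> poly_space n'" using flag(2) by auto
    then show "ip P b * b x = 0" using P n' by (auto simp: orth_poly_space_iff)
  qed
  finally show ?thesis .
qed

text \<open>The sum represents evaluation at x by orthonormal expansion. If k is another
  representer, the difference d satisfies \<open>ip d d = d x - d x = 0\<close>, which settles
  uniqueness.\<close>

lemma repr_kernel_eq: "repr_kernel \<mu> n x = (\<lambda>y. \<Sum>b\<in>bas n. b x * b y)"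
  unfolding repr_kernel_def
proof (rule the_equality)
  let ?k = "\<lambda>y. \<Sum>b\<in>bas n. b x * b y"
  have kV: "?k \<in> orth_poly_space \<mu> n"
    by (intro lin_closed_sum[OF lin_closed_orth_poly_space] lin_closed_cmult[OF lin_closed_orth_poly_space] bas_orth)
  have kr: "P x = ip P ?k" if "P \<in> orth_poly_space \<mu> n" for P
  proof -
    have "ip P ?k = (\<Sum>b\<in>bas n. b x * ip P b)"
      using that by (intro ip_sum_right[of _ _ n]) (auto simp: orth_poly_space_iff bas_poly intro: integrable_poly)
    then show ?thesis using orth_expansion[OF that] by (simp add: mult.commute)
  qed
  show "?k \<in> orth_poly_space \<mu> n \<and> (\<forall>P\<in>orth_poly_space \<mu> n. P x = (\<integral>y. P y * ?k y \<partial>M))"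
    using kV kr by (simp add: ip_def)
  fix k assume k: "k \<in> orth_poly_space \<mu> n \<and> (\<forall>P\<in>orth_poly_space \<mu> n. P x = (\<integral>y. P y * k y \<partial>M))"
  define d where "d y = k y - ?k y" for y
  have dV: "d \<in> orth_poly_space \<mu> n"
    unfolding d_def[abs_def] using k kV by (intro lin_closed_diff[OF lin_closed_orth_poly_space]) auto
  then have dp: "d \<in> poly_space n" by (simp add: orth_poly_space_iff)
  have "ip d k = d x" "ip d ?k = d x" using k kr[OF dV] dV by (auto simp: ip_def)
  moreover have "ip d d = ip d k - ip d ?k"
  proof -
    have "ip (\<lambda>y. k y - ?k y) d = ip k d - ip ?k d"
      using k kV dp by (intro ip_diff_left[of _ _ _ n]) (auto simp: orth_poly_space_iff intro: integrable_poly)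
    then show ?thesis by (simp add: d_def[abs_def, symmetric] ip_commute)
  qed
  ultimately have "d = (\<lambda>_. 0)" by (intro ip_self_zero[OF dp]) simp
  then have "k y = ?k y" for y using d_def by (metis eq_iff_diff_eq_0)
  then show "k = ?k" by blast
qed

text \<open>Coefficients are taken basis element by basis element, so this is a polynomial of degree
  at most k whatever f is; it agrees with \<open>proj\<close> for integrable f.\<close>

definition pr :: "nat \<Rightarrow> (real ^ 'n \<Rightarrow> real) \<Rightarrow> real ^ 'n \<Rightarrow> real" where
  "pr k f x = (\<Sum>b\<in>bas k. ip f b * b x)"

lemma proj_eq:
  assumes "integrable M f"
  shows "proj \<mu> k f x = pr k f x"
proof -
  have "proj \<mu> k f x = ip f (\<lambda>y. \<Sum>b\<in>bas k. b x * b y)" by (simp add: Defs.proj_def repr_kernel_eq ip_def)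
  also have "\<dots> = (\<Sum>b\<in>bas k. b x * ip f b)"
    using assms by (intro ip_sum_right[of _ _ k]) (auto intro: bas_poly)
  finally show ?thesis by (simp add: pr_def mult.commute)
qed

lemma pr_orth: "pr k f \<in> orth_poly_space \<mu> k"
  unfolding pr_def[abs_def]
  by (intro lin_closed_sum[OF lin_closed_orth_poly_space] lin_closed_cmult[OF lin_closed_orth_poly_space] bas_orth)

lemma pr_poly: "pr k f \<in> poly_space k"
  using pr_orth by (simp add: orth_poly_space_iff)

lemma poly_sum_pr: "P \<in> poly_space n \<Longrightarrow> P x = (\<Sum>k\<le>n. pr k P x)"
  using poly_expansion[of P n] unfolding sum_flag pr_def by meson

end

section \<open>The Poisson kernel\<close>

lemma pochhammer_sums:
  fixes z :: real
  assumes "\<bar>z\<bar> < 1"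
  shows "(\<lambda>n. pochhammer a n / fact n * z ^ n) sums (1 - z) powr (- a)"
proof -
  have "(\<lambda>n. ((- a) gchoose n) * (- z) ^ n) sums (1 + - z) powr (- a)"
    using assms by (intro gen_binomial_real) simp
  moreover have "((- a) gchoose n) * (- z) ^ n = pochhammer a n / fact n * z ^ n" for n
  proof -
    have "(- z) ^ n = (- 1) ^ n * z ^ n" by (rule power_minus)
    moreover have "(- 1) ^ n * (- 1) ^ n = (1 :: real)" by (simp add: power_mult_distrib[symmetric])
    ultimately show ?thesis by (simp add: gbinomial_pochhammer)
  qed
  ultimately show ?thesis by simp
qed

lemma (in finite_measure) sums_integral_dominated:
  fixes f :: "nat \<Rightarrow> 'a \<Rightarrow> real"
  assumes [measurable]: "\<And>n. f n \<in> borel_measurable M" "F \<in> borel_measurable M"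
    and bound: "\<And>n. AE t in M. \<bar>f n t\<bar> \<le> a n" and a: "summable a"
    and lim: "AE t in M. (\<lambda>n. f n t) sums F t"
  shows "(\<lambda>n. \<integral>t. f n t \<partial>M) sums (\<integral>t. F t \<partial>M)"
proof -
  have int: "integrable M (f n)" for n
    by (rule integrable_const_bound[OF _ assms(1), of _ "a n"]) (use bound in simp)
  have bound': "AE t in M. \<forall>n. \<bar>f n t\<bar> \<le> a n" using bound by (simp add: AE_all_countable)
  have "(\<lambda>n. \<integral>t. f n t \<partial>M) sums (\<integral>t. (\<Sum>n. f n t) \<partial>M)"
  proof (rule sums_integral[OF int])
    show "AE t in M. summable (\<lambda>n. norm (f n t))"
      using bound' by eventually_elim (auto intro: summable_comparison_test'[OF a])
    show "summable (\<lambda>n. \<integral>t. norm (f n t) \<partial>M)"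
    proof (rule summable_comparison_test')
      show "summable (\<lambda>n. measure M (space M) * a n)" by (rule summable_mult[OF a])
      fix n
      have "(\<integral>t. norm (f n t) \<partial>M) \<le> (\<integral>t. a n \<partial>M)"
        using bound[of n] int by (intro integral_mono_AE) auto
      moreover have "0 \<le> (\<integral>t. norm (f n t) \<partial>M)" by (intro Bochner_Integration.integral_nonneg) simp
      ultimately show "norm (\<integral>t. norm (f n t) \<partial>M) \<le> measure M (space M) * a n" by simp
    qed
  qed
  also have "(\<integral>t. (\<Sum>n. f n t) \<partial>M) = (\<integral>t. F t \<partial>M)"
    using lim by (intro integral_cong_AE) (auto simp: sums_iff)
  finally show ?thesis .
qed

context
  fixes \<rho> :: real
  assumes rho: "0 \<le> \<rho>" "\<rho> < 1"
begin

text \<open>For u = (s - \<rho>) / sqrt (Dn s) one has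
  \<open>Xn u = (1 - \<rho> * s) / sqrt (Dn s)\<close>, and \<open>Ps u\<close> is 1 / (1 - \<rho>
  s) expressed through u.\<close>

private definition "Dn s = 1 + \<rho>\<^sup>2 - 2 * \<rho> * s"
private definition "Xn u = sqrt (1 - \<rho>\<^sup>2 * (1 - u\<^sup>2))"
private definition "Ps u = 1 / (Xn u * (Xn u - \<rho> * u))"

lemma poisson_denominator_pos:
  assumes "\<bar>s\<bar> \<le> 1"
  shows "(1 - \<rho>)\<^sup>2 \<le> 1 + \<rho>\<^sup>2 - 2 * \<rho> * s" "0 < 1 + \<rho>\<^sup>2 - 2 * \<rho> * s"
proof -
  have "\<rho> * s \<le> \<rho> * 1" using assms rho by (intro mult_left_mono) auto
  then show 1: "(1 - \<rho>)\<^sup>2 \<le> 1 + \<rho>\<^sup>2 - 2 * \<rho> * s" by (simp add: power2_eq_square algebra_simps)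
  have "0 < (1 - \<rho>)\<^sup>2" using rho by simp
  then show "0 < 1 + \<rho>\<^sup>2 - 2 * \<rho> * s" using 1 by linarith
qed

private lemma Xn_props:
  assumes "\<bar>u\<bar> \<le> 1"
  shows "(Xn u)\<^sup>2 = 1 - \<rho>\<^sup>2 * (1 - u\<^sup>2)" "0 < Xn u" "0 < Xn u - \<rho> * u" "0 < Xn u + \<rho> * u"
    "(Xn u - \<rho> * u) * (Xn u + \<rho> * u) = 1 - \<rho>\<^sup>2"
proof -
  have u2: "u\<^sup>2 \<le> 1" using assms by (simp add: abs_square_le_1)
  have r2: "\<rho>\<^sup>2 < 1" using rho by (simp add: abs_square_less_1)
  have "\<rho>\<^sup>2 * (1 - u\<^sup>2) \<le> \<rho>\<^sup>2 * 1" using u2 by (intro mult_left_mono) auto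
  then have pos: "0 < 1 - \<rho>\<^sup>2 * (1 - u\<^sup>2)" using r2 by simp
  then show X2: "(Xn u)\<^sup>2 = 1 - \<rho>\<^sup>2 * (1 - u\<^sup>2)" by (simp add: Xn_def)
  from pos show X0: "0 < Xn u" by (simp add: Xn_def)
  have "(\<rho> * u)\<^sup>2 < (Xn u)\<^sup>2" unfolding X2 using r2 by (simp add: power_mult_distrib algebra_simps)
  then have "\<bar>\<rho> * u\<bar> < Xn u" using X0 power2_less_imp_less[of "\<bar>\<rho> * u\<bar>" "Xn u"] by simp
  then show "0 < Xn u - \<rho> * u" "0 < Xn u + \<rho> * u" by auto
  show "(Xn u - \<rho> * u) * (Xn u + \<rho> * u) = 1 - \<rho>\<^sup>2"
    using X2 by (simp add: power2_eq_square algebra_simps)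
qed

private lemma Ps_sym: "\<bar>u\<bar> \<le> 1 \<Longrightarrow> Ps u + Ps (- u) = 2 / (1 - \<rho>\<^sup>2)"
proof -
  assume u: "\<bar>u\<bar> \<le> 1"
  note X = Xn_props[OF u]
  have "Xn (- u) = Xn u" by (simp add: Xn_def)
  then have "Ps u + Ps (- u) = 1 / (Xn u * (Xn u - \<rho> * u)) + 1 / (Xn u * (Xn u + \<rho> * u))"
    by (simp add: Ps_def)
  also have "\<dots> = 2 * Xn u / (Xn u * ((Xn u - \<rho> * u) * (Xn u + \<rho> * u)))"
    using X by (simp add: divide_simps)
  finally show ?thesis using X by simp
qed

private lemma Ps_bound: "\<bar>u\<bar> \<le> 1 \<Longrightarrow> 0 \<le> Ps u \<and> Ps u \<le> 2 / (1 - \<rho>\<^sup>2)"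
proof -
  assume u: "\<bar>u\<bar> \<le> 1"
  have nn: "0 \<le> Ps u" if "\<bar>u\<bar> \<le> 1" for u using Xn_props[OF that] by (auto simp: Ps_def)
  show ?thesis using Ps_sym[OF u] nn[of u] nn[of "- u"] u by simp
qed

text \<open>Substituting \<open>u = (s - \<rho>) / sqrt D\<close>, the law of sines in the triangle with sides \<open>1\<close>, \<open>\<rho>\<close>
  and \<open>sqrt D\<close>, turns the integrand into one whose even part is constant.\<close>

lemma bump_poisson_integral:
  assumes b: "1 \<le> b"
  shows "(\<integral>s. (1 + \<rho>\<^sup>2 - 2 * \<rho> * s) powr (- b) \<partial>bump_measure (b - 3/2)) = 1 / (1 - \<rho>\<^sup>2)"
proof -
  define c where "c = b - 3/2"
  have c: "-1 < c" using b by (simp add: c_def)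
  define g where "g s = (s - \<rho>) / sqrt (Dn s)" for s
  define g' where "g' s = (1 - \<rho> * s) / (Dn s * sqrt (Dn s))" for s
  define f where "f u = bump c u * Ps u" for u :: real
  have [measurable]: "Ps \<in> borel_measurable borel" unfolding Ps_def Xn_def by measurable
  have [measurable]: "f \<in> borel_measurable borel" unfolding f_def by measurable
  have D0: "0 < Dn s" if "\<bar>s\<bar> \<le> 1" for s using poisson_denominator_pos(2)[OF that] by (simp add: Dn_def)
  have gm1: "g (- 1) = - 1"
  proof -
    have "Dn (- 1) = (1 + \<rho>)\<^sup>2" by (simp add: Dn_def power2_eq_square algebra_simps)
    then show ?thesis using rho by (simp add: g_def field_simps)
  qed
  have g1: "g 1 = 1"
  proof -
    have "Dn 1 = (1 - \<rho>)\<^sup>2" by (simp add: Dn_def power2_eq_square algebra_simps)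
    then show ?thesis using rho by (simp add: g_def)
  qed
  have fint: "integrable lborel f"
  proof (rule Bochner_Integration.integrable_bound)
    show "integrable lborel (\<lambda>u::real. (2 / (1 - \<rho>\<^sup>2)) * bump c u)" by (intro integrable_mult_right bump_integrable[OF c])
    have "norm (f u) \<le> norm ((2 / (1 - \<rho>\<^sup>2)) * bump c u)" for u
    proof (cases "\<bar>u\<bar> \<le> 1")
      case True
      then have "bump c u * Ps u \<le> bump c u * (2 / (1 - \<rho>\<^sup>2))"
        using Ps_bound by (intro mult_left_mono) (auto simp: bump_nonneg)
      moreover have "\<rho>\<^sup>2 < 1" using rho by (simp add: abs_square_less_1)
      ultimately show ?thesis using Ps_bound[OF True] by (simp add: f_def bump_nonneg abs_mult mult.commute)
    qed (simp add: f_def bump_outside)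
    then show "AE u in lborel. norm (f u) \<le> norm ((2 / (1 - \<rho>\<^sup>2)) * bump c u)" by simp
  qed measurable
  have sub: "(\<integral>u. f u * indicator {g (-1)..g 1} u \<partial>lborel) = (\<integral>s. f (g s) * g' s * indicator {-1..1} s \<partial>lborel)"
  proof (rule integral_substitution(2))
    show "set_integrable lborel {g (-1)..g 1} f"
      unfolding set_integrable_def by (intro integrable_mult_indicator fint) auto
    show "(g has_real_derivative g' s) (at s)" if s: "s \<in> {-1..1}" for s
    proof -
      have D: "0 < Dn s" using D0[of s] s by auto
      have d: "(Dn has_real_derivative - 2 * \<rho>) (at s)"
        unfolding Dn_def by (auto intro!: derivative_eq_intros)
      have "((\<lambda>s. sqrt (Dn s)) has_real_derivative - \<rho> / sqrt (Dn s)) (at s)"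
        using DERIV_chain2[OF DERIV_real_sqrt[OF D] d] by (simp add: field_simps)
      moreover have "((\<lambda>s. s - \<rho>) has_real_derivative 1) (at s)" by (auto intro!: derivative_eq_intros)
      ultimately have "(g has_real_derivative ((1 * sqrt (Dn s) - (s - \<rho>) * (- \<rho> / sqrt (Dn s))) / (sqrt (Dn s) * sqrt (Dn s)))) (at s)"
        unfolding g_def using D by (intro DERIV_divide) auto
      moreover have "(1 * sqrt (Dn s) - (s - \<rho>) * (- \<rho> / sqrt (Dn s))) / (sqrt (Dn s) * sqrt (Dn s)) = g' s"
      proof -
        have "(1 * sqrt (Dn s) - (s - \<rho>) * (- \<rho> / sqrt (Dn s))) = (Dn s + (s - \<rho>) * \<rho>) / sqrt (Dn s)"
          using D by (simp add: field_simps)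
        also have "Dn s + (s - \<rho>) * \<rho> = 1 - \<rho> * s" by (simp add: Dn_def power2_eq_square algebra_simps)
        finally show ?thesis using D by (simp add: g'_def)
      qed
      ultimately show ?thesis by simp
    qed
    show "continuous_on {-1..1} g'"
      unfolding g'_def Dn_def using poisson_denominator_pos(2)
      by (intro continuous_intros) (force simp: abs_le_iff)+
    show "0 \<le> g' s" if s: "s \<in> {-1..1}" for s
    proof -
      have "\<rho> * s \<le> 1 * 1" using s rho by (intro order_trans[OF mult_left_mono[of s 1 \<rho>]]) auto
      moreover have "0 < Dn s" using D0[of s] s by auto
      ultimately show ?thesis by (simp add: g'_def)
    qed
  qed simp
  \<comment> \<open>Under the substitution 1 - u^2 becomes (1 - s^2) / D, so the weight contributes
    D^(-c), while \<open>Ps\<close> times the Jacobian is D^(-3/2). The total exponent is -c - 3/2 =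
    -b.\<close>
  have fg: "f (g s) * g' s * indicator {-1..1} s = bump c s * Dn s powr (- b)" for s
  proof (cases "\<bar>s\<bar> < 1")
    case False
    then have "f (g s) * g' s * indicator {-1..1} s = 0"
    proof (cases "\<bar>s\<bar> = 1")
      case True
      then have "\<bar>g s\<bar> = 1" using g1 gm1 by (auto simp: abs_if split: if_splits)
      then show ?thesis by (simp add: f_def bump_outside)
    qed (use False in \<open>auto simp: indicator_def abs_le_iff\<close>)
    then show ?thesis using False by (simp add: bump_outside)
  next
    case True
    define q where "q = sqrt (Dn s)"
    have D: "0 < Dn s" using D0[of s] True by simp
    have q: "0 < q" "q\<^sup>2 = Dn s" using D by (auto simp: q_def)
    have rs: "0 < 1 - \<rho> * s"
    proof -
      have "\<rho> * s \<le> \<rho> * 1" using True rho by (intro mult_left_mono) auto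
      then show ?thesis using rho by simp
    qed
    have s2: "0 < 1 - s\<^sup>2" using True by (simp add: abs_square_less_1)
    have g2: "1 - (g s)\<^sup>2 = (1 - s\<^sup>2) / Dn s"
    proof -
      have "(g s)\<^sup>2 = (s - \<rho>)\<^sup>2 / Dn s" using D unfolding g_def power_divide by simp
      then have "1 - (g s)\<^sup>2 = (Dn s - (s - \<rho>)\<^sup>2) / Dn s" using D by (simp add: diff_divide_distrib)
      also have "Dn s - (s - \<rho>)\<^sup>2 = 1 - s\<^sup>2" by (simp add: Dn_def power2_eq_square algebra_simps)
      finally show ?thesis .
    qed
    have X: "Xn (g s) = (1 - \<rho> * s) / q"
    proof -
      have "1 - \<rho>\<^sup>2 * (1 - (g s)\<^sup>2) = (Dn s - \<rho>\<^sup>2 * (1 - s\<^sup>2)) / Dn s" unfolding g2 using D by (simp add: field_simps)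
      also have "Dn s - \<rho>\<^sup>2 * (1 - s\<^sup>2) = (1 - \<rho> * s)\<^sup>2" by (simp add: Dn_def power2_eq_square algebra_simps)
      finally show ?thesis using rs by (simp add: Xn_def real_sqrt_divide q_def)
    qed
    have "Xn (g s) - \<rho> * g s = ((1 - \<rho> * s) - \<rho> * (s - \<rho>)) / q"
      unfolding X by (simp add: g_def q_def diff_divide_distrib[symmetric])
    also have "(1 - \<rho> * s) - \<rho> * (s - \<rho>) = q\<^sup>2" unfolding q(2) by (simp add: Dn_def power2_eq_square algebra_simps)
    also have "q\<^sup>2 / q = q" using q(1) by (simp add: power2_eq_square)
    finally have "Ps (g s) = 1 / (1 - \<rho> * s)" unfolding Ps_def X using q by simp
    then have "Ps (g s) * g' s = Dn s powr (- (3/2))"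
    proof -
      have "Ps (g s) * g' s = 1 / (Dn s * sqrt (Dn s))" using \<open>Ps (g s) = 1 / (1 - \<rho> * s)\<close> rs by (simp add: g'_def)
      also have "Dn s * sqrt (Dn s) = Dn s powr (3/2)"
      proof -
        have "Dn s powr (3/2) = Dn s powr 1 * Dn s powr (1/2)" unfolding powr_add[symmetric] by simp
        then show ?thesis using D by (simp add: powr_half_sqrt)
      qed
      finally show ?thesis by (simp only: powr_minus_divide)
    qed
    moreover have "bump c (g s) = bump c s * Dn s powr (- c)"
    proof -
      have "bump c (g s) = ((1 - s\<^sup>2) / Dn s) powr c"
        using s2 D g2 by (simp add: bump_def max_def)
      also have "\<dots> = (1 - s\<^sup>2) powr c * Dn s powr (- c)"
        using s2 D by (simp add: powr_divide powr_minus_divide)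
      finally show ?thesis using s2 by (simp add: bump_def max_def)
    qed
    moreover have "Dn s powr (- c) * Dn s powr (- (3/2)) = Dn s powr (- b)"
      by (simp add: powr_add[symmetric] c_def)
    ultimately have "f (g s) * g' s = bump c s * Dn s powr (- b)"
      unfolding f_def by (simp add: mult.assoc)
    moreover have "indicator {-1..1} s = (1::real)" using True by (simp add: indicator_def abs_less_iff)
    ultimately show ?thesis by simp
  qed
  have fi: "f u * indicator {g (-1)..g 1} u = f u" for u
    unfolding g1 gm1 by (cases "\<bar>u\<bar> \<le> 1") (auto simp: indicator_def f_def bump_outside abs_le_iff)
  have main: "(\<integral>s. bump c s * Dn s powr (- b) \<partial>lborel) = (\<integral>u. f u \<partial>lborel)"
    using sub unfolding fg fi by simp
  have reflect: "(\<integral>u. f u \<partial>lborel) = (\<integral>u. f (- u) \<partial>lborel)"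
    using lborel_integral_real_affine[of "-1" f 0] by simp
  have fint': "integrable lborel (\<lambda>u. f (- u))"
    using lborel_integrable_real_affine[OF fint, of "-1" 0] by simp
  have "2 * (\<integral>u. f u \<partial>lborel) = (\<integral>u. f u + f (- u) \<partial>lborel)"
    using reflect fint fint' by simp
  also have "\<dots> = (\<integral>u. 2 / (1 - \<rho>\<^sup>2) * bump c (u::real) \<partial>lborel)"
  proof (rule Bochner_Integration.integral_cong[OF refl])
    fix u :: real
    have "bump c (- u) = bump c u" by (simp add: bump_def)
    then have "f u + f (- u) = bump c u * (Ps u + Ps (- u))" by (simp add: f_def distrib_left)
    then show "f u + f (- u) = 2 / (1 - \<rho>\<^sup>2) * bump c u"
      using Ps_sym[of u] by (cases "\<bar>u\<bar> \<le> 1") (auto simp: bump_outside)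
  qed
  finally have I: "(\<integral>u. f u \<partial>lborel) = integral\<^sup>L lborel (bump c :: real \<Rightarrow> real) / (1 - \<rho>\<^sup>2)" by simp
  have "(\<integral>s. Dn s powr (- b) \<partial>bump_measure c) = (\<integral>s. bump c s * Dn s powr (- b) \<partial>lborel) / integral\<^sup>L lborel (bump c :: real \<Rightarrow> real)"
    by (rule integral_bump_measure[OF c]) (unfold Dn_def, measurable)
  also have "\<dots> = 1 / (1 - \<rho>\<^sup>2)"
    unfolding main I using bump_integral_pos[OF c, where 'a = real] by simp
  finally show ?thesis by (simp add: Dn_def c_def)
qed

end

context ball_setting
begin

lemma kav_measurable:
  assumes [measurable]: "g \<in> borel_measurable borel"
  shows "case_prod (kav g) \<in> borel_measurable (borel \<Otimes>\<^sub>M borel)"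
proof -
  have "(\<lambda>p. \<integral>t. g (fst p \<bullet> snd p + t * \<delta> (fst p) * \<delta> (snd p)) \<partial>N) \<in> borel_measurable (borel \<Otimes>\<^sub>M borel)"
    by (rule N.borel_measurable_lebesgue_integral) measurable
  then show ?thesis by (simp add: kav_def case_prod_unfold)
qed

lemma kav_measurable_M:
  assumes "g \<in> borel_measurable borel"
  shows "kav g x \<in> borel_measurable M" "(\<lambda>x. kav g x y) \<in> borel_measurable M"
    "case_prod (kav g) \<in> borel_measurable (M \<Otimes>\<^sub>M M)"
proof -
  note [measurable] = kav_measurable[OF assms]
  have "(\<lambda>p. (fst p, snd p)) \<in> (M \<Otimes>\<^sub>M M) \<rightarrow>\<^sub>M (borel \<Otimes>\<^sub>M borel)" by measurable
  then have "(\<lambda>p. case_prod (kav g) (fst p, snd p)) \<in> borel_measurable (M \<Otimes>\<^sub>M M)" by measurable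
  then show "case_prod (kav g) \<in> borel_measurable (M \<Otimes>\<^sub>M M)" by (simp add: case_prod_unfold)
  have "(\<lambda>y. case_prod (kav g) (x, y)) \<in> borel_measurable borel" by measurable
  then show "kav g x \<in> borel_measurable M" by (intro borel_ball_measure) simp
  have "(\<lambda>x. case_prod (kav g) (x, y)) \<in> borel_measurable borel" by measurable
  then show "(\<lambda>x. kav g x y) \<in> borel_measurable M" by (intro borel_ball_measure) simp
qed

lemma kav_commute: "kav g x y = kav g y x"
  by (simp add: kav_def inner_commute mult_ac)

lemma kav_arg:
  assumes "x \<in> cball 0 1" "y \<in> cball 0 1"
  shows "AE t in N. \<bar>x \<bullet> y + t * \<delta> x * \<delta> y\<bar> \<le> 1"
  using AE_N by eventually_elim (use assms abs_inner_plus_le in auto)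

lemma kav_integrable:
  fixes g :: "real \<Rightarrow> real"
  assumes "g \<in> borel_measurable borel" "\<And>s. \<bar>s\<bar> \<le> 1 \<Longrightarrow> \<bar>g s\<bar> \<le> B" "x \<in> cball 0 1" "y \<in> cball 0 1"
  shows "integrable N (\<lambda>t. g (x \<bullet> y + t * \<delta> x * \<delta> y))"
proof (rule N.integrable_const_bound)
  show "AE t in N. norm (g (x \<bullet> y + t * \<delta> x * \<delta> y)) \<le> B"
    using kav_arg[OF assms(3,4)] by eventually_elim (use assms(2) in auto)
qed (use assms(1) in measurable)

lemma kav_mono:
  assumes "g \<in> borel_measurable borel" "\<And>s. \<bar>s\<bar> \<le> 1 \<Longrightarrow> \<bar>g s\<bar> \<le> B"
    "h \<in> borel_measurable borel" "\<And>s. \<bar>s\<bar> \<le> 1 \<Longrightarrow> \<bar>h s\<bar> \<le> B'"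
    "\<And>s. \<bar>s\<bar> \<le> 1 \<Longrightarrow> g s \<le> h s" "x \<in> cball 0 1" "y \<in> cball 0 1"
  shows "kav g x y \<le> kav h x y"
  unfolding kav_def
proof (rule integral_mono_AE)
  show "AE t in N. g (x \<bullet> y + t * \<delta> x * \<delta> y) \<le> h (x \<bullet> y + t * \<delta> x * \<delta> y)"
    using kav_arg[OF assms(6,7)] by eventually_elim (use assms(5) in auto)
qed (use kav_integrable assms in auto)

lemma kav_const: "kav (\<lambda>_. c) x y = c"
  using N.prob_space by (simp add: kav_def)

lemma kav_cmult: "kav (\<lambda>s. c * g s) x y = c * kav g x y"
  by (simp add: kav_def)

lemma kav_le:
  assumes "g \<in> borel_measurable borel" "\<And>s. \<bar>s\<bar> \<le> 1 \<Longrightarrow> \<bar>g s\<bar> \<le> B" "x \<in> cball 0 1" "y \<in> cball 0 1"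
  shows "\<bar>kav g x y\<bar> \<le> B"
proof -
  have B: "0 \<le> B" using assms(2)[of 0] by simp
  have "kav g x y \<le> kav (\<lambda>_. B) x y" by (rule kav_mono[of _ B _ B]) (use assms B in \<open>auto simp: abs_le_iff\<close>)
  moreover have "kav (\<lambda>_. - B) x y \<le> kav g x y"
    by (rule kav_mono[of _ B _ B]) (use assms B in \<open>force simp: abs_le_iff\<close>)+
  ultimately show ?thesis by (simp add: kav_const)
qed

lemma kav_nonneg:
  assumes "\<And>s. \<bar>s\<bar> \<le> 1 \<Longrightarrow> 0 \<le> g s" "x \<in> cball 0 1" "y \<in> cball 0 1"
  shows "0 \<le> kav g x y"
  unfolding kav_def
  by (rule Bochner_Integration.integral_nonneg_AE) (use kav_arg[OF assms(2,3)] assms(1) in \<open>auto elim!: eventually_mono\<close>)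

lemma kmon_le:
  assumes "x \<in> cball 0 1" "y \<in> cball 0 1"
  shows "\<bar>kmon n x y\<bar> \<le> 1"
  unfolding kav_power[OF assms, symmetric]
  by (rule kav_le) (use assms in \<open>auto simp: power_abs power_le_one\<close>)

text \<open>The Poisson kernel of Gegenbauer expansions of index \<kappa> - 1.\<close>

definition pois :: "real \<Rightarrow> real \<Rightarrow> real" where
  "pois \<rho> s = (1 - \<rho>\<^sup>2) * (1 + \<rho>\<^sup>2 - 2 * \<rho> * s) powr (- \<kappa>)"

lemma pois_measurable [measurable]: "pois \<rho> \<in> borel_measurable borel"
  unfolding pois_def by measurable

lemma pois_bounds:
  assumes "0 \<le> \<rho>" "\<rho> < 1" "\<bar>s\<bar> \<le> 1"
  shows "0 \<le> pois \<rho> s" "pois \<rho> s \<le> (1 - \<rho>\<^sup>2) * (1 - \<rho>) powr (- (2 * \<kappa>))"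
proof -
  note D = poisson_denominator_pos[OF assms]
  have r: "\<rho>\<^sup>2 \<le> 1" using assms by (simp add: power_le_one)
  then show "0 \<le> pois \<rho> s" by (simp add: pois_def)
  have "(1 + \<rho>\<^sup>2 - 2 * \<rho> * s) powr (- \<kappa>) \<le> ((1 - \<rho>)\<^sup>2) powr (- \<kappa>)"
    using D assms kappa_ge_1 by (intro powr_mono2') auto
  also have "((1 - \<rho>)\<^sup>2) powr (- \<kappa>) = (1 - \<rho>) powr (- (2 * \<kappa>))"
    using assms powr_powr[of "1 - \<rho>" 2 "- \<kappa>"] by (simp add: powr_numeral)
  finally show "pois \<rho> s \<le> (1 - \<rho>\<^sup>2) * (1 - \<rho>) powr (- (2 * \<kappa>))"
    unfolding pois_def using r by (intro mult_left_mono) auto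
qed

lemma pois_abs_le:
  assumes "0 \<le> \<rho>" "\<rho> < 1" "\<bar>s\<bar> \<le> 1"
  shows "\<bar>pois \<rho> s\<bar> \<le> (1 - \<rho>\<^sup>2) * (1 - \<rho>) powr (- (2 * \<kappa>))"
  using pois_bounds[OF assms] by simp

text \<open>The Taylor coefficients of \<open>pois \<rho>\<close> in s. They are nonnegative, so
  convergence at s = 1 gives a summable majorant on all of [-1,1].\<close>

definition pcoef :: "real \<Rightarrow> nat \<Rightarrow> real" where
  "pcoef \<rho> n = (1 - \<rho>\<^sup>2) * (1 + \<rho>\<^sup>2) powr (- \<kappa>) * (pochhammer \<kappa> n / fact n * (2 * \<rho> / (1 + \<rho>\<^sup>2)) ^ n)"

lemma pois_ratio:
  fixes \<rho> :: real
  assumes "0 \<le> \<rho>" "\<rho> < 1"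
  shows "0 \<le> 2 * \<rho> / (1 + \<rho>\<^sup>2)" "2 * \<rho> / (1 + \<rho>\<^sup>2) < 1"
proof -
  have p: "0 < 1 + \<rho>\<^sup>2" using zero_le_power2[of \<rho>] by linarith
  show "0 \<le> 2 * \<rho> / (1 + \<rho>\<^sup>2)" using assms p by simp
  have "0 < (1 - \<rho>)\<^sup>2" using assms by simp
  then show "2 * \<rho> / (1 + \<rho>\<^sup>2) < 1" using p by (simp add: power2_eq_square algebra_simps)
qed

lemma pois_powr_factor:
  fixes \<rho> :: real
  assumes "0 \<le> \<rho>" "\<rho> < 1" "\<bar>s\<bar> \<le> 1"
  shows "(1 - 2 * \<rho> / (1 + \<rho>\<^sup>2) * s) powr (- a) = (1 + \<rho>\<^sup>2) powr a * (1 + \<rho>\<^sup>2 - 2 * \<rho> * s) powr (- a)"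
proof -
  have p: "0 < 1 + \<rho>\<^sup>2" using zero_le_power2[of \<rho>] by linarith
  have "1 - 2 * \<rho> / (1 + \<rho>\<^sup>2) * s = (1 + \<rho>\<^sup>2 - 2 * \<rho> * s) / (1 + \<rho>\<^sup>2)" using p by (simp add: field_simps)
  then show ?thesis using p poisson_denominator_pos(2)[OF assms] by (simp add: powr_divide powr_minus field_simps)
qed

lemma pois_sums:
  assumes "0 \<le> \<rho>" "\<rho> < 1" "\<bar>s\<bar> \<le> 1"
  shows "(\<lambda>n. pcoef \<rho> n * s ^ n) sums pois \<rho> s"
proof -
  define v where "v = 2 * \<rho> / (1 + \<rho>\<^sup>2)"
  have v: "0 \<le> v" "v < 1" using pois_ratio[OF assms(1,2)] by (auto simp: v_def)
  have "\<bar>v * s\<bar> \<le> v * 1" unfolding abs_mult using v assms(3) by (intro mult_mono) auto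
  then have "\<bar>v * s\<bar> < 1" using v by simp
  then have "(\<lambda>n. pochhammer \<kappa> n / fact n * (v * s) ^ n) sums (1 - v * s) powr (- \<kappa>)"
    by (rule pochhammer_sums)
  from sums_mult[OF this, of "(1 - \<rho>\<^sup>2) * (1 + \<rho>\<^sup>2) powr (- \<kappa>)"]
  have "(\<lambda>n. pcoef \<rho> n * s ^ n) sums ((1 - \<rho>\<^sup>2) * (1 + \<rho>\<^sup>2) powr (- \<kappa>) * (1 - v * s) powr (- \<kappa>))"
    unfolding pcoef_def v_def[symmetric] power_mult_distrib by (simp only: mult_ac times_divide_eq_left times_divide_eq_right)
  also have "(1 - \<rho>\<^sup>2) * (1 + \<rho>\<^sup>2) powr (- \<kappa>) * (1 - v * s) powr (- \<kappa>) = pois \<rho> s"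
  proof -
    have "0 < 1 + \<rho>\<^sup>2" using zero_le_power2[of \<rho>] by linarith
    then show ?thesis unfolding v_def pois_powr_factor[OF assms] pois_def by (simp add: powr_minus)
  qed
  finally show ?thesis .
qed

lemma pcoef_nonneg: "0 \<le> \<rho> \<Longrightarrow> \<rho> < 1 \<Longrightarrow> 0 \<le> pcoef \<rho> n"
  unfolding pcoef_def using kappa_ge_1 pois_ratio(1)[of \<rho>]
  by (intro mult_nonneg_nonneg divide_nonneg_nonneg pochhammer_nonneg zero_le_power) (auto simp: power_le_one)

lemma pcoef_summable: "0 \<le> \<rho> \<Longrightarrow> \<rho> < 1 \<Longrightarrow> summable (pcoef \<rho>)"
  using pois_sums[of \<rho> 1] by (simp add: sums_iff)

lemma kav_pois_sums:
  assumes \<rho>: "0 \<le> \<rho>" "\<rho> < 1" and xy: "x \<in> cball 0 1" "y \<in> cball 0 1"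
  shows "(\<lambda>n. pcoef \<rho> n * kmon n x y) sums kav (pois \<rho>) x y"
proof -
  have "(\<lambda>n. \<integral>t. pcoef \<rho> n * (x \<bullet> y + t * \<delta> x * \<delta> y) ^ n \<partial>N) sums (\<integral>t. pois \<rho> (x \<bullet> y + t * \<delta> x * \<delta> y) \<partial>N)"
  proof (rule N.sums_integral_dominated[OF _ _ _ pcoef_summable[OF \<rho>]])
    show "AE t in N. \<bar>pcoef \<rho> n * (x \<bullet> y + t * \<delta> x * \<delta> y) ^ n\<bar> \<le> pcoef \<rho> n" for n
      using kav_arg[OF xy]
    proof eventually_elim
      case (elim t)
      then have "\<bar>x \<bullet> y + t * \<delta> x * \<delta> y\<bar> ^ n \<le> 1" by (intro power_le_one) auto
      then have "pcoef \<rho> n * \<bar>x \<bullet> y + t * \<delta> x * \<delta> y\<bar> ^ n \<le> pcoef \<rho> n * 1"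
        by (intro mult_left_mono pcoef_nonneg \<rho>)
      then show ?case using pcoef_nonneg[OF \<rho>] by (simp add: abs_mult power_abs)
    qed
    show "AE t in N. (\<lambda>n. pcoef \<rho> n * (x \<bullet> y + t * \<delta> x * \<delta> y) ^ n) sums pois \<rho> (x \<bullet> y + t * \<delta> x * \<delta> y)"
      using kav_arg[OF xy] by eventually_elim (rule pois_sums[OF \<rho>])
  qed measurable
  also have "(\<lambda>n. \<integral>t. pcoef \<rho> n * (x \<bullet> y + t * \<delta> x * \<delta> y) ^ n \<partial>N) = (\<lambda>n. pcoef \<rho> n * kmon n x y)"
    by (intro ext) (simp add: kav_power[OF xy, symmetric] kav_def)
  finally show ?thesis by (simp add: kav_def)
qed

text \<open>The multipliers of the monomials on degree m are, up to Taylor factors of the exponent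
  \<kappa> + m, the moments of a weight on the line. A series of multipliers thereby becomes the
  integral of a binomial series.\<close>

lemma eig_moment:
  "pochhammer \<kappa> (k + m) / fact (k + m) * eig (k + m) m
    = pochhammer (\<kappa> + real m) k / (2 ^ m * fact k) * (\<integral>s. s ^ k \<partial>bump_measure (\<kappa> + real m - 3/2))"
proof -
  define c where "c = \<kappa> + real m - 3/2"
  have c: "- 1 < c" using kappa_ge_1 by (simp add: c_def)
  have S: "(\<integral>s. s ^ k \<partial>bump_measure c) = bump_moment c k 0 (1::real)" for k by (simp add: bump_moment_def)
  show ?thesis
  proof (cases "even k")
    case False
    then show ?thesis using bump_moment_odd[OF c False, of 0 "1::real"] by (simp add: eig_odd S c_def[symmetric])
  next
    case True
    then obtain i where i: "k = 2 * i" by (auto elim: evenE)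
    have f: "(fact (2 * n) :: real) = 4 ^ n * pochhammer (1/2) n * fact n" for n
      using fact_double[of n, where 'a = real] by (simp add: power_mult)
    have "pochhammer (c + 1) i > 0" using c by (intro pochhammer_pos) simp
    then have "bump_moment c k 0 (1::real) = pochhammer (1/2) i / pochhammer (\<kappa> + real m) i"
      unfolding i bump_moment_even[OF c] bump_moment_zero[OF c] by (simp add: c_def)
    moreover have "eig (k + m) m = fact (k + m) / (2 ^ m * 4 ^ i * fact i * pochhammer \<kappa> (m + i))"
      using eig_eq[of m i] by (simp add: i add.commute)
    moreover have "pochhammer \<kappa> (k + m) = pochhammer \<kappa> m * pochhammer (\<kappa> + real m) k"
      using pochhammer_product[of m "k + m" \<kappa>] by simp
    moreover have "pochhammer \<kappa> (m + i) = pochhammer \<kappa> m * pochhammer (\<kappa> + real m) i"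
      using pochhammer_product[of m "m + i" \<kappa>] by simp
    moreover have "pochhammer \<kappa> m > 0" using kappa_ge_1 by (intro pochhammer_pos) simp
    moreover have "(fact k :: real) = 4 ^ i * pochhammer (1/2) i * fact i" unfolding i by (rule f)
    moreover have "pochhammer (1/2::real) i > 0" by (intro pochhammer_pos) simp
    ultimately show ?thesis unfolding c_def[symmetric] S by simp
  qed
qed

text \<open>By \<open>eig_moment\<close> the series from index m on is an integral of (1 - v s)^(-b)
  with b = \<kappa> + m, which is the one evaluated in \<open>bump_poisson_integral\<close>. The
  first m terms are 0, so the shift of index changes nothing.\<close>

lemma pois_eig_sums:
  assumes \<rho>: "0 \<le> \<rho>" "\<rho> < 1"
  shows "(\<lambda>n. pcoef \<rho> n * eig n m) sums \<rho> ^ m"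
proof -
  define b where "b = \<kappa> + real m"
  have b: "1 \<le> b" using kappa_ge_1 by (simp add: b_def)
  define v where "v = 2 * \<rho> / (1 + \<rho>\<^sup>2)"
  have v: "0 \<le> v" "v < 1" using pois_ratio[OF \<rho>] by (auto simp: v_def)
  have p: "0 < 1 + \<rho>\<^sup>2" using zero_le_power2[of \<rho>] by linarith
  have r2: "\<rho>\<^sup>2 < 1" using \<rho> by (simp add: abs_square_less_1)
  define A where "A = (1 - \<rho>\<^sup>2) * (1 + \<rho>\<^sup>2) powr (- \<kappa>)"
  interpret S: prob_space "bump_measure (b - 3/2) :: real measure"
    using b by (intro prob_space_bump_measure) simp
  have AES: "AE s::real in bump_measure (b - 3/2). \<bar>s\<bar> \<le> 1"
    using AE_bump_measure[of "b - 3/2", where 'a = real] by eventually_elim simp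
  define a where "a k = pochhammer b k / fact k * v ^ k" for k
  have a0: "0 \<le> a k" for k unfolding a_def using b v by (intro mult_nonneg_nonneg divide_nonneg_nonneg pochhammer_nonneg) auto
  have asum: "summable a" using pochhammer_sums[of v b] v by (simp add: a_def[abs_def] sums_iff)
  have "(\<lambda>k. \<integral>s. a k * s ^ k \<partial>bump_measure (b - 3/2)) sums (\<integral>s. (1 - v * s) powr (- b) \<partial>bump_measure (b - 3/2))"
  proof (rule S.sums_integral_dominated[OF _ _ _ asum])
    show "AE s in bump_measure (b - 3/2). \<bar>a k * s ^ k\<bar> \<le> a k" for k
      using AES
    proof eventually_elim
      case (elim s)
      then have "\<bar>s\<bar> ^ k \<le> 1" by (intro power_le_one) auto
      then have "a k * \<bar>s\<bar> ^ k \<le> a k * 1" by (intro mult_left_mono a0)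
      then show ?case using a0 by (simp add: abs_mult power_abs)
    qed
    show "AE s in bump_measure (b - 3/2). (\<lambda>k. a k * s ^ k) sums (1 - v * s) powr (- b)"
      using AES
    proof eventually_elim
      case (elim s)
      have "\<bar>v * s\<bar> \<le> v * 1" unfolding abs_mult using v elim by (intro mult_mono) auto
      then have "\<bar>v * s\<bar> < 1" using v by simp
      then show ?case using pochhammer_sums[of "v * s" b] by (simp add: a_def power_mult_distrib mult_ac)
    qed
  qed measurable
  also have "(\<integral>s. (1 - v * s) powr (- b) \<partial>bump_measure (b - 3/2))
     = (\<integral>s. (1 + \<rho>\<^sup>2) powr b * (1 + \<rho>\<^sup>2 - 2 * \<rho> * s) powr (- b) \<partial>bump_measure (b - 3/2))"
  proof (rule integral_cong_AE)
    show "AE s in bump_measure (b - 3/2). (1 - v * s) powr (- b) = (1 + \<rho>\<^sup>2) powr b * (1 + \<rho>\<^sup>2 - 2 * \<rho> * s) powr (- b)"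
      using AES by eventually_elim (unfold v_def, rule pois_powr_factor[OF \<rho>])
  qed measurable
  also have "\<dots> = (1 + \<rho>\<^sup>2) powr b / (1 - \<rho>\<^sup>2)"
    using bump_poisson_integral[OF \<rho> b] by simp
  finally have "(\<lambda>k. \<integral>s. a k * s ^ k \<partial>bump_measure (b - 3/2)) sums ((1 + \<rho>\<^sup>2) powr b / (1 - \<rho>\<^sup>2))" .
  from sums_mult[OF this, of "A * (v / 2) ^ m"]
  have "(\<lambda>k. A * (v / 2) ^ m * (\<integral>s. a k * s ^ k \<partial>bump_measure (b - 3/2))) sums (A * (v / 2) ^ m * ((1 + \<rho>\<^sup>2) powr b / (1 - \<rho>\<^sup>2)))" .
  also have "(\<lambda>k. A * (v / 2) ^ m * (\<integral>s. a k * s ^ k \<partial>bump_measure (b - 3/2))) = (\<lambda>k. pcoef \<rho> (k + m) * eig (k + m) m)"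
  proof
    fix k
    have "pcoef \<rho> (k + m) * eig (k + m) m = A * v ^ (k + m) * (pochhammer \<kappa> (k + m) / fact (k + m) * eig (k + m) m)"
      by (simp add: pcoef_def A_def v_def)
    also have "\<dots> = A * v ^ (k + m) * (pochhammer b k / (2 ^ m * fact k) * (\<integral>s. s ^ k \<partial>bump_measure (b - 3/2)))"
      unfolding eig_moment b_def ..
    also have "\<dots> = A * (v / 2) ^ m * (\<integral>s. a k * s ^ k \<partial>bump_measure (b - 3/2))"
      by (simp add: a_def power_add power_divide)
    finally show "A * (v / 2) ^ m * (\<integral>s. a k * s ^ k \<partial>bump_measure (b - 3/2)) = pcoef \<rho> (k + m) * eig (k + m) m" by simp
  qed
  also have "A * (v / 2) ^ m * ((1 + \<rho>\<^sup>2) powr b / (1 - \<rho>\<^sup>2)) = \<rho> ^ m"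
  proof -
    have "(1 + \<rho>\<^sup>2) powr b = (1 + \<rho>\<^sup>2) powr \<kappa> * (1 + \<rho>\<^sup>2) ^ m"
      using p by (simp add: b_def powr_add powr_realpow)
    moreover have "(v / 2) ^ m = \<rho> ^ m / (1 + \<rho>\<^sup>2) ^ m"
    proof -
      have "v / 2 = \<rho> / (1 + \<rho>\<^sup>2)" using p by (simp add: v_def divide_simps)
      then show ?thesis by (simp only: power_divide)
    qed
    moreover have "(1 + \<rho>\<^sup>2) powr (- \<kappa>) * (1 + \<rho>\<^sup>2) powr \<kappa> = 1" using p by (simp add: powr_add[symmetric])
    ultimately show ?thesis using p r2 by (simp add: A_def mult_ac)
  qed
  finally show ?thesis by (subst (asm) sums_zero_iff_shift) (simp add: eig_below)
qed

text \<open>The Taylor series of the kernel converges absolutely, so \<open>kop_eigen\<close> may be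
  applied term by term; the resulting series of multipliers has sum \<rho>^m.\<close>

lemma kav_pois_integral:
  assumes \<rho>: "0 \<le> \<rho>" "\<rho> < 1" and x: "x \<in> cball 0 1" and Q: "Q \<in> orth_poly_space \<mu> m"
  shows "(\<integral>y. kav (pois \<rho>) x y * Q y \<partial>M) = \<rho> ^ m * Q x"
proof -
  have Qc: "continuous_on (cball 0 1) Q" using Q by (auto simp: orth_poly_space_iff intro: poly_space_continuous)
  have "compact (Q ` cball 0 1)" by (intro compact_continuous_image Qc compact_cball)
  then obtain B where B: "\<And>y. y \<in> cball 0 1 \<Longrightarrow> \<bar>Q y\<bar> \<le> B"
    by (force dest!: compact_imp_bounded simp: bounded_iff)
  note [measurable] = continuous_ball_measure[OF Qc] kav_measurable_M(1)[OF pois_measurable]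
    borel_ball_measure[OF poly_space_borel[OF kmon_poly]]
  have "(\<lambda>n. \<integral>y. pcoef \<rho> n * (kmon n x y * Q y) \<partial>M) sums (\<integral>y. kav (pois \<rho>) x y * Q y \<partial>M)"
  proof (rule sums_integral_dominated)
    show "summable (\<lambda>n. pcoef \<rho> n * B)" by (rule summable_mult2[OF pcoef_summable[OF \<rho>]])
    show "AE y in M. \<bar>pcoef \<rho> n * (kmon n x y * Q y)\<bar> \<le> pcoef \<rho> n * B" for n
    proof (rule AE_I2)
      fix y assume "y \<in> space M"
      then have y: "y \<in> cball 0 1" by simp
      have "\<bar>kmon n x y\<bar> * \<bar>Q y\<bar> \<le> 1 * B" by (intro mult_mono kmon_le x y B) auto
      then show "\<bar>pcoef \<rho> n * (kmon n x y * Q y)\<bar> \<le> pcoef \<rho> n * B"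
        using mult_left_mono[OF _ pcoef_nonneg[OF \<rho>], of "\<bar>kmon n x y\<bar> * \<bar>Q y\<bar>" B n] pcoef_nonneg[OF \<rho>, of n]
        by (simp add: abs_mult)
    qed
    show "AE y in M. (\<lambda>n. pcoef \<rho> n * (kmon n x y * Q y)) sums (kav (pois \<rho>) x y * Q y)"
    proof (rule AE_I2)
      fix y assume "y \<in> space M"
      then have y: "y \<in> cball 0 1" by simp
      show "(\<lambda>n. pcoef \<rho> n * (kmon n x y * Q y)) sums (kav (pois \<rho>) x y * Q y)"
        using sums_mult2[OF kav_pois_sums[OF \<rho> x y], of "Q y"] by (simp add: mult.assoc)
    qed
  qed measurable
  also have "(\<lambda>n. \<integral>y. pcoef \<rho> n * (kmon n x y * Q y) \<partial>M) = (\<lambda>n. pcoef \<rho> n * eig n m * Q x)"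
    using kop_eigen[OF Q x] by (intro ext) (simp add: kop_def)
  finally show ?thesis using sums_unique2 sums_mult2[OF pois_eig_sums[OF \<rho>]] by blast
qed

lemma kav_pois_mass:
  assumes "0 \<le> \<rho>" "\<rho> < 1" "x \<in> cball 0 1"
  shows "(\<integral>y. kav (pois \<rho>) x y \<partial>M) = 1"
proof -
  have "(\<lambda>_. 1) \<in> orth_poly_space \<mu> 0" by (simp add: orth_poly_space_def poly_space_const)
  from kav_pois_integral[OF assms this] show ?thesis by simp
qed

end

section \<open>Polynomial approximation of inverse powers\<close>

fun cheb :: "nat \<Rightarrow> real poly" where
  "cheb 0 = 1"
| "cheb (Suc 0) = [:0, 1:]"
| "cheb (Suc (Suc n)) = [:0, 2:] * cheb (Suc n) - cheb n"

lemma degree_cheb: "degree (cheb n) \<le> n"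
proof (induction n rule: cheb.induct)
  case (3 n)
  have "degree ([:0, 2:] * cheb (Suc n)) \<le> 1 + Suc n"
    using degree_mult_le[of "[:0, 2:]" "cheb (Suc n)"] 3 by simp
  moreover have "degree (cheb n) \<le> Suc (Suc n)" using 3 by simp
  ultimately show ?case using degree_diff_le[of "[:0, 2:] * cheb (Suc n)" "Suc (Suc n)" "cheb n"] by simp
qed auto

lemma cheb_cos: "poly (cheb n) (cos t) = cos (real n * t)"
proof (induction n rule: cheb.induct)
  case (3 n)
  have "cos (real (Suc (Suc n)) * t) + cos (real n * t) = 2 * cos t * cos (real (Suc n) * t)"
  proof -
    have "real (Suc (Suc n)) * t = real (Suc n) * t + t" "real n * t = real (Suc n) * t - t"
      by (auto simp: algebra_simps)
    then show ?thesis by (simp only: cos_add cos_diff) (simp add: mult.commute)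
  qed
  then show ?case using 3 by simp
qed auto

lemma cheb_abs_le: "\<bar>s\<bar> \<le> 1 \<Longrightarrow> \<bar>poly (cheb n) s\<bar> \<le> 1"
  using cheb_cos[of n "arccos s"] by (simp add: abs_le_iff)

lemma cheb_cosh: "poly (cheb n) (cosh t) = cosh (real n * t)"
proof (induction n rule: cheb.induct)
  case (3 n)
  have "cosh (real (Suc (Suc n)) * t) + cosh (real n * t) = 2 * cosh t * cosh (real (Suc n) * t)"
  proof -
    have "real (Suc (Suc n)) * t = real (Suc n) * t + t" "real n * t = real (Suc n) * t - t"
      by (auto simp: algebra_simps)
    then show ?thesis by (simp only: cosh_add cosh_diff) (simp add: mult.commute)
  qed
  then show ?case using 3 by simp
qed auto

text \<open>The increments of the Chebyshev values at 1 + e grow by at least 2e per step, so they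
  add up to a quadratic lower bound. With e = 1/n^2 it makes the value at least 2.\<close>

lemma cheb_growth:
  assumes "0 \<le> e"
  shows "1 + (real n)\<^sup>2 * e \<le> poly (cheb n) (1 + e)"
proof -
  define a where "a n = poly (cheb n) (1 + e)" for n
  have "1 + (real n)\<^sup>2 * e \<le> a n \<and> (2 * real n + 1) * e \<le> a (Suc n) - a n" for n
  proof (induction n)
    case 0 show ?case by (simp add: a_def)
  next
    case (Suc n)
    have 1: "1 + (real (Suc n))\<^sup>2 * e \<le> a (Suc n)" using Suc by (simp add: power2_eq_square algebra_simps)
    then have "1 \<le> a (Suc n)" using assms by (smt (verit) mult_nonneg_nonneg zero_le_power2)
    then have "e \<le> e * a (Suc n)" using assms mult_left_mono[of 1 "a (Suc n)" e] by simp
    moreover have "a (Suc (Suc n)) - a (Suc n) = a (Suc n) - a n + 2 * (e * a (Suc n))"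
      by (simp add: a_def algebra_simps)
    ultimately have "(2 * real (Suc n) + 1) * e \<le> a (Suc (Suc n)) - a (Suc n)"
      using Suc by (simp add: algebra_simps)
    then show ?case using 1 by simp
  qed
  then show ?thesis by (simp add: a_def)
qed

lemma cosh_arcosh: "1 \<le> x \<Longrightarrow> \<exists>t\<ge>0. x = cosh (t::real)"
  by (intro exI[of _ "arcosh x"]) (simp add: arcosh_nonneg_real)

lemma cheb_mono: "1 \<le> x \<Longrightarrow> x \<le> y \<Longrightarrow> poly (cheb n) x \<le> poly (cheb n) y"
proof -
  assume "1 \<le> x" "x \<le> y"
  then obtain a b where ab: "0 \<le> a" "x = cosh a" "0 \<le> b" "y = cosh b"
    using cosh_arcosh[of x] cosh_arcosh[of y] by auto
  then have "a \<le> b" using \<open>x \<le> y\<close> cosh_real_nonneg_le_iff by simp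
  then show ?thesis using ab cosh_real_nonneg_le_iff[of "real n * a" "real n * b"] by (simp add: cheb_cosh mult_left_mono)
qed

lemma cheb_ge_power: "1 \<le> x \<Longrightarrow> x ^ n \<le> poly (cheb n) x"
proof -
  assume "1 \<le> x"
  then obtain t where t: "0 \<le> t" "x = cosh t" using cosh_arcosh by blast
  have "cosh t ^ n \<le> cosh (real n * t)"
  proof (induction n)
    case (Suc n)
    have "cosh t ^ Suc n \<le> cosh t * cosh (real n * t)" using Suc by (simp add: cosh_real_nonneg mult_left_mono)
    also have "\<dots> \<le> cosh t * cosh (real n * t) + sinh t * sinh (real n * t)" using t by (simp add: sinh_real_nonneg_iff)
    also have "\<dots> = cosh (real (Suc n) * t)" by (simp add: cosh_add distrib_right add.commute)
    finally show ?case .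
  qed simp
  then show ?thesis using t by (simp add: cheb_cosh)
qed

text \<open>The coefficients in s of the divided difference (T(\<zeta>) - T(s)) / (\<zeta> - s),
  divided by T(\<zeta>), with T the Chebyshev polynomial of degree m. They are written out so that
  they can be integrated in \<zeta>.\<close>

definition chebq_coeff :: "nat \<Rightarrow> nat \<Rightarrow> real \<Rightarrow> real" where
  "chebq_coeff m i \<zeta> = (\<Sum>j\<in>{i<..m}. coeff (cheb m) j * \<zeta> ^ (j - Suc i)) / poly (cheb m) \<zeta>"

definition chebq :: "nat \<Rightarrow> real \<Rightarrow> real poly" where
  "chebq m \<zeta> = (\<Sum>i<m. monom (chebq_coeff m i \<zeta>) i)"

lemma poly_chebq: "poly (chebq m \<zeta>) s = (\<Sum>i<m. chebq_coeff m i \<zeta> * s ^ i)"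
  by (simp add: chebq_def poly_sum poly_monom)

lemma degree_chebq: "degree (chebq m \<zeta>) \<le> m - 1"
  unfolding chebq_def by (intro degree_sum_le) (auto intro: order_trans[OF degree_monom_le])

lemma chebq_identity:
  assumes "poly (cheb m) \<zeta> \<noteq> 0"
  shows "(\<zeta> - s) * poly (chebq m \<zeta>) s = 1 - poly (cheb m) s / poly (cheb m) \<zeta>"
proof -
  have alt: "poly (cheb m) x = (\<Sum>j\<le>m. coeff (cheb m) j * x ^ j)" for x
  proof -
    have "poly (cheb m) x = (\<Sum>j\<le>degree (cheb m). coeff (cheb m) j * x ^ j)" by (rule poly_altdef)
    also have "\<dots> = (\<Sum>j\<le>m. coeff (cheb m) j * x ^ j)"
      by (rule sum.mono_neutral_left) (use degree_cheb[of m] in \<open>auto simp: coeff_eq_0\<close>)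
    finally show ?thesis .
  qed
  have "poly (cheb m) \<zeta> * poly (chebq m \<zeta>) s
     = (\<Sum>i<m. (\<Sum>j\<in>{i<..m}. coeff (cheb m) j * \<zeta> ^ (j - Suc i)) * s ^ i)"
    using assms by (simp add: poly_chebq chebq_coeff_def sum_distrib_left)
  also have "\<dots> = (\<Sum>i<m. \<Sum>j\<in>{i<..m}. coeff (cheb m) j * (\<zeta> ^ (j - Suc i) * s ^ i))"
    by (simp add: sum_distrib_right mult.assoc)
  also have "\<dots> = (\<Sum>i<m. \<Sum>j\<le>m. if i < j then coeff (cheb m) j * (\<zeta> ^ (j - Suc i) * s ^ i) else 0)"
    by (intro sum.cong refl sum.mono_neutral_cong_left) auto
  also have "\<dots> = (\<Sum>j\<le>m. \<Sum>i<m. if i < j then coeff (cheb m) j * (\<zeta> ^ (j - Suc i) * s ^ i) else 0)"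
    by (rule sum.swap)
  also have "\<dots> = (\<Sum>j\<le>m. \<Sum>i<j. coeff (cheb m) j * (\<zeta> ^ (j - Suc i) * s ^ i))"
    by (intro sum.cong refl sum.mono_neutral_cong_right) auto
  also have "\<dots> = (\<Sum>j\<le>m. coeff (cheb m) j * (\<Sum>i<j. \<zeta> ^ (j - Suc i) * s ^ i))"
    by (simp add: sum_distrib_left)
  finally have "poly (cheb m) \<zeta> * ((\<zeta> - s) * poly (chebq m \<zeta>) s)
     = (\<Sum>j\<le>m. coeff (cheb m) j * ((\<zeta> - s) * (\<Sum>i<j. \<zeta> ^ (j - Suc i) * s ^ i)))"
    by (simp add: sum_distrib_left mult_ac)
  also have "\<dots> = (\<Sum>j\<le>m. coeff (cheb m) j * \<zeta> ^ j - coeff (cheb m) j * s ^ j)"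
  proof (intro sum.cong refl)
    fix j
    have "(\<zeta> - s) * (\<Sum>i<j. \<zeta> ^ (j - Suc i) * s ^ i) = \<zeta> ^ j - s ^ j"
      using power_diff_sumr2[of s j \<zeta>] by (simp add: algebra_simps)
    then show "coeff (cheb m) j * ((\<zeta> - s) * (\<Sum>i<j. \<zeta> ^ (j - Suc i) * s ^ i))
      = coeff (cheb m) j * \<zeta> ^ j - coeff (cheb m) j * s ^ j" by (simp add: right_diff_distrib)
  qed
  also have "\<dots> = poly (cheb m) \<zeta> - poly (cheb m) s" by (simp add: alt sum_subtractf)
  finally show ?thesis using assms by (simp add: field_simps)
qed

lemma cheb_ge_1: "1 \<le> x \<Longrightarrow> 1 \<le> poly (cheb m) x"
  using cheb_ge_power[of x m] one_le_power[of x m] by linarith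

text \<open>The relative error is exactly T(s) / T(\<zeta>) in absolute value, where T oscillates
  between -1 and 1 on [-1,1] and is large to the right of 1.\<close>

lemma chebq_approx:
  assumes "1 < \<zeta>" "\<bar>s\<bar> \<le> 1"
  shows "\<bar>poly (chebq m \<zeta>) s - 1 / (\<zeta> - s)\<bar> \<le> 1 / poly (cheb m) \<zeta> * (1 / (\<zeta> - s))"
proof -
  have T: "1 \<le> poly (cheb m) \<zeta>" using cheb_ge_1[of \<zeta>] assms by simp
  have p: "0 < \<zeta> - s" using assms by (auto simp: abs_le_iff)
  have "poly (chebq m \<zeta>) s = (1 - poly (cheb m) s / poly (cheb m) \<zeta>) / (\<zeta> - s)"
    using chebq_identity[of m \<zeta> s] T p by (simp add: field_simps)
  then have "poly (chebq m \<zeta>) s - 1 / (\<zeta> - s) = - (poly (cheb m) s / poly (cheb m) \<zeta> / (\<zeta> - s))"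
    by (simp add: diff_divide_distrib)
  also have "\<bar>\<dots>\<bar> = \<bar>poly (cheb m) s\<bar> / poly (cheb m) \<zeta> / (\<zeta> - s)" using T p by simp
  also have "\<dots> \<le> 1 / poly (cheb m) \<zeta> / (\<zeta> - s)"
    using T p cheb_abs_le[OF assms(2)] by (intro divide_right_mono) auto
  finally show ?thesis by simp
qed

text \<open>The numerator has degree at most m - 1 in \<zeta>, and the Chebyshev value in the
  denominator is at least \<zeta>^m. The decay 1/\<zeta> is what makes the coefficients integrable
  against v^(-\<phi>).\<close>

lemma chebq_coeff_bound: "\<exists>B. \<forall>\<zeta>\<ge>1. \<bar>chebq_coeff m i \<zeta>\<bar> \<le> B / \<zeta>"
proof (intro exI allI impI)
  fix \<zeta> :: real assume z: "1 \<le> \<zeta>"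
  show "\<bar>chebq_coeff m i \<zeta>\<bar> \<le> (\<Sum>j\<in>{i<..m}. \<bar>coeff (cheb m) j\<bar>) / \<zeta>"
  proof (cases "m = 0")
    case False
    have "\<bar>\<Sum>j\<in>{i<..m}. coeff (cheb m) j * \<zeta> ^ (j - Suc i)\<bar> \<le> (\<Sum>j\<in>{i<..m}. \<bar>coeff (cheb m) j * \<zeta> ^ (j - Suc i)\<bar>)"
      by (rule sum_abs)
    also have "\<dots> \<le> (\<Sum>j\<in>{i<..m}. \<bar>coeff (cheb m) j\<bar> * \<zeta> ^ (m - 1))"
      using z by (intro sum_mono) (auto simp: abs_mult intro!: mult_left_mono power_increasing)
    finally have 1: "\<bar>\<Sum>j\<in>{i<..m}. coeff (cheb m) j * \<zeta> ^ (j - Suc i)\<bar> \<le> (\<Sum>j\<in>{i<..m}. \<bar>coeff (cheb m) j\<bar>) * \<zeta> ^ (m - 1)"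
      by (simp add: sum_distrib_right)
    have "\<bar>chebq_coeff m i \<zeta>\<bar> = \<bar>\<Sum>j\<in>{i<..m}. coeff (cheb m) j * \<zeta> ^ (j - Suc i)\<bar> / poly (cheb m) \<zeta>"
      using cheb_ge_1[OF z, of m] by (simp add: chebq_coeff_def)
    also have "\<dots> \<le> ((\<Sum>j\<in>{i<..m}. \<bar>coeff (cheb m) j\<bar>) * \<zeta> ^ (m - 1)) / \<zeta> ^ m"
      using z 1 cheb_ge_power[OF z, of m] by (intro frac_le) (auto intro!: mult_nonneg_nonneg sum_nonneg)
    also have "\<dots> = (\<Sum>j\<in>{i<..m}. \<bar>coeff (cheb m) j\<bar>) / \<zeta>"
      using z False by (cases m) auto
    finally show ?thesis .
  qed (simp add: chebq_coeff_def)
qed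

lemma integrable_stieltjes:
  assumes "0 < \<phi>" "\<phi> < 1"
  shows "integrable lborel (\<lambda>v::real. indicator {0<..} v * (v powr (- \<phi>) / (1 + v)))"
proof (rule Bochner_Integration.integrable_bound)
  have nn: "integrable lborel f" if "f \<in> borel_measurable borel" "\<And>x. 0 \<le> f x" "(f has_integral I) UNIV" for f :: "real \<Rightarrow> real" and I
    using nn_integral_has_integral_lborel[OF that] that by (intro integrableI_nonneg) auto
  have "((\<lambda>v. v powr (- \<phi>)) has_integral (1 powr (- \<phi> + 1) / (- \<phi> + 1))) {0..1}"
    using assms by (intro has_integral_powr_from_0) auto
  then have "((\<lambda>v. indicator {0..1} v * v powr (- \<phi>)) has_integral (1 powr (- \<phi> + 1) / (- \<phi> + 1))) UNIV"
    using has_integral_restrict_UNIV[of "{0..1}" "\<lambda>v. v powr (- \<phi>)"] by (simp add: indicator_mult_if)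
  then have 1: "integrable lborel (\<lambda>v::real. indicator {0..1} v * v powr (- \<phi>))"
    by (rule nn[rotated 2]) auto
  have "((\<lambda>v. v powr (- \<phi> - 1)) has_integral - (1 powr (- \<phi> - 1 + 1)) / (- \<phi> - 1 + 1)) {1..}"
    using assms by (intro has_integral_powr_to_inf) auto
  then have "((\<lambda>v. indicator {1..} v * v powr (- \<phi> - 1)) has_integral - (1 powr (- \<phi> - 1 + 1)) / (- \<phi> - 1 + 1)) UNIV"
    using has_integral_restrict_UNIV[of "{1..}" "\<lambda>v. v powr (- \<phi> - 1)"] by (simp add: indicator_mult_if)
  then have 2: "integrable lborel (\<lambda>v::real. indicator {1..} v * v powr (- \<phi> - 1))"
    by (rule nn[rotated 2]) auto
  show "integrable lborel (\<lambda>v::real. indicator {0..1} v * v powr (- \<phi>) + indicator {1..} v * v powr (- \<phi> - 1))"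
    using 1 2 by (rule Bochner_Integration.integrable_add)
  show "AE v in lborel. norm (indicator {0<..} v * (v powr (- \<phi>) / (1 + v)))
      \<le> norm (indicator {0..1} v * v powr (- \<phi>) + indicator {1..} v * v powr (- \<phi> - 1))"
  proof (rule AE_I2)
    fix v :: real
    consider "v \<le> 0" | "0 < v" "v \<le> 1" | "1 < v" by linarith
    then show "norm (indicator {0<..} v * (v powr (- \<phi>) / (1 + v)))
      \<le> norm (indicator {0..1} v * v powr (- \<phi>) + indicator {1..} v * v powr (- \<phi> - 1))"
    proof cases
      case 2
      then have "v powr (- \<phi>) / (1 + v) \<le> v powr (- \<phi>) / 1" by (intro divide_left_mono) auto
      also have "\<dots> \<le> v powr (- \<phi>) + indicator {1..} v * v powr (- \<phi> - 1)" by simp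
      finally show ?thesis using 2 by (simp add: indicator_def)
    next
      case 3
      then have "v powr (- \<phi>) / (1 + v) \<le> v powr (- \<phi>) / v" by (intro divide_left_mono) auto
      also have "\<dots> = v powr (- \<phi> - 1)" using 3 by (simp add: powr_diff)
      finally show ?thesis using 3 by (simp add: indicator_def)
    qed (simp add: indicator_def)
  qed
qed measurable

text \<open>The constant in Stieltjes' representation of x^(-\<phi>) as a superposition of the
  functions 1 / (x + v); its value is pi / sin (pi \<phi>).\<close>

definition stj :: "real \<Rightarrow> real" where
  "stj \<phi> = (\<integral>v. indicator {0<..} v * (v powr (- \<phi>) / (1 + v)) \<partial>lborel)"

lemma stieltjes_integral:
  assumes \<phi>: "0 < \<phi>" "\<phi> < 1" and x: "0 < x"
  shows "integrable lborel (\<lambda>v::real. indicator {0<..} v * (v powr (- \<phi>) / (x + v)))"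
    and "(\<integral>v. indicator {0<..} v * (v powr (- \<phi>) / (x + v)) \<partial>lborel) = stj \<phi> * x powr (- \<phi>)"
proof -
  define f where "f = (\<lambda>v::real. indicator {0<..} v * (v powr (- \<phi>) / (x + v)))"
  have fx: "f (0 + x * v) = x powr (- \<phi> - 1) * (indicator {0<..} v * (v powr (- \<phi>) / (1 + v)))" for v
  proof (cases "0 < v")
    case True
    have "(x * v) powr (- \<phi>) / (x + x * v) = x powr (- \<phi>) * v powr (- \<phi>) / (x * (1 + v))"
      using True x by (simp add: powr_mult distrib_left)
    also have "\<dots> = x powr (- \<phi> - 1) * (v powr (- \<phi>) / (1 + v))" using x by (simp add: powr_diff)
    finally show ?thesis using True x by (simp add: f_def indicator_def)
  next
    case False
    then have "x * v \<le> 0" using x by (simp add: mult_nonneg_nonpos)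
    then show ?thesis using False by (simp add: f_def indicator_def)
  qed
  have "integrable lborel (\<lambda>v. f (0 + x * v))"
    unfolding fx by (intro integrable_mult_right integrable_stieltjes \<phi>)
  then have "integrable lborel f"
    using lborel_integrable_real_affine_iff[of x f 0] x by simp
  then show "integrable lborel (\<lambda>v::real. indicator {0<..} v * (v powr (- \<phi>) / (x + v)))" by (simp add: f_def)
  have "(\<integral>v. f v \<partial>lborel) = \<bar>x\<bar> *\<^sub>R (\<integral>v. f (0 + x * v) \<partial>lborel)"
    using x by (intro lborel_integral_real_affine) auto
  also have "\<dots> = x * (x powr (- \<phi> - 1) * stj \<phi>)" unfolding fx stj_def integral_mult_right_zero using x by simp
  also have "\<dots> = stj \<phi> * x powr (- \<phi>)" using x by (simp add: powr_diff)
  finally show "(\<integral>v. indicator {0<..} v * (v powr (- \<phi>) / (x + v)) \<partial>lborel) = stj \<phi> * x powr (- \<phi>)"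
    by (simp add: f_def)
qed

lemma stj_pos:
  assumes \<phi>: "0 < \<phi>" "\<phi> < 1"
  shows "0 < stj \<phi>"
proof (rule ccontr)
  assume "\<not> ?thesis"
  moreover have "0 \<le> stj \<phi>" unfolding stj_def
    by (rule Bochner_Integration.integral_nonneg) (auto simp: indicator_def)
  ultimately have "stj \<phi> = 0" by simp
  then have "AE v::real in lborel. indicator {0<..} v * (v powr (- \<phi>) / (1 + v)) = 0"
    unfolding stj_def
    by (subst (asm) integral_nonneg_eq_0_iff_AE[OF integrable_stieltjes[OF \<phi>]]) (auto simp: indicator_def)
  then have "AE v::real in lborel. v \<notin> {0<..<1}"
    by eventually_elim (auto simp: indicator_def)
  then have "emeasure lborel {0<..<1::real} = 0"
    by (subst (asm) AE_iff_measurable[OF _ refl]) (auto simp: greaterThanLessThan_def greaterThan_def lessThan_def Int_def)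
  then show False by simp
qed

text \<open>For a fractional exponent, integrate the approximations of \<open>1 / (\<zeta> + v - s)\<close> over \<open>v\<close>: the
  relative error only decreases with \<open>v\<close>.\<close>

lemma fractional_power_approx:
  assumes \<phi>: "0 \<le> \<phi>" "\<phi> < 1" and z: "1 < \<zeta>" and m: "1 \<le> m"
  shows "\<exists>p. degree p \<le> m - 1 \<and>
    (\<forall>s. \<bar>s\<bar> \<le> 1 \<longrightarrow> \<bar>poly p s - (\<zeta> - s) powr (- \<phi>)\<bar> \<le> 1 / poly (cheb m) \<zeta> * (\<zeta> - s) powr (- \<phi>))"
proof (cases "\<phi> = 0")
  case True
  have "1 \<le> poly (cheb m) \<zeta>" using cheb_ge_1[of \<zeta>] z by simp
  then show ?thesis using True z by (intro exI[of _ 1]) (auto simp: abs_le_iff)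
next
  case False
  then have \<phi>': "0 < \<phi>" using \<phi> by simp
  define w where "w v = indicator {0<..} v * v powr (- \<phi>)" for v :: real
  have [measurable]: "poly (cheb m) \<in> borel_measurable borel"
    by (intro borel_measurable_continuous_onI continuous_intros)
  have wm [measurable]: "w \<in> borel_measurable borel" unfolding w_def by measurable
  have w0: "0 \<le> w v" for v by (simp add: w_def indicator_def)
  define S where "S = stj \<phi>"
  have S: "0 < S" using stj_pos[OF \<phi>' \<phi>(2)] by (simp add: S_def)
  have int1: "integrable lborel (\<lambda>v. w v * (1 / (x + v)))" and val1: "(\<integral>v. w v * (1 / (x + v)) \<partial>lborel) = S * x powr (- \<phi>)"
    if "0 < x" for x
    using stieltjes_integral[OF \<phi>' \<phi>(2) that] by (simp_all add: w_def S_def mult.assoc)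
  have intc: "integrable lborel (\<lambda>v. w v * chebq_coeff m i (\<zeta> + v))" for i
  proof -
    obtain B where B: "\<And>\<zeta>. 1 \<le> \<zeta> \<Longrightarrow> \<bar>chebq_coeff m i \<zeta>\<bar> \<le> B / \<zeta>" using chebq_coeff_bound by blast
    show ?thesis
    proof (rule Bochner_Integration.integrable_bound)
      show "integrable lborel (\<lambda>v. B * (w v * (1 / (1 + v))))" by (intro integrable_mult_right int1) simp
      show "AE v in lborel. norm (w v * chebq_coeff m i (\<zeta> + v)) \<le> norm (B * (w v * (1 / (1 + v))))"
      proof (rule AE_I2)
        fix v :: real
        show "norm (w v * chebq_coeff m i (\<zeta> + v)) \<le> norm (B * (w v * (1 / (1 + v))))"
        proof (cases "0 < v")
          case True
          have "0 \<le> \<bar>chebq_coeff m i 1\<bar>" by simp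
          also have "\<dots> \<le> B" using B[of 1] by simp
          finally have "0 \<le> B" .
          have "\<bar>chebq_coeff m i (\<zeta> + v)\<bar> \<le> B / (\<zeta> + v)" using True z by (intro B) simp
          also have "\<dots> \<le> B / (1 + v)" using True z \<open>0 \<le> B\<close> by (intro divide_left_mono) auto
          finally have "w v * \<bar>chebq_coeff m i (\<zeta> + v)\<bar> \<le> w v * (B / (1 + v))" by (intro mult_left_mono w0)
          then show ?thesis using w0[of v] \<open>0 \<le> B\<close> True by (simp add: abs_mult mult_ac)
        qed (simp add: w_def)
      qed
    qed (unfold chebq_coeff_def, measurable)
  qed
  \<comment> \<open>The polynomials for \<zeta> + v are integrated over v coefficient by
    coefficient, and S normalises the superposition.\<close>
  define p where "p = (\<Sum>i<m. monom ((\<integral>v. w v * chebq_coeff m i (\<zeta> + v) \<partial>lborel) / S) i)"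
  have deg: "degree p \<le> m - 1"
    unfolding p_def by (intro degree_sum_le) (auto intro: order_trans[OF degree_monom_le])
  have "\<bar>poly p s - (\<zeta> - s) powr (- \<phi>)\<bar> \<le> 1 / poly (cheb m) \<zeta> * (\<zeta> - s) powr (- \<phi>)" if s: "\<bar>s\<bar> \<le> 1" for s
  proof -
    have x: "0 < \<zeta> - s" using s z by (auto simp: abs_le_iff)
    have T: "1 \<le> poly (cheb m) \<zeta>" using cheb_ge_1[of \<zeta>] z by simp
    have intq: "integrable lborel (\<lambda>v. w v * poly (chebq m (\<zeta> + v)) s)"
    proof -
      have "integrable lborel (\<lambda>v. \<Sum>i<m. s ^ i * (w v * chebq_coeff m i (\<zeta> + v)))"
        by (intro Bochner_Integration.integrable_sum integrable_mult_right intc)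
      then show ?thesis by (simp add: poly_chebq sum_distrib_left mult_ac)
    qed
    have "poly p s = (\<Sum>i<m. s ^ i * (\<integral>v. w v * chebq_coeff m i (\<zeta> + v) \<partial>lborel)) / S"
      by (simp add: p_def poly_sum poly_monom sum_divide_distrib mult_ac)
    also have "(\<Sum>i<m. s ^ i * (\<integral>v. w v * chebq_coeff m i (\<zeta> + v) \<partial>lborel))
      = (\<integral>v. (\<Sum>i<m. s ^ i * (w v * chebq_coeff m i (\<zeta> + v))) \<partial>lborel)"
      using intc by (subst Bochner_Integration.integral_sum) auto
    also have "\<dots> = (\<integral>v. w v * poly (chebq m (\<zeta> + v)) s \<partial>lborel)"
      by (simp add: poly_chebq sum_distrib_left mult_ac)
    finally have "poly p s - (\<zeta> - s) powr (- \<phi>)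
        = ((\<integral>v. w v * poly (chebq m (\<zeta> + v)) s \<partial>lborel) - (\<integral>v. w v * (1 / (\<zeta> - s + v)) \<partial>lborel)) / S"
      unfolding val1[OF x] using S by (simp add: diff_divide_distrib)
    also have "\<dots> = (\<integral>v. w v * (poly (chebq m (\<zeta> + v)) s - 1 / (\<zeta> - s + v)) \<partial>lborel) / S"
      using intq int1[OF x] by (subst Bochner_Integration.integral_diff[symmetric]) (auto simp: right_diff_distrib)
    also have "\<bar>\<dots>\<bar> \<le> (1 / poly (cheb m) \<zeta> * (\<integral>v. w v * (1 / (\<zeta> - s + v)) \<partial>lborel)) / S"
    proof -
      have le: "\<bar>\<integral>v. w v * (poly (chebq m (\<zeta> + v)) s - 1 / (\<zeta> - s + v)) \<partial>lborel\<bar>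
         \<le> (\<integral>v. 1 / poly (cheb m) \<zeta> * (w v * (1 / (\<zeta> - s + v))) \<partial>lborel)"
      proof (rule integral_abs_bound[THEN order_trans], rule integral_mono)
        show "integrable lborel (\<lambda>v. \<bar>w v * (poly (chebq m (\<zeta> + v)) s - 1 / (\<zeta> - s + v))\<bar>)"
          using Bochner_Integration.integrable_diff[OF intq int1[OF x]] by (simp add: right_diff_distrib)
        show "integrable lborel (\<lambda>v. 1 / poly (cheb m) \<zeta> * (w v * (1 / (\<zeta> - s + v))))"
          by (intro integrable_mult_right int1 x)
        fix v :: real
        show "\<bar>w v * (poly (chebq m (\<zeta> + v)) s - 1 / (\<zeta> - s + v))\<bar> \<le> 1 / poly (cheb m) \<zeta> * (w v * (1 / (\<zeta> - s + v)))"
        proof (cases "0 < v")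
          case True
          have "\<bar>poly (chebq m (\<zeta> + v)) s - 1 / (\<zeta> + v - s)\<bar> \<le> 1 / poly (cheb m) (\<zeta> + v) * (1 / (\<zeta> + v - s))"
            using True z s by (intro chebq_approx) auto
          also have "\<dots> \<le> 1 / poly (cheb m) \<zeta> * (1 / (\<zeta> + v - s))"
            using True z x T cheb_mono[of \<zeta> "\<zeta> + v" m] by (intro mult_right_mono divide_left_mono) auto
          finally have "w v * \<bar>poly (chebq m (\<zeta> + v)) s - 1 / (\<zeta> + v - s)\<bar> \<le> w v * (1 / poly (cheb m) \<zeta> * (1 / (\<zeta> + v - s)))"
            by (intro mult_left_mono w0)
          then show ?thesis using w0[of v] by (simp add: abs_mult mult_ac add_diff_eq diff_add_eq)
        qed (simp add: w_def)
      qed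
      show ?thesis
        using S divide_right_mono[OF le[unfolded integral_mult_right_zero], of S] by (simp only: abs_divide abs_of_pos)
    qed
    also have "\<dots> = 1 / poly (cheb m) \<zeta> * (\<zeta> - s) powr (- \<phi>)" unfolding val1[OF x] using S by simp
    finally show ?thesis .
  qed
  then show ?thesis using deg by blast
qed

lemma prod_one_plus_bound:
  fixes e e' \<epsilon> :: real
  assumes "\<bar>e\<bar> \<le> \<epsilon>" "\<bar>e'\<bar> \<le> \<epsilon>" "\<epsilon> \<le> 1"
  shows "\<bar>(1 + e) ^ k * (1 + e') - 1\<bar> \<le> 2 ^ Suc k * \<epsilon> \<and> \<bar>(1 + e) ^ k * (1 + e')\<bar> \<le> 2 ^ Suc k"
proof (induction k)
  case 0
  then show ?case using assms by auto
next
  case (Suc k)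
  define A where "A = (1 + e) ^ k * (1 + e')"
  have A: "\<bar>A - 1\<bar> \<le> 2 ^ Suc k * \<epsilon>" "\<bar>A\<bar> \<le> 2 ^ Suc k" using Suc by (auto simp: A_def)
  have "\<bar>(1 + e) * A - 1\<bar> = \<bar>(A - 1) + e * A\<bar>" by (simp add: algebra_simps)
  also have "\<dots> \<le> \<bar>A - 1\<bar> + \<bar>e\<bar> * \<bar>A\<bar>" using abs_triangle_ineq[of "A - 1" "e * A"] by (simp add: abs_mult)
  also have "\<dots> \<le> 2 ^ Suc k * \<epsilon> + \<epsilon> * 2 ^ Suc k" using A assms by (intro add_mono mult_mono) auto
  finally have 1: "\<bar>(1 + e) * A - 1\<bar> \<le> 2 ^ Suc (Suc k) * \<epsilon>" by (simp add: mult_ac)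
  have 2: "\<bar>(1 + e) * A\<bar> \<le> 2 * 2 ^ Suc k" unfolding abs_mult using A assms by (intro mult_mono) auto
  show ?case using 1 2 by (simp add: A_def mult.assoc)
qed

text \<open>With K the integer part of \<kappa>, K copies of \<open>chebq\<close> and one
  approximant of the fractional power are multiplied. Each relative error is at most 1 / cosh (m t),
  hence at most 2 exp (- m t), and accumulating K + 1 of them costs 2^(K+1).\<close>

lemma inverse_power_approx:
  assumes \<kappa>: "1 \<le> \<kappa>" and t: "0 < t"
  shows "\<exists>p. degree p \<le> n \<and> (\<forall>s. \<bar>s\<bar> \<le> 1 \<longrightarrow> \<bar>poly p s - (cosh t - s) powr (- \<kappa>)\<bar>
     \<le> 2 powr (\<kappa> + 2) * exp (- (real n * t / (\<kappa> + 1))) * (cosh t - s) powr (- \<kappa>))"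
proof -
  define K where "K = nat \<lfloor>\<kappa>\<rfloor>"
  define \<phi> where "\<phi> = \<kappa> - real K"
  have K: "real K \<le> \<kappa>" "\<kappa> < real K + 1" "1 \<le> K"
    using \<kappa> by (auto simp: K_def le_nat_floor)
  have \<phi>: "0 \<le> \<phi>" "\<phi> < 1" using K by (auto simp: \<phi>_def)
  \<comment> \<open>Each of the K + 1 factors has degree m - 1, so the product has degree at most n,
    while m is still at least n / (\<kappa> + 1).\<close>
  define m where "m = n div (K + 1) + 1"
  define \<zeta> where "\<zeta> = cosh t"
  have z: "1 < \<zeta>" using t cosh_real_nonneg_less_iff[of 0 t] by (simp add: \<zeta>_def)
  define \<epsilon> where "\<epsilon> = 1 / poly (cheb m) \<zeta>"
  have T: "1 \<le> poly (cheb m) \<zeta>" using cheb_ge_1[of \<zeta>] z by simp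
  have \<epsilon>: "0 \<le> \<epsilon>" "\<epsilon> \<le> 1" using T by (auto simp: \<epsilon>_def)
  obtain p1 where p1: "degree p1 \<le> m - 1"
    "\<And>s. \<bar>s\<bar> \<le> 1 \<Longrightarrow> \<bar>poly p1 s - (\<zeta> - s) powr (- \<phi>)\<bar> \<le> \<epsilon> * (\<zeta> - s) powr (- \<phi>)"
    using fractional_power_approx[OF \<phi> z, of m] by (auto simp: m_def \<epsilon>_def)
  define p where "p = chebq m \<zeta> ^ K * p1"
  have "degree p \<le> K * (m - 1) + (m - 1)"
  proof -
    have "degree (chebq m \<zeta> ^ K) \<le> (m - 1) * K"
      using degree_power_le[of "chebq m \<zeta>" K] degree_chebq[of m \<zeta>] mult_le_mono1 order_trans by blast
    then show ?thesis unfolding p_def using degree_mult_le[of "chebq m \<zeta> ^ K" p1] p1(1) by (simp add: mult.commute)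
  qed
  also have "\<dots> = (K + 1) * (n div (K + 1))" by (simp add: m_def)
  also have "\<dots> \<le> n" by (rule times_div_less_eq_dividend)
  finally have deg: "degree p \<le> n" .
  have "\<epsilon> \<le> 2 * exp (- (real n * t / (\<kappa> + 1)))"
  proof -
    have "real n \<le> real m * (real K + 1)"
    proof -
      have "n < (n div (K + 1) + 1) * (K + 1)" using dividend_less_times_div[of "K + 1" n] by (simp add: algebra_simps)
      then have "n \<le> m * (K + 1)" by (simp add: m_def)
      then have "real n \<le> real (m * (K + 1))" by (rule of_nat_mono)
      then show ?thesis by (simp add: distrib_left add.commute)
    qed
    also have "\<dots> \<le> real m * (\<kappa> + 1)" using K by (intro mult_left_mono) auto
    finally have "real n / (\<kappa> + 1) \<le> real m" using \<kappa> by (simp add: field_simps)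
    then have "real n * t / (\<kappa> + 1) \<le> real m * t" using t mult_right_mono[of "real n / (\<kappa> + 1)" "real m" t] by simp
    moreover have "\<epsilon> = 1 / cosh (real m * t)" by (simp add: \<epsilon>_def \<zeta>_def cheb_cosh)
    moreover have "exp (real m * t) / 2 \<le> cosh (real m * t)" by (simp add: cosh_def)
    then have "1 / cosh (real m * t) \<le> 1 / (exp (real m * t) / 2)" by (intro divide_left_mono) (auto simp: cosh_real_pos)
    then have "1 / cosh (real m * t) \<le> 2 * exp (- (real m * t))" by (simp add: exp_minus field_simps)
    ultimately show ?thesis by (smt (verit) exp_le_cancel_iff)
  qed
  note eb = this
  have "\<bar>poly p s - (\<zeta> - s) powr (- \<kappa>)\<bar> \<le> 2 powr (\<kappa> + 2) * exp (- (real n * t / (\<kappa> + 1))) * (\<zeta> - s) powr (- \<kappa>)"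
    if s: "\<bar>s\<bar> \<le> 1" for s
  proof -
    have x: "0 < \<zeta> - s" using s z by (auto simp: abs_le_iff)
    define e where "e = (\<zeta> - s) * poly (chebq m \<zeta>) s - 1"
    define e' where "e' = poly p1 s / (\<zeta> - s) powr (- \<phi>) - 1"
    have xp: "0 < (\<zeta> - s) powr (- \<phi>)" using x by simp
    have "\<bar>e\<bar> = (\<zeta> - s) * \<bar>poly (chebq m \<zeta>) s - 1 / (\<zeta> - s)\<bar>"
    proof -
      have "e = (\<zeta> - s) * (poly (chebq m \<zeta>) s - 1 / (\<zeta> - s))" using x by (simp add: e_def right_diff_distrib)
      then show ?thesis using x by (simp add: abs_mult)
    qed
    also have "\<dots> \<le> (\<zeta> - s) * (\<epsilon> * (1 / (\<zeta> - s)))"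
      unfolding \<epsilon>_def using x by (intro mult_left_mono chebq_approx z s) auto
    finally have e: "\<bar>e\<bar> \<le> \<epsilon>" using x by simp
    have "\<bar>e'\<bar> = \<bar>poly p1 s - (\<zeta> - s) powr (- \<phi>)\<bar> / (\<zeta> - s) powr (- \<phi>)"
    proof -
      have "e' = (poly p1 s - (\<zeta> - s) powr (- \<phi>)) / (\<zeta> - s) powr (- \<phi>)" using xp by (simp add: e'_def diff_divide_distrib)
      then show ?thesis using xp by simp
    qed
    also have "\<dots> \<le> \<epsilon> * (\<zeta> - s) powr (- \<phi>) / (\<zeta> - s) powr (- \<phi>)" using p1(2)[OF s] xp by (intro divide_right_mono) auto
    finally have e': "\<bar>e'\<bar> \<le> \<epsilon>" using xp by simp
    have "poly (chebq m \<zeta>) s = (1 + e) / (\<zeta> - s)" using x by (simp add: e_def)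
    moreover have "poly p1 s = (1 + e') * (\<zeta> - s) powr (- \<phi>)" using xp by (simp add: e'_def)
    moreover have "(\<zeta> - s) powr (- \<kappa>) = (\<zeta> - s) powr (- \<phi>) / (\<zeta> - s) ^ K"
    proof -
      have "- \<kappa> = - \<phi> - real K" by (simp add: \<phi>_def)
      then show ?thesis using x by (simp add: powr_diff powr_realpow)
    qed
    ultimately have "poly p s - (\<zeta> - s) powr (- \<kappa>) = ((1 + e) ^ K * (1 + e') - 1) * (\<zeta> - s) powr (- \<kappa>)"
      by (simp add: p_def power_divide left_diff_distrib diff_divide_distrib mult.assoc)
    then have "\<bar>poly p s - (\<zeta> - s) powr (- \<kappa>)\<bar> = \<bar>(1 + e) ^ K * (1 + e') - 1\<bar> * (\<zeta> - s) powr (- \<kappa>)"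
      by (simp add: abs_mult)
    also have "\<dots> \<le> (2 ^ Suc K * \<epsilon>) * (\<zeta> - s) powr (- \<kappa>)"
      using prod_one_plus_bound[OF e e' \<epsilon>(2), of K] by (intro mult_right_mono) auto
    also have "\<dots> \<le> (2 powr (\<kappa> + 2) * exp (- (real n * t / (\<kappa> + 1)))) * (\<zeta> - s) powr (- \<kappa>)"
    proof (intro mult_right_mono)
      have "2 ^ Suc K * \<epsilon> \<le> 2 ^ Suc K * (2 * exp (- (real n * t / (\<kappa> + 1))))" by (intro mult_left_mono eb) auto
      also have "2 ^ Suc K * (2 * exp (- (real n * t / (\<kappa> + 1)))) = 2 powr (real K + 2) * exp (- (real n * t / (\<kappa> + 1)))"
        by (simp add: powr_add powr_realpow)
      also have "\<dots> \<le> 2 powr (\<kappa> + 2) * exp (- (real n * t / (\<kappa> + 1)))" using K by (intro mult_right_mono) auto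
      finally show "2 ^ Suc K * \<epsilon> \<le> 2 powr (\<kappa> + 2) * exp (- (real n * t / (\<kappa> + 1)))" .
    qed auto
    finally show ?thesis .
  qed
  then show ?thesis using deg unfolding \<zeta>_def by blast
qed

section \<open>Bounds for \<open>L\<^sub>p\<close> norms\<close>

text \<open>Convexity: the graph of v^p lies above its tangent at c. It is Young's inequality for v
  / c and 1.\<close>

lemma powr_tangent:
  assumes "1 \<le> p" "0 < c" "0 \<le> (v::real)"
  shows "p * c powr (p - 1) * v \<le> v powr p + (p - 1) * c powr p"
proof (cases "p = 1")
  case True
  then show ?thesis using assms by simp
next
  case False
  define q where "q = p / (p - 1)"
  have p: "p > 1" using False assms by simp
  have q: "q > 1" "1 / p + 1 / q = 1" using p by (auto simp: q_def field_simps)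
  have "v / c * 1 \<le> (v / c) powr p / p + 1 powr q / q"
    using p q assms by (intro Youngs_inequality) auto
  then have "p * (v / c) \<le> (v / c) powr p + p / q" using p by (simp add: field_simps)
  also have "p / q = p - 1" using p by (simp add: q_def)
  finally have "c powr p * (p * (v / c)) \<le> c powr p * ((v / c) powr p + (p - 1))"
    by (intro mult_left_mono) auto
  moreover have "c powr p * (v / c) powr p = v powr p" using assms by (simp add: powr_divide)
  moreover have "c powr p * (p * (v / c)) = p * c powr (p - 1) * v" using assms by (simp add: powr_diff)
  ultimately show ?thesis by (simp add: algebra_simps)
qed

lemma jensen_nn:
  assumes p: "1 \<le> p" and A: "0 < A" and [measurable]: "k \<in> borel_measurable N" "v \<in> borel_measurable N"
    and k0: "\<And>y. y \<in> space N \<Longrightarrow> 0 \<le> k y" and v0: "\<And>y. y \<in> space N \<Longrightarrow> 0 \<le> v y" and kA: "(\<integral>\<^sup>+y. ennreal (k y) \<partial>N) \<le> ennreal A"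
    and T: "0 \<le> T" "ennreal T \<le> (\<integral>\<^sup>+y. ennreal (k y * v y) \<partial>N)"
  shows "ennreal (T powr p) \<le> ennreal (A powr (p - 1)) * (\<integral>\<^sup>+y. ennreal (k y * v y powr p) \<partial>N)"
proof (cases "T = 0")
  case True
  then show ?thesis using p by simp
next
  case False
  then have T0: "0 < T" using T by simp
  define J where "J = (\<integral>\<^sup>+y. ennreal (k y * v y powr p) \<partial>N)"
  define c where "c = T / A"
  have c: "0 < c" using T0 A by (simp add: c_def)
  show ?thesis
  proof (cases "J = \<infinity>")
    case True
    then show ?thesis using A by (simp add: J_def[symmetric] ennreal_mult_top)
  next
    case False
    then obtain j where j: "J = ennreal j" "0 \<le> j" by (cases J) auto
    have "ennreal (p * c powr (p - 1)) * ennreal T \<le> ennreal (p * c powr (p - 1)) * (\<integral>\<^sup>+y. ennreal (k y * v y) \<partial>N)"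
      by (intro mult_left_mono T) auto
    also have "\<dots> = (\<integral>\<^sup>+y. ennreal (p * c powr (p - 1)) * ennreal (k y * v y) \<partial>N)"
      by (rule nn_integral_cmult[symmetric]) measurable
    also have "\<dots> \<le> (\<integral>\<^sup>+y. ennreal (k y * v y powr p) + ennreal ((p - 1) * c powr p) * ennreal (k y) \<partial>N)"
    proof (rule nn_integral_mono)
      fix y assume y: "y \<in> space N"
      have "k y * (p * c powr (p - 1) * v y) \<le> k y * (v y powr p + (p - 1) * c powr p)"
        by (intro mult_left_mono powr_tangent p c v0[OF y] k0[OF y])
      then have "ennreal (p * c powr (p - 1) * (k y * v y)) \<le> ennreal (k y * v y powr p + (p - 1) * c powr p * k y)"
        by (intro ennreal_leI) (simp add: algebra_simps)
      then show "ennreal (p * c powr (p - 1)) * ennreal (k y * v y) \<le> ennreal (k y * v y powr p) + ennreal ((p - 1) * c powr p) * ennreal (k y)"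
        using p k0[OF y] v0[OF y] by (simp add: ennreal_mult[symmetric] ennreal_plus[symmetric] del: ennreal_plus)
    qed
    also have "\<dots> = J + ennreal ((p - 1) * c powr p) * (\<integral>\<^sup>+y. ennreal (k y) \<partial>N)"
      unfolding J_def by (subst nn_integral_add) (auto simp: nn_integral_cmult)
    also have "\<dots> \<le> ennreal j + ennreal ((p - 1) * c powr p) * ennreal A"
      unfolding j(1) by (intro add_left_mono mult_left_mono kA) auto
    also have "\<dots> = ennreal (j + (p - 1) * c powr p * A)"
      using p A j(2) by (simp add: ennreal_mult[symmetric] ennreal_plus[symmetric] del: ennreal_plus)
    finally have "ennreal (p * c powr (p - 1) * T) \<le> ennreal (j + (p - 1) * c powr p * A)"
      using p T0 by (simp add: ennreal_mult)
    moreover have "0 \<le> j + (p - 1) * c powr p * A" using p A j(2) by simp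
    ultimately have "p * c powr (p - 1) * T \<le> j + (p - 1) * c powr p * A"
      by (subst (asm) ennreal_le_iff)
    moreover have "c powr (p - 1) * T = c powr p * A" using c A T0 by (simp add: powr_diff c_def)
    moreover have "p * c powr (p - 1) * T = p * (c powr (p - 1) * T)" by simp
    moreover have "(p - 1) * c powr p * A = p * (c powr p * A) - c powr p * A" by (simp add: algebra_simps)
    ultimately have "c powr p * A \<le> j" by simp
    then have "A powr (p - 1) * (c powr p * A) \<le> A powr (p - 1) * j" by (intro mult_left_mono) auto
    moreover have "A powr (p - 1) * (c powr p * A) = T powr p"
      using A T0 by (simp add: c_def powr_divide powr_diff)
    ultimately show ?thesis using A j(2) by (simp add: J_def[symmetric] j(1) ennreal_mult[symmetric] ennreal_leI)
  qed
qed

text \<open>\<open>lpb M X p f c\<close> means that the \<open>L\<^sub>p\<close> norm of \<open>f\<close> is at most \<open>c\<close>; for \<open>p = \<infinity>\<close> the bound is required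
  at every point of \<open>X\<close>, not almost everywhere.\<close>

definition lpb :: "'a measure \<Rightarrow> 'a set \<Rightarrow> ennreal \<Rightarrow> ('a \<Rightarrow> real) \<Rightarrow> real \<Rightarrow> bool" where
  "lpb M X p f c \<longleftrightarrow> 0 \<le> c \<and> f \<in> borel_measurable M \<and>
     (if p = \<infinity> then \<forall>x\<in>X. \<bar>f x\<bar> \<le> c
      else (\<integral>\<^sup>+x. ennreal (\<bar>f x\<bar> powr enn2real p) \<partial>M) \<le> ennreal (c powr enn2real p))"

lemma enn2real_ge_1: "1 \<le> p \<Longrightarrow> p \<noteq> \<infinity> \<Longrightarrow> 1 \<le> enn2real p"
  using enn2real_mono[of 1 p] by (simp add: less_top)

lemma lpb_nonneg: "lpb M X p f c \<Longrightarrow> 0 \<le> c" by (simp add: lpb_def)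

lemma lpb_mono: "lpb M X p f c \<Longrightarrow> c \<le> c' \<Longrightarrow> lpb M X p f c'"
  unfolding lpb_def
  by (auto intro: order_trans ennreal_leI powr_mono2 enn2real_nonneg split: if_splits) 
    (meson ennreal_leI enn2real_nonneg order_trans powr_mono2)

lemma lpb_cong:
  assumes "lpb M X p f c" "\<And>x. x \<in> X \<Longrightarrow> \<bar>g x\<bar> = \<bar>f x\<bar>" "g \<in> borel_measurable M" "space M \<subseteq> X"
  shows "lpb M X p g c"
proof -
  have "(\<integral>\<^sup>+x. ennreal (\<bar>g x\<bar> powr enn2real p) \<partial>M) = (\<integral>\<^sup>+x. ennreal (\<bar>f x\<bar> powr enn2real p) \<partial>M)"
    using assms by (intro nn_integral_cong) auto
  then show ?thesis using assms by (auto simp: lpb_def)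
qed

text \<open>A crude substitute for Minkowski's inequality: |f + g| is at most twice the larger of
  the two, and the two factors 2^r are collected into 4^r.\<close>

lemma lpb_add:
  assumes p: "1 \<le> p" and f: "lpb M X p f a" and g: "lpb M X p g b"
  shows "lpb M X p (\<lambda>x. f x + g x) (4 * (a + b))"
proof -
  have ab: "0 \<le> a" "0 \<le> b" using f g by (auto simp: lpb_def)
  have [measurable]: "f \<in> borel_measurable M" "g \<in> borel_measurable M" using f g by (auto simp: lpb_def)
  show ?thesis
  proof (cases "p = \<infinity>")
    case True
    have "\<bar>f x + g x\<bar> \<le> 4 * (a + b)" if "x \<in> X" for x
    proof -
      have "\<bar>f x\<bar> \<le> a" "\<bar>g x\<bar> \<le> b" using f g True that by (auto simp: lpb_def)
      then show ?thesis using ab abs_triangle_ineq[of "f x" "g x"] unfolding distrib_left by linarith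
    qed
    then show ?thesis using True ab by (simp add: lpb_def)
  next
    case False
    define r where "r = enn2real p"
    have r: "1 \<le> r" using enn2real_ge_1[OF p False] by (simp add: r_def)
    have pt: "\<bar>f x + g x\<bar> powr r \<le> 2 powr r * (\<bar>f x\<bar> powr r + \<bar>g x\<bar> powr r)" for x
    proof -
      define m where "m = max \<bar>f x\<bar> \<bar>g x\<bar>"
      have "\<bar>f x + g x\<bar> powr r \<le> (2 * m) powr r" using r by (intro powr_mono2) (auto simp: m_def)
      also have "\<dots> = 2 powr r * m powr r" by (simp add: powr_mult m_def)
      also have "m powr r \<le> \<bar>f x\<bar> powr r + \<bar>g x\<bar> powr r" by (auto simp: m_def max_def)
      finally show ?thesis by simp
    qed
    have "(\<integral>\<^sup>+x. ennreal (\<bar>f x + g x\<bar> powr r) \<partial>M) \<le> (\<integral>\<^sup>+x. ennreal (2 powr r) * (ennreal (\<bar>f x\<bar> powr r) + ennreal (\<bar>g x\<bar> powr r)) \<partial>M)"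
      by (intro nn_integral_mono) (use pt in \<open>simp add: ennreal_mult[symmetric] ennreal_plus[symmetric] ennreal_leI del: ennreal_plus\<close>)
    also have "\<dots> = ennreal (2 powr r) * ((\<integral>\<^sup>+x. ennreal (\<bar>f x\<bar> powr r) \<partial>M) + (\<integral>\<^sup>+x. ennreal (\<bar>g x\<bar> powr r) \<partial>M))"
      by (simp add: nn_integral_cmult nn_integral_add)
    also have "\<dots> \<le> ennreal (2 powr r) * (ennreal (a powr r) + ennreal (b powr r))"
      using f g False by (intro mult_left_mono add_mono) (auto simp: lpb_def r_def)
    also have "\<dots> = ennreal (2 powr r * (a powr r + b powr r))"
      by (simp add: ennreal_mult[symmetric] ennreal_plus[symmetric] del: ennreal_plus)
    also have "\<dots> \<le> ennreal ((4 * (a + b)) powr r)"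
    proof (rule ennreal_leI)
      have "a powr r + b powr r \<le> 2 * (a + b) powr r"
        using powr_mono2[of r a "a + b"] powr_mono2[of r b "a + b"] r ab by simp
      also have "\<dots> \<le> 2 powr r * (a + b) powr r"
        using powr_mono[of 1 r "2::real"] r by (intro mult_right_mono) auto
      finally have "2 powr r * (a powr r + b powr r) \<le> 2 powr r * (2 powr r * (a + b) powr r)" by (intro mult_left_mono) auto
      also have "\<dots> = (4 * (a + b)) powr r"
        using ab powr_mult[of 2 2 r] by (simp add: powr_mult mult.assoc[symmetric] del: distrib_left_numeral)
      finally show "2 powr r * (a powr r + b powr r) \<le> (4 * (a + b)) powr r" .
    qed
    finally show ?thesis using False ab by (simp add: lpb_def r_def)
  qed
qed

lemma lpb_uminus: "lpb M X p f c \<Longrightarrow> lpb M X p (\<lambda>x. - f x) c"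
  by (simp add: lpb_def)

lemma lpb_diff:
  assumes "1 \<le> p" "lpb M X p f a" "lpb M X p g b"
  shows "lpb M X p (\<lambda>x. f x - g x) (4 * (a + b))"
  using lpb_add[OF assms(1,2) lpb_uminus[OF assms(3)]] by simp

text \<open>Minkowski's integral inequality with a weight; it is Jensen's inequality for the weight \<open>\<beta>\<close>.\<close>

lemma lpb_minkowski:
  assumes M: "sigma_finite_measure M" and N: "sigma_finite_measure N" and p: "1 \<le> p" and X: "space M \<subseteq> X"
    and \<beta>: "\<beta> \<in> borel_measurable N" "\<And>v. v \<in> space N \<Longrightarrow> 0 \<le> \<beta> v" "(\<integral>\<^sup>+v. ennreal (\<beta> v) \<partial>N) \<le> ennreal B" "0 < B"
    and H: "case_prod H \<in> borel_measurable (M \<Otimes>\<^sub>M N)" and Hb: "\<And>v. v \<in> space N \<Longrightarrow> lpb M X p (\<lambda>x. H x v) c"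
    and Hx: "\<And>x. x \<in> X \<Longrightarrow> H x \<in> borel_measurable N"
    and F: "F \<in> borel_measurable M" "\<And>x. x \<in> X \<Longrightarrow> ennreal \<bar>F x\<bar> \<le> (\<integral>\<^sup>+v. ennreal (\<beta> v * \<bar>H x v\<bar>) \<partial>N)"
    and c: "0 \<le> c"
  shows "lpb M X p F (B * c)"
proof (cases "p = \<infinity>")
  case True
  have "\<bar>F x\<bar> \<le> B * c" if x: "x \<in> X" for x
  proof -
    have "ennreal \<bar>F x\<bar> \<le> (\<integral>\<^sup>+v. ennreal (\<beta> v * \<bar>H x v\<bar>) \<partial>N)" by (rule F(2)[OF x])
    also have "\<dots> \<le> (\<integral>\<^sup>+v. ennreal (\<beta> v) * ennreal c \<partial>N)"
      using Hb x True \<beta>(2) c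
      by (intro nn_integral_mono) (auto simp: lpb_def ennreal_mult[symmetric] intro!: ennreal_leI mult_left_mono)
    also have "\<dots> = (\<integral>\<^sup>+v. ennreal (\<beta> v) \<partial>N) * ennreal c" using \<beta>(1) by (intro nn_integral_multc) measurable
    also have "\<dots> \<le> ennreal B * ennreal c" by (intro mult_right_mono \<beta>(3)) auto
    also have "\<dots> = ennreal (B * c)" using \<beta>(4) c by (simp add: ennreal_mult)
    finally show ?thesis using \<beta>(4) c by (simp add: ennreal_le_iff)
  qed
  then show ?thesis using True F(1) \<beta>(4) c by (simp add: lpb_def)
next
  case False
  interpret M: sigma_finite_measure M by fact
  interpret N: sigma_finite_measure N by fact
  interpret MN: pair_sigma_finite M N ..
  define r where "r = enn2real p"
  have r: "1 \<le> r" using enn2real_ge_1[OF p False] by (simp add: r_def)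
  note [measurable] = \<beta>(1) H F(1)
  have "(\<integral>\<^sup>+x. ennreal (\<bar>F x\<bar> powr r) \<partial>M) \<le> (\<integral>\<^sup>+x. ennreal (B powr (r - 1)) * (\<integral>\<^sup>+v. ennreal (\<beta> v * \<bar>H x v\<bar> powr r) \<partial>N) \<partial>M)"
  proof (rule nn_integral_mono)
    fix x assume "x \<in> space M"
    then have x: "x \<in> X" using X by auto
    note [measurable] = Hx[OF x]
    show "ennreal (\<bar>F x\<bar> powr r) \<le> ennreal (B powr (r - 1)) * (\<integral>\<^sup>+v. ennreal (\<beta> v * \<bar>H x v\<bar> powr r) \<partial>N)"
      by (rule jensen_nn[OF r \<beta>(4)]) (use \<beta> F(2)[OF x] in \<open>auto intro: borel_measurable_abs Hx[OF x]\<close>)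
  qed
  also have "\<dots> = ennreal (B powr (r - 1)) * (\<integral>\<^sup>+x. (\<integral>\<^sup>+v. ennreal (\<beta> v * \<bar>H x v\<bar> powr r) \<partial>N) \<partial>M)"
    by (rule nn_integral_cmult) measurable
  also have "(\<integral>\<^sup>+x. (\<integral>\<^sup>+v. ennreal (\<beta> v * \<bar>H x v\<bar> powr r) \<partial>N) \<partial>M) = (\<integral>\<^sup>+v. (\<integral>\<^sup>+x. ennreal (\<beta> v * \<bar>H x v\<bar> powr r) \<partial>M) \<partial>N)"
    by (rule MN.Fubini'[symmetric]) measurable
  also have "\<dots> \<le> (\<integral>\<^sup>+v. ennreal (\<beta> v) * ennreal (c powr r) \<partial>N)"
  proof (rule nn_integral_mono)
    fix v assume v: "v \<in> space N"
    have [measurable]: "(\<lambda>x. H x v) \<in> borel_measurable M" using Hb[OF v] by (simp add: lpb_def)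
    have "(\<integral>\<^sup>+x. ennreal (\<beta> v * \<bar>H x v\<bar> powr r) \<partial>M) = (\<integral>\<^sup>+x. ennreal (\<beta> v) * ennreal (\<bar>H x v\<bar> powr r) \<partial>M)"
      using \<beta>(2)[OF v] by (simp add: ennreal_mult)
    also have "\<dots> = ennreal (\<beta> v) * (\<integral>\<^sup>+x. ennreal (\<bar>H x v\<bar> powr r) \<partial>M)" by (rule nn_integral_cmult) measurable
    also have "\<dots> \<le> ennreal (\<beta> v) * ennreal (c powr r)"
      using Hb[OF v] False by (intro mult_left_mono) (auto simp: lpb_def r_def)
    finally show "(\<integral>\<^sup>+x. ennreal (\<beta> v * \<bar>H x v\<bar> powr r) \<partial>M) \<le> ennreal (\<beta> v) * ennreal (c powr r)" .
  qed
  also have "\<dots> = (\<integral>\<^sup>+v. ennreal (\<beta> v) \<partial>N) * ennreal (c powr r)" by (rule nn_integral_multc) measurable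
  also have "\<dots> \<le> ennreal B * ennreal (c powr r)" by (intro mult_right_mono \<beta>(3)) auto
  finally have "(\<integral>\<^sup>+x. ennreal (\<bar>F x\<bar> powr r) \<partial>M) \<le> ennreal (B powr (r - 1)) * (ennreal B * ennreal (c powr r))"
    by (simp add: mult_left_mono)
  also have "\<dots> = ennreal (B powr (r - 1) * (B * c powr r))" using \<beta>(4) by (simp add: ennreal_mult)
  also have "B powr (r - 1) * (B * c powr r) = (B * c) powr r" using \<beta>(4) c by (simp add: powr_diff powr_mult)
  finally show ?thesis using False F(1) \<beta>(4) c by (simp add: lpb_def r_def)
qed

text \<open>Minkowski's integral inequality for the counting measure with weights
  \<open>\<beta> j\<close>, applied to \<open>R j / \<beta> j\<close>, all of which have the same
  bound c.\<close>

lemma lpb_sums: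
  assumes M: "sigma_finite_measure M" and p: "1 \<le> p" and X: "space M \<subseteq> X"
    and \<beta>: "\<And>j. 0 < \<beta> j" "summable \<beta>" "suminf \<beta> \<le> B" and c: "0 \<le> c"
    and R: "\<And>j. lpb M X p (R j) (c * \<beta> j)"
    and F: "F \<in> borel_measurable M" "\<And>x. x \<in> X \<Longrightarrow> (\<lambda>j. R j x) sums F x"
  shows "lpb M X p F (B * c)"
proof (rule lpb_minkowski[OF M sigma_finite_measure_count_space p X, where \<beta> = \<beta> and H = "\<lambda>x j. R j x / \<beta> j"])
  have "suminf \<beta> \<ge> 0" "suminf \<beta> > 0" using \<beta> by (auto intro: suminf_nonneg suminf_pos less_imp_le)
  then show "0 < B" using \<beta>(3) by simp
  have "(\<integral>\<^sup>+j. ennreal (\<beta> j) \<partial>count_space UNIV) = (\<Sum>j. ennreal (\<beta> j))" by (rule nn_integral_count_space_nat)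
  also have "\<dots> = ennreal (suminf \<beta>)" using \<beta> by (intro suminf_ennreal2) (auto intro: less_imp_le)
  finally show "(\<integral>\<^sup>+j. ennreal (\<beta> j) \<partial>count_space UNIV) \<le> ennreal B" using \<beta>(3) by (simp add: ennreal_leI)
  have Rm [measurable]: "R j \<in> borel_measurable M" for j using R by (simp add: lpb_def)
  show "(\<lambda>(x, j). R j x / \<beta> j) \<in> borel_measurable (M \<Otimes>\<^sub>M count_space UNIV)"
    unfolding case_prod_beta
    by (rule measurable_compose_countable[where f = "\<lambda>j z. R j (fst z) / \<beta> j" and g = snd]) measurable
  show "lpb M X p (\<lambda>x. R j x / \<beta> j) c" for j
  proof (cases "p = \<infinity>")
    case True
    then show ?thesis using R[of j] \<beta>(1)[of j] c by (auto simp: lpb_def divide_le_eq)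
  next
    case False
    define r where "r = enn2real p"
    have r: "1 \<le> r" using enn2real_ge_1[OF p False] by (simp add: r_def)
    have "(\<integral>\<^sup>+x. ennreal (\<bar>R j x / \<beta> j\<bar> powr r) \<partial>M) = (\<integral>\<^sup>+x. ennreal (\<beta> j powr (- r)) * ennreal (\<bar>R j x\<bar> powr r) \<partial>M)"
      using \<beta>(1)[of j] by (intro nn_integral_cong) (simp add: ennreal_mult[symmetric] powr_divide powr_minus_divide)
    also have "\<dots> = ennreal (\<beta> j powr (- r)) * (\<integral>\<^sup>+x. ennreal (\<bar>R j x\<bar> powr r) \<partial>M)" by (rule nn_integral_cmult) measurable
    also have "\<dots> \<le> ennreal (\<beta> j powr (- r)) * ennreal ((c * \<beta> j) powr r)"
      using R[of j] False by (intro mult_left_mono) (auto simp: lpb_def r_def)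
    also have "\<dots> = ennreal (c powr r)"
    proof -
      have "\<beta> j powr (- r) * (c * \<beta> j) powr r = c powr r" using \<beta>(1)[of j] c by (simp add: powr_mult powr_minus_divide)
      then show ?thesis by (simp add: ennreal_mult[symmetric])
    qed
    finally show ?thesis using False c by (simp add: lpb_def r_def)
  qed
  show "ennreal \<bar>F x\<bar> \<le> (\<integral>\<^sup>+j. ennreal (\<beta> j * \<bar>R j x / \<beta> j\<bar>) \<partial>count_space UNIV)" if x: "x \<in> X" for x
  proof -
    have "(\<integral>\<^sup>+j. ennreal (\<beta> j * \<bar>R j x / \<beta> j\<bar>) \<partial>count_space UNIV) = (\<Sum>j. ennreal \<bar>R j x\<bar>)"
      unfolding nn_integral_count_space_nat using \<beta>(1) by (intro suminf_cong) (simp add: less_imp_le abs_of_pos less_imp_neq[OF \<beta>(1), symmetric])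
    moreover have "ennreal \<bar>F x\<bar> \<le> (\<Sum>j. ennreal \<bar>R j x\<bar>)"
    proof (cases "summable (\<lambda>j. \<bar>R j x\<bar>)")
      case True
      have "\<bar>F x\<bar> \<le> (\<Sum>j. \<bar>R j x\<bar>)" using F(2)[OF x] summable_rabs[OF True] by (simp add: sums_iff)
      then have "ennreal \<bar>F x\<bar> \<le> ennreal (\<Sum>j. \<bar>R j x\<bar>)" by (rule ennreal_leI)
      also have "\<dots> = (\<Sum>j. ennreal \<bar>R j x\<bar>)" by (rule suminf_ennreal2[symmetric]) (use True in auto)
      finally show ?thesis .
    next
      case False
      have "(\<Sum>j. ennreal \<bar>R j x\<bar>) = \<top>"
        using summable_suminf_not_top[of "\<lambda>j. \<bar>R j x\<bar>"] False abs_ge_zero by blast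
      then show ?thesis by simp
    qed
    ultimately show ?thesis by simp
  qed
qed (use \<beta> c F in \<open>auto intro: less_imp_le\<close>)

text \<open>Schur's test: Jensen for the weight \<open>k x\<close> uses one marginal bound, and
  after Fubini the other marginal bound remains. The two measures are independent of each other, so
  that one of them can be the quadrature rule.\<close>

lemma lpb_schur:
  assumes M: "sigma_finite_measure M" and N: "sigma_finite_measure N" and p: "1 \<le> p" and X: "space M \<subseteq> X" and Y: "space N \<subseteq> Y"
    and k: "case_prod k \<in> borel_measurable (M \<Otimes>\<^sub>M N)" "\<And>x. x \<in> X \<Longrightarrow> k x \<in> borel_measurable N"
      "\<And>y. y \<in> Y \<Longrightarrow> (\<lambda>x. k x y) \<in> borel_measurable M"
      "\<And>x y. x \<in> X \<Longrightarrow> y \<in> Y \<Longrightarrow> 0 \<le> k x y"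
    and kN: "\<And>x. x \<in> X \<Longrightarrow> (\<integral>\<^sup>+y. ennreal (k x y) \<partial>N) \<le> ennreal A"
    and kM: "\<And>y. y \<in> Y \<Longrightarrow> (\<integral>\<^sup>+x. ennreal (k x y) \<partial>M) \<le> ennreal A" and A: "0 < A"
    and f: "lpb N Y p f c"
    and F: "F \<in> borel_measurable M" "\<And>x. x \<in> X \<Longrightarrow> ennreal \<bar>F x\<bar> \<le> (\<integral>\<^sup>+y. ennreal (k x y * \<bar>f y\<bar>) \<partial>N)"
  shows "lpb M X p F (A * c)"
proof -
  have c: "0 \<le> c" and [measurable]: "f \<in> borel_measurable N" using f by (auto simp: lpb_def)
  show ?thesis
  proof (cases "p = \<infinity>")
    case True
    have "\<bar>F x\<bar> \<le> A * c" if x: "x \<in> X" for x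
    proof -
      note [measurable] = k(2)[OF x]
      have "ennreal \<bar>F x\<bar> \<le> (\<integral>\<^sup>+y. ennreal (k x y * \<bar>f y\<bar>) \<partial>N)" by (rule F(2)[OF x])
      also have "\<dots> \<le> (\<integral>\<^sup>+y. ennreal (k x y) * ennreal c \<partial>N)"
      proof (rule nn_integral_mono)
        fix y assume "y \<in> space N"
        then have y: "y \<in> Y" using Y by auto
        then have "k x y * \<bar>f y\<bar> \<le> k x y * c" using f True k(4)[OF x y] by (intro mult_left_mono) (auto simp: lpb_def)
        then show "ennreal (k x y * \<bar>f y\<bar>) \<le> ennreal (k x y) * ennreal c"
          using k(4)[OF x y] c by (simp add: ennreal_mult[symmetric] ennreal_leI)
      qed
      also have "\<dots> = (\<integral>\<^sup>+y. ennreal (k x y) \<partial>N) * ennreal c" by (intro nn_integral_multc) measurable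
      also have "\<dots> \<le> ennreal A * ennreal c" by (intro mult_right_mono kN x) auto
      also have "\<dots> = ennreal (A * c)" using A c by (simp add: ennreal_mult)
      finally show ?thesis using A c by (simp add: ennreal_le_iff)
    qed
    then show ?thesis using True F(1) A c by (simp add: lpb_def)
  next
    case False
    interpret M: sigma_finite_measure M by fact
    interpret N: sigma_finite_measure N by fact
    interpret MN: pair_sigma_finite M N ..
    define r where "r = enn2real p"
    have r: "1 \<le> r" using enn2real_ge_1[OF p False] by (simp add: r_def)
    note [measurable] = k(1) F(1)
    have "(\<integral>\<^sup>+x. ennreal (\<bar>F x\<bar> powr r) \<partial>M) \<le> (\<integral>\<^sup>+x. ennreal (A powr (r - 1)) * (\<integral>\<^sup>+y. ennreal (k x y * \<bar>f y\<bar> powr r) \<partial>N) \<partial>M)"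
    proof (rule nn_integral_mono)
      fix x assume "x \<in> space M"
      then have x: "x \<in> X" using X by auto
      show "ennreal (\<bar>F x\<bar> powr r) \<le> ennreal (A powr (r - 1)) * (\<integral>\<^sup>+y. ennreal (k x y * \<bar>f y\<bar> powr r) \<partial>N)"
        by (rule jensen_nn[OF r A k(2)[OF x]]) (use k(4)[OF x] Y kN[OF x] F(2)[OF x] in auto)
    qed
    also have "\<dots> = ennreal (A powr (r - 1)) * (\<integral>\<^sup>+x. (\<integral>\<^sup>+y. ennreal (k x y * \<bar>f y\<bar> powr r) \<partial>N) \<partial>M)"
      by (rule nn_integral_cmult) measurable
    also have "(\<integral>\<^sup>+x. (\<integral>\<^sup>+y. ennreal (k x y * \<bar>f y\<bar> powr r) \<partial>N) \<partial>M) = (\<integral>\<^sup>+y. (\<integral>\<^sup>+x. ennreal (k x y * \<bar>f y\<bar> powr r) \<partial>M) \<partial>N)"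
      by (rule MN.Fubini'[symmetric]) measurable
    also have "\<dots> \<le> (\<integral>\<^sup>+y. ennreal A * ennreal (\<bar>f y\<bar> powr r) \<partial>N)"
    proof (rule nn_integral_mono)
      fix y assume "y \<in> space N"
      then have y: "y \<in> Y" using Y by auto
      note [measurable] = k(3)[OF y]
      have "(\<integral>\<^sup>+x. ennreal (k x y * \<bar>f y\<bar> powr r) \<partial>M) = (\<integral>\<^sup>+x. ennreal (k x y) * ennreal (\<bar>f y\<bar> powr r) \<partial>M)"
        using k(4) X y by (intro nn_integral_cong) (auto simp: ennreal_mult)
      also have "\<dots> = (\<integral>\<^sup>+x. ennreal (k x y) \<partial>M) * ennreal (\<bar>f y\<bar> powr r)" by (rule nn_integral_multc) measurable
      also have "\<dots> \<le> ennreal A * ennreal (\<bar>f y\<bar> powr r)" by (intro mult_right_mono kM y) auto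
      finally show "(\<integral>\<^sup>+x. ennreal (k x y * \<bar>f y\<bar> powr r) \<partial>M) \<le> ennreal A * ennreal (\<bar>f y\<bar> powr r)" .
    qed
    also have "\<dots> = ennreal A * (\<integral>\<^sup>+y. ennreal (\<bar>f y\<bar> powr r) \<partial>N)" by (rule nn_integral_cmult) measurable
    also have "\<dots> \<le> ennreal A * ennreal (c powr r)" using f False by (intro mult_left_mono) (auto simp: lpb_def r_def)
    finally have "(\<integral>\<^sup>+x. ennreal (\<bar>F x\<bar> powr r) \<partial>M) \<le> ennreal (A powr (r - 1)) * (ennreal A * ennreal (c powr r))"
      by (simp add: mult_left_mono)
    also have "\<dots> = ennreal (A powr (r - 1) * (A * c powr r))" using A by (simp add: ennreal_mult)
    also have "A powr (r - 1) * (A * c powr r) = (A * c) powr r" using A c by (simp add: powr_diff powr_mult)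
    finally show ?thesis using False F(1) A c by (simp add: lpb_def r_def)
  qed
qed

section \<open>Localised polynomial kernels\<close>

context ball_setting
begin

definition kpol :: "real poly \<Rightarrow> real ^ 'n \<Rightarrow> real ^ 'n \<Rightarrow> real" where
  "kpol g x y = (\<Sum>n\<le>degree g. coeff g n * kmon n x y)"

definition eigp :: "real poly \<Rightarrow> nat \<Rightarrow> real" where
  "eigp g m = (\<Sum>n\<le>degree g. coeff g n * eig n m)"

lemma kav_poly:
  assumes xy: "x \<in> cball 0 1" "y \<in> cball 0 1"
  shows "kav (poly g) x y = kpol g x y"
proof -
  have "kav (poly g) x y = (\<integral>t. (\<Sum>n\<le>degree g. coeff g n * (x \<bullet> y + t * \<delta> x * \<delta> y) ^ n) \<partial>N)"
    by (simp add: kav_def poly_altdef)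
  also have "\<dots> = (\<Sum>n\<le>degree g. coeff g n * (\<integral>t. (x \<bullet> y + t * \<delta> x * \<delta> y) ^ n \<partial>N))"
    by (subst Bochner_Integration.integral_sum) (auto intro!: integrable_N_continuous continuous_intros)
  also have "\<dots> = kpol g x y" using kav_power[OF xy] by (simp add: kav_def kpol_def)
  finally show ?thesis .
qed

lemma kpol_poly_space: "degree g \<le> n \<Longrightarrow> kpol g x \<in> poly_space n"
  unfolding kpol_def by (intro poly_space_sum poly_space_cmult poly_space_mono[OF _ kmon_poly]) auto

lemma kpol_commute: "kpol g x y = kpol g y x"
  by (simp add: kpol_def kmon_commute[of _ x])

text \<open>On the sphere the coefficient of t in the average vanishes. At such a z the kernel is a
  function of \<open>z \<bullet> y\<close> alone, which links multipliers and products of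
  polynomials in one variable.\<close>

lemma kpol_boundary:
  assumes "norm z = 1" "y \<in> cball 0 1"
  shows "kpol g z y = poly g (z \<bullet> y)"
  using assms N.prob_space by (subst kav_poly[symmetric]) (auto simp: kav_def)

lemma eigp_eq: "degree g \<le> n \<Longrightarrow> eigp g m = (\<Sum>i\<le>n. coeff g i * eig i m)"
  unfolding eigp_def by (rule sum.mono_neutral_left) (auto simp: coeff_eq_0)

lemma eigp_add: "eigp (g + h) m = eigp g m + eigp h m"
proof -
  let ?n = "max (degree g) (degree h)"
  have "degree (g + h) \<le> ?n" by (rule degree_add_le_max)
  then show ?thesis by (simp add: eigp_eq[of _ ?n] distrib_right sum.distrib)
qed

lemma eigp_monom: "eigp (monom a n) m = a * eig n m"
proof -
  have "eigp (monom a n) m = (\<Sum>i\<le>n. if i = n then a * eig n m else 0)"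
    unfolding eigp_eq[OF degree_monom_le] by (rule sum.cong) auto
  then show ?thesis by simp
qed

lemma integrable_kpol_mult: "Q \<in> poly_space m \<Longrightarrow> integrable M (\<lambda>y. kpol g x y * Q y)"
  by (rule integrable_poly[OF poly_space_mult[OF kpol_poly_space[OF order_refl]]])

lemma kpol_eigen:
  assumes Q: "Q \<in> orth_poly_space \<mu> m" and x: "x \<in> cball 0 1"
  shows "(\<integral>y. kpol g x y * Q y \<partial>M) = eigp g m * Q x"
proof -
  have Qp: "Q \<in> poly_space m" using Q by (simp add: orth_poly_space_def)
  have "(\<integral>y. kpol g x y * Q y \<partial>M) = (\<integral>y. (\<Sum>n\<le>degree g. coeff g n * (kmon n x y * Q y)) \<partial>M)"
    by (simp add: kpol_def sum_distrib_right mult.assoc)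
  also have "\<dots> = (\<Sum>n\<le>degree g. coeff g n * kop n Q x)"
    unfolding kop_def
    by (subst Bochner_Integration.integral_sum) (auto intro!: integrable_poly[OF poly_space_mult[OF kmon_poly Qp]])
  also have "\<dots> = eigp g m * Q x" using kop_eigen[OF Q x] by (simp add: eigp_def sum_distrib_right mult.assoc)
  finally show ?thesis .
qed

text \<open>The system is triangular, since \<open>eig n m\<close> vanishes for n < m, and its
  diagonal entries are positive.\<close>

lemma eigp_interpolation: "\<exists>g. degree g \<le> n \<and> (\<forall>k\<le>n. eigp g k = c k)"
proof (induction n arbitrary: c)
  case 0
  have "eigp (monom (c 0 / eig 0 0) 0) 0 = c 0" using eig_pos[of 0] unfolding eigp_monom by simp
  then show ?case by (intro exI[of _ "monom (c 0 / eig 0 0) 0"]) (use degree_monom_le[of "c 0 / eig 0 0" 0] in auto)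
next
  case (Suc n)
  define a where "a = c (Suc n) / eig (Suc n) (Suc n)"
  obtain h where h: "degree h \<le> n" "\<And>k. k \<le> n \<Longrightarrow> eigp h k = c k - a * eig (Suc n) k"
    using Suc[of "\<lambda>k. c k - a * eig (Suc n) k"] by blast
  have "eigp h (Suc n) = 0" using h(1) by (simp add: eigp_eq[OF h(1)] eig_below)
  then have "eigp (monom a (Suc n) + h) (Suc n) = c (Suc n)"
    using eig_pos[of "Suc n"] by (simp add: eigp_add eigp_monom a_def)
  moreover have "eigp (monom a (Suc n) + h) k = c k" if "k \<le> n" for k
    using h(2)[OF that] by (simp add: eigp_add eigp_monom)
  moreover have "degree (monom a (Suc n) + h) \<le> Suc n"
    using h(1) by (intro degree_add_le) (auto simp: degree_monom_le)
  ultimately show ?case by (intro exI[of _ "monom a (Suc n) + h"]) (auto simp: le_Suc_eq)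
qed

lemma flag_bas: "b \<in> flag n \<Longrightarrow> \<exists>k\<le>n. b \<in> bas k"
proof (induction n)
  case 0
  then show ?case by (auto simp: bas_def)
next
  case (Suc n)
  show ?case
  proof (cases "b \<in> flag n")
    case True
    then show ?thesis using Suc.IH by (meson le_SucI)
  next
    case False
    then have "b \<in> bas (Suc n)" using Suc.prems by (simp add: bas_def)
    then show ?thesis by blast
  qed
qed

lemma bessel:
  fixes f :: "real ^ 'n \<Rightarrow> real"
  assumes f: "f \<in> borel_measurable M" "\<And>y. y \<in> cball 0 1 \<Longrightarrow> \<bar>f y\<bar> \<le> B"
  shows "(\<Sum>b\<in>flag n. (ip f b)\<^sup>2) \<le> (\<integral>y. (f y)\<^sup>2 \<partial>M)"
proof -
  define P where "P = (\<lambda>y. \<Sum>b\<in>flag n. ip f b * b y)"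
  have bp: "b \<in> poly_space n" if "b \<in> flag n" for b using flag(2) that by blast
  have Pp: "P \<in> poly_space n" unfolding P_def by (intro poly_space_sum poly_space_cmult bp)
  have fi: "integrable M f" using f by (rule integrable_bounded)
  have f2: "integrable M (\<lambda>y. (f y)\<^sup>2)"
  proof (rule integrable_bounded)
    show "(\<lambda>y. (f y)\<^sup>2) \<in> borel_measurable M" using f(1) by (rule borel_measurable_power)
    show "\<bar>(f y)\<^sup>2\<bar> \<le> B\<^sup>2" if "y \<in> cball 0 1" for y
      using power_mono[OF f(2)[OF that], of 2] by simp
  qed
  have P2: "integrable M (\<lambda>y. (P y)\<^sup>2)" unfolding power2_eq_square by (rule integrable_poly[OF poly_space_mult[OF Pp Pp]])
  have "ip f P = (\<Sum>b\<in>flag n. (ip f b)\<^sup>2)"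
    unfolding P_def using ip_sum_right[OF fi bp] by (simp add: power2_eq_square)
  moreover have "ip P P = (\<Sum>b\<in>flag n. (ip f b)\<^sup>2)"
  proof -
    have "ip P b = ip f b" if b: "b \<in> flag n" for b
    proof -
      have "ip P b = ip b P" by (rule ip_commute)
      also have "\<dots> = (\<Sum>b'\<in>flag n. ip f b' * ip b b')" unfolding P_def by (rule ip_sum_right[OF integrable_poly[OF bp[OF b]] bp])
      also have "\<dots> = (\<Sum>b'\<in>flag n. if b' = b then ip f b' else 0)"
        using flag(1)[of n] b by (intro sum.cong) (auto simp: orthonormal_def)
      also have "\<dots> = ip f b" using b finite_flag by simp
      finally show ?thesis .
    qed
    moreover have "ip P P = (\<Sum>b\<in>flag n. ip f b * ip P b)"
      using ip_sum_right[OF integrable_poly[OF Pp] bp, where c = "ip f"] by (simp add: P_def)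
    ultimately show ?thesis by (simp add: power2_eq_square)
  qed
  moreover have "2 * ip f P \<le> (\<integral>y. (f y)\<^sup>2 \<partial>M) + ip P P"
  proof -
    have "2 * ip f P = (\<integral>y. 2 * (f y * P y) \<partial>M)" by (simp add: ip_def)
    also have "\<dots> \<le> (\<integral>y. (f y)\<^sup>2 + (P y)\<^sup>2 \<partial>M)"
    proof (rule integral_mono)
      show "integrable M (\<lambda>y. 2 * (f y * P y))" using integrable_mult_poly[OF fi Pp] by (rule integrable_mult_right)
      show "integrable M (\<lambda>y. (f y)\<^sup>2 + (P y)\<^sup>2)" using f2 P2 by (rule Bochner_Integration.integrable_add)
      show "2 * (f y * P y) \<le> (f y)\<^sup>2 + (P y)\<^sup>2" for y using sum_squares_bound[of "f y" "P y"] by simp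
    qed
    also have "\<dots> = (\<integral>y. (f y)\<^sup>2 \<partial>M) + ip P P"
      using f2 P2 by (subst Bochner_Integration.integral_add) (auto simp: ip_def power2_eq_square)
    finally show ?thesis .
  qed
  ultimately show ?thesis by simp
qed

text \<open>The effective dimension d + 2\<mu>, the exponent of n in the kernel bounds.\<close>

abbreviation D :: real where "D \<equiv> 2 * \<kappa> - 1"

lemma D_ge_1: "1 \<le> D" using kappa_ge_1 by simp

lemma kav_pois_bound:
  assumes "0 \<le> \<rho>" "\<rho> < 1" "x \<in> cball 0 1" "y \<in> cball 0 1"
  shows "\<bar>kav (pois \<rho>) x y\<bar> \<le> (1 - \<rho>\<^sup>2) * (1 - \<rho>) powr (- (2 * \<kappa>))"
  using assms by (intro kav_le pois_abs_le) auto

lemma integrable_kav_pois: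
  assumes "0 \<le> \<rho>" "\<rho> < 1" "x \<in> cball 0 1"
  shows "integrable M (kav (pois \<rho>) x)"
  by (rule integrable_bounded[OF kav_measurable_M(1)[OF pois_measurable] kav_pois_bound]) (use assms in auto)

lemma kav_pois_nonneg:
  assumes "0 \<le> \<rho>" "\<rho> < 1" "x \<in> cball 0 1" "y \<in> cball 0 1"
  shows "0 \<le> kav (pois \<rho>) x y"
  using assms by (intro kav_nonneg pois_bounds) auto

text \<open>Bessel's inequality for the Poisson kernel with \<open>1 - \<rho>\<close> comparable to \<open>1/n\<close>.\<close>

lemma christoffel:
  assumes n: "1 \<le> n" and x: "x \<in> cball 0 1"
  shows "(\<Sum>b\<in>flag n. (b x)\<^sup>2) \<le> 8 * 2 powr D * real n powr D"
proof -
  \<comment> \<open>By Bernoulli \<rho>^k is at least 1/2 for all k up to n, while the supremum of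
    the kernel, of order (1 - \<rho>)^(-D), stays of order n^D.\<close>
  define \<rho> where "\<rho> = 1 - 1 / (2 * real n)"
  have \<rho>: "0 \<le> \<rho>" "\<rho> < 1" using n by (auto simp: \<rho>_def field_simps)
  define B where "B = (1 - \<rho>\<^sup>2) * (1 - \<rho>) powr (- (2 * \<kappa>))"
  have Bb: "B \<le> 2 * (2 powr D * real n powr D)"
  proof -
    have "1 - \<rho>\<^sup>2 = (1 + \<rho>) * (1 - \<rho>)" by (simp add: power2_eq_square algebra_simps)
    also have "\<dots> \<le> 2 * (1 - \<rho>)" using \<rho> by (intro mult_right_mono) auto
    finally have "B \<le> 2 * (1 - \<rho>) * (1 - \<rho>) powr (- (2 * \<kappa>))"
      unfolding B_def by (intro mult_right_mono) auto
    also have "\<dots> = 2 * ((1 - \<rho>) powr 1 * (1 - \<rho>) powr (- (2 * \<kappa>)))" using \<rho> by simp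
    also have "\<dots> = 2 * (1 - \<rho>) powr (- D)" unfolding powr_add[symmetric] by simp
    also have "(1 - \<rho>) powr (- D) = (2 * real n) powr D"
      using n by (subst powr_minus_divide) (simp add: \<rho>_def powr_divide)
    finally show ?thesis by (simp add: powr_mult)
  qed
  have F: "kav (pois \<rho>) x \<in> borel_measurable M" "\<And>y. y \<in> cball 0 1 \<Longrightarrow> \<bar>kav (pois \<rho>) x y\<bar> \<le> B"
    using kav_measurable_M(1)[OF pois_measurable] kav_pois_bound[OF \<rho> x] by (auto simp: B_def)
  have half: "1 / 2 \<le> \<rho> ^ n"
  proof -
    have "1 + real n * (- (1 / (2 * real n))) \<le> (1 + (- (1 / (2 * real n)))) ^ n"
      using n by (intro Bernoulli_inequality) (simp add: field_simps)
    then show ?thesis using n by (simp add: \<rho>_def)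
  qed
  have "(\<Sum>b\<in>flag n. (b x)\<^sup>2) \<le> (\<Sum>b\<in>flag n. 4 * (ip (kav (pois \<rho>) x) b)\<^sup>2)"
  proof (rule sum_mono)
    fix b assume "b \<in> flag n"
    then obtain k where k: "k \<le> n" "b \<in> bas k" using flag_bas by blast
    have "ip (kav (pois \<rho>) x) b = \<rho> ^ k * b x"
      unfolding ip_def by (rule kav_pois_integral[OF \<rho> x bas_orth[OF k(2)]])
    moreover have "1 / 2 \<le> \<rho> ^ k" using half power_decreasing[OF k(1), of \<rho>] \<rho> by simp
    then have "(1 / 2)\<^sup>2 \<le> (\<rho> ^ k)\<^sup>2" by (rule power_mono) simp
    then have "(1 / 4) * (b x)\<^sup>2 \<le> (\<rho> ^ k)\<^sup>2 * (b x)\<^sup>2" by (intro mult_right_mono) (auto simp: power2_eq_square)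
    ultimately show "(b x)\<^sup>2 \<le> 4 * (ip (kav (pois \<rho>) x) b)\<^sup>2" by (simp add: power_mult_distrib)
  qed
  also have "\<dots> \<le> 4 * (\<integral>y. (kav (pois \<rho>) x y)\<^sup>2 \<partial>M)"
    using bessel[OF F] by (simp add: sum_distrib_left[symmetric])
  \<comment> \<open>The kernel is nonnegative, bounded by B and of total mass 1, so the integral of
    its square is at most B.\<close>
  also have "(\<integral>y. (kav (pois \<rho>) x y)\<^sup>2 \<partial>M) \<le> (\<integral>y. B * kav (pois \<rho>) x y \<partial>M)"
  proof (rule integral_mono_AE')
    show "integrable M (\<lambda>y. B * kav (pois \<rho>) x y)" by (intro integrable_mult_right integrable_kav_pois \<rho> x)
    show "AE y in M. (kav (pois \<rho>) x y)\<^sup>2 \<le> B * kav (pois \<rho>) x y"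
      using F(2) kav_pois_nonneg[OF \<rho> x] by (intro AE_I2) (auto simp: power2_eq_square intro!: mult_right_mono)
    show "AE y in M. 0 \<le> B * kav (pois \<rho>) x y"
      using F(2) kav_pois_nonneg[OF \<rho> x] by (intro AE_I2) (smt (verit) mult_nonneg_nonneg space_ball_measure)
  qed
  also have "(\<integral>y. B * kav (pois \<rho>) x y \<partial>M) = B" using kav_pois_mass[OF \<rho> x] by simp
  finally show ?thesis using Bb by simp
qed

text \<open>Prescribing the multiplier 1 up to degree n makes \<open>kpol d\<close> the reproducing
  kernel of the polynomials of degree n. Evaluated at a boundary point z and at s z it equals d(s),
  and Cauchy-Schwarz with the bound for the diagonal estimates it.\<close>

lemma dirichlet_kernel:
  "\<exists>d. \<forall>n\<ge>1. degree (d n) \<le> n \<and> (\<forall>k\<le>n. eigp (d n) k = 1) \<and> (\<forall>s. \<bar>s\<bar> \<le> 1 \<longrightarrow> \<bar>poly (d n) s\<bar> \<le> 8 * 2 powr D * real n powr D)"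
proof -
  have "\<exists>d. degree d \<le> n \<and> (\<forall>k\<le>n. eigp d k = 1) \<and> (\<forall>s. \<bar>s\<bar> \<le> 1 \<longrightarrow> \<bar>poly d s\<bar> \<le> 8 * 2 powr D * real n powr D)"
    if n: "1 \<le> n" for n
  proof -
    obtain d where d: "degree d \<le> n" "\<And>k. k \<le> n \<Longrightarrow> eigp d k = 1" using eigp_interpolation[of n "\<lambda>_. 1"] by blast
    define z :: "real ^ 'n" where "z = axis undefined 1"
    have z: "norm z = 1" by (simp add: z_def)
    have "\<bar>poly d s\<bar> \<le> 8 * 2 powr D * real n powr D" if s: "\<bar>s\<bar> \<le> 1" for s
    proof -
      define y where "y = s *\<^sub>R z"
      have y: "y \<in> cball 0 1" using s z by (simp add: y_def)
      have zc: "z \<in> cball 0 1" using z by simp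
      have "z \<bullet> y = s" using z by (simp add: y_def dot_square_norm)
      then have "poly d s = kpol d z y" using kpol_boundary[OF z y] by simp
      also have "\<dots> = (\<Sum>b\<in>flag n. ip (kpol d z) b * b y)"
        using poly_expansion[OF kpol_poly_space[OF d(1)], of z] by (rule fun_cong)
      also have "\<dots> = (\<Sum>b\<in>flag n. b z * b y)"
      proof (rule sum.cong)
        fix b assume "b \<in> flag n"
        then obtain k where k: "k \<le> n" "b \<in> bas k" using flag_bas by blast
        show "ip (kpol d z) b * b y = b z * b y"
          unfolding ip_def kpol_eigen[OF bas_orth[OF k(2)] zc] using d(2)[OF k(1)] by simp
      qed simp
      finally have "poly d s = (\<Sum>b\<in>flag n. b z * b y)" .
      then have "\<bar>poly d s\<bar> \<le> (\<Sum>b\<in>flag n. \<bar>b z * b y\<bar>)" by simp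
      also have "\<dots> \<le> (\<Sum>b\<in>flag n. (b z)\<^sup>2 / 2 + (b y)\<^sup>2 / 2)"
      proof (rule sum_mono)
        fix b :: "real ^ 'n \<Rightarrow> real"
        show "\<bar>b z * b y\<bar> \<le> (b z)\<^sup>2 / 2 + (b y)\<^sup>2 / 2"
          using sum_squares_bound[of "\<bar>b z\<bar>" "\<bar>b y\<bar>"] by (simp add: abs_mult)
      qed
      also have "\<dots> = (\<Sum>b\<in>flag n. (b z)\<^sup>2) / 2 + (\<Sum>b\<in>flag n. (b y)\<^sup>2) / 2"
        by (simp add: sum.distrib sum_divide_distrib)
      also have "\<dots> \<le> 8 * 2 powr D * real n powr D" using christoffel[OF n zc] christoffel[OF n y] by simp
      finally show ?thesis .
    qed
    then show ?thesis using d by blast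
  qed
  then show ?thesis by metis
qed

text \<open>If all these functions vanished at z, the ridge power of degree k, which is the kernel
  \<open>kmon k z\<close>, would have no component of degree k and so would have degree below k. The
  line through z refutes this. The nonzero value serves to divide when a multiplier is read off at
  z.\<close>

lemma bas_nonzero_boundary:
  assumes z: "norm z = 1"
  shows "\<exists>b\<in>bas k. b z \<noteq> 0"
proof (rule ccontr)
  assume "\<not> ?thesis"
  then have 0: "\<And>b. b \<in> bas k \<Longrightarrow> b z = 0" by blast
  have zc: "z \<in> cball 0 1" using z by simp
  define P where "P = (\<lambda>y. (z \<bullet> y) ^ k)"
  have Pp: "P \<in> poly_space k" unfolding P_def by (rule poly_space_inner_power)
  have "ip P b = 0" if b: "b \<in> bas k" for b
  proof -
    have "ip P b = kop k b z"
      unfolding ip_def kop_def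
    proof (rule Bochner_Integration.integral_cong)
      fix y assume "y \<in> space M"
      then have y: "y \<in> cball 0 1" by simp
      have "kmon k z y = (z \<bullet> y) ^ k"
        using kpol_boundary[OF z y, of "monom 1 k"] kav_power[OF zc y] kav_poly[OF zc y, of "monom 1 k"]
        by (simp add: poly_monom[abs_def])
      then show "P y * b y = kmon k z y * b y" by (simp add: P_def)
    qed simp
    also have "\<dots> = 0" using kop_eigen[OF bas_orth[OF b] zc] 0[OF b] by simp
    finally show ?thesis .
  qed
  then have pr0: "pr k P = (\<lambda>_. 0)" by (auto simp: pr_def)
  have *: "(z \<bullet> (t *\<^sub>R z)) ^ k = t ^ k" for t using z by (simp add: dot_square_norm)
  show False
  proof (cases k)
    case 0
    then show False using poly_sum_pr[OF Pp, of z] pr0 by (simp add: P_def)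
  next
    case (Suc j)
    have eq: "P x = (\<Sum>i\<le>j. pr i P x)" for x using poly_sum_pr[OF Pp, of x] pr0 Suc by simp
    have "(\<lambda>x. \<Sum>i\<le>j. pr i P x) \<in> poly_space j" by (intro poly_space_sum poly_space_mono[OF _ pr_poly]) auto
    moreover have "P = (\<lambda>x. \<Sum>i\<le>j. pr i P x)" by (rule ext) (rule eq)
    ultimately have "P \<in> poly_space j" by (rule ssubst[rotated])
    then obtain p where p: "degree p \<le> j" "\<And>t. poly p t = P (t *\<^sub>R z)" using poly_space_ray by blast
    have "poly p = poly (monom 1 k)" by (rule ext) (simp only: p(2) P_def * poly_monom mult_1)
    then have "p = monom 1 k" by (simp add: poly_eq_poly_eq_iff)
    then show False using p(1) Suc by (simp add: degree_monom_eq)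
  qed
qed

end

section \<open>Kernels concentrated at scale 1/n\<close>

context ball_setting
begin

text \<open>An integer exponent, so that powers of polynomials can be used, and at least \<kappa>,
  so that \<open>loc\<close> decays no slower than the Poisson kernel.\<close>

definition K :: nat where "K = nat \<lceil>\<kappa>\<rceil>"

lemma K_ge: "\<kappa> \<le> real K" "1 \<le> K" using kappa_ge_1 by (auto simp: K_def) linarith+

text \<open>With s the cosine of an angle, 1 - s is comparable to its square; the function decays on
  the scale of angles 1/n.\<close>

definition loc :: "nat \<Rightarrow> real \<Rightarrow> real" where
  "loc n s = (1 / (1 + (real n)\<^sup>2 * (1 - s))) ^ K"

lemma loc_measurable [measurable]: "loc n \<in> borel_measurable borel"
  unfolding loc_def[abs_def] by measurable

lemma loc_base: "\<bar>s\<bar> \<le> 1 \<Longrightarrow> 1 \<le> 1 + (real n)\<^sup>2 * (1 - s)" by simp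

lemma loc_bounds:
  assumes "\<bar>s\<bar> \<le> 1"
  shows "0 \<le> loc n s" "loc n s \<le> 1" "\<bar>loc n s\<bar> \<le> 1"
proof -
  have "0 \<le> 1 / (1 + (real n)\<^sup>2 * (1 - s))" "1 / (1 + (real n)\<^sup>2 * (1 - s)) \<le> 1"
    using loc_base[OF assms, of n] by (auto simp: divide_le_eq_1)
  then show "0 \<le> loc n s" "loc n s \<le> 1" "\<bar>loc n s\<bar> \<le> 1" unfolding loc_def by (auto intro: power_le_one)
qed

lemma loc_mono:
  assumes c: "0 < c" and mn: "(real m)\<^sup>2 \<le> c * (real n)\<^sup>2" "1 \<le> c" and s: "\<bar>s\<bar> \<le> 1"
  shows "loc n s \<le> c ^ K * loc m s"
proof -
  have "1 + (real m)\<^sup>2 * (1 - s) \<le> 1 + (c * (real n)\<^sup>2) * (1 - s)" using s mn by (intro add_left_mono mult_right_mono) auto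
  also have "\<dots> \<le> c * (1 + (real n)\<^sup>2 * (1 - s))" using mn by (simp add: algebra_simps)
  finally have "1 / (1 + (real n)\<^sup>2 * (1 - s)) \<le> c * (1 / (1 + (real m)\<^sup>2 * (1 - s)))"
    using loc_base[OF s, of n] loc_base[OF s, of m] by (simp add: field_simps)
  then show ?thesis unfolding loc_def power_mult_distrib[symmetric]
    using loc_base[OF s, of n] by (intro power_mono) auto
qed

text \<open>At \<zeta> = 1 + 1/m^2 the quantity 1 / (\<zeta> - s) is l, and the Chebyshev value is
  at least 2 by \<open>cheb_growth\<close>, so the relative error is at most 1/2.\<close>

lemma chebq_loc:
  assumes m: "1 \<le> m" and s: "\<bar>s\<bar> \<le> 1"
  defines "q \<equiv> poly (chebq m (1 + 1 / (real m)\<^sup>2)) s" and "l \<equiv> (real m)\<^sup>2 / (1 + (real m)\<^sup>2 * (1 - s))"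
  shows "l / 2 \<le> q" "q \<le> 3 / 2 * l"
proof -
  define \<zeta> where "\<zeta> = 1 + 1 / (real m)\<^sup>2"
  have m0: "0 < (real m)\<^sup>2" using m by simp
  have z: "1 < \<zeta>" using m0 by (simp add: \<zeta>_def)
  have l0: "0 \<le> l" using loc_base[OF s, of m] by (simp add: l_def)
  have T: "2 \<le> poly (cheb m) \<zeta>" using cheb_growth[of "1 / (real m)\<^sup>2" m] m0 by (simp add: \<zeta>_def)
  have le: "1 / (\<zeta> - s) = l"
  proof -
    have "\<zeta> - s = (1 + (real m)\<^sup>2 * (1 - s)) / (real m)\<^sup>2" using m0 by (simp add: \<zeta>_def field_simps)
    then show ?thesis by (simp add: l_def)
  qed
  have "\<bar>q - l\<bar> \<le> 1 / poly (cheb m) \<zeta> * l"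
    using chebq_approx[OF z s, of m] unfolding le by (simp add: q_def \<zeta>_def)
  also have "\<dots> \<le> 1 / 2 * l" using T l0 by (intro mult_right_mono) (auto simp: divide_le_eq)
  finally show "l / 2 \<le> q" "q \<le> 3 / 2 * l" unfolding abs_le_iff by linarith+
qed

text \<open>For 1 - \<rho> = 1/(2m) the denominator (1 - \<rho>)^2 + 2 \<rho> (1 - s) is at most 2 /
  m^2 times 1 + m^2 (1 - s). The domination transfers the mass 1 of the Poisson kernel to a bound
  m^(-D) for \<open>loc\<close>.\<close>

lemma loc_le_pois:
  assumes m: "1 \<le> m" and s: "\<bar>s\<bar> \<le> 1"
  shows "loc m s \<le> 2 powr (\<kappa> + 1) * real m powr (- D) * pois (1 - 1 / (2 * real m)) s"
proof -
  define \<rho> where "\<rho> = 1 - 1 / (2 * real m)"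
  define b where "b = 1 + (real m)\<^sup>2 * (1 - s)"
  have b: "1 \<le> b" using loc_base[OF s] by (simp add: b_def)
  have m0: "0 < real m" using m by simp
  have \<rho>: "0 \<le> \<rho>" "\<rho> < 1" using m by (auto simp: \<rho>_def field_simps)
  have eq: "1 + \<rho>\<^sup>2 - 2 * \<rho> * s = (1 - \<rho>)\<^sup>2 + 2 * \<rho> * (1 - s)" by (simp add: power2_eq_square algebra_simps)
  also have "\<dots> \<le> 1 / (real m)\<^sup>2 + 2 * 1 * (1 - s)"
    using \<rho> s m0 by (intro add_mono mult_right_mono) (auto simp: \<rho>_def power2_eq_square field_simps)
  also have "\<dots> \<le> 2 * b / (real m)\<^sup>2" using m0 by (simp add: b_def field_simps)
  finally have up: "1 + \<rho>\<^sup>2 - 2 * \<rho> * s \<le> 2 * b / (real m)\<^sup>2" .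
  have "loc m s = b powr (- real K)"
    using b by (simp add: loc_def b_def[symmetric] powr_minus_divide powr_realpow power_one_over)
  also have "\<dots> \<le> b powr (- \<kappa>)" using b K_ge by (intro powr_mono) auto
  also have "b powr (- \<kappa>) = 2 powr \<kappa> * real m powr (- (2 * \<kappa>)) * (2 * b / (real m)\<^sup>2) powr (- \<kappa>)"
  proof -
    have "(real m)\<^sup>2 powr \<kappa> = real m powr (2 * \<kappa>)"
      using m0 by (simp add: powr_realpow[symmetric] powr_powr del: powr_realpow powr_numeral)
    then show ?thesis using m0 b by (simp add: powr_minus_divide powr_divide powr_mult)
  qed
  also have "\<dots> \<le> 2 powr \<kappa> * real m powr (- (2 * \<kappa>)) * (1 + \<rho>\<^sup>2 - 2 * \<rho> * s) powr (- \<kappa>)"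
    using up poisson_denominator_pos(2)[OF \<rho> s] kappa_ge_1 by (intro mult_left_mono powr_mono2') auto
  also have "\<dots> = 2 powr (\<kappa> + 1) * real m powr (- D) * ((1 / (2 * real m)) * (1 + \<rho>\<^sup>2 - 2 * \<rho> * s) powr (- \<kappa>))"
  proof -
    have "real m powr (- (2 * \<kappa>)) = real m powr (- D) * (1 / real m)"
      using m0 by (simp add: powr_diff powr_minus_divide)
    then show ?thesis by (simp add: powr_add)
  qed
  also have "\<dots> \<le> 2 powr (\<kappa> + 1) * real m powr (- D) * ((1 - \<rho>\<^sup>2) * (1 + \<rho>\<^sup>2 - 2 * \<rho> * s) powr (- \<kappa>))"
  proof -
    have "1 / (2 * real m) = 1 - \<rho>" by (simp add: \<rho>_def)
    also have "\<dots> \<le> 1 - \<rho>\<^sup>2" using \<rho> by (simp add: power2_eq_square mult_left_le)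
    finally show ?thesis by (intro mult_left_mono mult_right_mono) auto
  qed
  finally show ?thesis by (simp add: pois_def \<rho>_def)
qed

lemma kav_loc_bounds:
  assumes "x \<in> cball 0 1" "y \<in> cball 0 1"
  shows "0 \<le> kav (loc n) x y" "kav (loc n) x y \<le> 1"
  using kav_nonneg[of "loc n", OF loc_bounds(1) assms] kav_le[of "loc n", OF loc_measurable loc_bounds(3) assms] by auto

lemma kav_loc_mass:
  assumes m: "1 \<le> m" and x: "x \<in> cball 0 1"
  shows "(\<integral>\<^sup>+y. ennreal (kav (loc m) x y) \<partial>M) \<le> ennreal (2 powr (\<kappa> + 1) * real m powr (- D))"
proof -
  define \<rho> where "\<rho> = 1 - 1 / (2 * real m)"
  have \<rho>: "0 \<le> \<rho>" "\<rho> < 1" using m by (auto simp: \<rho>_def field_simps)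
  define c where "c = 2 powr (\<kappa> + 1) * real m powr (- D)"
  have c: "0 \<le> c" by (simp add: c_def)
  have "(\<integral>\<^sup>+y. ennreal (kav (loc m) x y) \<partial>M) \<le> (\<integral>\<^sup>+y. ennreal (c * kav (pois \<rho>) x y) \<partial>M)"
  proof (intro nn_integral_mono ennreal_leI)
    fix y assume "y \<in> space M"
    then have y: "y \<in> cball 0 1" by simp
    have "kav (loc m) x y \<le> kav (\<lambda>s. c * pois \<rho> s) x y"
    proof (rule kav_mono[OF loc_measurable loc_bounds(3) _ _ _ x y])
      show "\<bar>c * pois \<rho> s\<bar> \<le> c * ((1 - \<rho>\<^sup>2) * (1 - \<rho>) powr (- (2 * \<kappa>)))" if "\<bar>s\<bar> \<le> 1" for s
        using pois_abs_le[OF \<rho> that] c by (simp add: abs_mult mult_left_mono)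
    qed (use loc_le_pois[OF m] in \<open>auto simp: c_def \<rho>_def\<close>)
    then show "kav (loc m) x y \<le> c * kav (pois \<rho>) x y" by (simp add: kav_cmult)
  qed
  also have "\<dots> = ennreal (\<integral>y. c * kav (pois \<rho>) x y \<partial>M)"
    using kav_pois_nonneg[OF \<rho> x] c
    by (intro nn_integral_eq_integral integrable_mult_right integrable_kav_pois \<rho> x AE_I2) auto
  also have "\<dots> = ennreal c" using kav_pois_mass[OF \<rho> x] by simp
  finally show ?thesis by (simp add: c_def)
qed

lemma eigp_reproduce:
  assumes g: "\<And>k. k \<le> n \<Longrightarrow> eigp g k = 1" and P: "P \<in> poly_space n" and x: "x \<in> cball 0 1"
  shows "(\<integral>y. kpol g x y * P y \<partial>M) = P x"
proof -
  have "(\<integral>y. kpol g x y * P y \<partial>M) = (\<integral>y. (\<Sum>k\<le>n. kpol g x y * pr k P y) \<partial>M)"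
    by (simp add: poly_sum_pr[OF P, symmetric] sum_distrib_left[symmetric])
  also have "\<dots> = (\<Sum>k\<le>n. (\<integral>y. kpol g x y * pr k P y \<partial>M))"
    by (rule Bochner_Integration.integral_sum) (rule integrable_kpol_mult[OF pr_poly])
  also have "\<dots> = (\<Sum>k\<le>n. pr k P x)" using kpol_eigen[OF pr_orth x] g by (intro sum.cong) auto
  finally show ?thesis using poly_sum_pr[OF P, of x] by simp
qed

lemma poly_ridge_space: "degree p \<le> n \<Longrightarrow> (\<lambda>y. poly p (z \<bullet> y)) \<in> poly_space n"
  unfolding poly_altdef by (intro poly_space_sum poly_space_cmult poly_space_mono[OF _ poly_space_inner_power]) auto

text \<open>The Dirichlet kernel of the larger degree N is multiplied by a decaying polynomial h
  with h(1) = 1. The decay comes from h, while the multipliers up to n remain 1.\<close>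

lemma localized_kernel:
  "\<exists>C>0. \<forall>n\<ge>1. \<exists>g. (\<forall>k\<le>n. eigp g k = 1) \<and> (\<forall>s. \<bar>s\<bar> \<le> 1 \<longrightarrow> \<bar>poly g s\<bar> \<le> C * real n powr D * loc n s)"
proof -
  obtain d where d: "\<And>n. 1 \<le> n \<Longrightarrow> degree (d n) \<le> n" "\<And>n k. 1 \<le> n \<Longrightarrow> k \<le> n \<Longrightarrow> eigp (d n) k = 1"
    "\<And>n s. 1 \<le> n \<Longrightarrow> \<bar>s\<bar> \<le> 1 \<Longrightarrow> \<bar>poly (d n) s\<bar> \<le> 8 * 2 powr D * real n powr D"
    using dirichlet_kernel by metis
  define C where "C = 8 * 2 powr D * real (K + 1) powr D * 3 ^ K"
  have "\<exists>g. (\<forall>k\<le>n. eigp g k = 1) \<and> (\<forall>s. \<bar>s\<bar> \<le> 1 \<longrightarrow> \<bar>poly g s\<bar> \<le> C * real n powr D * loc n s)" if n: "1 \<le> n" for n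
  proof -
    \<comment> \<open>The degree of h, at most K (n - 1), plus the degree n to be reproduced has to
      stay within N.\<close>
    define N where "N = (K + 1) * n"
    have N: "1 \<le> N" using n by (simp add: N_def)
    define q where "q = chebq n (1 + 1 / (real n)\<^sup>2)"
    define l where "l s = (real n)\<^sup>2 / (1 + (real n)\<^sup>2 * (1 - s))" for s
    have q: "l s / 2 \<le> poly q s" "poly q s \<le> 3 / 2 * l s" if "\<bar>s\<bar> \<le> 1" for s
      using chebq_loc[OF n that] by (auto simp: q_def l_def)
    have q1: "(real n)\<^sup>2 / 2 \<le> poly q 1" using q(1)[of 1] by (simp add: l_def)
    have "0 < (real n)\<^sup>2 / 2" using n by simp
    then have q10: "0 < poly q 1" using q1 by (rule less_le_trans)
    define h where "h = (smult (1 / poly q 1) q) ^ K"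
    have "degree h \<le> (n - 1) * K"
      unfolding h_def q_def using degree_chebq[of n "1 + 1 / (real n)\<^sup>2"] q10
      by (intro order_trans[OF degree_power_le] mult_right_mono) (auto simp: q_def)
    then have dh: "degree h + n \<le> N" using n by (simp add: N_def) (metis Nat.le_diff_conv2 add.commute add_le_cancel_left diff_le_self dual_order.trans mult.commute mult_le_mono2)
    define g where "g = d N * h"
    have "eigp g k = 1" if k: "k \<le> n" for k
    proof -
      define z :: "real ^ 'n" where "z = axis undefined 1"
      have z: "norm z = 1" by (simp add: z_def)
      have zc: "z \<in> cball 0 1" using z by simp
      obtain b where b: "b \<in> bas k" "b z \<noteq> 0" using bas_nonzero_boundary[OF z] by blast
      have bp: "b \<in> poly_space k" by (rule bas_poly[OF b(1)])
      have hb: "(\<lambda>y. poly h (z \<bullet> y) * b y) \<in> poly_space N"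
        by (rule poly_space_mono[OF _ poly_space_mult[OF poly_ridge_space[OF order_refl] bp]]) (use dh k in simp)
      have "eigp g k * b z = (\<integral>y. kpol g z y * b y \<partial>M)" using kpol_eigen[OF bas_orth[OF b(1)] zc] by simp
      \<comment> \<open>At a boundary point both kernels are functions of
        \<open>z \<bullet> y\<close>, so h can be moved over to the polynomial; reproduction by
        \<open>d N\<close> then evaluates it at \<open>z \<bullet> z = 1\<close>.\<close>
      also have "\<dots> = (\<integral>y. kpol (d N) z y * (poly h (z \<bullet> y) * b y) \<partial>M)"
        by (rule Bochner_Integration.integral_cong) (auto simp: kpol_boundary[OF z] g_def)
      also have "\<dots> = poly h (z \<bullet> z) * b z"
        using eigp_reproduce[OF d(2)[OF N] hb zc] by simp
      also have "poly h (z \<bullet> z) = 1" using z q10 by (simp add: h_def dot_square_norm)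
      finally show ?thesis using b(2) by simp
    qed
    moreover have "\<bar>poly g s\<bar> \<le> C * real n powr D * loc n s" if s: "\<bar>s\<bar> \<le> 1" for s
    proof -
      have l0: "0 \<le> l s" using loc_base[OF s, of n] by (simp add: l_def)
      have "\<bar>poly q s / poly q 1\<bar> \<le> (3 / 2 * l s) / ((real n)\<^sup>2 / 2)"
      proof -
        have "0 \<le> poly q s" using q(1)[OF s] l0 by simp
        then have "\<bar>poly q s / poly q 1\<bar> = poly q s / poly q 1" using q10 by simp
        also have "\<dots> \<le> (3 / 2 * l s) / ((real n)\<^sup>2 / 2)" by (rule frac_le) (use q(2)[OF s] l0 q1 n in auto)
        finally show ?thesis .
      qed
      also have "\<dots> = 3 * (1 / (1 + (real n)\<^sup>2 * (1 - s)))"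
      proof -
        have *: "3 / 2 * (a / b) / (a / 2) = 3 * (1 / b)" if "a \<noteq> 0" for a b :: real using that by (cases "b = 0") (auto simp: field_simps)
        show ?thesis unfolding l_def by (rule *) (use n in simp)
      qed
      finally have "\<bar>poly q s / poly q 1\<bar> ^ K \<le> (3 * (1 / (1 + (real n)\<^sup>2 * (1 - s)))) ^ K" by (rule power_mono) simp
      then have "\<bar>poly h s\<bar> \<le> 3 ^ K * loc n s" by (simp add: h_def power_abs loc_def power_mult_distrib power_divide)
      moreover have "\<bar>poly (d N) s\<bar> \<le> 8 * 2 powr D * (real (K + 1) powr D * real n powr D)"
      proof -
        have "real N = real (K + 1) * real n" unfolding N_def by (rule of_nat_mult)
        then have "real N powr D = real (K + 1) powr D * real n powr D" by (simp only: powr_mult)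
        then show ?thesis using d(3)[OF N s] by (simp only:)
      qed
      ultimately have "\<bar>poly (d N) s\<bar> * \<bar>poly h s\<bar> \<le> (8 * 2 powr D * (real (K + 1) powr D * real n powr D)) * (3 ^ K * loc n s)"
        by (intro mult_mono) auto
      then show ?thesis by (simp add: g_def abs_mult C_def mult_ac)
    qed
    ultimately show ?thesis by blast
  qed
  moreover have "0 < C" by (simp add: C_def)
  ultimately show ?thesis by blast
qed

text \<open>P is reproduced by a kernel dominated by a multiple of n^D \<open>kav (loc n)\<close>,
  whose integral has a bound independent of n and x. Jensen's inequality for this weight moves the
  power p inside. Taken at one point this leads to Nikolskii's inequality, summed over nodes to that
  of Marcinkiewicz and Zygmund.\<close>

lemma poly_local_bound:
  "\<exists>A>0. \<forall>n\<ge>1. \<forall>P\<in>poly_space n. \<forall>x\<in>cball 0 1. \<forall>p\<ge>1.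
     ennreal (\<bar>P x\<bar> powr p) \<le> ennreal (A powr (p - 1)) * (\<integral>\<^sup>+y. ennreal (A * real n powr D * kav (loc n) x y * \<bar>P y\<bar> powr p) \<partial>M)"
proof -
  obtain C where C: "0 < C" "\<And>n. 1 \<le> n \<Longrightarrow> \<exists>g. (\<forall>k\<le>n. eigp g k = 1) \<and> (\<forall>s. \<bar>s\<bar> \<le> 1 \<longrightarrow> \<bar>poly g s\<bar> \<le> C * real n powr D * loc n s)"
    using localized_kernel by auto
  define A where "A = C * 2 powr (\<kappa> + 1)"
  have A: "0 < A" "C \<le> A" using C(1) kappa_ge_1 by (auto simp: A_def ge_one_powr_ge_zero)
  have "ennreal (\<bar>P x\<bar> powr p) \<le> ennreal (A powr (p - 1)) * (\<integral>\<^sup>+y. ennreal (A * real n powr D * kav (loc n) x y * \<bar>P y\<bar> powr p) \<partial>M)"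
    if n: "1 \<le> n" and P: "P \<in> poly_space n" and x: "x \<in> cball 0 1" and p: "1 \<le> p" for n P x p
  proof -
    obtain g where g: "\<And>k. k \<le> n \<Longrightarrow> eigp g k = 1" "\<And>s. \<bar>s\<bar> \<le> 1 \<Longrightarrow> \<bar>poly g s\<bar> \<le> C * real n powr D * loc n s"
      using C(2)[OF n] by blast
    define c where "c = C * real n powr D"
    have c: "0 \<le> c" using C(1) by (simp add: c_def)
    have [measurable]: "P \<in> borel_measurable M" using integrable_poly[OF P] by simp
    have [measurable]: "kav (loc n) x \<in> borel_measurable M" by (rule kav_measurable_M(1)[OF loc_measurable])
    have gm: "poly g \<in> borel_measurable borel" by (intro borel_measurable_continuous_onI continuous_intros)
    have gb: "\<bar>poly g s\<bar> \<le> c" if "\<bar>s\<bar> \<le> 1" for s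
      using g(2)[OF that] mult_left_mono[OF loc_bounds(2)[OF that, of n] c] by (simp add: c_def)
    have kg: "\<bar>kpol g x y\<bar> \<le> c * kav (loc n) x y" if y: "y \<in> cball 0 1" for y
    proof -
      have lb: "\<bar>c * loc n s\<bar> \<le> c * 1" if "\<bar>s\<bar> \<le> 1" for s
        using loc_bounds(3)[OF that, of n] c by (simp add: abs_mult mult_left_le)
      have lm: "(\<lambda>s. c * loc n s) \<in> borel_measurable borel" by measurable
      have gm': "(\<lambda>s. - 1 * poly g s) \<in> borel_measurable borel" using gm by measurable
      have "kav (poly g) x y \<le> kav (\<lambda>s. c * loc n s) x y"
        by (rule kav_mono[OF gm gb lm lb _ x y]) (use g(2) in \<open>auto simp: c_def abs_le_iff\<close>)
      moreover have "kav (\<lambda>s. - 1 * poly g s) x y \<le> kav (\<lambda>s. c * loc n s) x y"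
        by (rule kav_mono[OF gm' _ lm lb _ x y]) (use g(2) gb in \<open>auto simp: c_def abs_le_iff\<close>)
      ultimately show ?thesis unfolding kav_cmult kav_poly[OF x y] by (simp add: abs_le_iff)
    qed
    have "ennreal \<bar>P x\<bar> \<le> (\<integral>\<^sup>+y. ennreal \<bar>kpol g x y * P y\<bar> \<partial>M)"
      using integral_norm_bound_ennreal[OF integrable_kpol_mult[OF P, of g x]] by (simp add: eigp_reproduce[OF g(1) P x])
    also have "\<dots> \<le> (\<integral>\<^sup>+y. ennreal (c * kav (loc n) x y * \<bar>P y\<bar>) \<partial>M)"
      using kg by (intro nn_integral_mono ennreal_leI) (auto simp: abs_mult intro!: mult_right_mono)
    finally have *: "ennreal \<bar>P x\<bar> \<le> (\<integral>\<^sup>+y. ennreal (c * kav (loc n) x y * \<bar>P y\<bar>) \<partial>M)" .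
    have mass: "(\<integral>\<^sup>+y. ennreal (c * kav (loc n) x y) \<partial>M) \<le> ennreal A"
    proof -
      have "(\<integral>\<^sup>+y. ennreal (c * kav (loc n) x y) \<partial>M) = (\<integral>\<^sup>+y. ennreal c * ennreal (kav (loc n) x y) \<partial>M)"
        using c kav_loc_bounds(1)[OF x] by (intro nn_integral_cong) (auto simp: ennreal_mult)
      also have "\<dots> = ennreal c * (\<integral>\<^sup>+y. ennreal (kav (loc n) x y) \<partial>M)" by (rule nn_integral_cmult) measurable
      also have "\<dots> \<le> ennreal c * ennreal (2 powr (\<kappa> + 1) * real n powr (- D))"
        by (intro mult_left_mono kav_loc_mass n x) simp
      also have "\<dots> = ennreal (c * (2 powr (\<kappa> + 1) * real n powr (- D)))" using c by (simp add: ennreal_mult)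
      also have "c * (2 powr (\<kappa> + 1) * real n powr (- D)) = A * (real n powr D * real n powr (- D))"
        by (simp add: c_def A_def)
      also have "\<dots> = A" using n unfolding powr_add[symmetric] by simp
      finally show ?thesis .
    qed
    have "ennreal (\<bar>P x\<bar> powr p) \<le> ennreal (A powr (p - 1)) * (\<integral>\<^sup>+y. ennreal (c * kav (loc n) x y * \<bar>P y\<bar> powr p) \<partial>M)"
      by (rule jensen_nn[OF p A(1) _ _ _ _ mass _ *]) (use c kav_loc_bounds(1)[OF x] in auto)
    also have "\<dots> \<le> ennreal (A powr (p - 1)) * (\<integral>\<^sup>+y. ennreal (A * real n powr D * kav (loc n) x y * \<bar>P y\<bar> powr p) \<partial>M)"
      using A kav_loc_bounds(1)[OF x]
      by (intro mult_left_mono nn_integral_mono ennreal_leI mult_right_mono) (auto simp: c_def intro: mult_right_mono)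
    finally show ?thesis .
  qed
  then show ?thesis using A(1) by blast
qed

lemma nikolskii:
  "\<exists>A>0. \<forall>n\<ge>1. \<forall>P\<in>poly_space n. \<forall>x\<in>cball 0 1. \<forall>p\<ge>1.
     ennreal (\<bar>P x\<bar> powr p) \<le> ennreal (A powr p * real n powr D) * (\<integral>\<^sup>+y. ennreal (\<bar>P y\<bar> powr p) \<partial>M)"
proof -
  obtain A where A: "0 < A" "\<And>n P x p. 1 \<le> n \<Longrightarrow> P \<in> poly_space n \<Longrightarrow> x \<in> cball 0 1 \<Longrightarrow> 1 \<le> p \<Longrightarrow>
     ennreal (\<bar>P x\<bar> powr p) \<le> ennreal (A powr (p - 1)) * (\<integral>\<^sup>+y. ennreal (A * real n powr D * kav (loc n) x y * \<bar>P y\<bar> powr p) \<partial>M)"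
    using poly_local_bound by blast
  have "ennreal (\<bar>P x\<bar> powr p) \<le> ennreal (A powr p * real n powr D) * (\<integral>\<^sup>+y. ennreal (\<bar>P y\<bar> powr p) \<partial>M)"
    if n: "1 \<le> n" and P: "P \<in> poly_space n" and x: "x \<in> cball 0 1" and p: "1 \<le> p" for n P x p
  proof -
    have [measurable]: "P \<in> borel_measurable M" using integrable_poly[OF P] by simp
    have "ennreal (\<bar>P x\<bar> powr p) \<le> ennreal (A powr (p - 1)) * (\<integral>\<^sup>+y. ennreal (A * real n powr D * kav (loc n) x y * \<bar>P y\<bar> powr p) \<partial>M)"
      by (rule A(2)[OF that])
    also have "\<dots> \<le> ennreal (A powr (p - 1)) * (\<integral>\<^sup>+y. ennreal (A * real n powr D) * ennreal (\<bar>P y\<bar> powr p) \<partial>M)"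
    proof (intro mult_left_mono nn_integral_mono)
      fix y assume "y \<in> space M"
      then have "kav (loc n) x y \<le> 1" using kav_loc_bounds(2)[OF x] by simp
      then have "A * real n powr D * kav (loc n) x y * \<bar>P y\<bar> powr p \<le> A * real n powr D * 1 * \<bar>P y\<bar> powr p"
        using A(1) by (intro mult_left_mono mult_right_mono) auto
      then show "ennreal (A * real n powr D * kav (loc n) x y * \<bar>P y\<bar> powr p) \<le> ennreal (A * real n powr D) * ennreal (\<bar>P y\<bar> powr p)"
        using A(1) by (simp add: ennreal_mult[symmetric] ennreal_leI)
    qed simp
    also have "\<dots> = ennreal (A powr (p - 1)) * (ennreal (A * real n powr D) * (\<integral>\<^sup>+y. ennreal (\<bar>P y\<bar> powr p) \<partial>M))"
      by (subst nn_integral_cmult) auto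
    also have "\<dots> = ennreal (A powr p * real n powr D) * (\<integral>\<^sup>+y. ennreal (\<bar>P y\<bar> powr p) \<partial>M)"
      using A(1) by (simp add: mult.assoc[symmetric] ennreal_mult[symmetric] powr_diff)
    finally show ?thesis .
  qed
  then show ?thesis using A(1) by blast
qed

text \<open>A single rule as a predicate: placing a constant before the quantifier over rules makes
  it independent of L, of the nodes and of the weights.\<close>

definition quad :: "nat \<Rightarrow> (real ^ 'n) set \<Rightarrow> (real ^ 'n \<Rightarrow> real) \<Rightarrow> bool" where
  "quad L \<Lambda> w \<longleftrightarrow> 1 \<le> L \<and> finite \<Lambda> \<and> \<Lambda> \<subseteq> cball 0 1 \<and> (\<forall>\<omega>\<in>\<Lambda>. 0 < w \<omega>) \<and>
     (\<forall>P\<in>poly_space (3 * L). (\<integral>x. P x \<partial>M) = (\<Sum>\<omega>\<in>\<Lambda>. w \<omega> * P \<omega>))"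

text \<open>The kernel \<open>loc L\<close> is comparable to a polynomial of degree at most \<open>L\<close>, which the quadrature
  rule integrates exactly.\<close>

lemma quad_loc_sum:
  "\<exists>C>0. \<forall>L \<Lambda> w n y. quad L \<Lambda> w \<longrightarrow> L \<le> n \<longrightarrow> y \<in> cball 0 1 \<longrightarrow>
     (\<Sum>\<omega>\<in>\<Lambda>. w \<omega> * kav (loc n) \<omega> y) \<le> C * real L powr (- D)"
proof -
  define C where "C = 12 ^ K * 2 powr (\<kappa> + 1) * real K powr D"
  have "(\<Sum>\<omega>\<in>\<Lambda>. w \<omega> * kav (loc n) \<omega> y) \<le> C * real L powr (- D)"
    if Q: "quad L \<Lambda> w" and n: "L \<le> n" and y: "y \<in> cball 0 1" for L \<Lambda> w n y
  proof -
    have L: "1 \<le> L" and \<Lambda>: "\<Lambda> \<subseteq> cball 0 1" and w: "\<And>\<omega>. \<omega> \<in> \<Lambda> \<Longrightarrow> 0 < w \<omega>"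
      and ex: "\<And>P. P \<in> poly_space (3 * L) \<Longrightarrow> (\<integral>x. P x \<partial>M) = (\<Sum>\<omega>\<in>\<Lambda>. w \<omega> * P \<omega>)"
      using Q by (auto simp: quad_def)
    \<comment> \<open>K factors of degree m - 1 stay within degree L, while m is at least L / K, so
      the scale is comparable to that of L.\<close>
    define m where "m = L div K + 1"
    have m: "1 \<le> m" by (simp add: m_def)
    have K0: "0 < K" using K_ge(2) by simp
    have mK: "(m - 1) * K \<le> L" "L \<le> m * K"
      using K0 by (simp_all add: m_def) (metis add.commute div_mult_mod_eq less_imp_le mod_less_divisor nat_add_left_cancel_le)
    have m2: "m \<le> 2 * L" using L div_le_dividend[of L K] unfolding m_def by linarith
    \<comment> \<open>By \<open>chebq_loc\<close> the quotient is known up to factors 1/2 and 3/2.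
      The normalisation makes \<open>loc m\<close> a lower bound, at the price of 3 ^ K in the upper
      bound.\<close>
    define h where "h = (smult (2 / (real m)\<^sup>2) (chebq m (1 + 1 / (real m)\<^sup>2))) ^ K"
    have "degree h \<le> (m - 1) * K"
      unfolding h_def using degree_chebq[of m "1 + 1 / (real m)\<^sup>2"] m
      by (intro order_trans[OF degree_power_le] mult_right_mono) auto
    then have dh: "degree h \<le> 3 * L" using mK by simp
    have hb: "loc m s \<le> poly h s" "poly h s \<le> 3 ^ K * loc m s" if s: "\<bar>s\<bar> \<le> 1" for s
    proof -
      define q where "q = poly (chebq m (1 + 1 / (real m)\<^sup>2)) s"
      define u where "u = 1 / (1 + (real m)\<^sup>2 * (1 - s))"
      have u: "0 \<le> u" using loc_base[OF s, of m] by (simp add: u_def)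
      have q: "(real m)\<^sup>2 * u / 2 \<le> q" "q \<le> 3 / 2 * ((real m)\<^sup>2 * u)" using chebq_loc[OF m s] by (auto simp: q_def u_def)
      have b: "u \<le> 2 / (real m)\<^sup>2 * q" "2 / (real m)\<^sup>2 * q \<le> 3 * u" using q m by (auto simp: field_simps)
      have 0: "0 \<le> 2 / (real m)\<^sup>2 * q" using u b(1) by (rule order_trans)
      show "loc m s \<le> poly h s" "poly h s \<le> 3 ^ K * loc m s"
        unfolding h_def loc_def poly_power poly_smult q_def[symmetric] u_def[symmetric] power_mult_distrib[where a = 3 and b = u, symmetric]
        using power_mono[OF b(1) u, of K] power_mono[OF b(2) 0, of K] by auto
    qed
    have hm: "poly h \<in> borel_measurable borel" by (intro borel_measurable_continuous_onI continuous_intros)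
    have hB: "\<bar>poly h s\<bar> \<le> 3 ^ K" if s: "\<bar>s\<bar> \<le> 1" for s
    proof -
      have "3 ^ K * loc m s \<le> 3 ^ K" using loc_bounds(2)[OF s] by simp
      then show ?thesis using hb[OF s] loc_bounds(1)[OF s, of m] by linarith
    qed
    have k1: "kav (loc n) \<omega> y \<le> 4 ^ K * kpol h \<omega> y" if \<omega>: "\<omega> \<in> cball 0 1" for \<omega>
    proof -
      have "kav (loc n) \<omega> y \<le> kav (\<lambda>s. 4 ^ K * poly h s) \<omega> y"
      proof (rule kav_mono[OF loc_measurable loc_bounds(3) _ _ _ \<omega> y])
        show "(\<lambda>s. 4 ^ K * poly h s) \<in> borel_measurable borel" using hm by measurable
        show "\<bar>4 ^ K * poly h s\<bar> \<le> 4 ^ K * 3 ^ K" if "\<bar>s\<bar> \<le> 1" for s using hB[OF that] by (simp add: abs_mult)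
        show "loc n s \<le> 4 ^ K * poly h s" if s: "\<bar>s\<bar> \<le> 1" for s
        proof -
          \<comment> \<open>m may exceed n, but not 2 L and so not 2 n; this is the origin of 4 ^
            K.\<close>
          have "(real m)\<^sup>2 \<le> (2 * real n)\<^sup>2" using m2 n by (intro power_mono) auto
          then have "loc n s \<le> 4 ^ K * loc m s" using s by (intro loc_mono) (auto simp: power_mult_distrib)
          also have "\<dots> \<le> 4 ^ K * poly h s" using hb(1)[OF s] by simp
          finally show ?thesis .
        qed
      qed
      then show ?thesis by (simp add: kav_cmult kav_poly[OF \<omega> y])
    qed
    have "(\<Sum>\<omega>\<in>\<Lambda>. w \<omega> * kav (loc n) \<omega> y) \<le> (\<Sum>\<omega>\<in>\<Lambda>. w \<omega> * (4 ^ K * kpol h \<omega> y))"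
      using k1 \<Lambda> w by (intro sum_mono mult_left_mono) (auto intro: less_imp_le)
    also have "\<dots> = 4 ^ K * (\<Sum>\<omega>\<in>\<Lambda>. w \<omega> * kpol h y \<omega>)"
      by (simp add: sum_distrib_left kpol_commute[of _ y] mult_ac)
    also have "(\<Sum>\<omega>\<in>\<Lambda>. w \<omega> * kpol h y \<omega>) = (\<integral>x. kpol h y x \<partial>M)" using ex[OF kpol_poly_space[OF dh]] by simp
    also have "(\<integral>x. kpol h y x \<partial>M) \<le> 3 ^ K * (2 powr (\<kappa> + 1) * real m powr (- D))"
    proof -
      have kp: "0 \<le> kpol h y x" "kpol h y x \<le> 3 ^ K * kav (loc m) y x" if x: "x \<in> cball 0 1" for x
      proof -
        have hp: "0 \<le> poly h s" if "\<bar>s\<bar> \<le> 1" for s using hb(1)[OF that] loc_bounds(1)[OF that, of m] by simp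
        show "0 \<le> kpol h y x" using kav_nonneg[of "poly h", OF hp y x] by (simp add: kav_poly[OF y x])
        have "kav (poly h) y x \<le> kav (\<lambda>s. 3 ^ K * loc m s) y x"
        proof (rule kav_mono[OF hm hB _ _ _ y x])
          show "\<bar>3 ^ K * loc m s\<bar> \<le> 3 ^ K * 1" if "\<bar>s\<bar> \<le> 1" for s using loc_bounds(3)[OF that] by (simp add: abs_mult)
        qed (use hb(2) in auto)
        then show "kpol h y x \<le> 3 ^ K * kav (loc m) y x" by (simp add: kav_cmult kav_poly[OF y x])
      qed
      have "ennreal (\<integral>x. kpol h y x \<partial>M) = (\<integral>\<^sup>+x. ennreal (kpol h y x) \<partial>M)"
        using kp(1) by (intro nn_integral_eq_integral[symmetric] integrable_poly[OF kpol_poly_space[OF order_refl]] AE_I2) auto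
      also have "\<dots> \<le> (\<integral>\<^sup>+x. ennreal (3 ^ K) * ennreal (kav (loc m) y x) \<partial>M)"
        using kp(2) kav_loc_bounds(1)[OF y] by (intro nn_integral_mono) (auto simp: ennreal_mult[symmetric] intro!: ennreal_leI)
      also have "\<dots> = ennreal (3 ^ K) * (\<integral>\<^sup>+x. ennreal (kav (loc m) y x) \<partial>M)"
        by (rule nn_integral_cmult) (use kav_measurable_M(1)[OF loc_measurable] in measurable)
      also have "\<dots> \<le> ennreal (3 ^ K) * ennreal (2 powr (\<kappa> + 1) * real m powr (- D))"
        by (intro mult_left_mono kav_loc_mass m y) simp
      also have "\<dots> = ennreal (3 ^ K * (2 powr (\<kappa> + 1) * real m powr (- D)))" by (simp add: ennreal_mult)
      finally show ?thesis by (subst (asm) ennreal_le_iff) auto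
    qed
    also have "real m powr (- D) \<le> (real L / real K) powr (- D)"
    proof (rule powr_mono2')
      have "real L \<le> real (m * K)" using mK(2) by (rule of_nat_mono)
      then show "real L / real K \<le> real m" using K0 by (simp add: divide_le_eq)
    qed (use L K0 D_ge_1 in auto)
    also have "4 ^ K * (3 ^ K * (2 powr (\<kappa> + 1) * (real L / real K) powr (- D))) = C * real L powr (- D)"
    proof -
      have "(real L / real K) powr (- D) = real K powr D * real L powr (- D)"
        unfolding powr_minus_divide by (simp add: powr_divide)
      moreover have "4 ^ K * 3 ^ K = (12 :: real) ^ K" by (simp add: power_mult_distrib[symmetric])
      ultimately show ?thesis by (simp add: C_def)
    qed
    finally show ?thesis by simp
  qed
  moreover have "0 < C" using K_ge by (simp add: C_def)
  ultimately show ?thesis by blast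
qed

text \<open>The local bound is summed over the nodes and \<open>quad_loc_sum\<close> is used under
  the integral; n^D from the kernel and L^(-D) from the nodes give the ratio. The maximum with 1
  lets a plain factor C be absorbed into a p-th power.\<close>

lemma marcinkiewicz_zygmund:
  "\<exists>A>0. \<forall>L \<Lambda> w n P p. quad L \<Lambda> w \<longrightarrow> L \<le> n \<longrightarrow> P \<in> poly_space n \<longrightarrow> 1 \<le> p \<longrightarrow>
     (\<Sum>\<omega>\<in>\<Lambda>. ennreal (w \<omega> * \<bar>P \<omega>\<bar> powr p)) \<le> ennreal (A powr p * (real n / real L) powr D) * (\<integral>\<^sup>+y. ennreal (\<bar>P y\<bar> powr p) \<partial>M)"
proof -
  obtain A where A: "0 < A" "\<And>n P x p. 1 \<le> n \<Longrightarrow> P \<in> poly_space n \<Longrightarrow> x \<in> cball 0 1 \<Longrightarrow> 1 \<le> p \<Longrightarrow>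
     ennreal (\<bar>P x\<bar> powr p) \<le> ennreal (A powr (p - 1)) * (\<integral>\<^sup>+y. ennreal (A * real n powr D * kav (loc n) x y * \<bar>P y\<bar> powr p) \<partial>M)"
    using poly_local_bound by blast
  obtain C where C: "0 < C" "\<And>L \<Lambda> w n y. quad L \<Lambda> w \<Longrightarrow> L \<le> n \<Longrightarrow> y \<in> cball 0 1 \<Longrightarrow>
     (\<Sum>\<omega>\<in>\<Lambda>. w \<omega> * kav (loc n) \<omega> y) \<le> C * real L powr (- D)"
    using quad_loc_sum by blast
  define B where "B = A * max 1 C"
  have B: "0 < B" using A C by (simp add: B_def)
  have "(\<Sum>\<omega>\<in>\<Lambda>. ennreal (w \<omega> * \<bar>P \<omega>\<bar> powr p)) \<le> ennreal (B powr p * (real n / real L) powr D) * (\<integral>\<^sup>+y. ennreal (\<bar>P y\<bar> powr p) \<partial>M)"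
    if Q: "quad L \<Lambda> w" and n: "L \<le> n" and P: "P \<in> poly_space n" and p: "1 \<le> p" for L \<Lambda> w n P p
  proof -
    have L: "1 \<le> L" and \<Lambda>: "\<Lambda> \<subseteq> cball 0 1" and w: "\<And>\<omega>. \<omega> \<in> \<Lambda> \<Longrightarrow> 0 < w \<omega>"
      using Q by (auto simp: quad_def)
    have n1: "1 \<le> n" using L n by simp
    have [measurable]: "P \<in> borel_measurable M" using integrable_poly[OF P] by simp
    have [measurable]: "kav (loc n) x \<in> borel_measurable M" for x by (rule kav_measurable_M(1)[OF loc_measurable])
    define c where "c = A powr (p - 1) * A * real n powr D"
    have c: "0 \<le> c" using A(1) by (simp add: c_def)
    have "(\<Sum>\<omega>\<in>\<Lambda>. ennreal (w \<omega> * \<bar>P \<omega>\<bar> powr p)) \<le> (\<Sum>\<omega>\<in>\<Lambda>. \<integral>\<^sup>+y. ennreal (c * (w \<omega> * kav (loc n) \<omega> y) * \<bar>P y\<bar> powr p) \<partial>M)"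
    proof (rule sum_mono)
      fix \<omega> assume \<omega>: "\<omega> \<in> \<Lambda>"
      then have \<omega>c: "\<omega> \<in> cball 0 1" using \<Lambda> by blast
      have "ennreal (w \<omega> * \<bar>P \<omega>\<bar> powr p) = ennreal (w \<omega>) * ennreal (\<bar>P \<omega>\<bar> powr p)"
        using w[OF \<omega>] by (simp add: ennreal_mult)
      also have "\<dots> \<le> ennreal (w \<omega>) * (ennreal (A powr (p - 1)) * (\<integral>\<^sup>+y. ennreal (A * real n powr D * kav (loc n) \<omega> y * \<bar>P y\<bar> powr p) \<partial>M))"
        by (intro mult_left_mono A(2)[OF n1 P \<omega>c p]) simp
      also have "\<dots> = (\<integral>\<^sup>+y. ennreal (w \<omega> * A powr (p - 1)) * ennreal (A * real n powr D * kav (loc n) \<omega> y * \<bar>P y\<bar> powr p) \<partial>M)"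
        using w[OF \<omega>] by (subst nn_integral_cmult) (auto simp: ennreal_mult mult.assoc)
      also have "\<dots> = (\<integral>\<^sup>+y. ennreal (c * (w \<omega> * kav (loc n) \<omega> y) * \<bar>P y\<bar> powr p) \<partial>M)"
        using w[OF \<omega>] A(1) kav_loc_bounds(1)[OF \<omega>c]
        by (intro nn_integral_cong) (auto simp: ennreal_mult[symmetric] c_def mult_ac)
      finally show "ennreal (w \<omega> * \<bar>P \<omega>\<bar> powr p) \<le> (\<integral>\<^sup>+y. ennreal (c * (w \<omega> * kav (loc n) \<omega> y) * \<bar>P y\<bar> powr p) \<partial>M)" .
    qed
    also have "\<dots> = (\<integral>\<^sup>+y. (\<Sum>\<omega>\<in>\<Lambda>. ennreal (c * (w \<omega> * kav (loc n) \<omega> y) * \<bar>P y\<bar> powr p)) \<partial>M)"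
      by (rule nn_integral_sum[symmetric]) measurable
    also have "\<dots> \<le> (\<integral>\<^sup>+y. ennreal (c * (C * real L powr (- D))) * ennreal (\<bar>P y\<bar> powr p) \<partial>M)"
    proof (rule nn_integral_mono)
      fix y assume "y \<in> space M"
      then have y: "y \<in> cball 0 1" by simp
      have "(\<Sum>\<omega>\<in>\<Lambda>. ennreal (c * (w \<omega> * kav (loc n) \<omega> y) * \<bar>P y\<bar> powr p)) = ennreal (\<Sum>\<omega>\<in>\<Lambda>. c * (w \<omega> * kav (loc n) \<omega> y) * \<bar>P y\<bar> powr p)"
      proof (rule sum_ennreal)
        fix \<omega> assume \<omega>: "\<omega> \<in> \<Lambda>"
        then have \<omega>c: "\<omega> \<in> cball 0 1" using \<Lambda> by blast
        show "0 \<le> c * (w \<omega> * kav (loc n) \<omega> y) * \<bar>P y\<bar> powr p"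
          using c w[OF \<omega>] kav_loc_bounds(1)[OF \<omega>c y] by simp
      qed
      also have "(\<Sum>\<omega>\<in>\<Lambda>. c * (w \<omega> * kav (loc n) \<omega> y) * \<bar>P y\<bar> powr p) = c * (\<Sum>\<omega>\<in>\<Lambda>. w \<omega> * kav (loc n) \<omega> y) * \<bar>P y\<bar> powr p"
        by (simp add: sum_distrib_left sum_distrib_right)
      also have "ennreal \<dots> \<le> ennreal (c * (C * real L powr (- D)) * \<bar>P y\<bar> powr p)"
        using c C(2)[OF Q n y] by (intro ennreal_leI mult_right_mono mult_left_mono) auto
      finally show "(\<Sum>\<omega>\<in>\<Lambda>. ennreal (c * (w \<omega> * kav (loc n) \<omega> y) * \<bar>P y\<bar> powr p)) \<le> ennreal (c * (C * real L powr (- D))) * ennreal (\<bar>P y\<bar> powr p)"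
        using c C(1) by (simp add: ennreal_mult)
    qed
    also have "\<dots> = ennreal (c * (C * real L powr (- D))) * (\<integral>\<^sup>+y. ennreal (\<bar>P y\<bar> powr p) \<partial>M)"
      by (rule nn_integral_cmult) measurable
    also have "\<dots> \<le> ennreal (B powr p * (real n / real L) powr D) * (\<integral>\<^sup>+y. ennreal (\<bar>P y\<bar> powr p) \<partial>M)"
    proof (intro mult_right_mono ennreal_leI)
      have "c * (C * real L powr (- D)) = A powr p * C * (real n / real L) powr D"
        using A(1) L n1 by (simp add: c_def powr_diff powr_divide powr_minus_divide field_simps)
      also have "\<dots> \<le> A powr p * max 1 C powr p * (real n / real L) powr D"
        using powr_mono[of 1 p "max 1 C"] p by (intro mult_left_mono mult_right_mono) auto
      also have "A powr p * max 1 C powr p = B powr p" using A(1) by (simp add: B_def powr_mult)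
      finally show "c * (C * real L powr (- D)) \<le> B powr p * (real n / real L) powr D" .
    qed simp
    finally show ?thesis .
  qed
  then show ?thesis using B by blast
qed

end

section \<open>The main estimate\<close>

lemma enn2real_inverse_exponent:
  "enn2real (1 / \<infinity>) = 0" "1 \<le> p \<Longrightarrow> p \<noteq> \<infinity> \<Longrightarrow> enn2real (1 / p) = 1 / enn2real p"
proof -
  show "enn2real (1 / \<infinity>) = 0" by (simp add: divide_ennreal_def)
  assume p: "1 \<le> p" "p \<noteq> \<infinity>"
  then obtain s where s: "p = ennreal s" "0 \<le> s" by (cases p) auto
  have "1 \<le> s" using enn2real_ge_1[OF p] s by simp
  then have "1 / p = ennreal (1 / s)" using divide_ennreal[of 1 s] s by simp
  then show "enn2real (1 / p) = 1 / enn2real p" using s by simp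
qed

lemma enn2real_inverse_antimono:
  assumes "1 \<le> p" "p \<le> q"
  shows "enn2real (1 / q) \<le> enn2real (1 / p)"
proof (cases "q = \<infinity>")
  case True
  then show ?thesis by (simp add: enn2real_inverse_exponent)
next
  case False
  then have p: "p \<noteq> \<infinity>" using assms by (auto simp: top_unique)
  have "enn2real p \<le> enn2real q" using assms False by (intro enn2real_mono) (auto simp: less_top)
  then show ?thesis
    using enn2real_ge_1[OF assms(1) p] assms False p
    by (subst (1 2) enn2real_inverse_exponent) (auto simp: frac_le)
qed

lemma powr_le_cancel_base:
  fixes x y s :: real
  assumes "x powr s \<le> y powr s" "0 < s" "0 \<le> x" "0 \<le> y"
  shows "x \<le> y"
proof (rule ccontr)
  assume "\<not> x \<le> y"
  then have "y powr s < x powr s" using assms by (intro powr_less_mono2) auto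
  then show False using assms by simp
qed

text \<open>Jensen's inequality with constant weight 1 on a probability space.\<close>

lemma lpb_exponent:
  assumes M: "prob_space M" and q: "1 \<le> q" "q \<le> p" and X: "space M \<subseteq> X" and f: "lpb M X p f c"
  shows "lpb M X q f c"
proof (cases "q = \<infinity>")
  case True
  then show ?thesis using f q by (simp add: top_unique)
next
  case qfin: False
  interpret prob_space M by fact
  have c: "0 \<le> c" and [measurable]: "f \<in> borel_measurable M" using f by (auto simp: lpb_def)
  define t where "t = enn2real q"
  have t: "1 \<le> t" using enn2real_ge_1[OF q(1) qfin] by (simp add: t_def)
  have "(\<integral>\<^sup>+x. ennreal (\<bar>f x\<bar> powr t) \<partial>M) \<le> ennreal (c powr t)"
  proof (cases "p = \<infinity>")
    case True
    have "(\<integral>\<^sup>+x. ennreal (\<bar>f x\<bar> powr t) \<partial>M) \<le> (\<integral>\<^sup>+x. ennreal (c powr t) \<partial>M)"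
      using f True X t by (intro nn_integral_mono ennreal_leI powr_mono2) (auto simp: lpb_def)
    then show ?thesis by (simp add: emeasure_space_1)
  next
    case False
    define s where "s = enn2real p"
    have ts: "t \<le> s" using q False unfolding s_def t_def by (intro enn2real_mono) (auto simp: less_top)
    have fs: "(\<integral>\<^sup>+x. ennreal (\<bar>f x\<bar> powr s) \<partial>M) \<le> ennreal (c powr s)" using f False by (simp add: lpb_def s_def)
    show ?thesis
    proof (rule ccontr)
      assume "\<not> ?thesis"
      then have "ennreal (c powr t) < (\<integral>\<^sup>+x. ennreal (\<bar>f x\<bar> powr t) \<partial>M)" by (simp only: not_le)
      \<comment> \<open>The integral of the power t might be infinite a priori, so Jensen is applied
        to a finite T strictly between the claimed bound and the integral.\<close>
      from dense[OF this] obtain z where z: "ennreal (c powr t) < z" "z < (\<integral>\<^sup>+x. ennreal (\<bar>f x\<bar> powr t) \<partial>M)" by blast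
      then obtain T where T: "z = ennreal T" "0 \<le> T" by (cases z) auto
      have "ennreal (T powr (s / t)) \<le> ennreal (1 powr (s / t - 1)) * (\<integral>\<^sup>+x. ennreal (1 * (\<bar>f x\<bar> powr t) powr (s / t)) \<partial>M)"
        by (rule jensen_nn) (use z(2) T t ts in \<open>auto simp: emeasure_space_1 intro: less_imp_le\<close>)
      also have "\<dots> \<le> ennreal (c powr s)" using fs t by (simp add: powr_powr)
      finally have "T powr (s / t) \<le> (c powr t) powr (s / t)" using t by (simp add: powr_powr)
      then have "T \<le> c powr t" by (rule powr_le_cancel_base) (use T t ts in auto)
      then show False using z(1) T by (simp add: ennreal_less_iff)
    qed
  qed
  then show ?thesis using qfin c by (simp add: lpb_def t_def)
qed

text \<open>For finite exponents a and b, |f|^b is |f|^a times at most (t c)^(b - a). For q =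
  \<infinity> the quotient in the exponent is 0, even when it reads 0 / 0, so t has exponent 1 and
  the sup bound results.\<close>

lemma lpb_interpolate:
  assumes p: "1 \<le> p" "p \<le> q" and f: "lpb M X p f c" and X: "space M \<subseteq> X" and S: "\<And>x. x \<in> X \<Longrightarrow> \<bar>f x\<bar> \<le> t * c" and t: "1 \<le> t"
  shows "lpb M X q f (t powr (1 - enn2real (1 / q) / enn2real (1 / p)) * c)"
proof (cases "q = \<infinity>")
  case True
  then show ?thesis using f S t by (auto simp: lpb_def enn2real_inverse_exponent)
next
  case False
  then have pf: "p \<noteq> \<infinity>" using p by (auto simp: top_unique)
  have c: "0 \<le> c" and [measurable]: "f \<in> borel_measurable M" using f by (auto simp: lpb_def)
  define a b where "a = enn2real p" and "b = enn2real q"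
  have ab: "1 \<le> a" "a \<le> b"
    using enn2real_ge_1[OF p(1) pf] p False unfolding a_def b_def by (auto intro!: enn2real_mono simp: less_top)
  have e: "enn2real (1 / q) / enn2real (1 / p) = a / b"
    using p pf False order_trans[OF p] ab by (simp add: enn2real_inverse_exponent a_def b_def)
  have "(\<integral>\<^sup>+x. ennreal (\<bar>f x\<bar> powr b) \<partial>M) \<le> (\<integral>\<^sup>+x. ennreal ((t * c) powr (b - a)) * ennreal (\<bar>f x\<bar> powr a) \<partial>M)"
  proof (rule nn_integral_mono)
    fix x assume "x \<in> space M"
    then have "\<bar>f x\<bar> powr (b - a) \<le> (t * c) powr (b - a)" using S X ab by (intro powr_mono2) auto
    then have "\<bar>f x\<bar> powr (b - a) * \<bar>f x\<bar> powr a \<le> (t * c) powr (b - a) * \<bar>f x\<bar> powr a" by (rule mult_right_mono) simp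
    then show "ennreal (\<bar>f x\<bar> powr b) \<le> ennreal ((t * c) powr (b - a)) * ennreal (\<bar>f x\<bar> powr a)"
      unfolding powr_add[symmetric] by (simp add: ennreal_mult[symmetric] ennreal_leI)
  qed
  also have "\<dots> = ennreal ((t * c) powr (b - a)) * (\<integral>\<^sup>+x. ennreal (\<bar>f x\<bar> powr a) \<partial>M)" by (rule nn_integral_cmult) measurable
  also have "\<dots> \<le> ennreal ((t * c) powr (b - a)) * ennreal (c powr a)"
    using f pf by (intro mult_left_mono) (auto simp: lpb_def a_def)
  also have "\<dots> = ennreal ((t powr (1 - a / b) * c) powr b)"
  proof -
    have "(t powr (1 - a / b) * c) powr b = t powr (b - a) * (c powr (b - a) * c powr a)"
      unfolding powr_add[symmetric] using t c ab by (simp add: powr_mult powr_powr left_diff_distrib)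
    then show ?thesis using t c by (simp add: ennreal_mult[symmetric] powr_mult)
  qed
  finally show ?thesis using False c t unfolding e by (simp add: lpb_def b_def)
qed

context ball_setting
begin

lemma lpb_lp_norm:
  fixes f :: "real ^ 'n \<Rightarrow> real"
  assumes p: "1 \<le> p" and f: "f \<in> lp_space \<mu> p"
  shows "lpb M (cball 0 1) p f (lp_norm \<mu> p f)"
proof (cases "p = \<infinity>")
  case True
  then have c: "continuous_on (cball 0 1) f" using f by (simp add: lp_space_def)
  have "compact ((\<lambda>x. \<bar>f x\<bar>) ` cball 0 1)" by (intro compact_continuous_image continuous_intros c) simp
  then have bdd: "bdd_above ((\<lambda>x. \<bar>f x\<bar>) ` cball 0 1)" by (rule bounded_imp_bdd_above[OF compact_imp_bounded])
  have le: "\<bar>f x\<bar> \<le> lp_norm \<mu> p f" if "x \<in> cball 0 1" for x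
    unfolding lp_norm_def using True by (simp add: cSUP_upper[OF that bdd])
  moreover have "0 \<le> lp_norm \<mu> p f" using order_trans[OF abs_ge_zero le[of 0]] by simp
  ultimately show ?thesis using True continuous_ball_measure[OF c] by (simp add: lpb_def)
next
  case False
  define s where "s = enn2real p"
  have s: "1 \<le> s" using enn2real_ge_1[OF p False] by (simp add: s_def)
  have fm: "f \<in> borel_measurable M" and fi: "integrable M (\<lambda>x. \<bar>f x\<bar> powr s)"
    using f False by (auto simp: lp_space_def s_def)
  define I where "I = (\<integral>x. \<bar>f x\<bar> powr s \<partial>M)"
  have I: "0 \<le> I" unfolding I_def by (rule Bochner_Integration.integral_nonneg) simp
  have "(\<integral>\<^sup>+x. ennreal (\<bar>f x\<bar> powr s) \<partial>M) = ennreal I"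
    unfolding I_def by (rule nn_integral_eq_integral[OF fi]) simp
  moreover have "(I powr (1 / s)) powr s = I" using I s by (simp add: powr_powr)
  ultimately show ?thesis using False fm by (simp add: lpb_def lp_norm_def s_def[symmetric] I_def[symmetric])
qed

lemma lp_norm_nonneg:
  fixes f :: "real ^ 'n \<Rightarrow> real"
  shows "1 \<le> p \<Longrightarrow> f \<in> lp_space \<mu> p \<Longrightarrow> 0 \<le> lp_norm \<mu> p f"
  using lpb_nonneg[OF lpb_lp_norm] by blast

lemma lp_norm_le:
  fixes f :: "real ^ 'n \<Rightarrow> real"
  assumes p: "1 \<le> p" and f: "lpb M (cball 0 1) p f c"
  shows "lp_norm \<mu> p f \<le> c"
proof (cases "p = \<infinity>")
  case True
  then show ?thesis unfolding lp_norm_def using f by (auto simp: lpb_def intro!: cSUP_least)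
next
  case False
  define s where "s = enn2real p"
  have s: "1 \<le> s" using enn2real_ge_1[OF p False] by (simp add: s_def)
  have c: "0 \<le> c" and [measurable]: "f \<in> borel_measurable M"
    and b: "(\<integral>\<^sup>+x. ennreal (\<bar>f x\<bar> powr s) \<partial>M) \<le> ennreal (c powr s)" using f False by (auto simp: lpb_def s_def)
  have "(\<integral>x. \<bar>f x\<bar> powr s \<partial>M) = enn2real (\<integral>\<^sup>+x. ennreal (\<bar>f x\<bar> powr s) \<partial>M)"
    by (rule integral_eq_nn_integral) auto
  also have "\<dots> \<le> c powr s" using enn2real_mono[OF b] by simp
  finally have "(\<integral>x. \<bar>f x\<bar> powr s \<partial>M) powr (1 / s) \<le> (c powr s) powr (1 / s)"
    using s by (intro powr_mono2 Bochner_Integration.integral_nonneg) auto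
  also have "\<dots> = c" using s c by (simp add: powr_powr)
  finally show ?thesis using False by (simp add: lp_norm_def s_def)
qed

lemma lp_space_continuous:
  fixes f :: "real ^ 'n \<Rightarrow> real"
  assumes p: "1 \<le> p" and f: "continuous_on (cball 0 1) f"
  shows "f \<in> lp_space \<mu> p"
proof (cases "p = \<infinity>")
  case True
  then show ?thesis using f by (simp add: lp_space_def)
next
  case False
  have "1 \<le> enn2real p" using enn2real_ge_1[OF p False] .
  then have "continuous_on (cball 0 1) (\<lambda>x. \<bar>f x\<bar> powr enn2real p)"
    by (intro continuous_on_powr' continuous_intros f) auto
  then show ?thesis using False continuous_ball_measure[OF f] integrable_continuous by (simp add: lp_space_def)
qed

lemma lp_space_diff_poly:
  fixes f :: "real ^ 'n \<Rightarrow> real"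
  assumes p: "1 \<le> p" and f: "f \<in> lp_space \<mu> p" and P: "P \<in> poly_space n"
  shows "(\<lambda>x. f x - P x) \<in> lp_space \<mu> p"
proof (cases "p = \<infinity>")
  case True
  then show ?thesis using f poly_space_continuous[OF P] by (simp add: lp_space_def continuous_on_diff)
next
  case False
  have "lpb M (cball 0 1) p (\<lambda>x. f x - P x) (4 * (lp_norm \<mu> p f + lp_norm \<mu> p P))"
    by (intro lpb_diff p lpb_lp_norm f lp_space_continuous poly_space_continuous[OF P])
  then have m [measurable]: "(\<lambda>x. f x - P x) \<in> borel_measurable M"
    and "(\<integral>\<^sup>+x. ennreal (\<bar>f x - P x\<bar> powr enn2real p) \<partial>M) < \<infinity>"
    using False by (auto simp: lpb_def intro: le_less_trans)
  then have "integrable M (\<lambda>x. \<bar>f x - P x\<bar> powr enn2real p)" by (intro integrableI_nonneg) auto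
  then show ?thesis using False m by (simp add: lp_space_def)
qed

lemma poly_sup_bound:
  assumes p: "1 \<le> p"
  shows "\<exists>A\<ge>1. \<forall>n\<ge>1. \<forall>P\<in>poly_space n. \<forall>c. lpb M (cball 0 1) p P c \<longrightarrow>
    (\<forall>x\<in>cball 0 1. \<bar>P x\<bar> \<le> A * real n powr (D * enn2real (1 / p)) * c)"
proof (cases "p = \<infinity>")
  case True
  then show ?thesis by (intro exI[of _ 1]) (auto simp: lpb_def enn2real_inverse_exponent)
next
  case False
  obtain A where A: "0 < A" "\<And>n P x p. 1 \<le> n \<Longrightarrow> P \<in> poly_space n \<Longrightarrow> x \<in> cball 0 1 \<Longrightarrow> 1 \<le> p \<Longrightarrow>
     ennreal (\<bar>P x\<bar> powr p) \<le> ennreal (A powr p * real n powr D) * (\<integral>\<^sup>+y. ennreal (\<bar>P y\<bar> powr p) \<partial>M)"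
    using nikolskii by blast
  define s where "s = enn2real p"
  have s: "1 \<le> s" using enn2real_ge_1[OF p False] by (simp add: s_def)
  have "\<bar>P x\<bar> \<le> max 1 A * real n powr (D * enn2real (1 / p)) * c"
    if n: "1 \<le> n" and P: "P \<in> poly_space n" and x: "x \<in> cball 0 1" and c: "lpb M (cball 0 1) p P c" for n P x c
  proof -
    have c0: "0 \<le> c" using lpb_nonneg[OF c] .
    have "ennreal (\<bar>P x\<bar> powr s) \<le> ennreal (A powr s * real n powr D) * ennreal (c powr s)"
      by (rule order_trans[OF A(2)[OF n P x s] mult_left_mono]) (use c False in \<open>auto simp: lpb_def s_def\<close>)
    then have "\<bar>P x\<bar> powr s \<le> A powr s * real n powr D * c powr s" by (simp add: ennreal_mult[symmetric])
    also have "\<dots> = (A * real n powr (D / s) * c) powr s" using A(1) c0 s by (simp add: powr_mult powr_powr)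
    finally have "\<bar>P x\<bar> \<le> A * real n powr (D / s) * c" by (rule powr_le_cancel_base) (use s A(1) c0 in auto)
    also have "\<dots> \<le> max 1 A * real n powr (D / s) * c" using c0 by (intro mult_right_mono) auto
    finally show ?thesis using enn2real_inverse_exponent(2)[OF p False] by (simp add: s_def)
  qed
  then show ?thesis by (intro exI[of _ "max 1 A"]) auto
qed

text \<open>Interpolation between the given bound and Nikolskii's sup bound. With A at least 1 the
  interpolated power of A is at most A.\<close>

lemma poly_norm_change:
  assumes p: "1 \<le> p" "p \<le> q"
  shows "\<exists>A\<ge>1. \<forall>n\<ge>1. \<forall>P\<in>poly_space n. \<forall>c. lpb M (cball 0 1) p P c \<longrightarrow>
    lpb M (cball 0 1) q P (A * real n powr (D * (enn2real (1 / p) - enn2real (1 / q))) * c)"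
proof -
  obtain A where A: "1 \<le> A" "\<And>n P c x. 1 \<le> n \<Longrightarrow> P \<in> poly_space n \<Longrightarrow> lpb M (cball 0 1) p P c \<Longrightarrow> x \<in> cball 0 1 \<Longrightarrow>
    \<bar>P x\<bar> \<le> A * real n powr (D * enn2real (1 / p)) * c" using poly_sup_bound[OF p(1)] by blast
  define a b where "a = enn2real (1 / p)" and "b = enn2real (1 / q)"
  have ab: "0 \<le> b" "b \<le> a" using enn2real_inverse_antimono[OF p] by (auto simp: a_def b_def)
  have "lpb M (cball 0 1) q P (A * real n powr (D * (a - b)) * c)"
    if n: "1 \<le> n" and P: "P \<in> poly_space n" and c: "lpb M (cball 0 1) p P c" for n P c
  proof -
    define t where "t = A * real n powr (D * a)"
    have "1 \<le> real n powr (D * a)" using n ab D_ge_1 by (intro ge_one_powr_ge_zero) auto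
    then have t: "1 \<le> t" using A(1) mult_mono[of 1 A 1 "real n powr (D * a)"] by (simp add: t_def)
    have "lpb M (cball 0 1) q P (t powr (1 - b / a) * c)"
      unfolding a_def b_def by (rule lpb_interpolate[OF p c _ _ t]) (use A(2)[OF n P c] in \<open>auto simp: t_def a_def\<close>)
    moreover have "t powr (1 - b / a) \<le> A * real n powr (D * (a - b))"
    proof -
      have "A powr (1 - b / a) \<le> A powr 1" using A(1) ab by (intro powr_mono) auto
      moreover have "a * (1 - b / a) = a - b" using ab by (cases "a = 0") (auto simp: field_simps)
      then have e: "D * a * (1 - b / a) = D * (a - b)" by (simp only: mult.assoc)
      ultimately show ?thesis
        using A(1) unfolding t_def by (simp add: powr_mult powr_powr e mult_right_mono)
    qed
    ultimately show ?thesis using lpb_nonneg[OF c] by (auto intro: lpb_mono mult_right_mono)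
  qed
  then show ?thesis using A(1) unfolding a_def b_def by blast
qed

text \<open>The quadrature rule as a measure, so that \<open>lpb\<close>, Schur's test and the
  summation of series apply to discrete norms unchanged.\<close>

abbreviation qm :: "(real ^ 'n) set \<Rightarrow> (real ^ 'n \<Rightarrow> real) \<Rightarrow> (real ^ 'n) measure" where
  "qm \<Lambda> w \<equiv> point_measure \<Lambda> (\<lambda>\<omega>. ennreal (w \<omega>))"

lemma poly_norm_qm:
  assumes q: "1 \<le> q"
  shows "\<exists>A\<ge>1. \<forall>L \<Lambda> w n P c. quad L \<Lambda> w \<longrightarrow> L \<le> n \<longrightarrow> P \<in> poly_space n \<longrightarrow> lpb M (cball 0 1) q P c \<longrightarrow>
    lpb (qm \<Lambda> w) \<Lambda> q P (A * (real n / real L) powr (D * enn2real (1 / q)) * c)"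
proof (cases "q = \<infinity>")
  case True
  have "lpb (qm \<Lambda> w) \<Lambda> q P (1 * (real n / real L) powr (D * enn2real (1 / q)) * c)"
    if "quad L \<Lambda> w" "L \<le> n" "lpb M (cball 0 1) q P c" for L \<Lambda> w n P c
    using that True by (auto simp: lpb_def quad_def enn2real_inverse_exponent measurable_point_measure_eq1)
  then show ?thesis by (intro exI[of _ 1]) auto
next
  case False
  obtain A where A: "0 < A" "\<And>L \<Lambda> w n P p. quad L \<Lambda> w \<Longrightarrow> L \<le> n \<Longrightarrow> P \<in> poly_space n \<Longrightarrow> 1 \<le> p \<Longrightarrow>
     (\<Sum>\<omega>\<in>\<Lambda>. ennreal (w \<omega> * \<bar>P \<omega>\<bar> powr p)) \<le> ennreal (A powr p * (real n / real L) powr D) * (\<integral>\<^sup>+y. ennreal (\<bar>P y\<bar> powr p) \<partial>M)"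
    using marcinkiewicz_zygmund by blast
  define s where "s = enn2real q"
  have s: "1 \<le> s" using enn2real_ge_1[OF q False] by (simp add: s_def)
  have "lpb (qm \<Lambda> w) \<Lambda> q P (max 1 A * (real n / real L) powr (D * enn2real (1 / q)) * c)"
    if Q: "quad L \<Lambda> w" and n: "L \<le> n" and P: "P \<in> poly_space n" and c: "lpb M (cball 0 1) q P c" for L \<Lambda> w n P c
  proof -
    have c0: "0 \<le> c" using lpb_nonneg[OF c] .
    have fin: "finite \<Lambda>" and w: "\<And>\<omega>. \<omega> \<in> \<Lambda> \<Longrightarrow> 0 < w \<omega>" using Q by (auto simp: quad_def)
    have "(\<integral>\<^sup>+\<omega>. ennreal (\<bar>P \<omega>\<bar> powr s) \<partial>qm \<Lambda> w) = (\<Sum>\<omega>\<in>\<Lambda>. ennreal (w \<omega> * \<bar>P \<omega>\<bar> powr s))"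
      using fin w by (simp add: nn_integral_point_measure_finite ennreal_mult less_imp_le)
    also have "\<dots> \<le> ennreal (A powr s * (real n / real L) powr D) * ennreal (c powr s)"
      by (rule order_trans[OF A(2)[OF Q n P s] mult_left_mono]) (use c False in \<open>auto simp: lpb_def s_def\<close>)
    also have "\<dots> = ennreal ((A * (real n / real L) powr (D / s) * c) powr s)"
      using A(1) c0 s by (simp add: powr_mult powr_powr ennreal_mult[symmetric])
    also have "\<dots> \<le> ennreal ((max 1 A * (real n / real L) powr (D / s) * c) powr s)"
      using A(1) c0 s by (intro ennreal_leI powr_mono2 mult_right_mono) auto
    finally show ?thesis
      using enn2real_inverse_exponent(2)[OF q False] False c0 by (simp add: lpb_def s_def measurable_point_measure_eq1)
  qed
  then show ?thesis by (intro exI[of _ "max 1 A"]) auto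
qed

end

section \<open>The filtered operators\<close>

locale filter_setting = ball_setting \<mu> \<kappa> dim_type for \<mu> \<kappa> and dim_type :: "'n::finite itself" +
  fixes \<eta> :: "real \<Rightarrow> real" and B\<^sub>0 :: real
  assumes eta: "\<And>t. 0 \<le> t \<Longrightarrow> indicator {0..1} t \<le> \<eta> t \<and> \<eta> t \<le> indicator {0..2} t"
    and kernel_L1: "\<And>L x. 1 \<le> L \<Longrightarrow> x \<in> cball (0 :: real ^ 'n) 1 \<Longrightarrow> lp_norm \<mu> 1 (filter_kernel \<mu> \<eta> L x) \<le> B\<^sub>0"
begin

abbreviation fk :: "nat \<Rightarrow> real ^ 'n \<Rightarrow> real ^ 'n \<Rightarrow> real" where "fk \<equiv> filter_kernel \<mu> \<eta>"

lemma eta_one: "0 \<le> t \<Longrightarrow> t \<le> 1 \<Longrightarrow> \<eta> t = 1"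
  using eta[of t] by (auto simp: indicator_def split: if_splits)

lemma eta_zero: "2 < t \<Longrightarrow> \<eta> t = 0"
  using eta[of t] by (auto simp: indicator_def split: if_splits)

text \<open>The filter cuts the series off beyond 2 L. A kernel of degree 2 L times a polynomial of
  degree L is just within the exactness degree 3 L of the rule.\<close>

lemma fk_eq:
  assumes "1 \<le> L"
  shows "fk L x y = (\<Sum>k\<le>2 * L. \<eta> (real k / real L) * (\<Sum>b\<in>bas k. b x * b y))"
  unfolding filter_kernel_def repr_kernel_eq
proof (rule suminf_finite)
  fix k assume "k \<notin> {..2 * L}"
  then have "2 * real L < real k" by auto
  then have "2 < real k / real L" using assms by (simp add: field_simps)
  then show "\<eta> (real k / real L) * (\<Sum>b\<in>bas k. b x * b y) = 0" by (simp add: eta_zero)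
qed simp

lemma fk_commute: "1 \<le> L \<Longrightarrow> fk L x y = fk L y x" by (simp add: fk_eq mult.commute)

lemma fk_poly:
  assumes "1 \<le> L"
  shows "fk L x \<in> poly_space (2 * L)"
proof -
  have "fk L x = (\<lambda>y. \<Sum>k\<le>2 * L. \<eta> (real k / real L) * (\<Sum>b\<in>bas k. b x * b y))"
    by (rule ext) (rule fk_eq[OF assms])
  then show ?thesis
    by (simp only:) (intro poly_space_sum poly_space_cmult poly_space_mono[OF _ bas_poly], auto)
qed

lemma bas_borel: "b \<in> bas k \<Longrightarrow> b \<in> borel_measurable borel"
  using poly_space_borel bas_poly by blast

lemma fk_integral_abs:
  assumes L: "1 \<le> L" and x: "x \<in> cball 0 1"
  shows "(\<integral>\<^sup>+y. ennreal \<bar>fk L x y\<bar> \<partial>M) \<le> ennreal B\<^sub>0"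
proof -
  have "lpb M (cball 0 1) 1 (fk L x) (lp_norm \<mu> 1 (fk L x))"
    by (intro lpb_lp_norm lp_space_continuous poly_space_continuous[OF fk_poly[OF L]]) auto
  then have *: "lpb M (cball 0 1) 1 (fk L x) B\<^sub>0" using kernel_L1[OF L x] by (rule lpb_mono)
  show ?thesis using * lpb_nonneg[OF *] by (simp add: lpb_def)
qed

definition B\<^sub>1 :: real where "B\<^sub>1 = max 1 B\<^sub>0"

lemma B1: "0 < B\<^sub>1" "B\<^sub>0 \<le> B\<^sub>1" by (auto simp: B\<^sub>1_def)

text \<open>The operator V_L of the filter, written on the projections, so that its values are
  polynomials for every f.\<close>

definition filt :: "nat \<Rightarrow> (real ^ 'n \<Rightarrow> real) \<Rightarrow> real ^ 'n \<Rightarrow> real" where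
  "filt L f x = (\<Sum>k\<le>2 * L. \<eta> (real k / real L) * pr k f x)"

lemma filt_poly: "filt L f \<in> poly_space (2 * L)"
  unfolding filt_def by (intro poly_space_sum poly_space_cmult poly_space_mono[OF _ pr_poly]) auto

lemma filt_integral:
  assumes L: "1 \<le> L" and f: "integrable M f"
  shows "filt L f x = (\<integral>y. f y * fk L x y \<partial>M)"
proof -
  have "(\<integral>y. f y * fk L x y \<partial>M) = (\<integral>y. (\<Sum>k\<le>2 * L. \<Sum>b\<in>bas k. (\<eta> (real k / real L) * b x) * (f y * b y)) \<partial>M)"
    by (simp add: fk_eq[OF L] sum_distrib_left mult_ac)
  also have "\<dots> = (\<Sum>k\<le>2 * L. \<Sum>b\<in>bas k. (\<eta> (real k / real L) * b x) * ip f b)"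
  proof -
    have "integrable M (\<lambda>y. c * (f y * b y))" if "b \<in> bas k" for b k c
      by (intro integrable_mult_right integrable_mult_poly[OF f bas_poly[OF that]])
    then show ?thesis
      by (simp add: ip_def Bochner_Integration.integral_sum Bochner_Integration.integrable_sum)
  qed
  finally show ?thesis by (simp add: filt_def pr_def sum_distrib_left mult_ac)
qed

lemma pr_high:
  assumes "P \<in> poly_space n" "n < k"
  shows "pr k P x = 0"
proof -
  have "ip P b = 0" if "b \<in> bas k" for b
    using bas_orth[OF that] assms ip_commute[of P b] by (auto simp: orth_poly_space_iff)
  then show ?thesis by (simp add: pr_def)
qed

lemma filt_reproduce:
  assumes L: "1 \<le> L" and P: "P \<in> poly_space L"
  shows "filt L P x = P x"
proof -
  have "filt L P x = (\<Sum>k\<le>2 * L. pr k P x)"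
    unfolding filt_def
  proof (rule sum.cong)
    show "\<eta> (real k / real L) * pr k P x = pr k P x" for k
      using pr_high[OF P, of k x] L by (cases "k \<le> L") (auto simp: eta_one divide_le_eq)
  qed simp
  also have "\<dots> = P x" using poly_sum_pr[OF poly_space_mono[OF _ P], of "2 * L" x] by simp
  finally show ?thesis .
qed

definition hyp :: "nat \<Rightarrow> (real ^ 'n) set \<Rightarrow> (real ^ 'n \<Rightarrow> real) \<Rightarrow> (real ^ 'n \<Rightarrow> real) \<Rightarrow> real ^ 'n \<Rightarrow> real" where
  "hyp L \<Lambda> w f x = (\<Sum>\<omega>\<in>\<Lambda>. w \<omega> * f \<omega> * fk L x \<omega>)"

text \<open>The product of P with the kernel has degree at most 3 L, so the quadrature sum is the
  integral, that is \<open>filt L P\<close>, which is P.\<close>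

lemma hyp_reproduce:
  assumes Q: "quad L \<Lambda> w" and P: "P \<in> poly_space L"
  shows "hyp L \<Lambda> w P x = P x"
proof -
  have L: "1 \<le> L" using Q by (simp add: quad_def)
  have "(\<lambda>y. P y * fk L x y) \<in> poly_space (L + 2 * L)" by (rule poly_space_mult[OF P fk_poly[OF L]])
  then have "(\<integral>y. P y * fk L x y \<partial>M) = (\<Sum>\<omega>\<in>\<Lambda>. w \<omega> * (P \<omega> * fk L x \<omega>))" using Q by (simp add: quad_def)
  then show ?thesis using filt_integral[OF L integrable_poly[OF P], of x] filt_reproduce[OF L P, of x]
    by (simp add: hyp_def mult.assoc)
qed

lemma hyp_diff: "hyp L \<Lambda> w (\<lambda>x. f x - g x) x = hyp L \<Lambda> w f x - hyp L \<Lambda> w g x"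
  by (simp add: hyp_def sum_subtractf[symmetric] algebra_simps)

lemma hyp_poly: "1 \<le> L \<Longrightarrow> hyp L \<Lambda> w f \<in> poly_space (2 * L)"
  unfolding hyp_def
  by (subst fk_commute) (auto intro!: poly_space_sum poly_space_cmult fk_poly)

lemma fk_measurable:
  assumes L: "1 \<le> L" and [measurable]: "(\<lambda>x. x) \<in> A \<rightarrow>\<^sub>M (borel :: (real ^ 'n) measure)" "(\<lambda>x. x) \<in> A' \<rightarrow>\<^sub>M (borel :: (real ^ 'n) measure)"
  shows "(\<lambda>(x, y). \<bar>fk L x y\<bar>) \<in> borel_measurable (A \<Otimes>\<^sub>M A')"
proof -
  have "(\<lambda>z. b (fst z) * b (snd z)) \<in> borel_measurable (A \<Otimes>\<^sub>M A')" if b: "b \<in> bas k" for b k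
  proof -
    have [measurable]: "b \<in> borel_measurable A" "b \<in> borel_measurable A'"
      using measurable_compose[OF assms(2) bas_borel[OF b]] measurable_compose[OF assms(3) bas_borel[OF b]] by auto
    then show ?thesis by measurable
  qed
  then show ?thesis unfolding fk_eq[OF L] case_prod_beta
    by (intro borel_measurable_abs borel_measurable_sum borel_measurable_times[OF borel_measurable_const])
qed

lemma fk_measurable1:
  assumes L: "1 \<le> L" and A: "(\<lambda>x. x) \<in> A \<rightarrow>\<^sub>M (borel :: (real ^ 'n) measure)"
  shows "(\<lambda>y. \<bar>fk L x y\<bar>) \<in> borel_measurable A"
  using measurable_compose[OF A poly_space_borel[OF fk_poly[OF L]]] by (rule borel_measurable_abs)

text \<open>Schur's test; the kernel is symmetric, so the assumed bound on its integrals gives both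
  marginals.\<close>

lemma filt_bound:
  assumes p: "1 \<le> p" and L: "1 \<le> L" and f: "lpb M (cball 0 1) p f c"
  shows "lpb M (cball 0 1) p (filt L f) (B\<^sub>1 * c)"
proof (rule lpb_schur[OF _ _ p _ _ fk_measurable[OF L id_measurable_M id_measurable_M] _ _ _ _ _ B1(1) f])
  have fi: "integrable M f"
  proof -
    have "lpb M (cball 0 1) 1 f c" by (rule lpb_exponent[OF prob_space_axioms _ p _ f]) auto
    then have [measurable]: "f \<in> borel_measurable M" and "(\<integral>\<^sup>+x. ennreal \<bar>f x\<bar> \<partial>M) < \<infinity>"
      by (auto simp: lpb_def intro: le_less_trans)
    then show ?thesis by (intro integrableI_bounded) auto
  qed
  show "ennreal \<bar>filt L f x\<bar> \<le> (\<integral>\<^sup>+y. ennreal (\<bar>fk L x y\<bar> * \<bar>f y\<bar>) \<partial>M)" for x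
    using integral_norm_bound_ennreal[OF integrable_mult_poly[OF fi fk_poly[OF L]], of x]
    by (simp add: filt_integral[OF L fi] abs_mult mult.commute)
  show "filt L f \<in> borel_measurable M" using integrable_poly[OF filt_poly] by simp
  show "(\<integral>\<^sup>+y. ennreal \<bar>fk L x y\<bar> \<partial>M) \<le> ennreal B\<^sub>1" if "x \<in> cball 0 1" for x
    using fk_integral_abs[OF L that] B1(2) by (auto intro: order_trans ennreal_leI)
  then show "(\<integral>\<^sup>+x. ennreal \<bar>fk L x y\<bar> \<partial>M) \<le> ennreal B\<^sub>1" if "y \<in> cball 0 1" for y
    using that by (simp add: fk_commute[OF L, of _ y])
  show "(\<lambda>x. \<bar>fk L x y\<bar>) \<in> borel_measurable M" for y
    using fk_measurable1[OF L id_measurable_M, of y] by (simp add: fk_commute[OF L, of y])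
qed (auto intro: sigma_finite_measure fk_measurable1[OF L id_measurable_M] sigma_finite_measure_axioms)

lemma sigma_finite_qm:
  assumes "quad L \<Lambda> w"
  shows "sigma_finite_measure (qm \<Lambda> w)"
proof (rule finite_measure.axioms(1), rule finite_measureI)
  have fin: "finite \<Lambda>" and w: "\<And>\<omega>. \<omega> \<in> \<Lambda> \<Longrightarrow> 0 < w \<omega>" using assms by (auto simp: quad_def)
  have "emeasure (qm \<Lambda> w) (space (qm \<Lambda> w)) = (\<Sum>\<omega>\<in>\<Lambda>. ennreal (w \<omega>))"
    using fin by (simp add: space_point_measure emeasure_point_measure_finite)
  also have "\<dots> = ennreal (\<Sum>\<omega>\<in>\<Lambda>. w \<omega>)" using w by (intro sum_ennreal) (auto simp: less_imp_le)
  finally show "emeasure (qm \<Lambda> w) (space (qm \<Lambda> w)) \<noteq> \<infinity>" by simp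
qed

text \<open>Schur's test between the quadrature measure and the ball. One marginal is the assumed
  integral bound; the other is a sum of the kernel over the nodes, controlled by
  Marcinkiewicz-Zygmund with p = 1 because the kernel is a polynomial of degree 2 L in the
  node.\<close>

lemma hyp_bound:
  assumes q: "1 \<le> q"
  shows "\<exists>A>0. \<forall>L \<Lambda> w f c. quad L \<Lambda> w \<longrightarrow> lpb (qm \<Lambda> w) \<Lambda> q f c \<longrightarrow> lpb M (cball 0 1) q (hyp L \<Lambda> w f) (A * c)"
proof -
  obtain A where A: "0 < A" "\<And>L \<Lambda> w n P p. quad L \<Lambda> w \<Longrightarrow> L \<le> n \<Longrightarrow> P \<in> poly_space n \<Longrightarrow> 1 \<le> p \<Longrightarrow>
     (\<Sum>\<omega>\<in>\<Lambda>. ennreal (w \<omega> * \<bar>P \<omega>\<bar> powr p)) \<le> ennreal (A powr p * (real n / real L) powr D) * (\<integral>\<^sup>+y. ennreal (\<bar>P y\<bar> powr p) \<partial>M)"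
    using marcinkiewicz_zygmund by blast
  define A' where "A' = max 1 (A * 2 powr D) * B\<^sub>1"
  have A': "0 < A'" "B\<^sub>1 \<le> A'" using B1 by (auto simp: A'_def)
  have "lpb M (cball 0 1) q (hyp L \<Lambda> w f) (A' * c)" if Q: "quad L \<Lambda> w" and f: "lpb (qm \<Lambda> w) \<Lambda> q f c" for L \<Lambda> w f c
  proof -
    have L: "1 \<le> L" and fin: "finite \<Lambda>" and w: "\<And>\<omega>. \<omega> \<in> \<Lambda> \<Longrightarrow> 0 < w \<omega>" and \<Lambda>: "\<Lambda> \<subseteq> cball 0 1" using Q by (auto simp: quad_def)
    have idq: "(\<lambda>x. x) \<in> qm \<Lambda> w \<rightarrow>\<^sub>M borel" by (simp add: measurable_point_measure_eq1)
    show ?thesis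
    proof (rule lpb_schur[OF _ _ q _ _ fk_measurable[OF L id_measurable_M idq] _ _ _ _ _ A'(1) f])
      show "sigma_finite_measure (qm \<Lambda> w)" by (rule sigma_finite_qm[OF Q])
      show "ennreal \<bar>hyp L \<Lambda> w f x\<bar> \<le> (\<integral>\<^sup>+\<omega>. ennreal (\<bar>fk L x \<omega>\<bar> * \<bar>f \<omega>\<bar>) \<partial>qm \<Lambda> w)" for x
      proof -
        have "\<bar>hyp L \<Lambda> w f x\<bar> \<le> (\<Sum>\<omega>\<in>\<Lambda>. \<bar>w \<omega> * f \<omega> * fk L x \<omega>\<bar>)" unfolding hyp_def by (rule sum_abs)
        also have "\<dots> = (\<Sum>\<omega>\<in>\<Lambda>. w \<omega> * (\<bar>fk L x \<omega>\<bar> * \<bar>f \<omega>\<bar>))"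
          using w by (intro sum.cong) (auto simp: abs_mult less_imp_le)
        finally have "ennreal \<bar>hyp L \<Lambda> w f x\<bar> \<le> ennreal (\<Sum>\<omega>\<in>\<Lambda>. w \<omega> * (\<bar>fk L x \<omega>\<bar> * \<bar>f \<omega>\<bar>))" by (rule ennreal_leI)
        also have "\<dots> = (\<Sum>\<omega>\<in>\<Lambda>. ennreal (w \<omega>) * ennreal (\<bar>fk L x \<omega>\<bar> * \<bar>f \<omega>\<bar>))"
          using w by (subst sum_ennreal[symmetric]) (auto simp: less_imp_le ennreal_mult intro!: sum.cong)
        also have "\<dots> = (\<integral>\<^sup>+\<omega>. ennreal (\<bar>fk L x \<omega>\<bar> * \<bar>f \<omega>\<bar>) \<partial>qm \<Lambda> w)"
          using fin by (simp add: nn_integral_point_measure_finite)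
        finally show ?thesis .
      qed
      show "hyp L \<Lambda> w f \<in> borel_measurable M" using integrable_poly[OF hyp_poly[OF L]] by simp
      show "(\<integral>\<^sup>+\<omega>. ennreal \<bar>fk L x \<omega>\<bar> \<partial>qm \<Lambda> w) \<le> ennreal A'" if x: "x \<in> cball 0 1" for x
      proof -
        have "(\<integral>\<^sup>+\<omega>. ennreal \<bar>fk L x \<omega>\<bar> \<partial>qm \<Lambda> w) = (\<Sum>\<omega>\<in>\<Lambda>. ennreal (w \<omega> * \<bar>fk L x \<omega>\<bar> powr 1))"
          using fin w by (simp add: nn_integral_point_measure_finite ennreal_mult less_imp_le)
        also have "\<dots> \<le> ennreal (A powr 1 * (real (2 * L) / real L) powr D) * (\<integral>\<^sup>+y. ennreal (\<bar>fk L x y\<bar> powr 1) \<partial>M)"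
          by (rule A(2)[OF Q _ fk_poly[OF L]]) auto
        also have "\<dots> \<le> ennreal (max 1 (A * 2 powr D)) * ennreal B\<^sub>1"
          using A(1) L fk_integral_abs[OF L x] B1(2) by (intro mult_mono) (auto intro: order_trans ennreal_leI)
        also have "\<dots> = ennreal A'" using B1 by (simp add: A'_def ennreal_mult[symmetric])
        finally show ?thesis .
      qed
      show "(\<integral>\<^sup>+x. ennreal \<bar>fk L x y\<bar> \<partial>M) \<le> ennreal A'" if "y \<in> \<Lambda>" for y
        using fk_integral_abs[OF L, of y] that \<Lambda> B1(2) A'(2)
        by (simp add: fk_commute[OF L, of _ y]) (meson ennreal_leI order_trans subsetD mem_cball_0)
      show "(\<lambda>x. \<bar>fk L x y\<bar>) \<in> borel_measurable M" for y
        using fk_measurable1[OF L id_measurable_M, of y] by (simp add: fk_commute[OF L, of y])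
    qed (auto simp: space_point_measure intro: fk_measurable1[OF L idq] sigma_finite_measure_axioms)
  qed
  then show ?thesis using A'(1) by blast
qed

end

context ball_setting
begin

text \<open>By Nikolskii the differences of consecutive approximants are uniformly bounded by a
  geometric sequence of ratio \<theta> = 2^(D/p - r). So they converge uniformly to a continuous g,
  and g = f in L_1 gives equality at every point by continuity. Equality almost everywhere would say
  nothing about the nodes.\<close>

lemma poly_approx_pointwise:
  fixes f :: "real ^ 'n \<Rightarrow> real"
  assumes p: "1 \<le> p" and r: "D * enn2real (1 / p) < r" and f: "continuous_on (cball 0 1) f"
    and P: "\<And>j. P j \<in> poly_space (2 ^ j)" "\<And>j. lpb M (cball 0 1) p (\<lambda>x. f x - P j x) (B * real (2 ^ j) powr (- r))"
    and B: "0 \<le> B" and x: "x \<in> cball 0 1"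
  shows "(\<lambda>j. P j x) \<longlonglongrightarrow> f x"
proof -
  define a where "a = enn2real (1 / p)"
  obtain A where A: "1 \<le> A" "\<And>n P c x. 1 \<le> n \<Longrightarrow> P \<in> poly_space n \<Longrightarrow> lpb M (cball 0 1) p P c \<Longrightarrow> x \<in> cball 0 1 \<Longrightarrow>
    \<bar>P x\<bar> \<le> A * real n powr (D * a) * c" using poly_sup_bound[OF p] unfolding a_def by blast
  have a0: "0 \<le> D * a" using D_ge_1 by (simp add: a_def)
  then have r0: "0 < r" using r by (simp add: a_def)
  define \<theta> where "\<theta> = 2 powr (D * a - r)"
  have \<theta>: "0 \<le> \<theta>" "\<theta> < 1" using r by (auto simp: \<theta>_def a_def powr_less_one)
  define R where "R j y = P (Suc j) y - P j y" for j y
  have Rb: "\<bar>R j y\<bar> \<le> (A * 2 powr (D * a) * 8 * B) * \<theta> ^ j" if y: "y \<in> cball 0 1" for j y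
  proof -
    have "lpb M (cball 0 1) p (\<lambda>y. (f y - P j y) - (f y - P (Suc j) y)) (4 * (B * real (2 ^ j) powr (- r) + B * real (2 ^ Suc j) powr (- r)))"
      by (intro lpb_diff p P)
    then have "lpb M (cball 0 1) p (\<lambda>y. (f y - P j y) - (f y - P (Suc j) y)) (8 * (B * real (2 ^ j) powr (- r)))"
    proof (rule lpb_mono)
      have "real (2 ^ Suc j) powr (- r) \<le> real (2 ^ j) powr (- r)" using r0 by (intro powr_mono2') auto
      then have "B * real (2 ^ Suc j) powr (- r) \<le> B * real (2 ^ j) powr (- r)" using B by (rule mult_left_mono)
      then show "4 * (B * real (2 ^ j) powr (- r) + B * real (2 ^ Suc j) powr (- r)) \<le> 8 * (B * real (2 ^ j) powr (- r))" by simp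
    qed
    then have "lpb M (cball 0 1) p (R j) (8 * (B * real (2 ^ j) powr (- r)))" by (simp add: R_def[abs_def])
    then have "\<bar>R j y\<bar> \<le> A * real (2 ^ Suc j) powr (D * a) * (8 * (B * real (2 ^ j) powr (- r)))"
    proof (rule A(2)[rotated 2])
      show "R j \<in> poly_space (2 ^ Suc j)" unfolding R_def[abs_def]
        by (intro poly_space_diff P(1) poly_space_mono[OF _ P(1)]) simp
    qed (use y in auto)
    also have "real (2 ^ Suc j) powr (D * a) = 2 powr (D * a) * real (2 ^ j) powr (D * a)" by (simp add: powr_mult)
    also have "A * (2 powr (D * a) * real (2 ^ j) powr (D * a)) * (8 * (B * real (2 ^ j) powr (- r)))
       = (A * 2 powr (D * a) * 8 * B) * (real (2 ^ j) powr (D * a) * real (2 ^ j) powr (- r))" by simp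
    also have "real (2 ^ j) powr (D * a) * real (2 ^ j) powr (- r) = \<theta> ^ j"
      unfolding powr_add[symmetric] by (simp add: \<theta>_def powr_realpow[symmetric] powr_powr mult.commute del: powr_realpow)
    finally show ?thesis .
  qed
  define g where "g y = P 0 y + (\<Sum>j. R j y)" for y
  have ul: "uniform_limit (cball 0 1) (\<lambda>n y. P 0 y + (\<Sum>j<n. R j y)) g sequentially"
    unfolding g_def
  proof (rule uniform_limit_add[OF uniform_limit_const], rule Weierstrass_m_test)
    show "norm (R j y) \<le> (A * 2 powr (D * a) * 8 * B) * \<theta> ^ j" if "y \<in> cball 0 1" for j y using Rb[OF that] by simp
    show "summable (\<lambda>j. (A * 2 powr (D * a) * 8 * B) * \<theta> ^ j)" using \<theta> by (intro summable_mult summable_geometric) simp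
  qed
  have tel: "P 0 y + (\<Sum>j<n. R j y) = P n y" for n y by (induction n) (simp_all add: R_def)
  have ul': "uniform_limit (cball 0 1) P g sequentially" using ul by (simp only: tel)
  have gc: "continuous_on (cball 0 1) g"
    by (rule uniform_limit_theorem[OF _ ul']) (auto intro!: always_eventually poly_space_continuous[OF P(1)])
  have hc: "continuous_on (cball 0 1) (\<lambda>y. \<bar>f y - g y\<bar>)" by (intro continuous_intros f gc)
  have "(\<integral>y. \<bar>f y - g y\<bar> \<partial>M) \<le> 0"
  proof (rule field_le_epsilon)
    fix e :: real assume e: "0 < e"
    have "(\<lambda>n. B * real (2 ^ n) powr (- r)) \<longlonglongrightarrow> B * 0"
    proof (rule tendsto_mult_left)
      have "(\<lambda>n. (2 powr (- r)) ^ n) \<longlonglongrightarrow> 0" using r0 by (intro LIMSEQ_realpow_zero) (auto simp: powr_less_one)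
      then show "(\<lambda>n. real (2 ^ n) powr (- r)) \<longlonglongrightarrow> 0"
        by (simp add: powr_realpow[symmetric] powr_powr mult.commute del: powr_realpow)
    qed
    then have "eventually (\<lambda>n. B * real (2 ^ n) powr (- r) < e / 2) sequentially" using e by (intro order_tendstoD(2)) auto
    moreover have "eventually (\<lambda>n. \<forall>y\<in>cball 0 1. dist (P n y) (g y) < e / 2) sequentially"
      using uniform_limitD[OF ul', of "e / 2"] e by simp
    ultimately have "eventually (\<lambda>n. B * real (2 ^ n) powr (- r) < e / 2 \<and> (\<forall>y\<in>cball 0 1. dist (P n y) (g y) < e / 2)) sequentially"
      by (rule eventually_conj)
    then obtain n where n: "B * real (2 ^ n) powr (- r) < e / 2" "\<And>y. y \<in> cball 0 1 \<Longrightarrow> dist (P n y) (g y) < e / 2"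
      unfolding eventually_sequentially by blast
    have fP: "integrable M (\<lambda>y. \<bar>f y - P n y\<bar>)" by (intro integrable_continuous continuous_intros f poly_space_continuous[OF P(1)])
    have "lpb M (cball 0 1) 1 (\<lambda>y. f y - P n y) (B * real (2 ^ n) powr (- r))"
      by (rule lpb_exponent[OF prob_space_axioms _ p _ P(2)]) auto
    then have "(\<integral>\<^sup>+y. ennreal \<bar>f y - P n y\<bar> \<partial>M) \<le> ennreal (B * real (2 ^ n) powr (- r))" using B by (simp add: lpb_def)
    then have l: "(\<integral>y. \<bar>f y - P n y\<bar> \<partial>M) \<le> B * real (2 ^ n) powr (- r)"
      using B by (subst (asm) nn_integral_eq_integral[OF fP]) auto
    have "(\<integral>y. \<bar>f y - g y\<bar> \<partial>M) \<le> (\<integral>y. \<bar>f y - P n y\<bar> + e / 2 \<partial>M)"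
    proof (rule integral_mono)
      show "integrable M (\<lambda>y. \<bar>f y - g y\<bar>)" using hc by (rule integrable_continuous)
      show "integrable M (\<lambda>y. \<bar>f y - P n y\<bar> + e / 2)" using fP by simp
      show "\<bar>f y - g y\<bar> \<le> \<bar>f y - P n y\<bar> + e / 2" if "y \<in> space M" for y
      proof -
        have "\<bar>P n y - g y\<bar> < e / 2" using n(2)[of y] that by (simp add: dist_real_def)
        then show ?thesis by arith
      qed
    qed
    also have "\<dots> = (\<integral>y. \<bar>f y - P n y\<bar> \<partial>M) + e / 2" using fP by (simp add: prob_space del: space_ball_measure)
    finally show "(\<integral>y. \<bar>f y - g y\<bar> \<partial>M) \<le> 0 + e" using l n(1) by simp
  qed
  then have "g x = f x" using integral_continuous_pos[OF hc _ x] by force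
  then show ?thesis using tendsto_uniform_limitI[OF ul' x] by simp
qed

end

section \<open>The error of hyperinterpolation in terms of approximation rates\<close>

context filter_setting
begin

text \<open>The rate is demanded in the form of one polynomial at each dyadic degree, which serves
  the Sobolev and the Besov spaces alike.\<close>

lemma hyp_error_up:
  assumes p: "1 \<le> p" "p \<le> q" and r: "D * enn2real (1 / p) < r"
  shows "\<exists>C>0. \<forall>L \<Lambda> w f B. quad L \<Lambda> w \<longrightarrow> continuous_on (cball 0 1) f \<longrightarrow> 0 \<le> B \<longrightarrow>
    (\<forall>j. \<exists>P\<in>poly_space (2 ^ j). lpb M (cball 0 1) p (\<lambda>x. f x - P x) (B * real (2 ^ j) powr (- r))) \<longrightarrow>
    lpb M (cball 0 1) q (\<lambda>x. f x - hyp L \<Lambda> w f x)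
      (C * real L powr (- r + D * (enn2real (1 / p) - enn2real (1 / q))) * B)"
proof -
  define a b where "a = enn2real (1 / p)" and "b = enn2real (1 / q)"
  have b0: "0 \<le> D * b" using D_ge_1 by (simp add: b_def)
  have q: "1 \<le> q" using p by (rule order_trans)
  have r0: "0 < r" using r D_ge_1 by (smt (verit) enn2real_nonneg mult_nonneg_nonneg)
  \<comment> \<open>Passing from p to q costs n^(D (a - b)) and passing to the nodes costs n^(D b).
    Together this is n^(D a), independent of q, and \<sigma> is what r has left over.\<close>
  define \<sigma> where "\<sigma> = r - D * a"
  have \<sigma>: "0 < \<sigma>" using r by (simp add: \<sigma>_def a_def)
  define \<theta> where "\<theta> = 2 powr (- \<sigma>)"
  have \<theta>: "0 < \<theta>" "\<theta> < 1" using \<sigma> by (auto simp: \<theta>_def powr_less_one)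
  obtain A1 where A1: "1 \<le> A1" "\<And>n P c. 1 \<le> n \<Longrightarrow> P \<in> poly_space n \<Longrightarrow> lpb M (cball 0 1) p P c \<Longrightarrow>
    lpb M (cball 0 1) q P (A1 * real n powr (D * (a - b)) * c)"
    using poly_norm_change[OF p] unfolding a_def b_def by blast
  obtain A2 where A2: "1 \<le> A2" "\<And>L \<Lambda> w n P c. quad L \<Lambda> w \<Longrightarrow> L \<le> n \<Longrightarrow> P \<in> poly_space n \<Longrightarrow> lpb M (cball 0 1) q P c \<Longrightarrow>
    lpb (qm \<Lambda> w) \<Lambda> q P (A2 * (real n / real L) powr (D * b) * c)"
    using poly_norm_qm[OF q] unfolding b_def by blast
  obtain A3 where A3: "0 < A3" "\<And>L \<Lambda> w f c. quad L \<Lambda> w \<Longrightarrow> lpb (qm \<Lambda> w) \<Lambda> q f c \<Longrightarrow> lpb M (cball 0 1) q (hyp L \<Lambda> w f) (A3 * c)"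
    using hyp_bound[OF q] by blast
  \<comment> \<open>The 8 is the factor 4 of \<open>lpb_diff\<close> applied to two terms. The power
    of 2 is the cost of expressing the rate at degree 2^(j0 + i) through \<open>n i\<close>, which
    is twice that degree.\<close>
  define C0 where "C0 = A1 * A2 * 8 * 2 powr r"
  define C where "C = 4 * (1 + A3) * C0 / (1 - \<theta>)"
  have C0: "0 < C0" using A1(1) A2(1) by (simp add: C0_def)
  have C: "0 < C" using C0 A3(1) \<theta> by (simp add: C_def)
  have "lpb M (cball 0 1) q (\<lambda>x. f x - hyp L \<Lambda> w f x) (C * real L powr (- r + D * (a - b)) * B)"
    if Q: "quad L \<Lambda> w" and f: "continuous_on (cball 0 1) f" and B: "0 \<le> B"
      and ap: "\<forall>j. \<exists>P\<in>poly_space (2 ^ j). lpb M (cball 0 1) p (\<lambda>x. f x - P x) (B * real (2 ^ j) powr (- r))"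
    for L \<Lambda> w f B
  proof -
    have L: "1 \<le> L" and \<Lambda>: "\<Lambda> \<subseteq> cball 0 1" using Q by (auto simp: quad_def)
    obtain P where P: "\<And>j. P j \<in> poly_space (2 ^ j)" "\<And>j. lpb M (cball 0 1) p (\<lambda>x. f x - P j x) (B * real (2 ^ j) powr (- r))"
      using ap by metis
    \<comment> \<open>The last dyadic degree that is reproduced. The degree bounds
      \<open>n i\<close> of all later differences are at least L, as the inequality at the nodes
      requires.\<close>
    obtain j0 where j0: "2 ^ j0 \<le> L" "L < 2 ^ (j0 + 1)" using ex_power_ivl1[of 2 L] L by auto
    define n where "n i = (2::nat) ^ Suc (j0 + i)" for i
    have n1: "1 \<le> n i" for i by (simp add: n_def)
    have Ln: "L \<le> n i" for i
    proof -
      have "L \<le> 2 ^ (j0 + 1)" using j0 by simp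
      also have "\<dots> \<le> n i" unfolding n_def by (intro power_increasing) auto
      finally show ?thesis .
    qed
    define R where "R i x = P (Suc (j0 + i)) x - P (j0 + i) x" for i x
    have Rp: "R i \<in> poly_space (n i)" for i
      unfolding R_def[abs_def] n_def by (intro poly_space_diff P(1) poly_space_mono[OF _ P(1)]) simp
    define c where "c = C0 * B * real L powr (- (D * b))"
    have c: "0 \<le> c" using C0 B by (simp add: c_def)
    define \<beta> where "\<beta> i = real (n i) powr (- \<sigma>)" for i
    have \<beta>0: "0 < \<beta> i" for i using n1[of i] by (simp add: \<beta>_def)
    define k where "k i = A1 * real (n i) powr (D * (a - b)) * (8 * 2 powr r * B * real (n i) powr (- r))" for i
    have RM: "lpb M (cball 0 1) q (R i) (k i)" for i
      unfolding k_def
    proof (rule A1(2)[OF n1 Rp])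
      have "lpb M (cball 0 1) p (\<lambda>y. (f y - P (j0 + i) y) - (f y - P (Suc (j0 + i)) y))
          (4 * (B * real (2 ^ (j0 + i)) powr (- r) + B * real (2 ^ Suc (j0 + i)) powr (- r)))"
        by (intro lpb_diff p P)
      moreover have "4 * (B * real (2 ^ (j0 + i)) powr (- r) + B * real (2 ^ Suc (j0 + i)) powr (- r)) \<le> 8 * 2 powr r * B * real (n i) powr (- r)"
      proof -
        have "real (2 ^ Suc (j0 + i)) powr (- r) \<le> real (2 ^ (j0 + i)) powr (- r)" using r0 by (intro powr_mono2') auto
        then have "B * real (2 ^ Suc (j0 + i)) powr (- r) \<le> B * real (2 ^ (j0 + i)) powr (- r)" using B by (rule mult_left_mono)
        moreover have "real (2 ^ (j0 + i)) powr (- r) = 2 powr r * real (n i) powr (- r)"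
        proof -
          have "real (n i) powr (- r) = 2 powr (- r) * real (2 ^ (j0 + i)) powr (- r)" by (simp add: n_def powr_mult)
          then have "2 powr r * real (n i) powr (- r) = (2 powr r * 2 powr (- r)) * real (2 ^ (j0 + i)) powr (- r)" by simp
          also have "2 powr r * 2 powr (- r) = (1 :: real)" unfolding powr_add[symmetric] by simp
          finally show ?thesis by simp
        qed
        ultimately show ?thesis by (simp only:) (simp add: mult_ac)
      qed
      ultimately have "lpb M (cball 0 1) p (\<lambda>y. (f y - P (j0 + i) y) - (f y - P (Suc (j0 + i)) y)) (8 * 2 powr r * B * real (n i) powr (- r))"
        by (rule lpb_mono)
      then show "lpb M (cball 0 1) p (R i) (8 * 2 powr r * B * real (n i) powr (- r))" by (simp add: R_def[abs_def])
    qed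
    have kq: "A2 * (real (n i) / real L) powr (D * b) * k i = c * \<beta> i" for i
    proof -
      have "real (n i) powr (D * b) * (real (n i) powr (D * (a - b)) * real (n i) powr (- r)) = real (n i) powr (- \<sigma>)"
        unfolding powr_add[symmetric] by (simp add: \<sigma>_def algebra_simps)
      then have e: "\<beta> i = real (n i) powr (D * b) * (real (n i) powr (D * (a - b)) * real (n i) powr (- r))" by (simp add: \<beta>_def)
      have "(real (n i) / real L) powr (D * b) = real (n i) powr (D * b) * real L powr (- (D * b))"
        unfolding powr_minus_divide by (simp add: powr_divide)
      then show ?thesis unfolding e by (simp add: c_def k_def C0_def)
    qed
    have k0: "0 \<le> k i" for i using A1(1) B by (simp add: k_def)
    \<comment> \<open>The bound at the nodes carries an extra factor that is at least 1, so it also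
      bounds the norm on the ball.\<close>
    have kM: "k i \<le> c * \<beta> i" for i
    proof -
      have "1 \<le> real (n i) / real L" using Ln[of i] L by simp
      then have "1 \<le> (real (n i) / real L) powr (D * b)" using b0 by (rule ge_one_powr_ge_zero)
      then have "1 * 1 \<le> A2 * (real (n i) / real L) powr (D * b)" using A2(1) by (intro mult_mono) auto
      then have "1 * k i \<le> A2 * (real (n i) / real L) powr (D * b) * k i" using k0 by (intro mult_right_mono) auto
      then show ?thesis using kq by simp
    qed
    have RM': "lpb M (cball 0 1) q (R i) (c * \<beta> i)" for i using RM kM by (rule lpb_mono)
    have RQ: "lpb (qm \<Lambda> w) \<Lambda> q (R i) (c * \<beta> i)" for i using A2(2)[OF Q Ln Rp RM] by (simp only: kq)
    define S where "S = real L powr (- \<sigma>) / (1 - \<theta>)"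
    have \<beta>eq: "\<beta> i = real (2 ^ (j0 + 1)) powr (- \<sigma>) * \<theta> ^ i" for i
    proof -
      have "real (n i) = real (2 ^ (j0 + 1)) * 2 ^ i" by (simp add: n_def power_add)
      then have "\<beta> i = real (2 ^ (j0 + 1)) powr (- \<sigma>) * (2 ^ i) powr (- \<sigma>)" unfolding \<beta>_def by (simp only: powr_mult)
      also have "(2 ^ i :: real) powr (- \<sigma>) = \<theta> ^ i"
        by (simp add: \<theta>_def powr_realpow[symmetric] powr_powr mult.commute del: powr_realpow)
      finally show ?thesis .
    qed
    have \<beta>s: "\<beta> sums (real (2 ^ (j0 + 1)) powr (- \<sigma>) * (1 / (1 - \<theta>)))"
      unfolding \<beta>eq[abs_def] using \<theta> by (intro sums_mult geometric_sums) simp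
    have \<beta>S: "suminf \<beta> \<le> S"
    proof -
      have "real (2 ^ (j0 + 1)) powr (- \<sigma>) \<le> real L powr (- \<sigma>)"
      proof (rule powr_mono2')
        show "real L \<le> real (2 ^ (j0 + 1))" using j0(2) by (intro of_nat_mono) simp
      qed (use \<sigma> L in auto)
      then have "real (2 ^ (j0 + 1)) powr (- \<sigma>) * (1 / (1 - \<theta>)) \<le> real L powr (- \<sigma>) * (1 / (1 - \<theta>))"
        using \<theta> by (intro mult_right_mono) auto
      then show ?thesis using sums_unique[OF \<beta>s] by (simp add: S_def)
    qed
    define h where "h x = f x - P j0 x" for x
    have hs: "(\<lambda>i. R i x) sums h x" if x: "x \<in> cball 0 1" for x
    proof -
      have "(\<lambda>j. P j x) \<longlonglongrightarrow> f x" by (rule poly_approx_pointwise[OF p(1) r f P B x])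
      then have "(\<lambda>i. P (i + j0) x) \<longlonglongrightarrow> f x" by (rule LIMSEQ_ignore_initial_segment)
      from telescope_sums[OF this] show ?thesis by (simp add: R_def h_def add.commute)
    qed
    have hm: "h \<in> borel_measurable M"
      unfolding h_def[abs_def] by (intro continuous_ball_measure continuous_intros f poly_space_continuous[OF P(1)])
    have hM: "lpb M (cball 0 1) q h (S * c)"
      by (rule lpb_sums[OF sigma_finite_measure_axioms q _ \<beta>0 sums_summable[OF \<beta>s] \<beta>S c RM' hm hs]) auto
    have hQ: "lpb (qm \<Lambda> w) \<Lambda> q h (S * c)"
      by (rule lpb_sums[OF sigma_finite_qm[OF Q] q _ \<beta>0 sums_summable[OF \<beta>s] \<beta>S c RQ])
        (use \<Lambda> hs in \<open>auto simp: space_point_measure measurable_point_measure_eq1\<close>)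
    have "lpb M (cball 0 1) q (\<lambda>x. h x - hyp L \<Lambda> w h x) (4 * (S * c + A3 * (S * c)))"
      by (rule lpb_diff[OF q hM A3(2)[OF Q hQ]])
    moreover have "h x - hyp L \<Lambda> w h x = f x - hyp L \<Lambda> w f x" for x
      unfolding h_def hyp_diff hyp_reproduce[OF Q poly_space_mono[OF j0(1) P(1)]] by simp
    moreover have "4 * (S * c + A3 * (S * c)) = C * real L powr (- r + D * (a - b)) * B"
    proof -
      have "real L powr (- r + D * (a - b)) = real L powr (- \<sigma>) * real L powr (- (D * b))"
        unfolding powr_add[symmetric] by (simp add: \<sigma>_def algebra_simps)
      then show ?thesis by (simp add: C_def S_def c_def algebra_simps add_divide_distrib)
    qed
    ultimately show ?thesis by simp
  qed
  then show ?thesis using C unfolding a_def b_def by blast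
qed

text \<open>For q below p the positive part of the difference of exponents is 0; the estimate in L_p
  is used, and L_q norms on a probability space are smaller.\<close>

lemma hyp_error:
  assumes p: "1 \<le> p" and q: "1 \<le> q" and r: "D * enn2real (1 / p) < r"
  shows "\<exists>C>0. \<forall>L \<Lambda> w f B. quad L \<Lambda> w \<longrightarrow> continuous_on (cball 0 1) f \<longrightarrow> 0 \<le> B \<longrightarrow>
    (\<forall>j. \<exists>P\<in>poly_space (2 ^ j). lpb M (cball 0 1) p (\<lambda>x. f x - P x) (B * real (2 ^ j) powr (- r))) \<longrightarrow>
    lpb M (cball 0 1) q (\<lambda>x. f x - hyp L \<Lambda> w f x)
      (C * real L powr (- r + D * max (enn2real (1 / p) - enn2real (1 / q)) 0) * B)"
proof (cases "p \<le> q")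
  case True
  then have "max (enn2real (1 / p) - enn2real (1 / q)) 0 = enn2real (1 / p) - enn2real (1 / q)"
    using enn2real_inverse_antimono[OF p True] by (simp add: max_def)
  then show ?thesis using hyp_error_up[OF p True r] by simp
next
  case False
  then have qp: "q \<le> p" by simp
  then have e: "max (enn2real (1 / p) - enn2real (1 / q)) 0 = 0"
    using enn2real_inverse_antimono[OF q qp] by (simp add: max_def)
  obtain C where C: "0 < C" "\<And>L \<Lambda> w f B. quad L \<Lambda> w \<Longrightarrow> continuous_on (cball 0 1) f \<Longrightarrow> 0 \<le> B \<Longrightarrow>
    (\<forall>j. \<exists>P\<in>poly_space (2 ^ j). lpb M (cball 0 1) p (\<lambda>x. f x - P x) (B * real (2 ^ j) powr (- r))) \<Longrightarrow>
    lpb M (cball 0 1) p (\<lambda>x. f x - hyp L \<Lambda> w f x) (C * real L powr (- r + D * (enn2real (1 / p) - enn2real (1 / p))) * B)"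
    using hyp_error_up[OF p order_refl r] by blast
  have "lpb M (cball 0 1) q (\<lambda>x. f x - hyp L \<Lambda> w f x) (C * real L powr (- r + D * 0) * B)"
    if "quad L \<Lambda> w" "continuous_on (cball 0 1) f" "0 \<le> B"
      "\<forall>j. \<exists>P\<in>poly_space (2 ^ j). lpb M (cball 0 1) p (\<lambda>x. f x - P x) (B * real (2 ^ j) powr (- r))" for L \<Lambda> w f B
    by (rule lpb_exponent[OF prob_space_axioms q qp]) (use C(2)[OF that] in auto)
  then show ?thesis unfolding e using C(1) by blast
qed

end

section \<open>A Jackson inequality for the Sobolev spaces\<close>

text \<open>The integrand of Euler's Gamma integral, normalised so that its total mass is
  \<open>b powr (- \<sigma>)\<close>.\<close>

definition gamma_density :: "real \<Rightarrow> real \<Rightarrow> real \<Rightarrow> real" where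
  "gamma_density \<sigma> b t = indicator {0..} t * t powr (\<sigma> - 1) * exp (- (b * t)) / Gamma \<sigma>"

lemma gamma_density_measurable [measurable]: "gamma_density \<sigma> b \<in> borel_measurable borel"
  unfolding gamma_density_def[abs_def] by measurable

lemma gamma_density_nonneg: "0 < \<sigma> \<Longrightarrow> 0 \<le> gamma_density \<sigma> b t"
  unfolding gamma_density_def using Gamma_real_pos[of \<sigma>] by simp

lemma gamma_density_nonpos: "t \<le> 0 \<Longrightarrow> gamma_density \<sigma> b t = 0"
  by (cases "t = 0") (auto simp: gamma_density_def)

lemma nn_integral_gamma_density:
  assumes \<sigma>: "0 < \<sigma>" and b: "0 < b"
  shows "(\<integral>\<^sup>+t. ennreal (gamma_density \<sigma> b t) \<partial>lborel) = ennreal (b powr (- \<sigma>))"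
proof -
  have G: "0 < Gamma \<sigma>" using \<sigma> by (rule Gamma_real_pos)
  have "ennreal (Gamma \<sigma>) = ennreal b * (\<integral>\<^sup>+t. ennreal (indicator {0..} (b * t) * (b * t) powr (\<sigma> - 1) / exp (b * t)) \<partial>lborel)"
    unfolding Gamma_conv_nn_integral_real[OF \<sigma>]
    by (subst nn_integral_real_affine[where c = b and t = 0]) (use b in auto)
  also have "(\<integral>\<^sup>+t. ennreal (indicator {0..} (b * t) * (b * t) powr (\<sigma> - 1) / exp (b * t)) \<partial>lborel)
      = (\<integral>\<^sup>+t. ennreal (b powr (\<sigma> - 1) * Gamma \<sigma>) * ennreal (gamma_density \<sigma> b t) \<partial>lborel)"
  proof (rule nn_integral_cong)
    fix t :: real
    have "indicator {0..} (b * t) * (b * t) powr (\<sigma> - 1) / exp (b * t) = b powr (\<sigma> - 1) * Gamma \<sigma> * gamma_density \<sigma> b t"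
      using b G by (auto simp: gamma_density_def powr_mult exp_minus field_simps indicator_def of_bool_def zero_le_mult_iff)
    then show "ennreal (indicator {0..} (b * t) * (b * t) powr (\<sigma> - 1) / exp (b * t)) = ennreal (b powr (\<sigma> - 1) * Gamma \<sigma>) * ennreal (gamma_density \<sigma> b t)"
      using G gamma_density_nonneg[OF \<sigma>, of b t] by (simp add: ennreal_mult[symmetric])
  qed
  also have "\<dots> = ennreal (b powr (\<sigma> - 1) * Gamma \<sigma>) * (\<integral>\<^sup>+t. ennreal (gamma_density \<sigma> b t) \<partial>lborel)"
    by (rule nn_integral_cmult) measurable
  finally have eq: "ennreal (Gamma \<sigma>) = ennreal (b powr \<sigma> * Gamma \<sigma>) * (\<integral>\<^sup>+t. ennreal (gamma_density \<sigma> b t) \<partial>lborel)"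
    using b G by (simp add: mult.assoc[symmetric] ennreal_mult[symmetric] powr_diff)
  have one: "b powr (- \<sigma>) / Gamma \<sigma> * (b powr \<sigma> * Gamma \<sigma>) = 1"
  proof -
    have "b powr (- \<sigma>) * b powr \<sigma> = 1" unfolding powr_add[symmetric] using b by simp
    then show ?thesis using G by (simp add: field_simps)
  qed
  have "ennreal (b powr (- \<sigma>)) = ennreal (b powr (- \<sigma>) / Gamma \<sigma>) * ennreal (Gamma \<sigma>)"
    using G by (simp add: ennreal_mult[symmetric])
  also have "\<dots> = ennreal (b powr (- \<sigma>) / Gamma \<sigma> * (b powr \<sigma> * Gamma \<sigma>)) * (\<integral>\<^sup>+t. ennreal (gamma_density \<sigma> b t) \<partial>lborel)"
    unfolding eq mult.assoc[symmetric] using G by (subst ennreal_mult[symmetric]) auto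
  finally show ?thesis unfolding one by simp
qed

lemma integral_gamma_density:
  assumes "0 < \<sigma>" "0 < b"
  shows "integrable lborel (gamma_density \<sigma> b)" "(\<integral>t. gamma_density \<sigma> b t \<partial>lborel) = b powr (- \<sigma>)"
proof -
  have "has_bochner_integral lborel (gamma_density \<sigma> b) (b powr (- \<sigma>))"
    by (rule has_bochner_integral_nn_integral) (use nn_integral_gamma_density[OF assms] gamma_density_nonneg[OF assms(1)] in auto)
  then show "integrable lborel (gamma_density \<sigma> b)" "(\<integral>t. gamma_density \<sigma> b t \<partial>lborel) = b powr (- \<sigma>)"
    by (auto simp: has_bochner_integral_iff)
qed

lemma lpb_cmult:
  assumes "1 \<le> p" "lpb M X p f c"
  shows "lpb M X p (\<lambda>x. a * f x) (\<bar>a\<bar> * c)"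
proof (cases "p = \<infinity>")
  case True
  then show ?thesis using assms by (auto simp: lpb_def abs_mult mult_left_mono)
next
  case False
  define s where "s = enn2real p"
  have [measurable]: "f \<in> borel_measurable M" using assms by (simp add: lpb_def)
  have "(\<integral>\<^sup>+x. ennreal (\<bar>a * f x\<bar> powr s) \<partial>M) = (\<integral>\<^sup>+x. ennreal (\<bar>a\<bar> powr s) * ennreal (\<bar>f x\<bar> powr s) \<partial>M)"
    by (simp add: abs_mult powr_mult ennreal_mult)
  also have "\<dots> = ennreal (\<bar>a\<bar> powr s) * (\<integral>\<^sup>+x. ennreal (\<bar>f x\<bar> powr s) \<partial>M)" by (rule nn_integral_cmult) measurable
  also have "\<dots> \<le> ennreal (\<bar>a\<bar> powr s) * ennreal (c powr s)"
    using assms False by (intro mult_left_mono) (auto simp: lpb_def s_def)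
  also have "\<dots> = ennreal ((\<bar>a\<bar> * c) powr s)" using lpb_nonneg[OF assms(2)] by (simp add: powr_mult ennreal_mult[symmetric])
  finally show ?thesis using assms False by (simp add: lpb_def s_def)
qed

text \<open>Each power of \<nu> is the integral of exp (- \<nu> t) against a Gamma density. The
  common decay exp (- b t) is absorbed into the density, whose mass becomes b^(-\<sigma>); the rest
  is bounded by A at every t, and Minkowski's inequality applies.\<close>

lemma lpb_laplace:
  fixes q :: "nat \<Rightarrow> 'a \<Rightarrow> real"
  assumes M: "sigma_finite_measure M" and p: "1 \<le> p" and X: "space M \<subseteq> X"
    and \<sigma>: "0 < \<sigma>" and b: "0 < b" and A: "0 \<le> A" and \<nu>: "\<And>k. k \<in> I \<Longrightarrow> 0 < \<nu> k"
    and qm: "\<And>k. k \<in> I \<Longrightarrow> q k \<in> borel_measurable M"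
    and H: "\<And>t. 0 < t \<Longrightarrow> lpb M X p (\<lambda>x. \<Sum>k\<in>I. q k x * exp (- (\<nu> k * t))) (A * exp (- (b * t)))"
  shows "lpb M X p (\<lambda>x. \<Sum>k\<in>I. q k x * \<nu> k powr (- \<sigma>)) (b powr (- \<sigma>) * A)"
proof (rule lpb_minkowski[OF M lborel.sigma_finite_measure_axioms p X, where \<beta> = "gamma_density \<sigma> b"
    and H = "\<lambda>x t. indicator {0<..} t * (exp (b * t) * (\<Sum>k\<in>I. q k x * exp (- (\<nu> k * t))))"])
  show "(\<integral>\<^sup>+v. ennreal (gamma_density \<sigma> b v) \<partial>lborel) \<le> ennreal (b powr (- \<sigma>))"
    by (simp add: nn_integral_gamma_density[OF \<sigma> b])
  show "(\<lambda>(x, t). indicator {0<..} t * (exp (b * t) * (\<Sum>k\<in>I. q k x * exp (- (\<nu> k * t))))) \<in> borel_measurable (M \<Otimes>\<^sub>M lborel)"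
  proof -
    have "(\<lambda>z. q k (fst z) * exp (- (\<nu> k * snd z))) \<in> borel_measurable (M \<Otimes>\<^sub>M lborel)" if "k \<in> I" for k
      using measurable_compose[OF measurable_fst qm[OF that]] by measurable
    then have [measurable]: "(\<lambda>z. \<Sum>k\<in>I. q k (fst z) * exp (- (\<nu> k * snd z))) \<in> borel_measurable (M \<Otimes>\<^sub>M lborel)"
      by (rule borel_measurable_sum)
    show ?thesis unfolding case_prod_beta by measurable
  qed
  show "lpb M X p (\<lambda>x. indicator {0<..} t * (exp (b * t) * (\<Sum>k\<in>I. q k x * exp (- (\<nu> k * t))))) A" for t
  proof (cases "0 < t")
    case True
    have *: "lpb M X p (\<lambda>x. exp (b * t) * (\<Sum>k\<in>I. q k x * exp (- (\<nu> k * t)))) (\<bar>exp (b * t)\<bar> * (A * exp (- (b * t))))"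
      by (rule lpb_cmult[OF p H[OF True]])
    have e: "\<bar>exp (b * t)\<bar> * (A * exp (- (b * t))) = A" by (simp add: exp_minus)
    show ?thesis using True *[unfolded e] by simp
  next
    case False
    then show ?thesis using A by (simp add: lpb_def)
  qed
  show "ennreal \<bar>\<Sum>k\<in>I. q k x * \<nu> k powr (- \<sigma>)\<bar> \<le> (\<integral>\<^sup>+t. ennreal (gamma_density \<sigma> b t *
      \<bar>indicator {0<..} t * (exp (b * t) * (\<Sum>k\<in>I. q k x * exp (- (\<nu> k * t))))\<bar>) \<partial>lborel)" for x
  proof -
    define F where "F t = (\<Sum>k\<in>I. q k x * gamma_density \<sigma> (\<nu> k) t)" for t
    have "integrable lborel F" unfolding F_def
      by (intro Bochner_Integration.integrable_sum integrable_mult_right integral_gamma_density \<sigma> \<nu>)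
    have "(\<Sum>k\<in>I. q k x * \<nu> k powr (- \<sigma>)) = (\<integral>t. F t \<partial>lborel)"
      unfolding F_def
      by (subst Bochner_Integration.integral_sum) (auto simp: integral_gamma_density[OF \<sigma> \<nu>] intro!: integrable_mult_right)
    then have "ennreal \<bar>\<Sum>k\<in>I. q k x * \<nu> k powr (- \<sigma>)\<bar> \<le> (\<integral>\<^sup>+t. ennreal \<bar>F t\<bar> \<partial>lborel)"
      using integral_norm_bound_ennreal[OF \<open>integrable lborel F\<close>] by simp
    also have "\<dots> = (\<integral>\<^sup>+t. ennreal (gamma_density \<sigma> b t * \<bar>indicator {0<..} t * (exp (b * t) * (\<Sum>k\<in>I. q k x * exp (- (\<nu> k * t))))\<bar>) \<partial>lborel)"
    proof (rule nn_integral_cong)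
      fix t :: real
      have "\<bar>F t\<bar> = gamma_density \<sigma> b t * \<bar>indicator {0<..} t * (exp (b * t) * (\<Sum>k\<in>I. q k x * exp (- (\<nu> k * t))))\<bar>"
      proof (cases "0 < t")
        case False
        then show ?thesis by (simp add: F_def gamma_density_nonpos)
      next
        case True
        have e: "gamma_density \<sigma> a t * exp (a * t) = gamma_density \<sigma> 0 t" for a by (simp add: gamma_density_def exp_minus)
        have g: "gamma_density \<sigma> a t = gamma_density \<sigma> 0 t * exp (- (a * t))" for a by (simp add: gamma_density_def)
        have "F t = gamma_density \<sigma> 0 t * (\<Sum>k\<in>I. q k x * exp (- (\<nu> k * t)))"
          unfolding F_def by (subst g) (simp add: sum_distrib_left mult_ac)
        then have "\<bar>F t\<bar> = gamma_density \<sigma> b t * exp (b * t) * \<bar>\<Sum>k\<in>I. q k x * exp (- (\<nu> k * t))\<bar>"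
          using gamma_density_nonneg[OF \<sigma>, of 0 t] by (simp add: abs_mult e)
        then show ?thesis using True by (simp add: abs_mult mult.assoc)
      qed
      then show "ennreal \<bar>F t\<bar> = ennreal (gamma_density \<sigma> b t * \<bar>indicator {0<..} t * (exp (b * t) * (\<Sum>k\<in>I. q k x * exp (- (\<nu> k * t))))\<bar>)" by simp
    qed
    finally show ?thesis .
  qed
qed (use \<sigma> b A gamma_density_nonneg[OF \<sigma>] in \<open>auto intro!: borel_measurable_sum borel_measurable_times qm\<close>)

lemma real_polynomial_function_poly_space:
  fixes g :: "real ^ 'n \<Rightarrow> real"
  assumes "real_polynomial_function g"
  shows "\<exists>n. g \<in> poly_space n"
  using assms
proof induction
  case (linear f)
  have "f = (\<lambda>x. adjoint f 1 \<bullet> x)"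
  proof
    show "f x = adjoint f 1 \<bullet> x" for x
      using adjoint_works[OF bounded_linear.linear[OF linear], of x 1] by (simp add: inner_commute)
  qed
  then show ?case using poly_space_inner by metis
next
  case (const c)
  then show ?case using poly_space_const by blast
next
  case (add f g)
  then obtain n m where "f \<in> poly_space n" "g \<in> poly_space m" by blast
  then have "(\<lambda>x. f x + g x) \<in> poly_space (max n m)"
    by (intro poly_space_add) (auto intro: poly_space_mono[rotated])
  then show ?case by blast
next
  case (mult f g)
  then show ?case using poly_space_mult by blast
qed

context filter_setting
begin

text \<open>A uniform polynomial approximant of f is reproduced by \<open>filt N\<close> once N is
  at least its degree, and \<open>filt N\<close> is bounded on continuous functions. It serves to
  replace f by a finite expansion.\<close>

lemma filt_converges:
  assumes f: "continuous_on (cball 0 1) f" and e: "0 < e" and L: "1 \<le> L"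
  shows "\<exists>N\<ge>L. lpb M (cball 0 1) \<infinity> (\<lambda>x. f x - filt N f x) e"
proof -
  define d where "d = e / (4 * (1 + B\<^sub>1))"
  have d: "0 < d" using e B1(1) by (simp add: d_def)
  obtain g where g: "real_polynomial_function g" "\<And>x. x \<in> cball 0 1 \<Longrightarrow> \<bar>f x - g x\<bar> < d"
    using Stone_Weierstrass_real_polynomial_function[OF compact_cball f d] by blast
  obtain n where n: "g \<in> poly_space n" using real_polynomial_function_poly_space[OF g(1)] by blast
  define N where "N = max L n"
  have N: "1 \<le> N" "g \<in> poly_space N" using poly_space_mono[OF _ n] L by (auto simp: N_def)
  have gc: "continuous_on (cball 0 1) g" by (rule poly_space_continuous[OF n])
  have fg: "lpb M (cball 0 1) \<infinity> (\<lambda>x. f x - g x) d"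
    using g(2) d continuous_ball_measure[OF continuous_on_diff[OF f gc]] by (auto simp: lpb_def intro: less_imp_le)
  have "lpb M (cball 0 1) \<infinity> (\<lambda>x. (f x - g x) - filt N (\<lambda>x. f x - g x) x) (4 * (d + B\<^sub>1 * d))"
    by (intro lpb_diff filt_bound fg N) auto
  moreover have "filt N (\<lambda>x. f x - g x) x = filt N f x - g x" for x
  proof -
    have "pr k (\<lambda>x. f x - g x) x = pr k f x - pr k g x" for k
      using ip_diff_left[OF integrable_continuous[OF f] integrable_continuous[OF gc] bas_poly]
      by (simp add: pr_def sum_subtractf[symmetric] left_diff_distrib)
    then have "filt N (\<lambda>x. f x - g x) x = filt N f x - filt N g x"
      by (simp add: filt_def sum_subtractf[symmetric] right_diff_distrib)
    then show ?thesis using filt_reproduce[OF N] by simp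
  qed
  moreover have "4 * (d + B\<^sub>1 * d) = e"
  proof -
    have "4 * (d + B\<^sub>1 * d) = d * (4 * (1 + B\<^sub>1))" by (simp add: algebra_simps)
    then show ?thesis using B1(1) by (simp add: d_def)
  qed
  ultimately show ?thesis by (intro exI[of _ N]) (auto simp: N_def)
qed

lemma bas_ip:
  assumes "b \<in> bas k" "b' \<in> bas k"
  shows "ip b b' = (if b = b' then 1 else 0)"
  using flag(1)[of k] subsetD[OF bas_subset_flag assms(1)] subsetD[OF bas_subset_flag assms(2)] unfolding orthonormal_def by blast

lemma pr_multiplier:
  assumes k: "k \<le> n"
  shows "pr k (\<lambda>x. \<Sum>j\<le>n. c j * pr j g x) x = c k * pr k g x"
proof -
  have "ip (\<lambda>x. \<Sum>j\<le>n. c j * pr j g x) b = c k * ip g b" if b: "b \<in> bas k" for b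
  proof -
    have bi: "integrable M b" by (rule integrable_poly[OF bas_poly[OF b]])
    have z: "ip b (pr j g) = (if j = k then ip g b else 0)" for j
    proof (cases "j = k")
      case True
      have "ip b (pr k g) = (\<Sum>b'\<in>bas k. ip g b' * ip b b')"
        unfolding pr_def by (rule ip_sum_right[OF bi bas_poly])
      also have "\<dots> = (\<Sum>b'\<in>bas k. if b' = b then ip g b' else 0)" by (rule sum.cong) (auto simp: bas_ip[OF b])
      also have "\<dots> = ip g b" using b finite_bas by simp
      finally show ?thesis using True by simp
    next
      case False
      then consider "j < k" | "k < j" by linarith
      then have "ip b (pr j g) = 0"
      proof cases
        case 1
        then show ?thesis using bas_orth[OF b] pr_poly by (simp add: orth_poly_space_iff)
      next
        case 2
        then have "ip (pr j g) b = 0" using pr_orth[of j g] bas_poly[OF b] by (simp add: orth_poly_space_iff)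
        then show ?thesis by (simp add: ip_commute)
      qed
      then show ?thesis using False by simp
    qed
    have "ip (\<lambda>x. \<Sum>j\<le>n. c j * pr j g x) b = ip b (\<lambda>x. \<Sum>j\<le>n. c j * pr j g x)" by (rule ip_commute)
    also have "\<dots> = (\<Sum>j\<le>n. c j * ip b (pr j g))"
    proof -
      have "integrable M (\<lambda>y. b y * (c j * pr j g y))" for j
        by (rule integrable_mult_poly[OF bi poly_space_cmult[OF pr_poly]])
      moreover have "(\<integral>y. b y * (c j * pr j g y) \<partial>M) = c j * (\<integral>y. b y * pr j g y \<partial>M)" for j
        by (subst mult.left_commute) simp
      ultimately show ?thesis by (simp add: ip_def sum_distrib_left Bochner_Integration.integral_sum)
    qed
    also have "\<dots> = (\<Sum>j\<le>n. if j = k then c k * ip g b else 0)" by (rule sum.cong) (auto simp: z)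
    also have "\<dots> = c k * ip g b" using k by simp
    finally show ?thesis .
  qed
  then show ?thesis by (simp add: pr_def sum_distrib_left mult_ac)
qed

lemma pr_filt: "k \<le> 2 * L \<Longrightarrow> pr k (filt L g) x = \<eta> (real k / real L) * pr k g x"
  unfolding filt_def by (rule pr_multiplier)

lemma filt_eq:
  assumes L: "1 \<le> L" and m: "2 * L \<le> m"
  shows "filt L f x = (\<Sum>k\<le>m. \<eta> (real k / real L) * pr k f x)"
  unfolding filt_def
proof (rule sum.mono_neutral_left)
  show "\<forall>k\<in>{..m} - {..2 * L}. \<eta> (real k / real L) * pr k f x = 0"
  proof
    fix k assume "k \<in> {..m} - {..2 * L}"
    then have "2 * real L < real k" by auto
    then have "2 < real k / real L" using L by (simp add: field_simps)
    then show "\<eta> (real k / real L) * pr k f x = 0" by (simp add: eta_zero)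
  qed
qed (use m in auto)

lemma pois_cosh:
  assumes t: "0 < t" and s: "\<bar>s\<bar> \<le> 1"
  shows "pois (exp (- t)) s = (1 - (exp (- t))\<^sup>2) * (2 * exp (- t)) powr (- \<kappa>) * (cosh t - s) powr (- \<kappa>)"
proof -
  have "1 < cosh t" using cosh_real_strict_mono[of 0 t] t by simp
  then have "0 \<le> cosh t - s" using s by simp
  moreover have "1 + (exp (- t))\<^sup>2 - 2 * exp (- t) * s = 2 * exp (- t) * (cosh t - s)"
    by (simp add: cosh_def power2_eq_square algebra_simps exp_minus)
  ultimately show ?thesis by (simp add: pois_def powr_mult)
qed

text \<open>The Poisson means are approximated by polynomials at an exponential rate, since the Poisson
  kernel is a multiple of a power of \<open>cosh t - s\<close>.\<close>

lemma poisson_filt_error: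
  assumes p: "1 \<le> p" and L: "1 \<le> L" "2 * L \<le> m" and Q: "Q \<in> poly_space m" and c: "lpb M (cball 0 1) p Q c" and t: "0 < t"
  shows "lpb M (cball 0 1) p (\<lambda>x. \<Sum>k\<le>m. (1 - \<eta> (real k / real L)) * pr k Q x * exp (- (real k * t)))
    (4 * (1 + B\<^sub>1) * 2 powr (\<kappa> + 2) * c * exp (- (real L / (\<kappa> + 1) * t)))"
proof -
  define \<rho> where "\<rho> = exp (- t)"
  have \<rho>: "0 \<le> \<rho>" "\<rho> < 1" using t by (auto simp: \<rho>_def)
  define \<epsilon> where "\<epsilon> = 2 powr (\<kappa> + 2) * exp (- (real L * t / (\<kappa> + 1)))"
  have \<epsilon>: "0 < \<epsilon>" by (simp add: \<epsilon>_def)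
  obtain h where h: "degree h \<le> L" "\<And>s. \<bar>s\<bar> \<le> 1 \<Longrightarrow> \<bar>poly h s - (cosh t - s) powr (- \<kappa>)\<bar> \<le> \<epsilon> * (cosh t - s) powr (- \<kappa>)"
    using inverse_power_approx[OF kappa_ge_1 t, of L] unfolding \<epsilon>_def by blast
  define C0 where "C0 = (1 - \<rho>\<^sup>2) * (2 * \<rho>) powr (- \<kappa>)"
  have C0: "0 \<le> C0" using \<rho> by (simp add: C0_def power_le_one)
  define g where "g = smult C0 h"
  have dg: "degree g \<le> L" using h(1) by (simp add: g_def)
  have gp: "\<bar>pois \<rho> s - poly g s\<bar> \<le> \<epsilon> * pois \<rho> s" if s: "\<bar>s\<bar> \<le> 1" for s
  proof -
    have e: "pois \<rho> s = C0 * (cosh t - s) powr (- \<kappa>)" using pois_cosh[OF t s] by (simp add: \<rho>_def C0_def)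
    have "\<bar>pois \<rho> s - poly g s\<bar> = C0 * \<bar>poly h s - (cosh t - s) powr (- \<kappa>)\<bar>"
      using C0 by (simp add: e g_def abs_mult[symmetric, of C0] right_diff_distrib[symmetric] abs_minus_commute abs_mult)
    also have "\<dots> \<le> C0 * (\<epsilon> * (cosh t - s) powr (- \<kappa>))" by (intro mult_left_mono h s C0)
    finally show ?thesis by (simp add: e mult.left_commute[of C0])
  qed
  \<comment> \<open>E is the Poisson mean of Q minus the mean with the polynomial kernel of g. The
    two kernels differ by at most \<epsilon> times the Poisson kernel, which has mass 1, so Schur's
    test bounds E by \<epsilon> c.\<close>
  define E where "E = (\<lambda>x. \<Sum>k\<le>m. (\<rho> ^ k - eigp g k) * pr k Q x)"
  have Ep: "E \<in> poly_space m" unfolding E_def by (intro poly_space_sum poly_space_cmult poly_space_mono[OF _ pr_poly]) auto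
  have gm: "poly g \<in> borel_measurable borel" by (intro borel_measurable_continuous_onI continuous_intros)
  define B where "B = (1 - \<rho>\<^sup>2) * (1 - \<rho>) powr (- (2 * \<kappa>))"
  have pB: "\<bar>pois \<rho> s\<bar> \<le> B" if "\<bar>s\<bar> \<le> 1" for s using pois_abs_le[OF \<rho> that] by (simp add: B_def)
  have gB: "\<bar>poly g s\<bar> \<le> B + \<epsilon> * B" if s: "\<bar>s\<bar> \<le> 1" for s
  proof -
    have "\<epsilon> * pois \<rho> s \<le> \<epsilon> * B" using pB[OF s] \<epsilon> by (intro mult_left_mono) auto
    then show ?thesis using gp[OF s] pB[OF s] by linarith
  qed
  have kk: "\<bar>kav (pois \<rho>) x y - kpol g x y\<bar> \<le> \<epsilon> * kav (pois \<rho>) x y" if x: "x \<in> cball 0 1" and y: "y \<in> cball 0 1" for x y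
  proof -
    have i1: "integrable N (\<lambda>t. pois \<rho> (x \<bullet> y + t * \<delta> x * \<delta> y))" by (rule kav_integrable[OF pois_measurable pB x y])
    have i2: "integrable N (\<lambda>t. poly g (x \<bullet> y + t * \<delta> x * \<delta> y))" by (rule kav_integrable[OF gm gB x y])
    have "kav (pois \<rho>) x y - kpol g x y = kav (\<lambda>s. pois \<rho> s - poly g s) x y"
      unfolding kav_poly[OF x y, symmetric] kav_def by (rule Bochner_Integration.integral_diff[OF i1 i2, symmetric])
    moreover have "kav (\<lambda>s. pois \<rho> s - poly g s) x y \<le> kav (\<lambda>s. \<epsilon> * pois \<rho> s) x y"
      and "kav (\<lambda>s. - \<epsilon> * pois \<rho> s) x y \<le> kav (\<lambda>s. pois \<rho> s - poly g s) x y"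
    proof -
      have 1: "\<bar>pois \<rho> s - poly g s\<bar> \<le> B + (B + \<epsilon> * B)" if "\<bar>s\<bar> \<le> 1" for s using pB[OF that] gB[OF that] by linarith
      have 2: "\<bar>\<epsilon> * pois \<rho> s\<bar> \<le> \<epsilon> * B" if "\<bar>s\<bar> \<le> 1" for s using pB[OF that] \<epsilon> by (simp add: abs_mult)
      have 3: "\<bar>- \<epsilon> * pois \<rho> s\<bar> \<le> \<epsilon> * B" if "\<bar>s\<bar> \<le> 1" for s using pB[OF that] \<epsilon> by (simp add: abs_mult)
      have m1: "(\<lambda>s. pois \<rho> s - poly g s) \<in> borel_measurable borel" using gm by measurable
      have m2: "(\<lambda>s. \<epsilon> * pois \<rho> s) \<in> borel_measurable borel" by measurable
      have m3: "(\<lambda>s. - \<epsilon> * pois \<rho> s) \<in> borel_measurable borel" by measurable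
      show "kav (\<lambda>s. pois \<rho> s - poly g s) x y \<le> kav (\<lambda>s. \<epsilon> * pois \<rho> s) x y"
        by (rule kav_mono[OF m1 1 m2 2 _ x y]) (use gp in \<open>auto simp: abs_le_iff\<close>)
      show "kav (\<lambda>s. - \<epsilon> * pois \<rho> s) x y \<le> kav (\<lambda>s. pois \<rho> s - poly g s) x y"
      proof (rule kav_mono[OF m3 3 m1 1 _ x y])
        show "- \<epsilon> * pois \<rho> s \<le> pois \<rho> s - poly g s" if "\<bar>s\<bar> \<le> 1" for s using gp[OF that] by (simp add: abs_le_iff)
      qed
    qed
    ultimately show ?thesis unfolding kav_cmult by (simp add: abs_le_iff)
  qed
  have Qm: "integrable M (\<lambda>y. kav (pois \<rho>) x y * Q y)" if x: "x \<in> cball 0 1" for x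
    by (rule integrable_mult_poly[OF integrable_kav_pois[OF \<rho> x] Q])
  have EI: "E x = (\<integral>y. (kav (pois \<rho>) x y - kpol g x y) * Q y \<partial>M)" if x: "x \<in> cball 0 1" for x
  proof -
    have "(\<integral>y. kav (pois \<rho>) x y * Q y \<partial>M) = (\<integral>y. (\<Sum>k\<le>m. kav (pois \<rho>) x y * pr k Q y) \<partial>M)"
      by (simp add: poly_sum_pr[OF Q, symmetric] sum_distrib_left[symmetric])
    also have "\<dots> = (\<Sum>k\<le>m. (\<integral>y. kav (pois \<rho>) x y * pr k Q y \<partial>M))"
      by (rule Bochner_Integration.integral_sum) (rule integrable_mult_poly[OF integrable_kav_pois[OF \<rho> x] pr_poly])
    also have "\<dots> = (\<Sum>k\<le>m. \<rho> ^ k * pr k Q x)" using kav_pois_integral[OF \<rho> x pr_orth] by simp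
    finally have 1: "(\<integral>y. kav (pois \<rho>) x y * Q y \<partial>M) = (\<Sum>k\<le>m. \<rho> ^ k * pr k Q x)" .
    have "(\<integral>y. kpol g x y * Q y \<partial>M) = (\<integral>y. (\<Sum>k\<le>m. kpol g x y * pr k Q y) \<partial>M)"
      by (simp add: poly_sum_pr[OF Q, symmetric] sum_distrib_left[symmetric])
    also have "\<dots> = (\<Sum>k\<le>m. (\<integral>y. kpol g x y * pr k Q y \<partial>M))"
      by (rule Bochner_Integration.integral_sum) (rule integrable_kpol_mult[OF pr_poly])
    also have "\<dots> = (\<Sum>k\<le>m. eigp g k * pr k Q x)" using kpol_eigen[OF pr_orth x] by simp
    finally have 2: "(\<integral>y. kpol g x y * Q y \<partial>M) = (\<Sum>k\<le>m. eigp g k * pr k Q x)" .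
    have "(\<integral>y. (kav (pois \<rho>) x y - kpol g x y) * Q y \<partial>M) = (\<integral>y. kav (pois \<rho>) x y * Q y \<partial>M) - (\<integral>y. kpol g x y * Q y \<partial>M)"
      unfolding left_diff_distrib by (rule Bochner_Integration.integral_diff[OF Qm[OF x] integrable_kpol_mult[OF Q]])
    then show ?thesis unfolding 1 2 E_def by (simp add: left_diff_distrib sum_subtractf)
  qed
  have kn: "0 \<le> kav (pois \<rho>) x y" if "x \<in> cball 0 1" "y \<in> cball 0 1" for x y using kav_pois_nonneg[OF \<rho> that] .
  have km: "(\<integral>\<^sup>+y. ennreal (\<epsilon> * kav (pois \<rho>) x y) \<partial>M) \<le> ennreal \<epsilon>" if x: "x \<in> cball 0 1" for x
  proof -
    have "(\<integral>\<^sup>+y. ennreal (\<epsilon> * kav (pois \<rho>) x y) \<partial>M) = ennreal (\<integral>y. \<epsilon> * kav (pois \<rho>) x y \<partial>M)"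
      using kn[OF x] \<epsilon> by (intro nn_integral_eq_integral integrable_mult_right integrable_kav_pois \<rho> x AE_I2) auto
    then show ?thesis using kav_pois_mass[OF \<rho> x] by simp
  qed
  note kmeas [measurable] = kav_measurable_M[OF pois_measurable]
  have Eb: "lpb M (cball 0 1) p E (\<epsilon> * c)"
  proof (rule lpb_schur[OF _ _ p _ _ _ _ _ _ km _ \<epsilon> c])
    show "case_prod (\<lambda>x y. \<epsilon> * kav (pois \<rho>) x y) \<in> borel_measurable (M \<Otimes>\<^sub>M M)"
      using kmeas(3)[of \<rho>] unfolding case_prod_beta' by measurable
    show "(\<integral>\<^sup>+x. ennreal (\<epsilon> * kav (pois \<rho>) x y) \<partial>M) \<le> ennreal \<epsilon>" if y: "y \<in> cball 0 1" for y
      using km[OF y] by (simp add: kav_commute[of _ _ y])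
    show "E \<in> borel_measurable M" using integrable_poly[OF Ep] by simp
    show "ennreal \<bar>E x\<bar> \<le> (\<integral>\<^sup>+y. ennreal (\<epsilon> * kav (pois \<rho>) x y * \<bar>Q y\<bar>) \<partial>M)" if x: "x \<in> cball 0 1" for x
    proof -
      have "integrable M (\<lambda>y. (kav (pois \<rho>) x y - kpol g x y) * Q y)"
        unfolding left_diff_distrib by (rule Bochner_Integration.integrable_diff[OF Qm[OF x] integrable_kpol_mult[OF Q]])
      from integral_norm_bound_ennreal[OF this]
      have "ennreal \<bar>E x\<bar> \<le> (\<integral>\<^sup>+y. ennreal \<bar>(kav (pois \<rho>) x y - kpol g x y) * Q y\<bar> \<partial>M)" by (simp add: EI[OF x])
      also have "\<dots> \<le> (\<integral>\<^sup>+y. ennreal (\<epsilon> * kav (pois \<rho>) x y * \<bar>Q y\<bar>) \<partial>M)"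
      proof (rule nn_integral_mono, rule ennreal_leI)
        fix y assume "y \<in> space M"
        then have y: "y \<in> cball 0 1" by simp
        show "\<bar>(kav (pois \<rho>) x y - kpol g x y) * Q y\<bar> \<le> \<epsilon> * kav (pois \<rho>) x y * \<bar>Q y\<bar>"
          unfolding abs_mult by (intro mult_right_mono kk[OF x y]) simp
      qed
      finally show ?thesis .
    qed
  qed (use \<epsilon> kn in \<open>auto intro: sigma_finite_measure_axioms\<close>)
  have "lpb M (cball 0 1) p (\<lambda>x. E x - filt L E x) (4 * (\<epsilon> * c + B\<^sub>1 * (\<epsilon> * c)))"
    by (rule lpb_diff[OF p Eb filt_bound[OF p L(1) Eb]])
  moreover have "E x - filt L E x = (\<Sum>k\<le>m. (1 - \<eta> (real k / real L)) * pr k Q x * exp (- (real k * t)))" for x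
  proof -
    have "filt L E x = (\<Sum>k\<le>m. \<eta> (real k / real L) * ((\<rho> ^ k - eigp g k) * pr k Q x))"
      unfolding filt_eq[OF L] E_def by (intro sum.cong) (auto simp: pr_multiplier)
    then have "E x - filt L E x = (\<Sum>k\<le>m. (\<rho> ^ k - eigp g k) * pr k Q x - \<eta> (real k / real L) * ((\<rho> ^ k - eigp g k) * pr k Q x))"
      by (simp add: E_def sum_subtractf)
    \<comment> \<open>For k up to L the factor 1 - \<eta> is 0; for larger k the multiplier of g is
      0, since g has degree at most L. Only the multiplier of the Poisson mean is left.\<close>
    also have "\<dots> = (\<Sum>k\<le>m. (1 - \<eta> (real k / real L)) * pr k Q x * exp (- (real k * t)))"
    proof (rule sum.cong)
      fix k assume "k \<in> {..m}"
      have \<rho>k: "\<rho> ^ k = exp (- (real k * t))" by (simp add: \<rho>_def exp_of_nat_mult[symmetric])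
      show "(\<rho> ^ k - eigp g k) * pr k Q x - \<eta> (real k / real L) * ((\<rho> ^ k - eigp g k) * pr k Q x)
          = (1 - \<eta> (real k / real L)) * pr k Q x * exp (- (real k * t))"
      proof (cases "k \<le> L")
        case True
        then have "\<eta> (real k / real L) = 1" using L(1) by (intro eta_one) (auto simp: divide_le_eq)
        then show ?thesis by simp
      next
        case False
        then have "eigp g k = 0" unfolding eigp_eq[OF dg] by (intro sum.neutral) (auto simp: eig_below)
        then show ?thesis by (simp add: \<rho>k algebra_simps)
      qed
    qed simp
    finally show ?thesis .
  qed
  moreover have "4 * (\<epsilon> * c + B\<^sub>1 * (\<epsilon> * c)) = 4 * (1 + B\<^sub>1) * 2 powr (\<kappa> + 2) * c * exp (- (real L / (\<kappa> + 1) * t))"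
    by (simp add: \<epsilon>_def algebra_simps)
  ultimately show ?thesis by simp
qed

end

text \<open>Lets a norm be replaced by an arbitrary c strictly above it, which yields positivity for
  the Sobolev bound and near best approximants for the Besov bound.\<close>

lemma le_of_all_greater:
  fixes a X y :: real
  assumes "0 < a" "\<And>c. X < c \<Longrightarrow> y \<le> a * c"
  shows "y \<le> a * X"
proof (rule field_le_epsilon)
  fix e :: real assume "0 < e"
  then have "y \<le> a * (X + e / a)" using assms by (intro assms(2)) simp
  also have "\<dots> = a * X + e" using assms(1) by (simp add: algebra_simps)
  finally show "y \<le> a * X + e" .
qed

context filter_setting
begin

text \<open>The Poisson estimate is integrated against two Gamma densities, one for each factor of
  the eigenvalue k (k + D - 1). For the second factor the additional exp (- (D - 1) t) is at most
  1.\<close>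

lemma potential_filt_error:
  assumes p: "1 \<le> p" and \<sigma>: "0 < \<sigma>" and L: "1 \<le> L" "2 * L \<le> m" and Q: "Q \<in> poly_space m" and c: "lpb M (cball 0 1) p Q c"
  shows "lpb M (cball 0 1) p
    (\<lambda>x. \<Sum>k\<in>{1..m}. (1 - \<eta> (real k / real L)) * pr k Q x * real k powr (- \<sigma>) * (real k + (D - 1)) powr (- \<sigma>))
    ((real L / (\<kappa> + 1)) powr (- \<sigma>) * ((real L / (\<kappa> + 1)) powr (- \<sigma>) * (4 * (1 + B\<^sub>1) * 2 powr (\<kappa> + 2) * c)))"
proof -
  define A where "A = 4 * (1 + B\<^sub>1) * 2 powr (\<kappa> + 2) * c"
  have A: "0 \<le> A" using B1(1) lpb_nonneg[OF c] by (simp add: A_def)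
  define b where "b = real L / (\<kappa> + 1)"
  have b: "0 < b" using L kappa_ge_1 by (simp add: b_def)
  define q where "q k x = (1 - \<eta> (real k / real L)) * pr k Q x" for k x
  have qm: "q k \<in> borel_measurable M" for k
    unfolding q_def[abs_def] using integrable_poly[OF poly_space_cmult[OF pr_poly]] by blast
  have base: "lpb M (cball 0 1) p (\<lambda>x. \<Sum>k\<in>{1..m}. q k x * exp (- (real k * t))) (A * exp (- (b * t)))" if t: "0 < t" for t
  proof -
    \<comment> \<open>The constant component is removed because the filter is 1 at 0; the negative
      powers start at k = 1.\<close>
    have "q 0 x = 0" for x using eta_one[of 0] by (simp add: q_def)
    then have "(\<Sum>k\<le>m. q k x * exp (- (real k * t))) = (\<Sum>k\<in>{1..m}. q k x * exp (- (real k * t)))" for x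
      by (intro sum.mono_neutral_right) (auto simp: not_less_eq_eq Suc_le_eq)
    then show ?thesis
      using poisson_filt_error[OF p L Q c t] by (simp add: q_def A_def b_def)
  qed
  have step: "lpb M (cball 0 1) p (\<lambda>x. \<Sum>k\<in>{1..m}. q k x * exp (- (real k * t)) * real k powr (- \<sigma>)) (b powr (- \<sigma>) * (A * exp (- (b * t))))"
    if t: "0 < t" for t
  proof (rule lpb_laplace[OF sigma_finite_measure_axioms p _ \<sigma> b])
    \<comment> \<open>The first Laplace integral keeps a spare factor exp (- k t) for the second
      one: the basic bound is used at time t + s.\<close>
    show "lpb M (cball 0 1) p (\<lambda>x. \<Sum>k\<in>{1..m}. q k x * exp (- (real k * t)) * exp (- (real k * s))) (A * exp (- (b * t)) * exp (- (b * s)))"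
      if s: "0 < s" for s
    proof -
      have "exp (- (a * (t + s))) = exp (- (a * t)) * exp (- (a * s))" for a by (simp add: exp_add[symmetric] algebra_simps)
      then show ?thesis using base[of "t + s"] t s by (simp add: mult.assoc)
    qed
    show "(\<lambda>x. q k x * exp (- (real k * t))) \<in> borel_measurable M" for k using qm[of k] by measurable
  qed (use A in auto)
  have "lpb M (cball 0 1) p (\<lambda>x. \<Sum>k\<in>{1..m}. q k x * real k powr (- \<sigma>) * (real k + (D - 1)) powr (- \<sigma>)) (b powr (- \<sigma>) * (b powr (- \<sigma>) * A))"
  proof (rule lpb_laplace[OF sigma_finite_measure_axioms p _ \<sigma> b])
    show "lpb M (cball 0 1) p (\<lambda>x. \<Sum>k\<in>{1..m}. q k x * real k powr (- \<sigma>) * exp (- ((real k + (D - 1)) * t))) (b powr (- \<sigma>) * A * exp (- (b * t)))"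
      if t: "0 < t" for t
    proof -
      have "lpb M (cball 0 1) p (\<lambda>x. exp (- ((D - 1) * t)) * (\<Sum>k\<in>{1..m}. q k x * exp (- (real k * t)) * real k powr (- \<sigma>)))
          (\<bar>exp (- ((D - 1) * t))\<bar> * (b powr (- \<sigma>) * (A * exp (- (b * t)))))"
        by (rule lpb_cmult[OF p step[OF t]])
      moreover have "\<bar>exp (- ((D - 1) * t))\<bar> * (b powr (- \<sigma>) * (A * exp (- (b * t)))) \<le> 1 * (b powr (- \<sigma>) * (A * exp (- (b * t))))"
        using A D_ge_1 t by (intro mult_right_mono) auto
      moreover have "exp (- ((D - 1) * t)) * (\<Sum>k\<in>{1..m}. q k x * exp (- (real k * t)) * real k powr (- \<sigma>))
         = (\<Sum>k\<in>{1..m}. q k x * real k powr (- \<sigma>) * exp (- ((real k + (D - 1)) * t)))" for x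
      proof -
        have "exp (- ((real k + (D - 1)) * t)) = exp (- ((D - 1) * t)) * exp (- (real k * t))" for k
          by (simp add: exp_add[symmetric] algebra_simps)
        then show ?thesis by (simp add: sum_distrib_left mult_ac)
      qed
      ultimately show ?thesis by (simp add: lpb_mono mult.assoc)
    qed
    show "(\<lambda>x. q k x * real k powr (- \<sigma>)) \<in> borel_measurable M" for k using qm[of k] by measurable
  qed (use A D_ge_1 in auto)
  then show ?thesis by (simp add: q_def A_def b_def)
qed

text \<open>For F = \<open>filt N f\<close> the difference \<open>F x - filt L F x\<close> is the
  operator of \<open>potential_filt_error\<close> applied to \<open>filt N g\<close>, since the
  projections of f of degree at least 1 are those of g divided by the power r/2 of the eigenvalue.
  Filtering at a large N makes both expansions finite.\<close>

lemma sobolev_approx: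
  assumes p: "1 \<le> p" and r: "0 < r"
  shows "\<exists>C>0. \<forall>L f g c. 1 \<le> L \<longrightarrow> continuous_on (cball 0 1) f \<longrightarrow> lpb M (cball 0 1) p g c \<longrightarrow> 0 < c \<longrightarrow>
    (\<forall>k. \<forall>x\<in>cball 0 1. pr k g x = (real k * (real k + (D - 1))) powr (r / 2) * pr k f x) \<longrightarrow>
    (\<exists>P\<in>poly_space (2 * L). lpb M (cball 0 1) p (\<lambda>x. f x - P x) (C * real L powr (- r) * c))"
proof -
  define \<sigma> where "\<sigma> = r / 2"
  have \<sigma>: "0 < \<sigma>" using r by (simp add: \<sigma>_def)
  define A where "A = (\<kappa> + 1) powr r * (4 * (1 + B\<^sub>1) * 2 powr (\<kappa> + 2) * B\<^sub>1)"
  have A: "0 < A" using B1(1) kappa_ge_1 by (simp add: A_def)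
  have "\<exists>P\<in>poly_space (2 * L). lpb M (cball 0 1) p (\<lambda>x. f x - P x) (4 * (1 + A) * real L powr (- r) * c)"
    if L: "1 \<le> L" and f: "continuous_on (cball 0 1) f" and g: "lpb M (cball 0 1) p g c" and c: "0 < c"
      and fg: "\<forall>k. \<forall>x\<in>cball 0 1. pr k g x = (real k * (real k + (D - 1))) powr (r / 2) * pr k f x" for L f g c
  proof -
    \<comment> \<open>The accuracy asked of \<open>filt N f\<close> has the size of the final bound,
      so this error is absorbed; it is positive because c is.\<close>
    define e where "e = real L powr (- r) * c"
    have e: "0 < e" using L c by (simp add: e_def)
    obtain N where N: "L \<le> N" "lpb M (cball 0 1) \<infinity> (\<lambda>x. f x - filt N f x) e" using filt_converges[OF f e L] by blast
    have N1: "1 \<le> N" using N(1) L by simp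
    have LN: "2 * L \<le> 2 * N" using N(1) by simp
    have f1: "lpb M (cball 0 1) p (\<lambda>x. f x - filt N f x) e"
      by (rule lpb_exponent[OF prob_space_axioms p _ _ N(2)]) auto
    define F where "F = filt N f"
    define Q where "Q = filt N g"
    have Qp: "Q \<in> poly_space (2 * N)" unfolding Q_def by (rule filt_poly)
    have Qb: "lpb M (cball 0 1) p Q (B\<^sub>1 * c)" unfolding Q_def by (rule filt_bound[OF p N1 g])
    have eq: "F x - filt L F x = (\<Sum>k\<in>{1..2 * N}. (1 - \<eta> (real k / real L)) * pr k Q x * real k powr (- \<sigma>) * (real k + (D - 1)) powr (- \<sigma>))"
      if x: "x \<in> cball 0 1" for x
    proof -
      have "F x - filt L F x = (\<Sum>k\<le>2 * N. (1 - \<eta> (real k / real L)) * (\<eta> (real k / real N) * pr k f x))"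
        unfolding filt_eq[OF L LN] unfolding F_def
        by (simp add: pr_filt filt_def[of N f x] sum_subtractf[symmetric] left_diff_distrib)
      also have "\<dots> = (\<Sum>k\<in>{1..2 * N}. (1 - \<eta> (real k / real L)) * (\<eta> (real k / real N) * pr k f x))"
        using eta_one[of 0] by (intro sum.mono_neutral_right) (auto simp: not_less_eq_eq Suc_le_eq)
      also have "\<dots> = (\<Sum>k\<in>{1..2 * N}. (1 - \<eta> (real k / real L)) * pr k Q x * real k powr (- \<sigma>) * (real k + (D - 1)) powr (- \<sigma>))"
      proof (rule sum.cong)
        fix k assume k: "k \<in> {1..2 * N}"
        have pos: "0 < real k" "0 < real k + (D - 1)" using k D_ge_1 by auto
        have 1: "pr k Q x = \<eta> (real k / real N) * ((real k * (real k + (D - 1))) powr \<sigma> * pr k f x)"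
          using k pr_filt[of k N g x] fg x by (simp add: Q_def \<sigma>_def)
        have 2: "(real k * (real k + (D - 1))) powr \<sigma> = real k powr \<sigma> * (real k + (D - 1)) powr \<sigma>"
          using pos by (subst powr_mult) auto
        have 3: "real k powr \<sigma> * real k powr (- \<sigma>) = 1" "(real k + (D - 1)) powr \<sigma> * (real k + (D - 1)) powr (- \<sigma>) = 1"
          unfolding powr_add[symmetric] using pos by auto
        have "pr k Q x * real k powr (- \<sigma>) * (real k + (D - 1)) powr (- \<sigma>)
            = (real k powr \<sigma> * real k powr (- \<sigma>)) * ((real k + (D - 1)) powr \<sigma> * (real k + (D - 1)) powr (- \<sigma>)) * (\<eta> (real k / real N) * pr k f x)"
          unfolding 1 2 by (simp only: mult_ac)
        then have "pr k Q x * real k powr (- \<sigma>) * (real k + (D - 1)) powr (- \<sigma>) = \<eta> (real k / real N) * pr k f x"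
          unfolding 3 by simp
        then show "(1 - \<eta> (real k / real L)) * (\<eta> (real k / real N) * pr k f x)
            = (1 - \<eta> (real k / real L)) * pr k Q x * real k powr (- \<sigma>) * (real k + (D - 1)) powr (- \<sigma>)"
          by (simp only: mult.assoc)
      qed simp
      finally show ?thesis .
    qed
    have Fm: "(\<lambda>x. F x - filt L F x) \<in> borel_measurable M"
      using integrable_poly[OF filt_poly, of N f] integrable_poly[OF filt_poly, of L F] unfolding F_def by measurable
    have b1: "lpb M (cball 0 1) p (\<lambda>x. F x - filt L F x)
        ((real L / (\<kappa> + 1)) powr (- \<sigma>) * ((real L / (\<kappa> + 1)) powr (- \<sigma>) * (4 * (1 + B\<^sub>1) * 2 powr (\<kappa> + 2) * (B\<^sub>1 * c))))"
      by (rule lpb_cong[OF potential_filt_error[OF p \<sigma> L LN Qp Qb] _ Fm]) (simp_all add: eq)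
    have b2: "(real L / (\<kappa> + 1)) powr (- \<sigma>) * ((real L / (\<kappa> + 1)) powr (- \<sigma>) * (4 * (1 + B\<^sub>1) * 2 powr (\<kappa> + 2) * (B\<^sub>1 * c))) = A * e"
    proof -
      have "(real L / (\<kappa> + 1)) powr (- \<sigma>) * (real L / (\<kappa> + 1)) powr (- \<sigma>) = (real L / (\<kappa> + 1)) powr (- r)"
        unfolding powr_add[symmetric] by (simp add: \<sigma>_def)
      also have "\<dots> = (\<kappa> + 1) powr r * real L powr (- r)"
        unfolding powr_minus_divide using kappa_ge_1 by (simp add: powr_divide)
      finally show ?thesis by (simp add: mult.assoc[symmetric] A_def e_def)
    qed
    have "lpb M (cball 0 1) p (\<lambda>x. (f x - F x) + (F x - filt L F x)) (4 * (e + A * e))"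
      by (rule lpb_add[OF p f1[folded F_def] b1[unfolded b2]])
    then have "lpb M (cball 0 1) p (\<lambda>x. f x - filt L F x) (4 * (1 + A) * real L powr (- r) * c)"
      by (simp add: e_def algebra_simps)
    then show ?thesis using filt_poly by blast
  qed
  moreover have "0 < 4 * (1 + A)" using A by simp
  ultimately show ?thesis by blast
qed

section \<open>Conclusion for the two function spaces\<close>

lemma hyp_sobolev_error:
  assumes p: "1 \<le> p" and q: "1 \<le> q" and r: "D * enn2real (1 / p) < r"
  shows "\<exists>C. \<forall>L \<Lambda> w f. quad L \<Lambda> w \<longrightarrow> f \<in> sobolev_space \<mu> p r \<longrightarrow> continuous_on (cball 0 1) f \<longrightarrow>
    lp_norm \<mu> q (\<lambda>x. f x - hyp L \<Lambda> w f x)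
      \<le> C * real L powr (- r + D * max (enn2real (1 / p) - enn2real (1 / q)) 0) * sobolev_norm \<mu> p r f"
proof -
  define ex where "ex = - r + D * max (enn2real (1 / p) - enn2real (1 / q)) 0"
  have "0 \<le> D * enn2real (1 / p)" using D_ge_1 by simp
  then have r0: "0 < r" using r by linarith
  obtain C1 where C1: "0 < C1" "\<And>L \<Lambda> w f B. quad L \<Lambda> w \<Longrightarrow> continuous_on (cball 0 1) f \<Longrightarrow> 0 \<le> B \<Longrightarrow>
    (\<forall>j. \<exists>P\<in>poly_space (2 ^ j). lpb M (cball 0 1) p (\<lambda>x. f x - P x) (B * real (2 ^ j) powr (- r))) \<Longrightarrow>
    lpb M (cball 0 1) q (\<lambda>x. f x - hyp L \<Lambda> w f x) (C1 * real L powr ex * B)"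
    using hyp_error[OF p q r] unfolding ex_def by blast
  obtain C2 where C2: "0 < C2" "\<And>L f g c. 1 \<le> L \<Longrightarrow> continuous_on (cball 0 1) f \<Longrightarrow> lpb M (cball 0 1) p g c \<Longrightarrow> 0 < c \<Longrightarrow>
    (\<forall>k. \<forall>x\<in>cball 0 1. pr k g x = (real k * (real k + (D - 1))) powr (r / 2) * pr k f x) \<Longrightarrow>
    \<exists>P\<in>poly_space (2 * L). lpb M (cball 0 1) p (\<lambda>x. f x - P x) (C2 * real L powr (- r) * c)"
    using sobolev_approx[OF p r0] by blast
  define C3 where "C3 = max 1 (C2 * 2 powr r)"
  have C3: "1 \<le> C3" "C2 * 2 powr r \<le> C3" by (auto simp: C3_def)
  have "lp_norm \<mu> q (\<lambda>x. f x - hyp L \<Lambda> w f x) \<le> C1 * C3 * real L powr ex * sobolev_norm \<mu> p r f"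
    if Q: "quad L \<Lambda> w" and fs: "f \<in> sobolev_space \<mu> p r" and f: "continuous_on (cball 0 1) f" for L \<Lambda> w f
  proof (rule le_of_all_greater)
    have L: "1 \<le> L" using Q by (simp add: quad_def)
    then show "0 < C1 * C3 * real L powr ex" using C1(1) C3 by simp
    define g where "g = (SOME g. is_frac_D \<mu> p r f g)"
    have fp: "f \<in> lp_space \<mu> p" and "\<exists>g. is_frac_D \<mu> p r f g" using fs by (auto simp: sobolev_space_def)
    from someI_ex[OF this(2)] have "is_frac_D \<mu> p r f g" by (simp only: g_def)
    then have gp: "g \<in> lp_space \<mu> p"
      and gD: "\<And>k x. x \<in> cball 0 1 \<Longrightarrow> proj \<mu> k g x = (real k * (real k + 2 * \<mu> + real CARD('n) - 1)) powr (r / 2) * proj \<mu> k f x"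
      by (auto simp: is_frac_D_def)
    have nf: "0 \<le> lp_norm \<mu> p f" and ng: "0 \<le> lp_norm \<mu> p g" using lp_norm_nonneg[OF p] fp gp by auto
    have Xeq: "sobolev_norm \<mu> p r f = lp_norm \<mu> p f + lp_norm \<mu> p g" by (simp add: sobolev_norm_def g_def)
    have gi: "integrable M g"
    proof -
      have "lpb M (cball 0 1) 1 g (lp_norm \<mu> p g)" by (rule lpb_exponent[OF prob_space_axioms _ p _ lpb_lp_norm[OF p gp]]) auto
      then have [measurable]: "g \<in> borel_measurable M" and "(\<integral>\<^sup>+x. ennreal \<bar>g x\<bar> \<partial>M) < \<infinity>"
        by (auto simp: lpb_def intro: le_less_trans)
      then show ?thesis by (intro integrableI_bounded) auto
    qed
    have D1: "D - 1 = 2 * \<mu> + real CARD('n) - 1" by (simp add: kappa_eq field_simps)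
    have pg: "\<forall>k. \<forall>x\<in>cball 0 1. pr k g x = (real k * (real k + (D - 1))) powr (r / 2) * pr k f x"
      using gD unfolding proj_eq[OF gi] proj_eq[OF integrable_continuous[OF f]] D1 by (simp add: add.assoc add_diff_eq)
    fix c assume c: "sobolev_norm \<mu> p r f < c"
    have c0: "0 < c" using c nf ng Xeq by linarith
    have fc: "lpb M (cball 0 1) p f c" by (rule lpb_mono[OF lpb_lp_norm[OF p fp]]) (use c Xeq ng in linarith)
    have gc: "lpb M (cball 0 1) p g c" by (rule lpb_mono[OF lpb_lp_norm[OF p gp]]) (use c Xeq nf in linarith)
    \<comment> \<open>The zero polynomial serves for j = 0. Otherwise \<open>sobolev_approx\<close>
      at L = 2^(j - 1) gives degree 2^j, at the cost of 2^r; both cases are covered by C3.\<close>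
    have "\<exists>P\<in>poly_space (2 ^ j). lpb M (cball 0 1) p (\<lambda>x. f x - P x) (C3 * c * real (2 ^ j) powr (- r))" for j
    proof (cases j)
      case 0
      have "lpb M (cball 0 1) p f (C3 * c)" by (rule lpb_mono[OF fc]) (use C3 c0 in simp)
      then show ?thesis using 0 poly_space_const[of 0] by (intro bexI[of _ "\<lambda>_. 0"]) auto
    next
      case (Suc i)
      obtain P where P: "P \<in> poly_space (2 * 2 ^ i)" "lpb M (cball 0 1) p (\<lambda>x. f x - P x) (C2 * real (2 ^ i) powr (- r) * c)"
        using C2(2)[OF _ f gc c0 pg, of "2 ^ i"] by auto
      have "real (2 ^ i) powr (- r) = 2 powr r * real (2 ^ j) powr (- r)"
      proof -
        have "real (2 ^ j) powr (- r) = 2 powr (- r) * real (2 ^ i) powr (- r)" by (simp add: Suc powr_mult)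
        then have "2 powr r * real (2 ^ j) powr (- r) = (2 powr r * 2 powr (- r)) * real (2 ^ i) powr (- r)" by simp
        also have "2 powr r * 2 powr (- r) = (1 :: real)" unfolding powr_add[symmetric] by simp
        finally show ?thesis by simp
      qed
      then have "C2 * real (2 ^ i) powr (- r) * c = (C2 * 2 powr r) * (c * real (2 ^ j) powr (- r))" by (simp only: mult_ac)
      also have "\<dots> \<le> C3 * (c * real (2 ^ j) powr (- r))" using C3 c0 by (intro mult_right_mono) auto
      finally have le: "C2 * real (2 ^ i) powr (- r) * c \<le> C3 * c * real (2 ^ j) powr (- r)" by (simp only: mult.assoc)
      show ?thesis using P(1) lpb_mono[OF P(2) le] by (auto simp: Suc)
    qed
    then have "lpb M (cball 0 1) q (\<lambda>x. f x - hyp L \<Lambda> w f x) (C1 * real L powr ex * (C3 * c))"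
      using C3 c0 by (intro C1(2)[OF Q f]) auto
    from lp_norm_le[OF q this] show "lp_norm \<mu> q (\<lambda>x. f x - hyp L \<Lambda> w f x) \<le> C1 * C3 * real L powr ex * c" by (simp only: mult_ac)
  qed
  then show ?thesis unfolding ex_def by blast
qed

lemma best_approx_nonneg:
  fixes f :: "real ^ 'n \<Rightarrow> real"
  assumes "1 \<le> p" "f \<in> lp_space \<mu> p"
  shows "0 \<le> best_approx \<mu> p n f"
  unfolding best_approx_def
  by (rule cINF_greatest) (use poly_space_const[of 0 n] lp_norm_nonneg[OF assms(1) lp_space_diff_poly[OF assms]] in auto)

text \<open>The Besov norm dominates each single weighted term, because it is a supremum of these
  terms or a sum of nonnegative powers of them.\<close>

lemma best_approx_besov:
  fixes f :: "real ^ 'n \<Rightarrow> real"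
  assumes p: "1 \<le> p" and \<tau>: "0 < \<tau>" and f: "f \<in> besov_space \<mu> p r \<tau>"
  shows "best_approx \<mu> p (2 ^ j) f \<le> besov_norm \<mu> p r \<tau> f * real (2 ^ j) powr (- r)" "0 \<le> besov_norm \<mu> p r \<tau> f"
proof -
  have fp: "f \<in> lp_space \<mu> p" using f by (simp add: besov_space_def)
  have nf: "0 \<le> lp_norm \<mu> p f" by (rule lp_norm_nonneg[OF p fp])
  define E where "E j = best_approx \<mu> p (2 ^ j) f" for j :: nat
  have E0: "0 \<le> E j" for j unfolding E_def by (rule best_approx_nonneg[OF p fp])
  have le: "2 powr (real j * r) * E j \<le> besov_norm \<mu> p r \<tau> f" for j
  proof (cases "\<tau> = \<infinity>")
    case True
    have "bdd_above (range (\<lambda>j::nat. 2 powr (real j * r) * E j))" using f True by (simp add: besov_space_def E_def)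
    then have "2 powr (real j * r) * E j \<le> (SUP j::nat. 2 powr (real j * r) * E j)" by (intro cSUP_upper) auto
    then show ?thesis using nf True by (simp add: besov_norm_def E_def)
  next
    case False
    define t where "t = enn2real \<tau>"
    have t: "0 < t" using \<tau> False by (simp add: t_def enn2real_positive_iff less_top)
    define u where "u j = 2 powr (real j * r * t) * E j powr t" for j
    have u0: "0 \<le> u j" for j by (simp add: u_def)
    have s: "summable u" using f False unfolding besov_space_def u_def E_def t_def by auto
    have "sum u {j} \<le> suminf u" by (rule sum_le_suminf[OF s]) (use u0 in auto)
    then have "u j powr (1 / t) \<le> suminf u powr (1 / t)" using u0 t by (intro powr_mono2) auto
    moreover have "u j powr (1 / t) = 2 powr (real j * r) * E j" using t E0 by (simp add: u_def powr_mult powr_powr)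
    ultimately show ?thesis using nf False by (simp add: besov_norm_def u_def[abs_def] E_def t_def)
  qed
  from order_trans[OF _ le[of 0]] show "0 \<le> besov_norm \<mu> p r \<tau> f" using E0 by simp
  have pw: "2 powr (real j * r) = real (2 ^ j) powr r" by (simp add: powr_realpow[symmetric] powr_powr del: powr_realpow)
  have "E j = (real (2 ^ j) powr r * real (2 ^ j) powr (- r)) * E j" unfolding powr_add[symmetric] by simp
  also have "\<dots> = (2 powr (real j * r) * E j) * real (2 ^ j) powr (- r)" by (simp add: pw)
  also have "\<dots> \<le> besov_norm \<mu> p r \<tau> f * real (2 ^ j) powr (- r)" by (intro mult_right_mono le) simp
  finally show "best_approx \<mu> p (2 ^ j) f \<le> besov_norm \<mu> p r \<tau> f * real (2 ^ j) powr (- r)" by (simp only: E_def)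
qed

lemma hyp_besov_error:
  assumes p: "1 \<le> p" and q: "1 \<le> q" and r: "D * enn2real (1 / p) < r" and \<tau>: "0 < \<tau>"
  shows "\<exists>C. \<forall>L \<Lambda> w f. quad L \<Lambda> w \<longrightarrow> f \<in> besov_space \<mu> p r \<tau> \<longrightarrow> continuous_on (cball 0 1) f \<longrightarrow>
    lp_norm \<mu> q (\<lambda>x. f x - hyp L \<Lambda> w f x)
      \<le> C * real L powr (- r + D * max (enn2real (1 / p) - enn2real (1 / q)) 0) * besov_norm \<mu> p r \<tau> f"
proof -
  define ex where "ex = - r + D * max (enn2real (1 / p) - enn2real (1 / q)) 0"
  obtain C where C: "0 < C" "\<And>L \<Lambda> w f B. quad L \<Lambda> w \<Longrightarrow> continuous_on (cball 0 1) f \<Longrightarrow> 0 \<le> B \<Longrightarrow>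
    (\<forall>j. \<exists>P\<in>poly_space (2 ^ j). lpb M (cball 0 1) p (\<lambda>x. f x - P x) (B * real (2 ^ j) powr (- r))) \<Longrightarrow>
    lpb M (cball 0 1) q (\<lambda>x. f x - hyp L \<Lambda> w f x) (C * real L powr ex * B)"
    using hyp_error[OF p q r] unfolding ex_def by blast
  have "lp_norm \<mu> q (\<lambda>x. f x - hyp L \<Lambda> w f x) \<le> C * real L powr ex * besov_norm \<mu> p r \<tau> f"
    if Q: "quad L \<Lambda> w" and fs: "f \<in> besov_space \<mu> p r \<tau>" and f: "continuous_on (cball 0 1) f" for L \<Lambda> w f
  proof (rule le_of_all_greater)
    have "1 \<le> L" using Q by (simp add: quad_def)
    then show "0 < C * real L powr ex" using C(1) by simp
    have fp: "f \<in> lp_space \<mu> p" using fs by (simp add: besov_space_def)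
    fix c assume c: "besov_norm \<mu> p r \<tau> f < c"
    have c0: "0 \<le> c" using c best_approx_besov(2)[OF p \<tau> fs] by simp
    have "\<exists>P\<in>poly_space (2 ^ j). lpb M (cball 0 1) p (\<lambda>x. f x - P x) (c * real (2 ^ j) powr (- r))" for j
    proof -
      have "besov_norm \<mu> p r \<tau> f * real (2 ^ j) powr (- r) < c * real (2 ^ j) powr (- r)" using c by (intro mult_strict_right_mono) auto
      then have "best_approx \<mu> p (2 ^ j) f < c * real (2 ^ j) powr (- r)"
        using best_approx_besov(1)[OF p \<tau> fs, of j] by (rule le_less_trans[rotated])
      \<comment> \<open>The infimum need not be attained; the strict inequality between the norm and
        c supplies an admissible polynomial.\<close>
      then obtain P where P: "P \<in> poly_space (2 ^ j)" "lp_norm \<mu> p (\<lambda>x. f x - P x) < c * real (2 ^ j) powr (- r)"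
        unfolding best_approx_def using cInf_lessD[of "(\<lambda>P. lp_norm \<mu> p (\<lambda>x. f x - P x)) ` poly_space (2 ^ j)"] poly_space_const[of 0 "2 ^ j"] by blast
      have "lpb M (cball 0 1) p (\<lambda>x. f x - P x) (c * real (2 ^ j) powr (- r))"
        by (rule lpb_mono[OF lpb_lp_norm[OF p lp_space_diff_poly[OF p fp P(1)]]]) (use P(2) in simp)
      then show ?thesis using P(1) by blast
    qed
    then have "lpb M (cball 0 1) q (\<lambda>x. f x - hyp L \<Lambda> w f x) (C * real L powr ex * c)"
      using c0 by (intro C(2)[OF Q f]) auto
    from lp_norm_le[OF q this] show "lp_norm \<mu> q (\<lambda>x. f x - hyp L \<Lambda> w f x) \<le> C * real L powr ex * c" .
  qed
  then show ?thesis unfolding ex_def by blast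
qed

end

theorem theorem3p1:
  fixes \<mu> r :: real and p q \<tau> :: ennreal and \<eta> :: "real \<Rightarrow> real"
    and \<Lambda> :: "nat \<Rightarrow> (real ^ 'n) set" and w :: "nat \<Rightarrow> real ^ 'n \<Rightarrow> real"
  assumes "\<mu> \<ge> 0" and "1 \<le> p" and "1 \<le> q" and "0 < \<tau>"
    and "r > (real CARD('n) + 2 * \<mu>) * enn2real (1 / p)"
    and "continuous_on {0..} \<eta>"
    and "\<And>t. t \<ge> 0 \<Longrightarrow> indicator {0..1} t \<le> \<eta> t \<and> \<eta> t \<le> indicator {0..2} t"
    and "\<exists>M. \<forall>L\<ge>1. \<forall>x\<in>cball (0 :: real ^ 'n) 1. lp_norm \<mu> 1 (filter_kernel \<mu> \<eta> L x) \<le> M"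
    and "\<And>L. L \<ge> 1 \<Longrightarrow> finite (\<Lambda> L)"
    and "\<And>L. L \<ge> 1 \<Longrightarrow> \<Lambda> L \<subseteq> cball 0 1"
    and "\<exists>c1>0. \<exists>c2>0. \<forall>L\<ge>1. c1 * real L ^ CARD('n) \<le> real (card (\<Lambda> L))
                            \<and> real (card (\<Lambda> L)) \<le> c2 * real L ^ CARD('n)"
    and "\<And>L \<omega>. L \<ge> 1 \<Longrightarrow> \<omega> \<in> \<Lambda> L \<Longrightarrow> w L \<omega> > 0"
    and "\<And>L P. L \<ge> 1 \<Longrightarrow> P \<in> poly_space (3 * L) \<Longrightarrow>
           (LINT x|ball_measure \<mu>. P x) = (\<Sum>\<omega>\<in>\<Lambda> L. w L \<omega> * P \<omega>)"
  shows "(\<exists>C. \<forall>L\<ge>1. \<forall>f\<in>sobolev_space \<mu> p r. continuous_on (cball 0 1) f \<longrightarrow>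
            lp_norm \<mu> q (\<lambda>x. f x - hyperinterp \<mu> \<eta> \<Lambda> w L f x)
              \<le> C * real L powr (- r + (real CARD('n) + 2 * \<mu>)
                                    * max (enn2real (1 / p) - enn2real (1 / q)) 0)
                  * sobolev_norm \<mu> p r f) \<and>
         (\<exists>C. \<forall>L\<ge>1. \<forall>f\<in>besov_space \<mu> p r \<tau>. continuous_on (cball 0 1) f \<longrightarrow>
            lp_norm \<mu> q (\<lambda>x. f x - hyperinterp \<mu> \<eta> \<Lambda> w L f x)
              \<le> C * real L powr (- r + (real CARD('n) + 2 * \<mu>)
                                    * max (enn2real (1 / p) - enn2real (1 / q)) 0)
                  * besov_norm \<mu> p r \<tau> f)"
proof -
  obtain B where B: "\<And>L x. 1 \<le> L \<Longrightarrow> x \<in> cball (0 :: real ^ 'n) 1 \<Longrightarrow> lp_norm \<mu> 1 (filter_kernel \<mu> \<eta> L x) \<le> B"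
    using assms(8) by blast
  interpret filter_setting \<mu> "\<mu> + (real CARD('n) + 1) / 2" "TYPE('n)" \<eta> B
    using assms(1,7) B by unfold_locales auto
  \<comment> \<open>With this choice of \<kappa> the exponent \<open>D\<close> of the locale becomes
    the dimension in the statement.\<close>
  have D: "2 * (\<mu> + (real CARD('n) + 1) / 2) - 1 = real CARD('n) + 2 * \<mu>" by (simp add: field_simps)
  have r: "(2 * (\<mu> + (real CARD('n) + 1) / 2) - 1) * enn2real (1 / p) < r" using assms(5) by (simp only: D)
  have Q: "quad L (\<Lambda> L) (w L)" if "1 \<le> L" for L
    using that assms(9,10,12,13)[OF that] by (simp add: quad_def)
  have h: "hyperinterp \<mu> \<eta> \<Lambda> w L f x = hyp L (\<Lambda> L) (w L) f x" for L f x
    by (simp add: hyperinterp_def hyp_def)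
  show ?thesis
    using hyp_sobolev_error[OF assms(2,3) r] hyp_besov_error[OF assms(2,3) r assms(4)] Q
    unfolding D h by (intro conjI) blast+
qed

end
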